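(* Let $H$ be a finite-dimensional Hopf algebra over a field $\Bbbk$, let the involutive Hopf bimodule $(M,\psi)$ over $H$ be induced by a pair in involution, let $\Gamma\in\mathcal{RK}$, let $g$ be the genus of $\Sigma_\Gamma^{\mathrm{cl}}$, and let $U\in\mathsf{Mod}_H^H$ be the right-right module-comodule with underlying vector space $H\otimes H$ and $$(k\otimes l)\triangleleft h=kh_{(2)}\otimes S^{-1}(h_{(1)})\,l\,S^2(h_{(3)}),\qquad(k\otimes l)_{[0]}\otimes(k\otimes l)_{[1]}=(k\otimes l_{(1)})\otimes l_{(2)}.$$ Then there is an isomorphism of vector spaces $$\mathrm{Prot}_H^M(\Gamma,U)\cong M^{\otimes2g}.$$
   Context: **Notation.** $\otimes=\otimes_\Bbbk$; Sweedler notation; $\mathrm{Gr}(H)$ group-like elements; $\mathrm{Gr}(H^* )$ characters $H\to\Bbbk$ under convolution. A pair in involution is $(p,\chi)\in\mathrm{Gr}(H)\times\mathrm{Gr}(H^* )$ with $S^2(h)=\chi^{-1}(h_{(1)})\chi(h_{(3)})ph_{(2)}p^{-1}$ for all $h$. The involutive Hopf bimodule induced by $(p,\chi)$ (and a square root $\zeta\in\Bbbk$ of $\chi(p)$, assumed to exist) is $M=H$ with $g\triangleright m\triangleleft h=\chi^{-1}(h_{(2)})gmh_{(1)}$, $m_{[-1]}\otimes m_{[0]}\otimes m_{[1]}=m_{(1)}\otimes m_{(2)}\otimes m_{(3)}p$ and involution $\psi(m)=\zeta\chi(m_{(1)})p^{-1}S(m_{(2)})$. **Kitaev graphs.** A ribbon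 graph $(\Gamma,\iota,\rho)$ is a finite set $\Gamma$ of half-edges with a fixed-point free involution $\iota$ and a permutation $\rho$. Vertices $V_\Gamma$, edges $E_\Gamma$, faces $F_\Gamma$ are the cycles (including those of length one) of $\rho$, $\iota$, $\rho^{-1}\iota$; $v_h,e_h,f_h$ are the ones containing $h\in\Gamma$. It is connected if $\langle\iota,\rho\rangle$ acts transitively. A Kitaev graph is a connected ribbon graph with a subset $C_\Gamma\subset\Gamma$ of cilia such that $C_\Gamma\to V_\Gamma$, $c\mapsto v_c$, and $C_\Gamma\to F_\Gamma$, $c\mapsto f_{\rho^{-1}(c)}$, are bijective, a distinguished cilium $\mathrm{pt}\in C_\Gamma$, and a total order on $\Gamma$ such that for $e_h\ne e_k$: $h<k$ iff $\iota(h)<\iota(k)$. The source of an edge $\{h,\iota(h)\}$ is $s=\min\{h,\iota(h)\}$, its target is $\iota(s)$. $\mathcal{RK}$ is the set of Kitaev graphs whose half-edges form a finite subset of $\mathbb N=\{1,2,\dots\}$ stable under $\kappa_\infty=(1\,2)(3\,4)\cdots$, with $\iota$ the restriction of $\kappa_\infty$ and order inherited from $\mathbb N$. $\Sigma_\Gamma$ is the compact oriented surface obtained from oriented discs (one per vertex, with disjoint boundary intervals labelled counterclockwise by its half-edges in cyclic order) by gluing a rectangle along its short sides to the intervals $h,\iota(h)$ for each edge, compatibly with orientations; $\Sigma_\Gamma^{\mathrm{cl}}$ is obtained by gluing a disc to each boundary component. Its genus is $1-\tfrac12(|V_\Gamma|-|E_\Gamma|+|F_\Gamma|)$. **Extended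 Hilbert space.** $\mathbb M_\Gamma=\bigotimes_{e\in E_\Gamma}M$. For a half-edge $h$, $a\in H$, $\alpha\in H^*$, $L_h(a),T_h(\alpha)$ are the identity on all factors except that of $e_h$, where $L_h(a)m=a\triangleright m$ if $h$ is a target, $m\triangleleft S(a)$ if $h$ is a source; $T_h(\alpha)m=\alpha(m_{[-1]})m_{[0]}$ if $h$ is a source, $\alpha(S(m_{[1]}))m_{[0]}$ if $h$ is a target. For a cilium $c$ let $v_c=[h_1,\dots,h_i]$ with $h_1=c$, $h_{r+1}=\rho(h_r)$, and $f_{\rho^{-1}(c)}=[k_1,\dots,k_j]$ with $k_1=\rho^{-1}(c)$, $k_{r+1}=\rho^{-1}\iota(k_r)$. $H_c=H$ acts by $a\bullet_cm=L_{h_i}(a_{(i)})\cdots L_{h_1}(a_{(1)})m$ and coacts by $\delta_c$ with $(\alpha\otimes\mathrm{id})\delta_c(m)=T_{k_j}(\alpha_{(1)})\cdots T_{k_1}(\alpha_{(j)})m$. These commute for different cilia and make $\mathbb M_\Gamma$ a left-left Yetter--Drinfeld module over $\mathbb H_\Gamma=\bigotimes_{c\in C_\Gamma}H_c$. **Protected space.** $\mathsf{Mod}_A^C$ denotes right modules over an algebra $A$ that are also right comodules over a coalgebra $C$ (no compatibility). For $X\in\mathsf{Mod}_A^C$ and a left-left module-comodule $N$, $\mathrm{Bit}_A^C(X,N)$ is the image of $X\square_CN\hookrightarrow X\otimes N\twoheadrightarrow X\otimes_AN$. $\Bbbk^q_\zeta$ is $\Bbbk$ with right action $\lambda h=\zeta(h)\lambda$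 and right coaction $\lambda\mapsto\lambda\otimes q$. For $X\in\mathsf{Mod}_H^H$, $\mathrm{Prot}_H^M(\Gamma,X)=\mathrm{Bit}_{\mathbb H_\Gamma}^{\mathbb H_\Gamma}(\mathbb X_\Gamma,\mathbb M_\Gamma)$ with $\mathbb X_\Gamma=\bigotimes_{c\in C_\Gamma}Z_c$, $Z_{\mathrm{pt}}=X$, $Z_c=\Bbbk^{p^{-2}}_{\chi^2}$ for $c\ne\mathrm{pt}$, with factorwise structure. *)

theory Defs
  imports
    Complex_Main
    "HOL-Library.FuncSet"
    "HOL-Library.Function_Algebras"
    "HOL-Combinatorics.Permutations"
    "HOL-Combinatorics.Orbits"
begin

section \<open>Finite-dimensional vector spaces in coordinates\<close>

text \<open>
  A finite-dimensional vector space over the field \<open>'k\<close> is given in coordinates with respect to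
  a basis indexed by a finite set \<open>B\<close>: its vectors are the functions \<open>'i \<Rightarrow> 'k\<close> that vanish
  outside \<open>B\<close>. The tensor product of the spaces on \<open>B\<close> and \<open>B'\<close> is then the space on \<open>B \<times> B'\<close>, and
  that of a finite family \<open>(B c)\<^sub>c\<^sub>\<in>\<^sub>C\<close> is the space on \<open>PiE C B\<close>; neither an order
  of the factors nor a bracketing is chosen.
\<close>

definition fscale :: "'k::field \<Rightarrow> ('i \<Rightarrow> 'k) \<Rightarrow> 'i \<Rightarrow> 'k"  (infixr \<open>*\<^sub>v\<close> 75)
  where "c *\<^sub>v v = (\<lambda>i. c * v i)"

interpretation fun_vs: vector_space "fscale :: 'k::field \<Rightarrow> ('i \<Rightarrow> 'k) \<Rightarrow> 'i \<Rightarrow> 'k"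
  by unfold_locales (simp_all add: fscale_def plus_fun_def fun_eq_iff algebra_simps)

abbreviation lin_map :: "(('i \<Rightarrow> 'k::field) \<Rightarrow> 'j \<Rightarrow> 'k) \<Rightarrow> bool"
  where "lin_map \<equiv> Vector_Spaces.linear fscale fscale"

abbreviation lin_form :: "(('i \<Rightarrow> 'k::field) \<Rightarrow> 'k) \<Rightarrow> bool"
  where "lin_form \<equiv> Vector_Spaces.linear fscale (*)"

definition coord_space :: "'i set \<Rightarrow> ('i \<Rightarrow> 'k::field) set"
  where "coord_space B = {v. \<forall>i. i \<notin> B \<longrightarrow> v i = 0}"

definition unit_vec :: "'i \<Rightarrow> 'i \<Rightarrow> 'k::field"
  where "unit_vec i = (\<lambda>j. if j = i then 1 else 0)"

definition coord :: "'i \<Rightarrow> ('i \<Rightarrow> 'k::field) \<Rightarrow> 'k"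
  where "coord i = (\<lambda>v. v i)"

definition tensor :: "('i \<Rightarrow> 'k::field) \<Rightarrow> ('j \<Rightarrow> 'k) \<Rightarrow> 'i \<times> 'j \<Rightarrow> 'k"  (infixr \<open>\<otimes>\<^sub>v\<close> 74)
  where "u \<otimes>\<^sub>v v = (\<lambda>(i, j). u i * v j)"

text \<open>The linear map on a tensor product that is induced by a bilinear map \<open>F\<close>.\<close>

definition lift2 ::
    "(('i::finite \<Rightarrow> 'k::field) \<Rightarrow> ('j::finite \<Rightarrow> 'k) \<Rightarrow> 'n \<Rightarrow> 'k) \<Rightarrow> ('i \<times> 'j \<Rightarrow> 'k) \<Rightarrow> 'n \<Rightarrow> 'k"
  where "lift2 F t = (\<Sum>(i, j)\<in>UNIV. t (i, j) *\<^sub>v F (unit_vec i) (unit_vec j))"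

text \<open>Vector spaces with an explicit carrier, as needed for quotients.\<close>

record ('k, 'v) vspace =
  vcarrier :: "'v set"
  vplus :: "'v \<Rightarrow> 'v \<Rightarrow> 'v"
  vscale :: "'k \<Rightarrow> 'v \<Rightarrow> 'v"

definition vspace_iso :: "('k, 'v) vspace \<Rightarrow> ('k, 'w) vspace \<Rightarrow> bool"  (infix \<open>\<cong>\<^sub>v\<close> 50)
  where "V \<cong>\<^sub>v W \<longleftrightarrow> (\<exists>f. bij_betw f (vcarrier V) (vcarrier W) \<and>
    (\<forall>u\<in>vcarrier V. \<forall>v\<in>vcarrier V. f (vplus V u v) = vplus W (f u) (f v)) \<and>
    (\<forall>c. \<forall>v\<in>vcarrier V. f (vscale V c v) = vscale W c (f v)))"

definition coord_vspace :: "'i set \<Rightarrow> ('k::field, 'i \<Rightarrow> 'k) vspace"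
  where "coord_vspace B = \<lparr>vcarrier = coord_space B, vplus = (+), vscale = fscale\<rparr>"

text \<open>
  The image of the subspace \<open>V\<close> in the quotient by the subspace \<open>R\<close>. The summand \<open>r\<close> in the
  scalar multiplication is needed because \<open>0\<close> times a coset has to be \<open>R\<close>.
\<close>

definition image_in_quotient ::
    "('i \<Rightarrow> 'k::field) set \<Rightarrow> ('i \<Rightarrow> 'k) set \<Rightarrow> ('k, ('i \<Rightarrow> 'k) set) vspace"
  where "image_in_quotient V R =
    \<lparr>vcarrier = (\<lambda>v. {v + r | r. r \<in> R}) ` V,
     vplus = (\<lambda>P Q. {u + v | u v. u \<in> P \<and> v \<in> Q}),
     vscale = (\<lambda>c P. {c *\<^sub>v u + r | u r. u \<in> P \<and> r \<in> R})\<rparr>"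


section \<open>Hopf algebras\<close>

text \<open>Underlying vector space: all functions \<open>'b \<Rightarrow> 'k\<close> on a finite type \<open>'b\<close>.\<close>

record ('b, 'k) hopf =
  hmult :: "('b \<Rightarrow> 'k) \<Rightarrow> ('b \<Rightarrow> 'k) \<Rightarrow> 'b \<Rightarrow> 'k"  (infixl \<open>\<cdot>\<index>\<close> 76)
  hunit :: "'b \<Rightarrow> 'k"  (\<open>\<one>\<index>\<close>)
  comult :: "('b \<Rightarrow> 'k) \<Rightarrow> 'b \<times> 'b \<Rightarrow> 'k"
  counit :: "('b \<Rightarrow> 'k) \<Rightarrow> 'k"
  antipode :: "('b \<Rightarrow> 'k) \<Rightarrow> 'b \<Rightarrow> 'k"

text \<open>
  Sweedler notation: \<open>sw2 H h F\<close> is $F(h_{(1)}, h_{(2)})$ and \<open>sw3 H h F\<close> is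
  $F(h_{(1)}, h_{(2)}, h_{(3)})$, for multilinear \<open>F\<close>.
\<close>

definition sw2 ::
    "('b::finite, 'k::field) hopf \<Rightarrow> ('b \<Rightarrow> 'k) \<Rightarrow> (('b \<Rightarrow> 'k) \<Rightarrow> ('b \<Rightarrow> 'k) \<Rightarrow> 'n \<Rightarrow> 'k) \<Rightarrow> 'n \<Rightarrow> 'k"
  where "sw2 H h F = lift2 F (comult H h)"

definition sw3 ::
    "('b::finite, 'k::field) hopf \<Rightarrow> ('b \<Rightarrow> 'k) \<Rightarrow>
      (('b \<Rightarrow> 'k) \<Rightarrow> ('b \<Rightarrow> 'k) \<Rightarrow> ('b \<Rightarrow> 'k) \<Rightarrow> 'n \<Rightarrow> 'k) \<Rightarrow> 'n \<Rightarrow> 'k"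
  where "sw3 H h F = sw2 H h (\<lambda>x w. sw2 H w (\<lambda>y z. F x y z))"

locale hopf_algebra =
  fixes H :: "('b::finite, 'k::field) hopf" (structure)
  assumes mult_linear_left: "lin_map (\<lambda>x. x \<cdot> y)"
    and mult_linear_right: "lin_map (\<lambda>y. x \<cdot> y)"
    and mult_assoc: "(x \<cdot> y) \<cdot> z = x \<cdot> (y \<cdot> z)"
    and mult_unit_left: "\<one> \<cdot> x = x"
    and mult_unit_right: "x \<cdot> \<one> = x"
    and comult_linear: "lin_map (comult H)"
    and counit_linear: "lin_form (counit H)"
    and coassoc: "sw2 H x (\<lambda>w c. sw2 H w (\<lambda>a b. a \<otimes>\<^sub>v b \<otimes>\<^sub>v c)) = sw2 H x (\<lambda>a w. sw2 H w (\<lambda>b c. a \<otimes>\<^sub>v b \<otimes>\<^sub>v c))"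
    and counit_left: "sw2 H x (\<lambda>a b. counit H a *\<^sub>v b) = x"
    and counit_right: "sw2 H x (\<lambda>a b. counit H b *\<^sub>v a) = x"
    and comult_mult: "comult H (x \<cdot> y) = sw2 H x (\<lambda>a b. sw2 H y (\<lambda>c d. (a \<cdot> c) \<otimes>\<^sub>v (b \<cdot> d)))"
    and comult_unit: "comult H \<one> = \<one> \<otimes>\<^sub>v \<one>"
    and counit_mult: "counit H (x \<cdot> y) = counit H x * counit H y"
    and counit_unit: "counit H \<one> = 1"
    and antipode_linear: "lin_map (antipode H)"
    and antipode_left: "sw2 H x (\<lambda>a b. antipode H a \<cdot> b) = counit H x *\<^sub>v \<one>"
    and antipode_right: "sw2 H x (\<lambda>a b. a \<cdot> antipode H b) = counit H x *\<^sub>v \<one>"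

definition grouplikes :: "('b::finite, 'k::field) hopf \<Rightarrow> ('b \<Rightarrow> 'k) set"
  where "grouplikes H = {p. comult H p = p \<otimes>\<^sub>v p \<and> counit H p = 1}"

definition characters :: "('b::finite, 'k::field) hopf \<Rightarrow> (('b \<Rightarrow> 'k) \<Rightarrow> 'k) set"
  where "characters H = {\<chi>. lin_form \<chi> \<and> (\<forall>x y. \<chi> (x \<cdot>\<^bsub>H\<^esub> y) = \<chi> x * \<chi> y) \<and> \<chi> \<one>\<^bsub>H\<^esub> = 1}"

definition hinverse :: "('b::finite, 'k::field) hopf \<Rightarrow> ('b \<Rightarrow> 'k) \<Rightarrow> 'b \<Rightarrow> 'k"
  where "hinverse H p = (THE q. p \<cdot>\<^bsub>H\<^esub> q = \<one>\<^bsub>H\<^esub> \<and> q \<cdot>\<^bsub>H\<^esub> p = \<one>\<^bsub>H\<^esub>)"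

text \<open>Convolution of linear forms and the convolution inverse.\<close>

definition conv ::
    "('b::finite, 'k::field) hopf \<Rightarrow> (('b \<Rightarrow> 'k) \<Rightarrow> 'k) \<Rightarrow> (('b \<Rightarrow> 'k) \<Rightarrow> 'k) \<Rightarrow> ('b \<Rightarrow> 'k) \<Rightarrow> 'k"
  where "conv H \<alpha> \<beta> h = (\<Sum>(i, j)\<in>UNIV. comult H h (i, j) * (\<alpha> (unit_vec i) * \<beta> (unit_vec j)))"

definition conv_inverse ::
    "('b::finite, 'k::field) hopf \<Rightarrow> (('b \<Rightarrow> 'k) \<Rightarrow> 'k) \<Rightarrow> ('b \<Rightarrow> 'k) \<Rightarrow> 'k"
  where "conv_inverse H \<chi> =
    (THE \<eta>. lin_form \<eta> \<and> conv H \<chi> \<eta> = counit H \<and> conv H \<eta> \<chi> = counit H)"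

definition pair_in_involution ::
    "('b::finite, 'k::field) hopf \<Rightarrow> ('b \<Rightarrow> 'k) \<Rightarrow> (('b \<Rightarrow> 'k) \<Rightarrow> 'k) \<Rightarrow> bool"
  where "pair_in_involution H p \<chi> \<longleftrightarrow> p \<in> grouplikes H \<and> \<chi> \<in> characters H \<and>
    (\<forall>h. antipode H (antipode H h) =
      sw3 H h (\<lambda>x y z. (conv_inverse H \<chi> x * \<chi> z) *\<^sub>v (p \<cdot>\<^bsub>H\<^esub> y \<cdot>\<^bsub>H\<^esub> hinverse H p)))"


section \<open>Involutive Hopf bimodules\<close>

text \<open>Only the left and the right coaction of the bicomodule structure are recorded; the two-sided
  coaction $m_{[-1]} \otimes m_{[0]} \otimes m_{[1]}$ is their composite.\<close>

record ('b, 'm, 'k) inv_bimodule =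
  b_lact :: "('b \<Rightarrow> 'k) \<Rightarrow> ('m \<Rightarrow> 'k) \<Rightarrow> 'm \<Rightarrow> 'k"
  b_ract :: "('m \<Rightarrow> 'k) \<Rightarrow> ('b \<Rightarrow> 'k) \<Rightarrow> 'm \<Rightarrow> 'k"
  b_lcoact :: "('m \<Rightarrow> 'k) \<Rightarrow> 'b \<times> 'm \<Rightarrow> 'k"
  b_rcoact :: "('m \<Rightarrow> 'k) \<Rightarrow> 'm \<times> 'b \<Rightarrow> 'k"
  b_inv :: "('m \<Rightarrow> 'k) \<Rightarrow> 'm \<Rightarrow> 'k"

definition induced_bimodule ::
    "('b::finite, 'k::field) hopf \<Rightarrow> ('b \<Rightarrow> 'k) \<Rightarrow> (('b \<Rightarrow> 'k) \<Rightarrow> 'k) \<Rightarrow> 'k \<Rightarrow> ('b, 'b, 'k) inv_bimodule"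
  where "induced_bimodule H p \<chi> \<zeta> =
    \<lparr>b_lact = (\<lambda>g m. g \<cdot>\<^bsub>H\<^esub> m),
     b_ract = (\<lambda>m h. sw2 H h (\<lambda>x y. conv_inverse H \<chi> y *\<^sub>v (m \<cdot>\<^bsub>H\<^esub> x))),
     b_lcoact = (\<lambda>m. sw2 H m (\<lambda>x y. x \<otimes>\<^sub>v y)),
     b_rcoact = (\<lambda>m. sw2 H m (\<lambda>x y. x \<otimes>\<^sub>v (y \<cdot>\<^bsub>H\<^esub> p))),
     b_inv = (\<lambda>m. sw2 H m (\<lambda>x y. (\<zeta> * \<chi> x) *\<^sub>v (hinverse H p \<cdot>\<^bsub>H\<^esub> antipode H y)))\<rparr>"


section \<open>Kitaev graphs\<close>

record 'h ribbon_graph =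
  half_edges :: "'h set"
  iota :: "'h \<Rightarrow> 'h"
  rho :: "'h \<Rightarrow> 'h"

record 'h kitaev_graph = "'h ribbon_graph" +
  cilia :: "'h set"
  pt :: 'h
  order :: "'h rel"  \<comment> \<open>the reflexive order \<open>\<le>\<close>\<close>

definition is_ribbon_graph :: "('h, 'z) ribbon_graph_scheme \<Rightarrow> bool"
  where "is_ribbon_graph \<Gamma> \<longleftrightarrow> finite (half_edges \<Gamma>) \<and>
    iota \<Gamma> permutes half_edges \<Gamma> \<and> (\<forall>h\<in>half_edges \<Gamma>. iota \<Gamma> (iota \<Gamma> h) = h \<and> iota \<Gamma> h \<noteq> h) \<and>
    rho \<Gamma> permutes half_edges \<Gamma>"

definition connected_ribbon_graph :: "('h, 'z) ribbon_graph_scheme \<Rightarrow> bool"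
  where "connected_ribbon_graph \<Gamma> \<longleftrightarrow> (\<forall>h\<in>half_edges \<Gamma>. \<forall>k\<in>half_edges \<Gamma>.
    (h, k) \<in> {(x, y). y = iota \<Gamma> x \<or> y = rho \<Gamma> x \<or> y = inv (rho \<Gamma>) x}\<^sup>*)"

definition face_perm :: "('h, 'z) ribbon_graph_scheme \<Rightarrow> 'h \<Rightarrow> 'h"
  where "face_perm \<Gamma> = inv (rho \<Gamma>) \<circ> iota \<Gamma>"

text \<open>Cycles (fixed points included) are represented by their sets of elements.\<close>

definition vertex_of :: "('h, 'z) ribbon_graph_scheme \<Rightarrow> 'h \<Rightarrow> 'h set"
  where "vertex_of \<Gamma> h = orbit (rho \<Gamma>) h"

definition edge_of :: "('h, 'z) ribbon_graph_scheme \<Rightarrow> 'h \<Rightarrow> 'h set"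
  where "edge_of \<Gamma> h = orbit (iota \<Gamma>) h"

definition face_of :: "('h, 'z) ribbon_graph_scheme \<Rightarrow> 'h \<Rightarrow> 'h set"
  where "face_of \<Gamma> h = orbit (face_perm \<Gamma>) h"

definition vertices :: "('h, 'z) ribbon_graph_scheme \<Rightarrow> 'h set set"
  where "vertices \<Gamma> = vertex_of \<Gamma> ` half_edges \<Gamma>"

definition edges :: "('h, 'z) ribbon_graph_scheme \<Rightarrow> 'h set set"
  where "edges \<Gamma> = edge_of \<Gamma> ` half_edges \<Gamma>"

definition faces :: "('h, 'z) ribbon_graph_scheme \<Rightarrow> 'h set set"
  where "faces \<Gamma> = face_of \<Gamma> ` half_edges \<Gamma>"

text \<open>
  The genus of the closed connected oriented surface obtained from a connected ribbon graph by gluing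
  a disc to each boundary component of the thickened graph: its Euler characteristic is
  $|V| - |E| + |F| = 2 - 2g$.
\<close>

definition genus :: "('h, 'z) ribbon_graph_scheme \<Rightarrow> nat"
  where "genus \<Gamma> =
    (THE g. 2 - 2 * int g = int (card (vertices \<Gamma>)) - int (card (edges \<Gamma>)) + int (card (faces \<Gamma>)))"

definition is_kitaev_graph :: "'h kitaev_graph \<Rightarrow> bool"
  where "is_kitaev_graph \<Gamma> \<longleftrightarrow> is_ribbon_graph \<Gamma> \<and> connected_ribbon_graph \<Gamma> \<and>
    cilia \<Gamma> \<subseteq> half_edges \<Gamma> \<and>
    bij_betw (vertex_of \<Gamma>) (cilia \<Gamma>) (vertices \<Gamma>) \<and>
    bij_betw (\<lambda>c. face_of \<Gamma> (inv (rho \<Gamma>) c)) (cilia \<Gamma>) (faces \<Gamma>) \<and>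
    pt \<Gamma> \<in> cilia \<Gamma> \<and>
    linear_order_on (half_edges \<Gamma>) (order \<Gamma>) \<and>
    (\<forall>h\<in>half_edges \<Gamma>. \<forall>k\<in>half_edges \<Gamma>. edge_of \<Gamma> h \<noteq> edge_of \<Gamma> k \<longrightarrow>
      ((h, k) \<in> order \<Gamma> - Id \<longleftrightarrow> (iota \<Gamma> h, iota \<Gamma> k) \<in> order \<Gamma> - Id))"

definition kappa :: "nat \<Rightarrow> nat"  \<comment> \<open>$(1\,2)(3\,4)\cdots$\<close>
  where "kappa n = (if odd n then n + 1 else n - 1)"

definition RK :: "nat kitaev_graph set"
  where "RK = {\<Gamma>. is_kitaev_graph \<Gamma> \<and> half_edges \<Gamma> \<subseteq> {1..} \<and> kappa ` half_edges \<Gamma> \<subseteq> half_edges \<Gamma> \<and>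
    (\<forall>h\<in>half_edges \<Gamma>. iota \<Gamma> h = kappa h) \<and>
    order \<Gamma> = {(h, k). h \<in> half_edges \<Gamma> \<and> k \<in> half_edges \<Gamma> \<and> h \<le> k}}"

definition is_source :: "'h kitaev_graph \<Rightarrow> 'h \<Rightarrow> bool"
  where "is_source \<Gamma> h \<longleftrightarrow> (h, iota \<Gamma> h) \<in> order \<Gamma>"

definition cycle_list :: "('h \<Rightarrow> 'h) \<Rightarrow> 'h \<Rightarrow> 'h list"  \<comment> \<open>\<open>[h, f h, f (f h), \<dots>]\<close>, once around\<close>
  where "cycle_list f h = map (\<lambda>r. (f ^^ r) h) [0..<card (orbit f h)]"

definition vertex_list :: "('h, 'z) ribbon_graph_scheme \<Rightarrow> 'h \<Rightarrow> 'h list"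
  where "vertex_list \<Gamma> c = cycle_list (rho \<Gamma>) c"

definition face_list :: "('h, 'z) ribbon_graph_scheme \<Rightarrow> 'h \<Rightarrow> 'h list"
  where "face_list \<Gamma> c = cycle_list (face_perm \<Gamma>) (inv (rho \<Gamma>) c)"


section \<open>Module-comodules and bitensor products\<close>

text \<open>
  In \<open>('x, 'a, 'k) right_mc\<close> the space is the coordinate space on \<open>r_basis\<close>, and \<open>'a\<close> indexes the
  bases of the algebra and of the coalgebra.
\<close>

record ('x, 'a, 'k) right_mc =
  r_basis :: "'x set"
  r_act :: "('x \<Rightarrow> 'k) \<Rightarrow> ('a \<Rightarrow> 'k) \<Rightarrow> 'x \<Rightarrow> 'k"
  r_coact :: "('x \<Rightarrow> 'k) \<Rightarrow> 'x \<times> 'a \<Rightarrow> 'k"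

record ('x, 'a, 'k) left_mc =
  l_basis :: "'x set"
  l_act :: "('a \<Rightarrow> 'k) \<Rightarrow> ('x \<Rightarrow> 'k) \<Rightarrow> 'x \<Rightarrow> 'k"
  l_coact :: "('x \<Rightarrow> 'k) \<Rightarrow> 'a \<times> 'x \<Rightarrow> 'k"

text \<open>\<open>\<rho> \<otimes> id\<close> and \<open>id \<otimes> \<delta>\<close> as maps from \<open>X \<otimes> N\<close> to \<open>X \<otimes> C \<otimes> N\<close>, for linear \<open>\<rho>\<close> and \<open>\<delta>\<close>.\<close>

definition coact_fst :: "(('x \<Rightarrow> 'k::field) \<Rightarrow> 'x \<times> 'c \<Rightarrow> 'k) \<Rightarrow> ('x \<times> 'n \<Rightarrow> 'k) \<Rightarrow> 'x \<times> 'c \<times> 'n \<Rightarrow> 'k"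
  where "coact_fst \<rho> t = (\<lambda>(x, c, n). \<rho> (\<lambda>x'. t (x', n)) (x, c))"

definition coact_snd :: "(('n \<Rightarrow> 'k::field) \<Rightarrow> 'c \<times> 'n \<Rightarrow> 'k) \<Rightarrow> ('x \<times> 'n \<Rightarrow> 'k) \<Rightarrow> 'x \<times> 'c \<times> 'n \<Rightarrow> 'k"
  where "coact_snd \<delta> t = (\<lambda>(x, c, n). \<delta> (\<lambda>n'. t (x, n')) (c, n))"

definition cotensor :: "('x, 'a, 'k::field) right_mc \<Rightarrow> ('n, 'a, 'k) left_mc \<Rightarrow> ('x \<times> 'n \<Rightarrow> 'k) set"
  where "cotensor X N = {t \<in> coord_space (r_basis X \<times> l_basis N).
    coact_fst (r_coact X) t = coact_snd (l_coact N) t}"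

text \<open>The kernel of \<open>X \<otimes> N \<rightarrow> X \<otimes>\<^sub>A N\<close>, where \<open>A\<close> is the coordinate space on \<open>BA\<close>.\<close>

definition tensor_relations ::
    "'a set \<Rightarrow> ('x, 'a, 'k::field) right_mc \<Rightarrow> ('n, 'a, 'k) left_mc \<Rightarrow> ('x \<times> 'n \<Rightarrow> 'k) set"
  where "tensor_relations BA X N = fun_vs.span
    {r_act X x a \<otimes>\<^sub>v n - x \<otimes>\<^sub>v l_act N a n | x a n.
      x \<in> coord_space (r_basis X) \<and> a \<in> coord_space BA \<and> n \<in> coord_space (l_basis N)}"

definition Bit ::
    "'a set \<Rightarrow> ('x, 'a, 'k::field) right_mc \<Rightarrow> ('n, 'a, 'k) left_mc \<Rightarrow> ('k, ('x \<times> 'n \<Rightarrow> 'k) set) vspace"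
  where "Bit BA X N = image_in_quotient (cotensor X N) (tensor_relations BA X N)"

text \<open>
  Factorwise tensor product of the module-comodules \<open>Z c\<close>, \<open>c \<in> C\<close>. The guard in \<open>pure_tensor\<close> makes
  it vanish outside \<open>PiE C (\<lambda>_. UNIV)\<close>.
\<close>

definition pure_tensor :: "'h set \<Rightarrow> ('h \<Rightarrow> 'x \<Rightarrow> 'k::field) \<Rightarrow> ('h \<Rightarrow> 'x) \<Rightarrow> 'k"
  where "pure_tensor C v = (\<lambda>w. if w \<in> extensional C then \<Prod>c\<in>C. v c (w c) else 0)"

definition tensor_mc ::
    "'h set \<Rightarrow> ('h \<Rightarrow> ('x, 'b::finite, 'k::field) right_mc) \<Rightarrow> ('h \<Rightarrow> 'x, 'h \<Rightarrow> 'b, 'k) right_mc"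
  where "tensor_mc C Z =
    \<lparr>r_basis = PiE C (\<lambda>c. r_basis (Z c)),
     r_act = (\<lambda>v a. \<Sum>z\<in>PiE C (\<lambda>c. r_basis (Z c)). \<Sum>b\<in>PiE C (\<lambda>_. UNIV).
       (v z * a b) *\<^sub>v pure_tensor C (\<lambda>c. r_act (Z c) (unit_vec (z c)) (unit_vec (b c)))),
     r_coact = (\<lambda>v (w, b). \<Sum>z\<in>PiE C (\<lambda>c. r_basis (Z c)).
       v z * (if w \<in> extensional C \<and> b \<in> extensional C
              then \<Prod>c\<in>C. r_coact (Z c) (unit_vec (z c)) (w c, b c) else 0))\<rparr>"

text \<open>
  The one-dimensional module-comodule $\Bbbk^q_\zeta$, on the basis \<open>{None}\<close>, and the transport of a
  module-comodule along the injection \<open>Some\<close>: a common index type for the factors of a tensor product.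
\<close>

definition one_dim_mc ::
    "('b \<Rightarrow> 'k::field) \<Rightarrow> (('b \<Rightarrow> 'k) \<Rightarrow> 'k) \<Rightarrow> ('x option, 'b, 'k) right_mc"
  where "one_dim_mc q \<zeta> =
    \<lparr>r_basis = {None}, r_act = (\<lambda>v h. \<zeta> h *\<^sub>v v), r_coact = (\<lambda>v. v \<otimes>\<^sub>v q)\<rparr>"

definition some_mc :: "('x, 'b, 'k::field) right_mc \<Rightarrow> ('x option, 'b, 'k) right_mc"
  where "some_mc X =
    \<lparr>r_basis = Some ` r_basis X,
     r_act = (\<lambda>v h y. case y of None \<Rightarrow> 0 | Some x \<Rightarrow> r_act X (v \<circ> Some) h x),
     r_coact = (\<lambda>v (y, b). case y of None \<Rightarrow> 0 | Some x \<Rightarrow> r_coact X (v \<circ> Some) (x, b))\<rparr>"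


section \<open>The extended Hilbert space\<close>

text \<open>Coordinates of \<open>M\<^sup>\<otimes>\<^sup>E\<close> are indexed by \<open>PiE (edges \<Gamma>) (\<lambda>_. UNIV)\<close>.\<close>

definition at_edge ::
    "'e \<Rightarrow> (('m \<Rightarrow> 'k::field) \<Rightarrow> 'm \<Rightarrow> 'k) \<Rightarrow> (('e \<Rightarrow> 'm) \<Rightarrow> 'k) \<Rightarrow> ('e \<Rightarrow> 'm) \<Rightarrow> 'k"
    \<comment> \<open>a linear map applied to the tensor factor \<open>e\<close>, the identity on the other factors\<close>
  where "at_edge e f t = (\<lambda>x. f (\<lambda>i. t (x(e := i))) (x e))"

definition L_op ::
    "('b::finite, 'k::field) hopf \<Rightarrow> ('b, 'm::finite, 'k) inv_bimodule \<Rightarrow> 'h kitaev_graph \<Rightarrow> 'h \<Rightarrow>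
      ('b \<Rightarrow> 'k) \<Rightarrow> (('h set \<Rightarrow> 'm) \<Rightarrow> 'k) \<Rightarrow> ('h set \<Rightarrow> 'm) \<Rightarrow> 'k"
  where "L_op H M \<Gamma> h a = at_edge (edge_of \<Gamma> h)
    (if is_source \<Gamma> h then (\<lambda>m. b_ract M m (antipode H a)) else (\<lambda>m. b_lact M a m))"

definition T_op ::
    "('b::finite, 'k::field) hopf \<Rightarrow> ('b, 'm::finite, 'k) inv_bimodule \<Rightarrow> 'h kitaev_graph \<Rightarrow> 'h \<Rightarrow>
      (('b \<Rightarrow> 'k) \<Rightarrow> 'k) \<Rightarrow> (('h set \<Rightarrow> 'm) \<Rightarrow> 'k) \<Rightarrow> ('h set \<Rightarrow> 'm) \<Rightarrow> 'k"
  where "T_op H M \<Gamma> h \<alpha> = at_edge (edge_of \<Gamma> h)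
    (if is_source \<Gamma> h then (\<lambda>m. lift2 (\<lambda>x y. \<alpha> x *\<^sub>v y) (b_lcoact M m))
     else (\<lambda>m. lift2 (\<lambda>x y. \<alpha> (antipode H y) *\<^sub>v x) (b_rcoact M m)))"

text \<open>
  $L_{h_i}(a_{(i)}) \cdots L_{h_1}(a_{(1)})\, t$ for the list \<open>[h\<^sub>1, \<dots>, h\<^sub>i]\<close>.
\<close>

primrec L_word ::
    "('b::finite, 'k::field) hopf \<Rightarrow> ('b, 'm::finite, 'k) inv_bimodule \<Rightarrow> 'h kitaev_graph \<Rightarrow> 'h list \<Rightarrow>
      ('b \<Rightarrow> 'k) \<Rightarrow> (('h set \<Rightarrow> 'm) \<Rightarrow> 'k) \<Rightarrow> ('h set \<Rightarrow> 'm) \<Rightarrow> 'k"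
  where
    "L_word H M \<Gamma> [] a t = counit H a *\<^sub>v t"
  | "L_word H M \<Gamma> (h # hs) a t = sw2 H a (\<lambda>x y. L_word H M \<Gamma> hs y (L_op H M \<Gamma> h x t))"

text \<open>
  $T_{k_j}(\alpha_{(1)}) \cdots T_{k_1}(\alpha_{(j)})\, t$ for the list \<open>[k\<^sub>1, \<dots>, k\<^sub>j]\<close>. The
  comultiplication of the dual Hopf algebra is
  $\alpha \mapsto \sum_{r,s} \alpha(e_r e_s)\, e^r \otimes e^s$ in terms of dual bases.
\<close>

primrec T_word ::
    "('b::finite, 'k::field) hopf \<Rightarrow> ('b, 'm::finite, 'k) inv_bimodule \<Rightarrow> 'h kitaev_graph \<Rightarrow> 'h list \<Rightarrow>
      (('b \<Rightarrow> 'k) \<Rightarrow> 'k) \<Rightarrow> (('h set \<Rightarrow> 'm) \<Rightarrow> 'k) \<Rightarrow> ('h set \<Rightarrow> 'm) \<Rightarrow> 'k"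
  where
    "T_word H M \<Gamma> [] \<alpha> t = \<alpha> \<one>\<^bsub>H\<^esub> *\<^sub>v t"
  | "T_word H M \<Gamma> (k # ks) \<alpha> t = (\<Sum>(r, s)\<in>UNIV.
      \<alpha> (unit_vec r \<cdot>\<^bsub>H\<^esub> unit_vec s) *\<^sub>v T_word H M \<Gamma> ks (coord r) (T_op H M \<Gamma> k (coord s) t))"

text \<open>
  The action and the coaction of the tensor product of the Hopf algebras $H_c$, whose coordinates are
  indexed by \<open>PiE (cilia \<Gamma>) (\<lambda>_. UNIV)\<close>. The structures at different cilia commute, so the order in
  which they are composed is immaterial. The coaction is determined by pairing its first factor with
  the dual basis elements $\bigotimes_c e^{b(c)}$.
\<close>

definition hilbert_space ::
    "('b::finite, 'k::field) hopf \<Rightarrow> ('b, 'm::finite, 'k) inv_bimodule \<Rightarrow> 'h::linorder kitaev_graph \<Rightarrow>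
      ('h set \<Rightarrow> 'm, 'h \<Rightarrow> 'b, 'k) left_mc"
  where "hilbert_space H M \<Gamma> =
    \<lparr>l_basis = PiE (edges \<Gamma>) (\<lambda>_. UNIV),
     l_act = (\<lambda>a t. \<Sum>b\<in>PiE (cilia \<Gamma>) (\<lambda>_. UNIV).
       a b *\<^sub>v foldr (\<lambda>c. L_word H M \<Gamma> (vertex_list \<Gamma> c) (unit_vec (b c))) (sorted_list_of_set (cilia \<Gamma>)) t),
     l_coact = (\<lambda>t (b, x). if b \<in> PiE (cilia \<Gamma>) (\<lambda>_. UNIV)
       then foldr (\<lambda>c. T_word H M \<Gamma> (face_list \<Gamma> c) (coord (b c))) (sorted_list_of_set (cilia \<Gamma>)) t x
       else 0)\<rparr>"


section \<open>The protected space\<close>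

definition coefficient_mc ::
    "('b::finite, 'k::field) hopf \<Rightarrow> ('b \<Rightarrow> 'k) \<Rightarrow> (('b \<Rightarrow> 'k) \<Rightarrow> 'k) \<Rightarrow> 'h kitaev_graph \<Rightarrow>
      ('x, 'b, 'k) right_mc \<Rightarrow> ('h \<Rightarrow> 'x option, 'h \<Rightarrow> 'b, 'k) right_mc"
  where "coefficient_mc H p \<chi> \<Gamma> X = tensor_mc (cilia \<Gamma>) (\<lambda>c.
    if c = pt \<Gamma> then some_mc X
    else one_dim_mc (hinverse H p \<cdot>\<^bsub>H\<^esub> hinverse H p) (conv H \<chi> \<chi>))"

definition Prot ::
    "('b::finite, 'k::field) hopf \<Rightarrow> ('b \<Rightarrow> 'k) \<Rightarrow> (('b \<Rightarrow> 'k) \<Rightarrow> 'k) \<Rightarrow>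
      ('b, 'm::finite, 'k) inv_bimodule \<Rightarrow> 'h::linorder kitaev_graph \<Rightarrow> ('x, 'b, 'k) right_mc \<Rightarrow>
      ('k, (('h \<Rightarrow> 'x option) \<times> ('h set \<Rightarrow> 'm) \<Rightarrow> 'k) set) vspace"
  where "Prot H p \<chi> M \<Gamma> X =
    Bit (PiE (cilia \<Gamma>) (\<lambda>_. UNIV)) (coefficient_mc H p \<chi> \<Gamma> X) (hilbert_space H M \<Gamma>)"

text \<open>The \<open>n\<close>-fold tensor power of the vector space underlying \<open>M\<close>.\<close>

definition tensor_power ::
    "('b, 'm::finite, 'k::field) inv_bimodule \<Rightarrow> nat \<Rightarrow> ('k, (nat \<Rightarrow> 'm) \<Rightarrow> 'k) vspace"
  where "tensor_power M n = coord_vspace (PiE {..<n} (\<lambda>_. UNIV))"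

text \<open>
  The module-comodule \<open>U\<close> on \<open>H \<otimes> H\<close>, with
  $(k \otimes l) \triangleleft h = k h_{(2)} \otimes S^{-1}(h_{(1)})\, l\, S^2(h_{(3)})$ and
  $k \otimes l \mapsto (k \otimes l_{(1)}) \otimes l_{(2)}$.
\<close>

definition U_mc :: "('b::finite, 'k::field) hopf \<Rightarrow> ('b \<times> 'b, 'b, 'k) right_mc"
  where "U_mc H =
    \<lparr>r_basis = UNIV,
     r_act = (\<lambda>t h. lift2 (\<lambda>k l. sw3 H h (\<lambda>x y z.
       (k \<cdot>\<^bsub>H\<^esub> y) \<otimes>\<^sub>v (inv (antipode H) x \<cdot>\<^bsub>H\<^esub> l \<cdot>\<^bsub>H\<^esub> antipode H (antipode H z)))) t),
     r_coact = (\<lambda>t. lift2 (\<lambda>k l. sw2 H l (\<lambda>x y. (k \<otimes>\<^sub>v x) \<otimes>\<^sub>v y)) t)\<rparr>"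

end

(* Proof idea. Let A_c and B_c be the action and the coaction at the cilium c. The module-comodule U
   is induced from the pt-factor: F(k (x) l (x) n) = eps(l) k.n identifies Prot(Gamma, U) with the
   image of Inv = {n : B_c n = p^(-2) (x) n for c <> pt} modulo Rel = span {A_c(a) n - chi^2(a) n : c <> pt};
   this uses the Yetter-Drinfeld condition at pt only.

   The subquotient Inv/(Inv meet Rel) does not change, up to isomorphism, if an end of an edge is slid
   along a neighbouring edge, since the sum of L_h(e_i) T_k(e^i) over dual bases intertwines the vertex
   and the face words before and after the slide. If there is a cilium c <> pt, slides produce a
   graph in which its vertex is a single half-edge e and its face is [e, y, iota(e)]. There the conditions
   at c are solved by rank-one projections at the edges of e and y, and both edges and the site c can
   be removed. With only pt left there are no conditions, so the space is the tensor product of the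
   copies of M at the remaining edges; their number is |E| - 2(|C| - 1), which is 2g because
   |V| = |F| = |C|. That it is even, so that the genus is the expected number, follows from the sign
   of the permutations. *)
theory Submission
  imports Defs "HOL-Combinatorics.Cycles"
begin

section \<open>The algebra of linear operators\<close>

text \<open>The space is a subquotient: the coaction enters through invariants, the action through
  relations, and neither determines the other. Each step must therefore be one linear map that
  respects both; \<open>subquot_iso\<close> records this, and the projections at a removed site obey
  laws for L and for T at the same time. The coefficients \<chi>^2 and p^-2 are what the removal of
  a site balances. The projection for e absorbs one p^-1 of the face condition and leaves the other
  one for y; it also turns L at \<iota>(e) into \<chi>^-1. By the pair in involution this is the
  twist under which the two letters at y act trivially on the image of the projection at y, so that
  no trace of the site remains. Slides change the cyclic orders but not the operators, and the last
  site may be left without half-edges. A graph is therefore replaced by lists of half-edges at sites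
  (\<open>config\<close>), where a site is a node of its own in both cyclic orders. The commutation
  of actions with coactions at other sites and the Yetter--Drinfeld condition come from slides too,
  of an auxiliary half-edge on a new tensor factor.\<close>

typedef (overloaded) ('i, 'k::field) lop = "{f :: ('i \<Rightarrow> 'k) \<Rightarrow> 'i \<Rightarrow> 'k. lin_map f}"
  morphisms app Lop
proof
  show "(\<lambda>v. v) \<in> {f :: ('i \<Rightarrow> 'k) \<Rightarrow> 'i \<Rightarrow> 'k. lin_map f}"
    using fun_vs.linear_id by (simp add: id_def)
qed

lemma lin_mapI:
  assumes "\<And>u v. f (u + v) = f u + f v" "\<And>c v. f (c *\<^sub>v v) = c *\<^sub>v f v"
  shows "lin_map f"
  using assms by unfold_locales auto

lemma lin_map_add: "lin_map f \<Longrightarrow> f (u + v) = f u + f v"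
  by (metis Vector_Spaces.linear_iff_module_hom module_hom.add)

lemma lin_map_scale: "lin_map f \<Longrightarrow> f (c *\<^sub>v v) = c *\<^sub>v f v"
  by (metis Vector_Spaces.linear_iff_module_hom module_hom.scale)

lemma lin_map_sum: "lin_map f \<Longrightarrow> f (\<Sum>x\<in>A. g x) = (\<Sum>x\<in>A. f (g x))"
  by (metis (no_types, lifting) Vector_Spaces.linear_iff_module_hom module_hom.sum sum.cong)

lemma lin_map_0: "lin_map f \<Longrightarrow> f 0 = 0"
  by (metis Vector_Spaces.linear_iff_module_hom module_hom.zero)

lemma lin_map_diff: "lin_map f \<Longrightarrow> f (u - v) = f u - f v"
  using lin_map_add[of f "u - v" v] by simp

lemma fscale_apply [simp]: "(c *\<^sub>v v) i = c * v i"
  by (simp add: fscale_def)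

lemma sum_fun_apply: "(\<Sum>x\<in>A. f x) i = (\<Sum>x\<in>A. f x i)"
  by (induction A rule: infinite_finite_induct) auto

lemma lin_map_app [simp]: "lin_map (app A)"
  using app[of A] by simp

lemmas app_add [simp] = lin_map_add[OF lin_map_app]
lemmas app_scale [simp] = lin_map_scale[OF lin_map_app]
lemmas app_sum = lin_map_sum[OF lin_map_app]
lemmas app_0 [simp] = lin_map_0[OF lin_map_app]

lemmas app_minus [simp] = lin_map_diff[OF lin_map_app]

lemma lop_eqI: "(\<And>v. app A v = app B v) \<Longrightarrow> A = B"
  by (simp add: app_inject[symmetric] fun_eq_iff)

lemma app_Lop: "lin_map f \<Longrightarrow> app (Lop f) = f"
  by (simp add: Lop_inverse)

text \<open>Operators are total on the full function space, so that words of them can be rearranged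
  by ring algebra without carriers; invariance of the coordinate spaces is treated separately, by
  \<open>pres\<close> and \<open>stable\<close>.\<close>

instantiation lop :: (type, field) ring_1
begin

definition zero_lop :: "('a, 'b) lop" where "zero_lop = Lop (\<lambda>v. 0)"
definition one_lop :: "('a, 'b) lop" where "one_lop = Lop (\<lambda>v. v)"
definition plus_lop :: "('a, 'b) lop \<Rightarrow> ('a, 'b) lop \<Rightarrow> ('a, 'b) lop"
  where "A + B = Lop (\<lambda>v. app A v + app B v)"
definition minus_lop :: "('a, 'b) lop \<Rightarrow> ('a, 'b) lop \<Rightarrow> ('a, 'b) lop"
  where "A - B = Lop (\<lambda>v. app A v - app B v)"
definition uminus_lop :: "('a, 'b) lop \<Rightarrow> ('a, 'b) lop"
  where "- A = Lop (\<lambda>v. - app A v)"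
definition times_lop :: "('a, 'b) lop \<Rightarrow> ('a, 'b) lop \<Rightarrow> ('a, 'b) lop"
  where "A * B = Lop (\<lambda>v. app A (app B v))"

lemma app_zero: "app 0 v = 0"
  unfolding zero_lop_def by (subst app_Lop) (auto intro!: lin_mapI simp: fun_eq_iff)
lemma app_one: "app 1 v = v"
  unfolding one_lop_def by (subst app_Lop) (auto intro!: lin_mapI simp: fun_eq_iff)
lemma app_plus: "app (A + B) v = app A v + app B v"
  unfolding plus_lop_def by (subst app_Lop) (auto intro!: lin_mapI simp: fun_eq_iff algebra_simps)
lemma app_diff: "app (A - B) v = app A v - app B v"
  unfolding minus_lop_def by (subst app_Lop) (auto intro!: lin_mapI simp: fun_eq_iff algebra_simps)
lemma app_uminus: "app (- A) v = - app A v"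
  unfolding uminus_lop_def by (subst app_Lop) (auto intro!: lin_mapI simp: fun_eq_iff algebra_simps)
lemma app_times: "app (A * B) v = app A (app B v)"
  unfolding times_lop_def by (subst app_Lop) (auto intro!: lin_mapI simp: fun_eq_iff algebra_simps)

instance
proof
  fix A B C :: "('a, 'b) lop"
  show "A + B + C = A + (B + C)" by (rule lop_eqI) (simp add: app_plus add.assoc)
  show "A + B = B + A" by (rule lop_eqI) (simp add: app_plus add.commute)
  show "0 + A = A" by (rule lop_eqI) (simp add: app_plus app_zero)
  show "- A + A = 0" by (rule lop_eqI) (simp add: app_plus app_zero app_uminus)
  show "A - B = A + - B" by (rule lop_eqI) (simp add: app_plus app_diff app_uminus)
  show "A * B * C = A * (B * C)" by (rule lop_eqI) (simp add: app_times)
  show "1 * A = A" by (rule lop_eqI) (simp add: app_times app_one)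
  show "A * 1 = A" by (rule lop_eqI) (simp add: app_times app_one)
  show "(A + B) * C = A * C + B * C" by (rule lop_eqI) (simp add: app_times app_plus)
  show "A * (B + C) = A * B + A * C" by (rule lop_eqI) (simp add: app_times app_plus)
  have "app (1 :: ('a, 'b) lop) (\<lambda>_. 1) \<noteq> app 0 (\<lambda>_. 1)"
    by (simp add: app_one app_zero fun_eq_iff)
  then show "(0 :: ('a, 'b) lop) \<noteq> 1" by metis
qed

end

lemmas app_lop = app_zero app_one app_plus app_diff app_uminus app_times

definition lscale :: "'k::field \<Rightarrow> ('i, 'k) lop \<Rightarrow> ('i, 'k) lop"  (infixr \<open>*\<^sub>o\<close> 75)
  where "c *\<^sub>o A = Lop (\<lambda>v. c *\<^sub>v app A v)"

lemma app_lscale: "app (c *\<^sub>o A) v = c *\<^sub>v app A v"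
  unfolding lscale_def by (subst app_Lop) (auto intro!: lin_mapI simp: fun_eq_iff algebra_simps)

lemma app_lsum: "app (\<Sum>x\<in>S. f x) v = (\<Sum>x\<in>S. app (f x) v)"
  by (induction S rule: infinite_finite_induct) (auto simp: app_lop)

lemma lscale_mult_left [simp]: "(c *\<^sub>o A) * B = c *\<^sub>o (A * B)"
  by (rule lop_eqI) (simp add: app_lop app_lscale)
lemma lscale_mult_right [simp]: "A * (c *\<^sub>o B) = c *\<^sub>o (A * B)"
  by (rule lop_eqI) (simp add: app_lop app_lscale)
lemma lscale_lscale [simp]: "c *\<^sub>o d *\<^sub>o A = (c * d) *\<^sub>o A"
  by (rule lop_eqI) (simp add: app_lop app_lscale fun_eq_iff)
lemma lscale_one [simp]: "1 *\<^sub>o A = A"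
  by (rule lop_eqI) (simp add: app_lop app_lscale fun_eq_iff)
lemma lscale_zero_left [simp]: "0 *\<^sub>o A = 0"
  by (rule lop_eqI) (simp add: app_lop app_lscale fun_eq_iff)
lemma lscale_zero_right [simp]: "c *\<^sub>o 0 = 0"
  by (rule lop_eqI) (simp add: app_lop app_lscale fun_eq_iff)
lemma lscale_sum_right: "c *\<^sub>o (\<Sum>x\<in>S. f x) = (\<Sum>x\<in>S. c *\<^sub>o f x)"
  by (rule lop_eqI) (simp add: app_lscale app_lsum fun_eq_iff sum_fun_apply sum_distrib_left)
lemma lscale_sum_left: "(\<Sum>x\<in>S. c x) *\<^sub>o A = (\<Sum>x\<in>S. c x *\<^sub>o A)"
  by (rule lop_eqI) (simp add: app_lscale app_lsum fun_eq_iff sum_fun_apply sum_distrib_right)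
lemma lscale_add_right: "c *\<^sub>o (A + B) = c *\<^sub>o A + c *\<^sub>o B"
  by (rule lop_eqI) (simp add: app_lop app_lscale fun_eq_iff algebra_simps)

lemma lscale_sum_product:
  "(\<Sum>x\<in>S. c x *\<^sub>o f x) * (\<Sum>y\<in>T. d y *\<^sub>o g y) = (\<Sum>x\<in>S. \<Sum>y\<in>T. (c x * d y) *\<^sub>o (f x * g y))"
  by (simp add: sum_product mult.commute)

subsection \<open>Operators on one tensor factor\<close>

lemma unit_vec_expand: "v = (\<Sum>i\<in>UNIV. v i *\<^sub>v unit_vec (i::'i::finite))"
  by (simp add: fun_eq_iff sum_fun_apply unit_vec_def if_distrib[of "\<lambda>x. _ * x"] sum.delta cong: if_cong)

lemma at_edge_lin:
  fixes f :: "('m \<Rightarrow> 'k::field) \<Rightarrow> 'm \<Rightarrow> 'k" and e :: 'e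
  shows "lin_map f \<Longrightarrow> lin_map (at_edge e f)"
proof (rule lin_mapI)
  fix u v :: "('e \<Rightarrow> 'm) \<Rightarrow> 'k" and c
  assume f: "lin_map f"
  have "f (\<lambda>i. a i + b i) = (\<lambda>i. f a i + f b i)" for a b
    using lin_map_add[OF f, of a b] by (simp add: plus_fun_def)
  then show "at_edge e f (u + v) = at_edge e f u + at_edge e f v"
    by (simp add: at_edge_def fun_eq_iff)
  have "f (\<lambda>i. c * a i) = (\<lambda>i. c * f a i)" for a
    using lin_map_scale[OF f, of c a] by (simp add: fscale_def)
  then show "at_edge e f (c *\<^sub>v v) = c *\<^sub>v at_edge e f v"
    by (simp add: at_edge_def fun_eq_iff)
qed

definition slot :: "'e \<Rightarrow> ('m, 'k::field) lop \<Rightarrow> ('e \<Rightarrow> 'm, 'k) lop"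
  where "slot e A = Lop (at_edge e (app A))"

lemma app_slot: "app (slot e A) t x = app A (\<lambda>i. t (x(e := i))) (x e)"
  by (simp add: slot_def app_Lop at_edge_lin at_edge_def)

lemma slot_one [simp]: "slot e 1 = 1"
  by (rule lop_eqI) (simp add: app_slot app_lop fun_eq_iff)
lemma slot_zero [simp]: "slot e 0 = 0"
  by (rule lop_eqI) (simp add: app_slot app_lop fun_eq_iff)
lemma slot_times: "slot e (A * B) = slot e A * slot e B"
  by (rule lop_eqI) (simp add: app_slot app_lop fun_eq_iff)
lemma slot_plus: "slot e (A + B) = slot e A + slot e B"
  by (rule lop_eqI) (simp add: app_slot app_lop fun_eq_iff)
lemma slot_lscale: "slot e (c *\<^sub>o A) = c *\<^sub>o slot e A"
  by (rule lop_eqI) (simp add: app_slot app_lscale fun_eq_iff)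
lemma slot_sum: "slot e (\<Sum>x\<in>S. f x) = (\<Sum>x\<in>S. slot e (f x))"
  by (induction S rule: infinite_finite_induct) (auto simp: slot_plus)

lemma app_expand: "app A (v :: 'm::finite \<Rightarrow> 'k::field) j = (\<Sum>i\<in>UNIV. v i * app A (unit_vec i) j)"
proof -
  have "app A v j = app A (\<Sum>i\<in>UNIV. v i *\<^sub>v unit_vec i) j"
    using unit_vec_expand[of v] by simp
  also have "\<dots> = (\<Sum>i\<in>UNIV. v i * app A (unit_vec i) j)"
    by (simp add: app_sum sum_fun_apply)
  finally show ?thesis .
qed

text \<open>As \<open>'m\<close> is finite, both operators have matrices; the two composites are the
  same double sum over the values at \<open>e\<close> and \<open>f\<close>, with the two updates
  exchanged.\<close>

lemma slot_commute:
  fixes A B :: "('m::finite, 'k::field) lop"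
  assumes "e \<noteq> f"
  shows "slot e A * slot f B = slot f B * slot e A"
proof (rule lop_eqI, rule ext)
  fix t :: "('a \<Rightarrow> 'm) \<Rightarrow> 'k" and x
  let ?a = "\<lambda>i. app A (unit_vec i) (x e)" and ?b = "\<lambda>j. app B (unit_vec j) (x f)"
  have A: "app (slot e A) s z = (\<Sum>i\<in>UNIV. s (z(e := i)) * app A (unit_vec i) (z e))" for s z
    by (subst app_slot, subst app_expand) simp
  have B: "app (slot f B) s z = (\<Sum>i\<in>UNIV. s (z(f := i)) * app B (unit_vec i) (z f))" for s z
    by (subst app_slot, subst app_expand) simp
  have "app (slot e A * slot f B) t x = (\<Sum>i\<in>UNIV. \<Sum>j\<in>UNIV. t (x(e := i, f := j)) * ?b j * ?a i)"
    using assms by (simp add: app_times A B sum_distrib_right)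
  also have "\<dots> = (\<Sum>j\<in>UNIV. \<Sum>i\<in>UNIV. t (x(f := j, e := i)) * ?a i * ?b j)"
    using assms by (subst sum.swap) (simp add: fun_upd_twist mult_ac)
  also have "\<dots> = app (slot f B * slot e A) t x"
    using assms by (simp add: app_times A B sum_distrib_right)
  finally show "app (slot e A * slot f B) t x = app (slot f B * slot e A) t x" .
qed

definition ketbra :: "('m \<Rightarrow> 'k::field) \<Rightarrow> ('m::finite \<Rightarrow> 'k) \<Rightarrow> ('m, 'k) lop"
  where "ketbra u \<phi> = Lop (\<lambda>v. (\<Sum>i\<in>UNIV. \<phi> i * v i) *\<^sub>v u)"

lemma app_ketbra: "app (ketbra u \<phi>) v = (\<Sum>i\<in>UNIV. \<phi> i * v i) *\<^sub>v u"
  unfolding ketbra_def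
  by (subst app_Lop)
     (auto intro!: lin_mapI simp: fun_eq_iff algebra_simps sum.distrib sum_distrib_left sum_distrib_right)

section \<open>Sweedler calculus\<close>

text \<open>\<open>lift2\<close> evaluates its argument at basis vectors only, so Sweedler rules
  carry multilinearity conditions; this collection of introduction rules discharges them.\<close>

named_theorems lin

lemma lin_formI:
  assumes "\<And>u v. f (u + v) = f u + f v" "\<And>c v. f (c *\<^sub>v v) = c * f v"
  shows "lin_form f"
  using assms by unfold_locales (auto simp: algebra_simps)

lemma lin_form_add: "lin_form f \<Longrightarrow> f (u + v) = f u + f v"
  by (metis Vector_Spaces.linear_iff_module_hom module_hom.add)
lemma lin_form_scale: "lin_form f \<Longrightarrow> f (c *\<^sub>v v) = c * f v"
  by (metis Vector_Spaces.linear_iff_module_hom module_hom.scale)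
lemma lin_form_sum: "lin_form f \<Longrightarrow> f (\<Sum>x\<in>A. g x) = (\<Sum>x\<in>A. f (g x))"
  by (metis (no_types, lifting) Vector_Spaces.linear_iff_module_hom module_hom.sum sum.cong)

lemma lin_form_expand: "lin_form f \<Longrightarrow> f (v :: 'i::finite \<Rightarrow> 'k::field) = (\<Sum>i\<in>UNIV. v i * f (unit_vec i))"
  by (subst unit_vec_expand[of v]) (simp only: lin_form_sum lin_form_scale)

lemma lin_form_coord: "lin_map f \<Longrightarrow> lin_form (\<lambda>x. f x r)"
  by (rule lin_formI) (simp_all add: lin_map_add lin_map_scale)

lemma lin_map_ident [lin]: "lin_map (\<lambda>x. x)"
  by (rule lin_mapI) auto

lemma lin_map_scaled [lin]: "lin_map f \<Longrightarrow> lin_map (\<lambda>x. c *\<^sub>v f x)"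
  by (rule lin_mapI) (auto simp: lin_map_add lin_map_scale fun_eq_iff algebra_simps)

lemma lin_map_form [lin]: "lin_form g \<Longrightarrow> lin_map (\<lambda>x. g x *\<^sub>v v)"
  by (rule lin_mapI) (auto simp: lin_form_add lin_form_scale fun_eq_iff algebra_simps)

lemma lin_form_mult_right [lin]: "lin_form g \<Longrightarrow> lin_form (\<lambda>x. c * g x)"
  by (rule lin_formI) (auto simp: lin_form_add lin_form_scale algebra_simps)

lemma lin_map_tensor_left [lin]: "lin_map f \<Longrightarrow> lin_map (\<lambda>x. f x \<otimes>\<^sub>v v)"
  by (rule lin_mapI) (auto simp: lin_map_add lin_map_scale fun_eq_iff algebra_simps tensor_def)

lemma lin_map_tensor_right [lin]: "lin_map f \<Longrightarrow> lin_map (\<lambda>x. v \<otimes>\<^sub>v f x)"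
  by (rule lin_mapI) (auto simp: lin_map_add lin_map_scale fun_eq_iff algebra_simps tensor_def)

lemma lin_map_comp: "lin_map g \<Longrightarrow> lin_map f \<Longrightarrow> lin_map (\<lambda>x. g (f x))"
  by (rule lin_mapI) (simp_all only: lin_map_add[of f] lin_map_scale[of f] lin_map_add[of g] lin_map_scale[of g])

lemma lin_form_comp: "lin_form g \<Longrightarrow> lin_map f \<Longrightarrow> lin_form (\<lambda>x. g (f x))"
  by (rule lin_formI) (simp_all only: lin_map_add[of f] lin_map_scale[of f] lin_form_add[of g] lin_form_scale[of g])

lemma lin_map_sum_fun [lin]: "(\<And>a. a \<in> A \<Longrightarrow> lin_map (F a)) \<Longrightarrow> lin_map (\<lambda>x. \<Sum>a\<in>A. F a x)"
  by (rule lin_mapI) (simp_all only: lin_map_add lin_map_scale sum.distrib fun_vs.scale_sum_right cong: sum.cong)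

lemma lin_form_sum_fun [lin]: "(\<And>a. a \<in> A \<Longrightarrow> lin_form (F a)) \<Longrightarrow> lin_form (\<lambda>x. \<Sum>a\<in>A. F a x)"
  by (rule lin_formI) (simp_all only: lin_form_add lin_form_scale sum.distrib sum_distrib_left cong: sum.cong)

lemma lift2_linear [lin]: "lin_map f \<Longrightarrow> lin_map (\<lambda>x. lift2 F (f x))"
  unfolding lift2_def
  by (rule lin_mapI)
     (auto simp: lin_map_add lin_map_scale fun_eq_iff sum_fun_apply algebra_simps sum.distrib sum_distrib_left split_beta)

lemma lift2_lin: "lin_map g \<Longrightarrow> g (lift2 F t) = lift2 (\<lambda>a b. g (F a b)) t"
  by (simp only: lift2_def lin_map_sum[of g] lin_map_scale[of g] case_prod_unfold)

lemma lift2_lin_fun [lin]: "(\<And>a b. lin_map (F a b)) \<Longrightarrow> lin_map (\<lambda>x. lift2 (\<lambda>a b. F a b x) t)"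
  unfolding lift2_def split_beta by (intro lin)

lemma lift2_sum: "lift2 F t = (\<Sum>i\<in>UNIV. \<Sum>j\<in>UNIV. t (i, j) *\<^sub>v F (unit_vec i) (unit_vec j))"
  by (simp add: lift2_def sum.cartesian_product UNIV_Times_UNIV[symmetric] del: UNIV_Times_UNIV)

lemma lin_map_expand: "lin_map f \<Longrightarrow> f (v :: 'i::finite \<Rightarrow> 'k::field) = (\<Sum>i\<in>UNIV. v i *\<^sub>v f (unit_vec i))"
  by (subst unit_vec_expand[of v]) (simp only: lin_map_sum lin_map_scale)

lemma lift2_tensor:
  assumes "\<And>y. lin_map (\<lambda>x. F x y)" "\<And>x. lin_map (\<lambda>y. F x y)"
  shows "lift2 F (a \<otimes>\<^sub>v b) = F a b"
proof -
  have F: "F x b = (\<Sum>j\<in>UNIV. b j *\<^sub>v F x (unit_vec j))" for x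
    by (rule lin_map_expand[OF assms(2)])
  have "F a b = (\<Sum>i\<in>UNIV. a i *\<^sub>v F (unit_vec i) b)"
    by (rule lin_map_expand[OF assms(1)])
  also have "\<dots> = (\<Sum>i\<in>UNIV. a i *\<^sub>v (\<Sum>j\<in>UNIV. b j *\<^sub>v F (unit_vec i) (unit_vec j)))"
    by (simp only: F)
  finally show ?thesis
    by (simp add: lift2_sum tensor_def fun_vs.scale_sum_right)
qed

lemma sw2_linear [lin]: "lin_map (comult H) \<Longrightarrow> lin_map f \<Longrightarrow> lin_map (\<lambda>x. sw2 H (f x) F)"
  unfolding sw2_def by (rule lift2_linear, rule lin_map_comp)

lemma sw2_linear_fun [lin]: "(\<And>a b. lin_map (F a b)) \<Longrightarrow> lin_map (\<lambda>x. sw2 H y (\<lambda>a b. F a b x))"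
  unfolding sw2_def by (intro lin)

lemma sw2_lin: "lin_map g \<Longrightarrow> g (sw2 H x F) = sw2 H x (\<lambda>a b. g (F a b))"
  unfolding sw2_def by (rule lift2_lin)

lemma sw2_scale: "sw2 H x (\<lambda>a b. c *\<^sub>v F a b) = c *\<^sub>v sw2 H x F"
  by (rule sw2_lin[symmetric]) (intro lin)

lemma sw2_apply: "sw2 H x F r = (\<Sum>i\<in>UNIV. \<Sum>j\<in>UNIV. comult H x (i, j) * F (unit_vec i) (unit_vec j) r)"
  by (simp add: sw2_def lift2_sum sum_fun_apply)

lemma sw2_swap: "sw2 H x (\<lambda>a b. sw2 H y (F a b)) = sw2 H y (\<lambda>c d. sw2 H x (\<lambda>a b. F a b c d))"
proof -
  let ?f = "\<lambda>r i j k l. comult H x (i, j) * (comult H y (k, l) * F (unit_vec i) (unit_vec j) (unit_vec k) (unit_vec l) r)"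
  have "sw2 H x (\<lambda>a b. sw2 H y (F a b)) r = sw2 H y (\<lambda>c d. sw2 H x (\<lambda>a b. F a b c d)) r" for r
  proof -
    have "(\<Sum>i\<in>UNIV. \<Sum>j\<in>UNIV. \<Sum>k\<in>UNIV. \<Sum>l\<in>UNIV. ?f r i j k l) = (\<Sum>i\<in>UNIV. \<Sum>k\<in>UNIV. \<Sum>j\<in>UNIV. \<Sum>l\<in>UNIV. ?f r i j k l)"
      by (rule sum.cong[OF refl], rule sum.swap)
    also have "\<dots> = (\<Sum>k\<in>UNIV. \<Sum>i\<in>UNIV. \<Sum>l\<in>UNIV. \<Sum>j\<in>UNIV. ?f r i j k l)"
      by (subst sum.swap, rule sum.cong[OF refl], rule sum.cong[OF refl], rule sum.swap)
    also have "\<dots> = (\<Sum>k\<in>UNIV. \<Sum>l\<in>UNIV. \<Sum>i\<in>UNIV. \<Sum>j\<in>UNIV. ?f r i j k l)"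
      by (rule sum.cong[OF refl], rule sum.swap)
    finally show ?thesis
      by (simp add: sw2_apply sum_distrib_left mult_ac)
  qed
  then show ?thesis by blast
qed

lemma comult_sw2: "comult H x = sw2 H x (\<lambda>a b. a \<otimes>\<^sub>v b)"
proof
  fix r :: "'a \<times> 'a"
  obtain k l where r: "r = (k, l)" by fastforce
  have "sw2 H x (\<lambda>a b. a \<otimes>\<^sub>v b) r
      = (\<Sum>i\<in>UNIV. \<Sum>j\<in>UNIV. if i = k then (if j = l then comult H x (k, l) else 0) else 0)"
    unfolding sw2_apply r by (intro sum.cong refl) (auto simp: tensor_def unit_vec_def)
  also have "\<dots> = (\<Sum>i\<in>UNIV. if i = k then (\<Sum>j\<in>UNIV. if j = l then comult H x (k, l) else 0) else 0)"
    by (intro sum.cong) auto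
  also have "\<dots> = comult H x r"
    by (simp add: r)
  finally show "comult H x r = sw2 H x (\<lambda>a b. a \<otimes>\<^sub>v b) r" by simp
qed

abbreviation bilin :: "(('i \<Rightarrow> 'k::field) \<Rightarrow> ('j \<Rightarrow> 'k) \<Rightarrow> 'n \<Rightarrow> 'k) \<Rightarrow> bool"
  where "bilin F \<equiv> (\<forall>y. lin_map (\<lambda>x. F x y)) \<and> (\<forall>x. lin_map (\<lambda>y. F x y))"

abbreviation trilin :: "(('i \<Rightarrow> 'k::field) \<Rightarrow> ('j \<Rightarrow> 'k) \<Rightarrow> ('l \<Rightarrow> 'k) \<Rightarrow> 'n \<Rightarrow> 'k) \<Rightarrow> bool"
  where "trilin F \<equiv> (\<forall>y z. lin_map (\<lambda>x. F x y z)) \<and> (\<forall>x z. lin_map (\<lambda>y. F x y z)) \<and> (\<forall>x y. lin_map (\<lambda>z. F x y z))"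

lemma lift3_tensor:
  assumes F: "trilin F"
  shows "lift2 (\<lambda>a. lift2 (F a)) (a \<otimes>\<^sub>v b \<otimes>\<^sub>v c) = F a b c"
  using F by (subst lift2_tensor) (auto intro!: lin lift2_tensor)

context hopf_algebra
begin

lemma lin_mult_left [lin]: "lin_map f \<Longrightarrow> lin_map (\<lambda>x. f x \<cdot> y)"
  by (rule lin_map_comp[OF mult_linear_left])
lemma lin_mult_right [lin]: "lin_map f \<Longrightarrow> lin_map (\<lambda>x. y \<cdot> f x)"
  by (rule lin_map_comp[OF mult_linear_right])
lemma lin_antipode [lin]: "lin_map f \<Longrightarrow> lin_map (\<lambda>x. antipode H (f x))"
  by (rule lin_map_comp[OF antipode_linear])
lemma lin_counit [lin]: "lin_map f \<Longrightarrow> lin_form (\<lambda>x. counit H (f x))"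
  by (rule lin_form_comp[OF counit_linear])
lemma lin_comult [lin]: "lin_map f \<Longrightarrow> lin_map (\<lambda>x. comult H (f x))"
  by (rule lin_map_comp[OF comult_linear])
text \<open>The axiom \<open>coassoc\<close> speaks of pure tensors; applying to it the linear map
  on the triple tensor product that is induced by \<open>F\<close> gives the rule for every
  trilinear \<open>F\<close>.\<close>

lemma sw2_coassoc:
  assumes F: "trilin F"
  shows "sw2 H x (\<lambda>w c. sw2 H w (\<lambda>a b. F a b c)) = sw2 H x (\<lambda>a w. sw2 H w (\<lambda>b c. F a b c))"
proof -
  let ?g = "lift2 (\<lambda>a. lift2 (F a))"
  have "?g (sw2 H x (\<lambda>w c. sw2 H w (\<lambda>a b. a \<otimes>\<^sub>v b \<otimes>\<^sub>v c))) = ?g (sw2 H x (\<lambda>a w. sw2 H w (\<lambda>b c. a \<otimes>\<^sub>v b \<otimes>\<^sub>v c)))"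
    by (simp only: coassoc)
  moreover have g: "lin_map ?g" by (intro lin)
  ultimately show ?thesis
    by (simp add: sw2_lin[OF g] lift3_tensor[OF F])
qed

lemma sw2_counit_left: "lin_map F \<Longrightarrow> sw2 H x (\<lambda>a b. counit H a *\<^sub>v F b) = F x"
  using sw2_lin[of F H x "\<lambda>a b. counit H a *\<^sub>v b"] by (simp only: counit_left lin_map_scale[of F])

lemma sw2_counit_right: "lin_map F \<Longrightarrow> sw2 H x (\<lambda>a b. counit H b *\<^sub>v F a) = F x"
  using sw2_lin[of F H x "\<lambda>a b. counit H b *\<^sub>v a"] by (simp only: counit_right lin_map_scale[of F])

lemma sw2_antipode_left: "lin_map F \<Longrightarrow> sw2 H x (\<lambda>a b. F (antipode H a \<cdot> b)) = counit H x *\<^sub>v F \<one>"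
  using sw2_lin[of F H x "\<lambda>a b. antipode H a \<cdot> b"] by (simp only: antipode_left lin_map_scale[of F])

lemma sw2_antipode_right: "lin_map F \<Longrightarrow> sw2 H x (\<lambda>a b. F (a \<cdot> antipode H b)) = counit H x *\<^sub>v F \<one>"
  using sw2_lin[of F H x "\<lambda>a b. a \<cdot> antipode H b"] by (simp only: antipode_right lin_map_scale[of F])

lemma sw2_mult:
  assumes F: "bilin F"
  shows "sw2 H (x \<cdot> y) F = sw2 H x (\<lambda>a b. sw2 H y (\<lambda>c d. F (a \<cdot> c) (b \<cdot> d)))"
proof -
  have g: "lin_map (lift2 F)" by (intro lin)
  show ?thesis
    using F unfolding sw2_def[of H "x \<cdot> y"] comult_mult sw2_lin[OF g] by (simp add: lift2_tensor)
qed

lemma sw2_grouplike: "bilin F \<Longrightarrow> comult H g = g \<otimes>\<^sub>v g \<Longrightarrow> sw2 H g F = F g g"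
  unfolding sw2_def by (simp add: lift2_tensor)

lemma sw2_unit: "bilin F \<Longrightarrow> sw2 H \<one> F = F \<one> \<one>"
  by (simp add: sw2_grouplike comult_unit)

lemma antipode_unit: "antipode H \<one> = \<one>"
proof -
  have "sw2 H \<one> (\<lambda>a b. antipode H a \<cdot> b) = antipode H \<one> \<cdot> \<one>"
    by (rule sw2_unit) (intro conjI allI lin)
  then show ?thesis
    by (simp add: antipode_left counit_unit mult_unit_right)
qed

text \<open>Both sides are convolution inverses of the multiplication. Concretely, \<open>?E\<close>
  is S(y_(1)) S(x_(1)) x_(2) y_(2) S(x_(3) y_(3)): contracting its right end leaves S(y) S(x),
  contracting first S(x_(1)) x_(2) and then S(y_(1)) y_(2) leaves S(x y).\<close>

lemma antipode_mult: "antipode H (x \<cdot> y) = antipode H y \<cdot> antipode H x"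
proof -
  let ?S = "antipode H"
  let ?E = "sw2 H x (\<lambda>x1 x'. sw2 H y (\<lambda>y1 y'. sw2 H x' (\<lambda>x2 x3. sw2 H y' (\<lambda>y2 y3.
      ?S y1 \<cdot> (?S x1 \<cdot> ((x2 \<cdot> y2) \<cdot> ?S (x3 \<cdot> y3)))))))"
  have "sw2 H x' (\<lambda>x2 x3. sw2 H y' (\<lambda>y2 y3. ?S y1 \<cdot> (?S x1 \<cdot> ((x2 \<cdot> y2) \<cdot> ?S (x3 \<cdot> y3)))))
      = counit H x' *\<^sub>v counit H y' *\<^sub>v (?S y1 \<cdot> ?S x1)" for x1 x' y1 y'
  proof -
    have "sw2 H x' (\<lambda>x2 x3. sw2 H y' (\<lambda>y2 y3. ?S y1 \<cdot> (?S x1 \<cdot> ((x2 \<cdot> y2) \<cdot> ?S (x3 \<cdot> y3)))))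
        = sw2 H (x' \<cdot> y') (\<lambda>u v. ?S y1 \<cdot> (?S x1 \<cdot> (u \<cdot> ?S v)))"
      by (rule sw2_mult[symmetric]) (intro conjI allI lin)
    also have "\<dots> = counit H (x' \<cdot> y') *\<^sub>v (?S y1 \<cdot> (?S x1 \<cdot> \<one>))"
      by (rule sw2_antipode_right[where F = "\<lambda>z. ?S y1 \<cdot> (?S x1 \<cdot> z)"]) (intro lin)
    finally show ?thesis by (simp add: counit_mult mult_unit_right)
  qed
  then have "?E = sw2 H x (\<lambda>x1 x'. counit H x' *\<^sub>v sw2 H y (\<lambda>y1 y'. counit H y' *\<^sub>v (?S y1 \<cdot> ?S x1)))"
    by (simp only: sw2_scale)
  also have "\<dots> = sw2 H x (\<lambda>x1 x'. counit H x' *\<^sub>v (?S y \<cdot> ?S x1))"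
    by (subst sw2_counit_right) (intro lin refl)+
  also have "\<dots> = ?S y \<cdot> ?S x"
    by (rule sw2_counit_right) (intro lin)
  finally have 1: "?E = ?S y \<cdot> ?S x" .
  have "?E = sw2 H x (\<lambda>x1 x'. sw2 H x' (\<lambda>x2 x3. sw2 H y (\<lambda>y1 y'. sw2 H y' (\<lambda>y2 y3.
      ?S y1 \<cdot> (?S x1 \<cdot> ((x2 \<cdot> y2) \<cdot> ?S (x3 \<cdot> y3)))))))"
    by (subst (2) sw2_swap) (rule refl)
  also have "\<dots> = sw2 H x (\<lambda>w x3. sw2 H w (\<lambda>x1 x2. sw2 H y (\<lambda>y1 y'. sw2 H y' (\<lambda>y2 y3.
      ?S y1 \<cdot> (?S x1 \<cdot> ((x2 \<cdot> y2) \<cdot> ?S (x3 \<cdot> y3)))))))"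
    by (rule sw2_coassoc[symmetric]) (intro conjI allI lin)
  also have "\<dots> = sw2 H x (\<lambda>w x3. sw2 H y (\<lambda>y1 y'. sw2 H y' (\<lambda>y2 y3. sw2 H w (\<lambda>x1 x2. 
      ?S y1 \<cdot> ((?S x1 \<cdot> x2) \<cdot> (y2 \<cdot> ?S (x3 \<cdot> y3)))))))"
    by (subst (2) sw2_swap, subst (3) sw2_swap) (simp only: mult_assoc)
  also have "\<dots> = sw2 H x (\<lambda>w x3. sw2 H y (\<lambda>y1 y'. sw2 H y' (\<lambda>y2 y3. counit H w *\<^sub>v (?S y1 \<cdot> (\<one> \<cdot> (y2 \<cdot> ?S (x3 \<cdot> y3)))))))"
    by (subst sw2_antipode_left[where F = "\<lambda>z. ?S _ \<cdot> (z \<cdot> (_ \<cdot> ?S (_ \<cdot> _)))"]) (intro lin refl)+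
  also have "\<dots> = sw2 H x (\<lambda>w x3. counit H w *\<^sub>v sw2 H y (\<lambda>y1 y'. sw2 H y' (\<lambda>y2 y3. ?S y1 \<cdot> (y2 \<cdot> ?S (x3 \<cdot> y3)))))"
    by (simp only: sw2_scale mult_unit_left)
  also have "\<dots> = sw2 H y (\<lambda>y1 y'. sw2 H y' (\<lambda>y2 y3. ?S y1 \<cdot> (y2 \<cdot> ?S (x \<cdot> y3))))"
    by (rule sw2_counit_left) (intro lin)
  also have "\<dots> = sw2 H y (\<lambda>w y3. sw2 H w (\<lambda>y1 y2. ?S y1 \<cdot> (y2 \<cdot> ?S (x \<cdot> y3))))"
    by (rule sw2_coassoc[symmetric]) (intro conjI allI lin)
  also have "\<dots> = sw2 H y (\<lambda>w y3. counit H w *\<^sub>v (\<one> \<cdot> ?S (x \<cdot> y3)))"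
    by (subst mult_assoc[symmetric], subst sw2_antipode_left[where F = "\<lambda>z. z \<cdot> ?S (_ \<cdot> _)"]) (intro lin refl)+
  also have "\<dots> = \<one> \<cdot> ?S (x \<cdot> y)"
    by (rule sw2_counit_left) (intro lin)
  finally show ?thesis using 1 by (simp add: mult_unit_left)
qed

end

context hopf_algebra
begin

text \<open>Uniqueness of convolution inverses again, now with values in the tensor square of H. In
  \<open>?E\<close>, where u \<otimes> v is the coproduct of S(x_(1)), the tail x_(2) S(x_(5))
  \<otimes> x_(3) S(x_(4)) contracts to the counit, while the head multiplies up to the coproduct of
  S(x_(1)) m, with m the element that splits into the next two legs.\<close>

lemma sw2_antipode:
  assumes F: "bilin F"
  shows "sw2 H (antipode H x) F = sw2 H x (\<lambda>a b. F (antipode H b) (antipode H a))"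
proof -
  let ?S = "antipode H"
  have [lin]: "lin_map f \<Longrightarrow> lin_map (\<lambda>x. F (f x) y)" "lin_map f \<Longrightarrow> lin_map (\<lambda>x. F y (f x))" for f y
    using F by (auto intro: lin_map_comp[of "F y" f] lin_map_comp[of "\<lambda>z. F z y" f])
  let ?E = "sw2 H x (\<lambda>x1 r. sw2 H (?S x1) (\<lambda>u v. sw2 H r (\<lambda>m n. sw2 H m (\<lambda>x2 x3. sw2 H n (\<lambda>x4 x5.
     F (u \<cdot> (x2 \<cdot> ?S x5)) (v \<cdot> (x3 \<cdot> ?S x4)))))))"
  have 1: "sw2 H r (\<lambda>m n. sw2 H m (\<lambda>x2 x3. sw2 H n (\<lambda>x4 x5. F (u \<cdot> (x2 \<cdot> ?S x5)) (v \<cdot> (x3 \<cdot> ?S x4)))))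
      = counit H r *\<^sub>v F u v" for r u v
  proof -
    have "sw2 H w (\<lambda>x3 n. sw2 H n (\<lambda>x4 x5. F (u \<cdot> (x2 \<cdot> ?S x5)) (v \<cdot> (x3 \<cdot> ?S x4))))
      = F (u \<cdot> (x2 \<cdot> ?S w)) v" for w x2
    proof -
      have "sw2 H w (\<lambda>x3 n. sw2 H n (\<lambda>x4 x5. F (u \<cdot> (x2 \<cdot> ?S x5)) (v \<cdot> (x3 \<cdot> ?S x4))))
        = sw2 H w (\<lambda>z x5. sw2 H z (\<lambda>x3 x4. F (u \<cdot> (x2 \<cdot> ?S x5)) (v \<cdot> (x3 \<cdot> ?S x4))))"
        by (rule sw2_coassoc[symmetric]) (intro conjI allI lin)
      also have "\<dots> = sw2 H w (\<lambda>z x5. counit H z *\<^sub>v F (u \<cdot> (x2 \<cdot> ?S x5)) (v \<cdot> \<one>))"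
        by (subst sw2_antipode_right[where F = "\<lambda>z. F _ (v \<cdot> z)"]) (intro lin refl)+
      also have "\<dots> = F (u \<cdot> (x2 \<cdot> ?S w)) (v \<cdot> \<one>)"
        by (rule sw2_counit_left) (intro lin)
      finally show ?thesis by (simp add: mult_unit_right)
    qed
    moreover have "sw2 H r (\<lambda>m n. sw2 H m (\<lambda>x2 x3. sw2 H n (\<lambda>x4 x5. F (u \<cdot> (x2 \<cdot> ?S x5)) (v \<cdot> (x3 \<cdot> ?S x4)))))
      = sw2 H r (\<lambda>x2 w. sw2 H w (\<lambda>x3 n. sw2 H n (\<lambda>x4 x5. F (u \<cdot> (x2 \<cdot> ?S x5)) (v \<cdot> (x3 \<cdot> ?S x4)))))"
      by (rule sw2_coassoc) (intro conjI allI lin)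
    moreover have "sw2 H r (\<lambda>x2 w. F (u \<cdot> (x2 \<cdot> ?S w)) v) = counit H r *\<^sub>v F (u \<cdot> \<one>) v"
      by (rule sw2_antipode_right[where F = "\<lambda>z. F (u \<cdot> z) v"]) (intro lin)
    ultimately show ?thesis by (simp add: mult_unit_right)
  qed
  have "?E = sw2 H x (\<lambda>x1 r. counit H r *\<^sub>v sw2 H (?S x1) F)"
    unfolding 1 by (simp only: sw2_scale)
  also have "\<dots> = sw2 H (?S x) F"
    by (rule sw2_counit_right) (intro lin)
  finally have E: "?E = sw2 H (?S x) F" .
  let ?P = "\<lambda>n a b. sw2 H n (\<lambda>x4 x5. F (a \<cdot> ?S x5) (b \<cdot> ?S x4))"
  have "?E = sw2 H x (\<lambda>x1 r. sw2 H r (\<lambda>m n. sw2 H (?S x1) (\<lambda>u v. sw2 H m (\<lambda>x2 x3. ?P n (u \<cdot> x2) (v \<cdot> x3)))))"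
    by (subst (2) sw2_swap) (simp only: mult_assoc)
  also have "\<dots> = sw2 H x (\<lambda>w n. sw2 H w (\<lambda>x1 m. sw2 H (?S x1) (\<lambda>u v. sw2 H m (\<lambda>x2 x3. ?P n (u \<cdot> x2) (v \<cdot> x3)))))"
    by (rule sw2_coassoc[symmetric]) (intro conjI allI lin)
  also have "\<dots> = sw2 H x (\<lambda>w n. sw2 H w (\<lambda>x1 m. sw2 H (?S x1 \<cdot> m) (?P n)))"
    by (subst sw2_mult) (intro conjI allI lin refl)+
  also have "\<dots> = sw2 H x (\<lambda>w n. counit H w *\<^sub>v sw2 H \<one> (?P n))"
    by (subst sw2_antipode_left[where F = "\<lambda>z. sw2 H z (?P _)"]) (intro lin refl)+
  also have "\<dots> = sw2 H \<one> (?P x)"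
    by (rule sw2_counit_left) (intro lin)
  also have "\<dots> = ?P x \<one> \<one>"
    by (rule sw2_unit) (intro conjI allI lin)
  finally show ?thesis
    by (simp add: E mult_unit_left)
qed

lemma counit_antipode: "counit H (antipode H x) = counit H x"
proof -
  \<comment> \<open>Sweedler sums take values in function spaces; identities of scalars are stated
    in the one-dimensional space of functions on \<open>unit\<close>.\<close>
  let ?u = "\<lambda>_::unit. 1 :: 'k"
  have "counit H x *\<^sub>v counit H \<one> *\<^sub>v ?u = sw2 H x (\<lambda>a b. counit H (antipode H a \<cdot> b) *\<^sub>v ?u)"
    by (rule sw2_antipode_left[symmetric]) (intro lin)
  also have "\<dots> = sw2 H x (\<lambda>a b. counit H b *\<^sub>v counit H (antipode H a) *\<^sub>v ?u)"
    by (simp add: counit_mult mult_ac)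
  also have "\<dots> = counit H (antipode H x) *\<^sub>v ?u"
    by (rule sw2_counit_right) (intro lin)
  finally show ?thesis
    by (auto simp: counit_unit fun_eq_iff)
qed

lemma conv_sw2: "conv H \<alpha> \<beta> h *\<^sub>v v = sw2 H h (\<lambda>a b. \<alpha> a *\<^sub>v \<beta> b *\<^sub>v v)"
proof
  fix r
  have "(\<Sum>x\<in>UNIV. comult H h x * (\<alpha> (unit_vec (fst x)) * \<beta> (unit_vec (snd x)))) * v r =
    (\<Sum>x\<in>UNIV. comult H h x * (\<alpha> (unit_vec (fst x)) * (\<beta> (unit_vec (snd x)) * v r)))"
    by (simp add: sum_distrib_left mult_ac)
  then show "(conv H \<alpha> \<beta> h *\<^sub>v v) r = sw2 H h (\<lambda>a b. \<alpha> a *\<^sub>v \<beta> b *\<^sub>v v) r"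
    unfolding conv_def sw2_def lift2_def by (simp add: sum_fun_apply split_beta mult.assoc)
qed

lemma unit_scale_cancel: "a *\<^sub>v (\<lambda>_::unit. 1 :: 'x::field) = b *\<^sub>v (\<lambda>_. 1) \<Longrightarrow> a = b"
  by (simp add: fun_eq_iff)

lemma lin_form_conv:
  assumes "lin_form \<alpha>" "lin_form \<beta>"
  shows "lin_form (conv H \<alpha> \<beta>)"
proof -
  have "lin_map (\<lambda>h. conv H \<alpha> \<beta> h *\<^sub>v (\<lambda>_::unit. 1 :: 'k))"
    unfolding conv_sw2 by (intro lin)
  from lin_map_add[OF this] lin_map_scale[OF this] show ?thesis
    by (intro lin_formI) (auto simp: fun_eq_iff)
qed

lemma conv_assoc:
  assumes "lin_form \<alpha>" "lin_form \<beta>" "lin_form \<gamma>"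
  shows "conv H (conv H \<alpha> \<beta>) \<gamma> = conv H \<alpha> (conv H \<beta> \<gamma>)"
proof
  fix h
  have l [lin]: "lin_map f \<Longrightarrow> lin_form (\<lambda>x. \<alpha> (f x))" "lin_map f \<Longrightarrow> lin_form (\<lambda>x. \<beta> (f x))" "lin_map f \<Longrightarrow> lin_form (\<lambda>x. \<gamma> (f x))" for f
    using assms by (auto intro: lin_form_comp)
  let ?u = "\<lambda>_::unit. 1 :: 'k"
  have "conv H (conv H \<alpha> \<beta>) \<gamma> h *\<^sub>v ?u = sw2 H h (\<lambda>w c. sw2 H w (\<lambda>a b. \<alpha> a *\<^sub>v \<beta> b *\<^sub>v \<gamma> c *\<^sub>v ?u))"
    by (simp only: conv_sw2)
  also have "\<dots> = sw2 H h (\<lambda>a w. sw2 H w (\<lambda>b c. \<alpha> a *\<^sub>v \<beta> b *\<^sub>v \<gamma> c *\<^sub>v ?u))"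
    by (rule sw2_coassoc) (intro conjI allI lin)
  also have "\<dots> = conv H \<alpha> (conv H \<beta> \<gamma>) h *\<^sub>v ?u"
    by (simp only: conv_sw2 sw2_scale)
  finally show "conv H (conv H \<alpha> \<beta>) \<gamma> h = conv H \<alpha> (conv H \<beta> \<gamma>) h"
    by (rule unit_scale_cancel)
qed

lemma conv_counit_left: "lin_form \<alpha> \<Longrightarrow> conv H (counit H) \<alpha> = \<alpha>"
proof
  fix h assume a: "lin_form \<alpha>"
  have "conv H (counit H) \<alpha> h *\<^sub>v (\<lambda>_::unit. 1 :: 'k) = \<alpha> h *\<^sub>v (\<lambda>_. 1)"
    unfolding conv_sw2 by (rule sw2_counit_left) (intro lin a)
  then show "conv H (counit H) \<alpha> h = \<alpha> h" by (rule unit_scale_cancel)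
qed

lemma conv_counit_right: "lin_form \<alpha> \<Longrightarrow> conv H \<alpha> (counit H) = \<alpha>"
proof
  fix h assume a: "lin_form \<alpha>"
  have "conv H \<alpha> (counit H) h *\<^sub>v (\<lambda>_::unit. 1 :: 'k) = sw2 H h (\<lambda>a b. counit H b *\<^sub>v \<alpha> a *\<^sub>v (\<lambda>_. 1))"
    unfolding conv_sw2 by (simp add: mult_ac fscale_def)
  also have "\<dots> = \<alpha> h *\<^sub>v (\<lambda>_. 1)"
    by (rule sw2_counit_right) (intro lin a)
  finally show "conv H \<alpha> (counit H) h = \<alpha> h" by (rule unit_scale_cancel)
qed

lemma conv_inverse_unique:
  assumes "lin_form \<alpha>" "lin_form \<beta>" "lin_form \<gamma>" "conv H \<beta> \<alpha> = counit H" "conv H \<alpha> \<gamma> = counit H"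
  shows "\<beta> = \<gamma>"
  by (metis assms conv_assoc conv_counit_left conv_counit_right)

end

section \<open>Consequences of a pair in involution\<close>

locale hopf_pair = hopf_algebra H for H :: "('b::finite, 'k::field) hopf" (structure) +
  fixes p \<chi>
  assumes pair: "pair_in_involution H p \<chi>"
begin

abbreviation "S \<equiv> antipode H"
abbreviation "\<epsilon> \<equiv> counit H"
abbreviation "pinv \<equiv> hinverse H p"
abbreviation "\<chi>inv \<equiv> conv_inverse H \<chi>"

lemma chi_linear: "lin_form \<chi>" and chi_mult: "\<chi> (x \<cdot> y) = \<chi> x * \<chi> y" and chi_unit: "\<chi> \<one> = 1"
  and comult_p: "comult H p = p \<otimes>\<^sub>v p" and counit_p: "\<epsilon> p = 1"
  using pair by (auto simp: pair_in_involution_def grouplikes_def characters_def)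

lemma lin_chi [lin]: "lin_map f \<Longrightarrow> lin_form (\<lambda>x. \<chi> (f x))"
  by (rule lin_form_comp[OF chi_linear])

lemma S_p_left: "S p \<cdot> p = \<one>"
  using antipode_left[of p] by (subst (asm) sw2_grouplike) (auto simp: comult_p counit_p intro!: lin)
lemma S_p_right: "p \<cdot> S p = \<one>"
  using antipode_right[of p] by (subst (asm) sw2_grouplike) (auto simp: comult_p counit_p intro!: lin)

lemma pinv: "pinv = S p"
  unfolding hinverse_def
proof (rule the_equality)
  show "p \<cdot> S p = \<one> \<and> S p \<cdot> p = \<one>" by (simp add: S_p_left S_p_right)
  fix q assume "p \<cdot> q = \<one> \<and> q \<cdot> p = \<one>"
  then show "q = S p" by (metis S_p_left mult_assoc mult_unit_left mult_unit_right)
qed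

lemma p_pinv: "p \<cdot> pinv = \<one>" and pinv_p: "pinv \<cdot> p = \<one>"
  by (simp_all add: pinv S_p_left S_p_right)

lemma p_pinv_assoc: "p \<cdot> (pinv \<cdot> x) = x" and pinv_p_assoc: "pinv \<cdot> (p \<cdot> x) = x"
  by (simp_all add: mult_assoc[symmetric] p_pinv pinv_p mult_unit_left)

lemma comult_pinv: "comult H pinv = pinv \<otimes>\<^sub>v pinv"
proof -
  have "sw2 H (S p) (\<lambda>a b. a \<otimes>\<^sub>v b) = sw2 H p (\<lambda>a b. S b \<otimes>\<^sub>v S a)"
    by (rule sw2_antipode) (intro conjI allI lin)
  also have "\<dots> = S p \<otimes>\<^sub>v S p"
    by (rule sw2_grouplike) (intro conjI allI lin comult_p)+
  finally show ?thesis
    by (simp add: comult_sw2[symmetric] pinv)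
qed

lemma counit_pinv: "\<epsilon> pinv = 1"
  by (simp add: pinv counit_antipode counit_p)

lemma S_pinv: "S pinv = p"
proof -
  have "S p \<cdot> S (S p) = \<one>"
    using antipode_mult[of "S p" p] S_p_left by (simp add: antipode_mult[symmetric] S_p_right S_p_left antipode_unit)
  then have "p \<cdot> (S p \<cdot> S (S p)) = p" by (simp add: mult_unit_right)
  then show ?thesis by (simp add: mult_assoc[symmetric] S_p_right mult_unit_left pinv)
qed

lemma chi_p_pinv: "\<chi> p * \<chi> pinv = 1"
  by (metis chi_mult chi_unit p_pinv)

lemma conv_chi_S: "conv H \<chi> (\<lambda>x. \<chi> (S x)) = \<epsilon>" and conv_S_chi: "conv H (\<lambda>x. \<chi> (S x)) \<chi> = \<epsilon>"
proof (rule_tac [!] ext)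
  fix h
  let ?u = "\<lambda>_::unit. 1 :: 'k"
  have "conv H \<chi> (\<lambda>x. \<chi> (S x)) h *\<^sub>v ?u = sw2 H h (\<lambda>a b. \<chi> (a \<cdot> S b) *\<^sub>v ?u)"
    unfolding conv_sw2 by (simp add: chi_mult)
  also have "\<dots> = \<epsilon> h *\<^sub>v \<chi> \<one> *\<^sub>v ?u"
    by (rule sw2_antipode_right) (intro lin)
  finally show "conv H \<chi> (\<lambda>x. \<chi> (S x)) h = \<epsilon> h"
    by (simp add: chi_unit fun_eq_iff)
  have "conv H (\<lambda>x. \<chi> (S x)) \<chi> h *\<^sub>v ?u = sw2 H h (\<lambda>a b. \<chi> (S a \<cdot> b) *\<^sub>v ?u)"
    unfolding conv_sw2 by (simp add: chi_mult)
  also have "\<dots> = \<epsilon> h *\<^sub>v \<chi> \<one> *\<^sub>v ?u"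
    by (rule sw2_antipode_left) (intro lin)
  finally show "conv H (\<lambda>x. \<chi> (S x)) \<chi> h = \<epsilon> h"
    by (simp add: chi_unit fun_eq_iff)
qed

lemma chiinv: "\<chi>inv = (\<lambda>x. \<chi> (S x))"
  unfolding conv_inverse_def
proof (rule the_equality)
  show 1: "lin_form (\<lambda>x. \<chi> (S x)) \<and> conv H \<chi> (\<lambda>x. \<chi> (S x)) = \<epsilon> \<and> conv H (\<lambda>x. \<chi> (S x)) \<chi> = \<epsilon>"
    by (simp add: conv_chi_S conv_S_chi) (intro lin)
  fix \<eta> assume "lin_form \<eta> \<and> conv H \<chi> \<eta> = \<epsilon> \<and> conv H \<eta> \<chi> = \<epsilon>"
  with 1 show "\<eta> = (\<lambda>x. \<chi> (S x))" using conv_inverse_unique[OF chi_linear] by blast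
qed

lemma lin_chiinv [lin]: "lin_map f \<Longrightarrow> lin_form (\<lambda>x. \<chi>inv (f x))"
  unfolding chiinv by (intro lin)

lemma chi_chiinv: "sw2 H h (\<lambda>a b. \<chi> a *\<^sub>v \<chi>inv b *\<^sub>v v) = \<epsilon> h *\<^sub>v v"
  unfolding conv_sw2[symmetric] chiinv conv_chi_S ..

text \<open>Both \<chi> and \<chi> S^2 are convolution inverse to \<chi> S, hence they are
  equal.\<close>

lemma chiinv_S: "\<chi>inv (S x) = \<chi> x"
proof -
  have 1: "conv H (\<lambda>x. \<chi> (S (S x))) (\<lambda>x. \<chi> (S x)) = \<epsilon>"
  proof
    fix x
    let ?u = "\<lambda>_::unit. 1 :: 'k"
    have "conv H (\<lambda>x. \<chi> (S (S x))) (\<lambda>x. \<chi> (S x)) x *\<^sub>v ?u = sw2 H x (\<lambda>a b. \<chi> (S b) *\<^sub>v \<chi> (S (S a)) *\<^sub>v ?u)"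
      unfolding conv_sw2 by (simp add: fscale_def mult_ac)
    also have "\<dots> = sw2 H (S x) (\<lambda>a b. \<chi> a *\<^sub>v \<chi> (S b) *\<^sub>v ?u)"
      by (rule sw2_antipode[symmetric]) (intro conjI allI lin)
    also have "\<dots> = \<epsilon> x *\<^sub>v ?u"
      unfolding conv_sw2[symmetric] conv_chi_S counit_antipode ..
    finally show "conv H (\<lambda>x. \<chi> (S (S x))) (\<lambda>x. \<chi> (S x)) x = \<epsilon> x"
      by (rule unit_scale_cancel)
  qed
  have "(\<lambda>x. \<chi> (S (S x))) = \<chi>"
    by (rule conv_inverse_unique[OF _ _ chi_linear 1 conv_S_chi]) (intro lin)+
  then show ?thesis by (simp add: chiinv fun_eq_iff)
qed

lemma antipode_square:
  "S (S h) = sw2 H h (\<lambda>x w. sw2 H w (\<lambda>y z. \<chi>inv x *\<^sub>v \<chi> z *\<^sub>v (p \<cdot> y \<cdot> pinv)))"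
  using pair by (simp add: pair_in_involution_def sw3_def)

end

subsection \<open>Translations by linear forms\<close>

context hopf_algebra
begin

text \<open>The right regular action of the dual algebra on H. Together with the left one,
  \<open>ra\<close>, it moves factors that are linear forms between Sweedler legs without
  introducing further legs.\<close>

definition la :: "(('b \<Rightarrow> 'k) \<Rightarrow> 'k) \<Rightarrow> ('b \<Rightarrow> 'k) \<Rightarrow> 'b \<Rightarrow> 'k"
  where "la \<alpha> x = sw2 H x (\<lambda>a b. \<alpha> a *\<^sub>v b)"

definition ra :: "(('b \<Rightarrow> 'k) \<Rightarrow> 'k) \<Rightarrow> ('b \<Rightarrow> 'k) \<Rightarrow> 'b \<Rightarrow> 'k"
  where "ra \<alpha> x = sw2 H x (\<lambda>a b. \<alpha> b *\<^sub>v a)"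

lemma lin_la [lin]: "lin_map f \<Longrightarrow> lin_map (\<lambda>x. la \<alpha> (f x))"
  unfolding la_def by (intro lin)

lemma lin_ra [lin]: "lin_map f \<Longrightarrow> lin_map (\<lambda>x. ra \<alpha> (f x))"
  unfolding ra_def by (intro lin)

lemma bilin_left: "bilin F \<Longrightarrow> lin_map f \<Longrightarrow> lin_map (\<lambda>x. F (f x) y)"
  by (auto intro: lin_map_comp[of "\<lambda>z. F z y" f])

lemma bilin_right: "bilin F \<Longrightarrow> lin_map f \<Longrightarrow> lin_map (\<lambda>x. F y (f x))"
  by (auto intro: lin_map_comp[of "F y" f])

lemma sw2_la:
  assumes "lin_form \<alpha>" and F: "bilin F"
  shows "sw2 H (la \<alpha> x) F = sw2 H x (\<lambda>a b. F (la \<alpha> a) b)"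
proof -
  note [lin] = lin_form_comp[OF assms(1)] bilin_left[OF F] bilin_right[OF F]
  have "sw2 H (la \<alpha> x) F = sw2 H x (\<lambda>a w. sw2 H w (\<lambda>b c. \<alpha> a *\<^sub>v F b c))"
    unfolding la_def by (subst sw2_lin[of "\<lambda>z. sw2 H z F"]) (intro lin, simp add: sw2_scale lin_map_scale[of "\<lambda>z. sw2 H z F"] lin)
  also have "\<dots> = sw2 H x (\<lambda>w c. sw2 H w (\<lambda>a b. \<alpha> a *\<^sub>v F b c))"
    by (rule sw2_coassoc[symmetric]) (intro conjI allI lin)
  also have "\<dots> = sw2 H x (\<lambda>w c. F (la \<alpha> w) c)"
    unfolding la_def using F by (simp add: sw2_lin[of "\<lambda>z. F z _"] lin_map_scale[of "\<lambda>z. F z _"])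
  finally show ?thesis .
qed

lemma sw2_ra:
  assumes "lin_form \<alpha>" and F: "bilin F"
  shows "sw2 H (ra \<alpha> x) F = sw2 H x (\<lambda>a b. F a (ra \<alpha> b))"
proof -
  note [lin] = lin_form_comp[OF assms(1)] bilin_left[OF F] bilin_right[OF F]
  have "sw2 H (ra \<alpha> x) F = sw2 H x (\<lambda>w c. sw2 H w (\<lambda>a b. \<alpha> c *\<^sub>v F a b))"
    unfolding ra_def by (subst sw2_lin[of "\<lambda>z. sw2 H z F"]) (intro lin, simp add: sw2_scale lin_map_scale[of "\<lambda>z. sw2 H z F"] lin)
  also have "\<dots> = sw2 H x (\<lambda>a w. sw2 H w (\<lambda>b c. \<alpha> c *\<^sub>v F a b))"
    by (rule sw2_coassoc) (intro conjI allI lin)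
  also have "\<dots> = sw2 H x (\<lambda>a w. F a (ra \<alpha> w))"
    unfolding ra_def using F by (simp add: sw2_lin[of "F _"] lin_map_scale[of "F _"])
  finally show ?thesis .
qed

text \<open>Coassociativity in terms of translations: a form evaluated on a middle leg may be
  attached to either of its neighbours.\<close>

lemma sw2_ra_la:
  assumes "lin_form \<alpha>" and F: "bilin F"
  shows "sw2 H x (\<lambda>a b. F (ra \<alpha> a) b) = sw2 H x (\<lambda>a b. F a (la \<alpha> b))"
proof -
  note [lin] = lin_form_comp[OF assms(1)] bilin_left[OF F] bilin_right[OF F]
  have "sw2 H x (\<lambda>a b. F (ra \<alpha> a) b) = sw2 H x (\<lambda>w c. sw2 H w (\<lambda>a b. \<alpha> b *\<^sub>v F a c))"
    unfolding ra_def using F by (simp add: sw2_lin[of "\<lambda>z. F z _"] lin_map_scale[of "\<lambda>z. F z _"])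
  also have "\<dots> = sw2 H x (\<lambda>a w. sw2 H w (\<lambda>b c. \<alpha> b *\<^sub>v F a c))"
    by (rule sw2_coassoc) (intro conjI allI lin)
  also have "\<dots> = sw2 H x (\<lambda>a b. F a (la \<alpha> b))"
    unfolding la_def using F by (simp add: sw2_lin[of "F _"] lin_map_scale[of "F _"])
  finally show ?thesis .
qed

lemma la_ra: "lin_form \<alpha> \<Longrightarrow> lin_form \<beta> \<Longrightarrow> la \<alpha> (ra \<beta> x) = ra \<beta> (la \<alpha> x)"
proof -
  assume a: "lin_form \<alpha>" and b: "lin_form \<beta>"
  note [lin] = lin_form_comp[OF a] lin_form_comp[OF b]
  have "la \<alpha> (ra \<beta> x) = sw2 H x (\<lambda>c d. \<alpha> c *\<^sub>v ra \<beta> d)"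
    unfolding la_def by (rule sw2_ra[OF b]) (intro conjI allI lin)
  also have "\<dots> = ra \<beta> (la \<alpha> x)"
    unfolding la_def by (simp add: sw2_lin[of "ra \<beta>"] lin_map_scale[of "ra \<beta>"] lin)
  finally show ?thesis .
qed

lemma la_la: "lin_form \<alpha> \<Longrightarrow> lin_form \<beta> \<Longrightarrow> la \<alpha> (la \<beta> x) = la (conv H \<beta> \<alpha>) x"
proof -
  assume a: "lin_form \<alpha>" and b: "lin_form \<beta>"
  note [lin] = lin_form_comp[OF a] lin_form_comp[OF b]
  have "la \<alpha> (la \<beta> x) = sw2 H x (\<lambda>c w. sw2 H w (\<lambda>d e. \<beta> c *\<^sub>v \<alpha> d *\<^sub>v e))"
    unfolding la_def[of \<beta>] by (simp add: sw2_lin[of "la \<alpha>"] lin_map_scale[of "la \<alpha>"] lin) (simp add: la_def sw2_scale[symmetric])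
  also have "\<dots> = sw2 H x (\<lambda>w e. sw2 H w (\<lambda>c d. \<beta> c *\<^sub>v \<alpha> d *\<^sub>v e))"
    by (rule sw2_coassoc[symmetric]) (intro conjI allI lin)
  finally show ?thesis by (simp add: la_def conv_sw2)
qed

lemma ra_ra: "lin_form \<alpha> \<Longrightarrow> lin_form \<beta> \<Longrightarrow> ra \<alpha> (ra \<beta> x) = ra (conv H \<alpha> \<beta>) x"
proof -
  assume a: "lin_form \<alpha>" and b: "lin_form \<beta>"
  note [lin] = lin_form_comp[OF a] lin_form_comp[OF b]
  have "ra \<alpha> (ra \<beta> x) = sw2 H x (\<lambda>w e. sw2 H w (\<lambda>c d. \<alpha> d *\<^sub>v \<beta> e *\<^sub>v c))"
    unfolding ra_def[of \<beta>] by (simp add: sw2_lin[of "ra \<alpha>"] lin_map_scale[of "ra \<alpha>"] lin) (simp add: ra_def sw2_scale[symmetric] mult.commute)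
  also have "\<dots> = sw2 H x (\<lambda>c w. sw2 H w (\<lambda>d e. \<alpha> d *\<^sub>v \<beta> e *\<^sub>v c))"
    by (rule sw2_coassoc) (intro conjI allI lin)
  finally show ?thesis by (simp add: ra_def conv_sw2)
qed

lemma la_counit: "la (counit H) x = x"
  by (simp add: la_def counit_left)

lemma ra_counit: "ra (counit H) x = x"
  by (simp add: ra_def counit_right)

lemma form_la: "lin_form \<alpha> \<Longrightarrow> lin_form \<beta> \<Longrightarrow> \<beta> (la \<alpha> x) = conv H \<alpha> \<beta> x"
proof -
  assume a: "lin_form \<alpha>" and b: "lin_form \<beta>"
  note [lin] = lin_form_comp[OF a] lin_form_comp[OF b]
  have "\<beta> (la \<alpha> x) *\<^sub>v (\<lambda>_::unit. 1 :: 'k) = conv H \<alpha> \<beta> x *\<^sub>v (\<lambda>_. 1)"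
    unfolding la_def conv_sw2 by (subst sw2_lin[of "\<lambda>z. \<beta> z *\<^sub>v _"]) (intro lin, simp add: lin_form_scale[OF b])
  then show ?thesis by (rule unit_scale_cancel)
qed

lemma form_ra: "lin_form \<alpha> \<Longrightarrow> lin_form \<beta> \<Longrightarrow> \<beta> (ra \<alpha> x) = conv H \<beta> \<alpha> x"
proof -
  assume a: "lin_form \<alpha>" and b: "lin_form \<beta>"
  note [lin] = lin_form_comp[OF a] lin_form_comp[OF b]
  have "\<beta> (ra \<alpha> x) *\<^sub>v (\<lambda>_::unit. 1 :: 'k) = conv H \<beta> \<alpha> x *\<^sub>v (\<lambda>_. 1)"
    unfolding ra_def conv_sw2 by (subst sw2_lin[of "\<lambda>z. \<beta> z *\<^sub>v _"]) (intro lin, simp add: lin_form_scale[OF b] mult.commute)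
  then show ?thesis by (rule unit_scale_cancel)
qed

lemma la_mult:
  assumes a: "lin_form \<alpha>" and m: "\<And>x y. \<alpha> (x \<cdot> y) = \<alpha> x * \<alpha> y"
  shows "la \<alpha> (x \<cdot> y) = la \<alpha> x \<cdot> la \<alpha> y"
proof -
  note [lin] = lin_form_comp[OF a]
  have "la \<alpha> (x \<cdot> y) = sw2 H x (\<lambda>a b. sw2 H y (\<lambda>c d. \<alpha> (a \<cdot> c) *\<^sub>v (b \<cdot> d)))"
    unfolding la_def by (rule sw2_mult) (intro conjI allI lin)
  also have "\<dots> = sw2 H x (\<lambda>a b. \<alpha> a *\<^sub>v (b \<cdot> sw2 H y (\<lambda>c d. \<alpha> c *\<^sub>v d)))"
    by (simp add: m sw2_lin[OF mult_linear_right] lin_map_scale[OF mult_linear_right] sw2_scale[symmetric])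
  also have "\<dots> = la \<alpha> x \<cdot> la \<alpha> y"
    unfolding la_def[symmetric] by (simp add: la_def[of \<alpha> x] sw2_lin[of "\<lambda>z. z \<cdot> _"] lin_map_scale[of "\<lambda>z. z \<cdot> _"] lin)
  finally show ?thesis .
qed

lemma la_antipode:
  assumes a: "lin_form \<alpha>"
  shows "la \<alpha> (antipode H x) = antipode H (ra (\<lambda>y. \<alpha> (antipode H y)) x)"
proof -
  note [lin] = lin_form_comp[OF a]
  have "la \<alpha> (antipode H x) = sw2 H x (\<lambda>b c. \<alpha> (antipode H c) *\<^sub>v antipode H b)"
    unfolding la_def by (rule sw2_antipode) (intro conjI allI lin)
  then show ?thesis
    by (simp add: ra_def sw2_lin[OF antipode_linear] lin_map_scale[OF antipode_linear])
qed

end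

context hopf_pair
begin

lemma chiinv_linear: "lin_form \<chi>inv"
  by (intro lin)

lemma conv_chi_chiinv: "conv H \<chi> \<chi>inv = \<epsilon>" and conv_chiinv_chi: "conv H \<chi>inv \<chi> = \<epsilon>"
  by (simp_all add: chiinv conv_chi_S conv_S_chi)

lemmas la_chi_simps = la_la[OF chi_linear chiinv_linear] la_la[OF chiinv_linear chi_linear]
  ra_ra[OF chi_linear chiinv_linear] ra_ra[OF chiinv_linear chi_linear]
  conv_chi_chiinv conv_chiinv_chi la_counit ra_counit

lemma antipode_square': "S (S h) = p \<cdot> la \<chi>inv (ra \<chi> h) \<cdot> pinv"
proof -
  have [lin]: "lin_map f \<Longrightarrow> lin_map (\<lambda>x. p \<cdot> f x \<cdot> pinv)" for f :: "('b \<Rightarrow> 'k) \<Rightarrow> 'b \<Rightarrow> 'k"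
    by (intro lin)
  have l: "lin_map (\<lambda>x. p \<cdot> x \<cdot> pinv)" by (intro lin)
  have "la \<chi>inv (ra \<chi> h) = sw2 H h (\<lambda>x w. \<chi>inv x *\<^sub>v ra \<chi> w)"
    unfolding la_def by (rule sw2_ra[OF chi_linear]) (intro conjI allI lin)
  then show ?thesis
    unfolding antipode_square by (simp add: sw2_lin[OF l] lin_map_scale[OF l] ra_def sw2_scale[symmetric])
qed

lemma antipode_square_la_ra: "S (S (la \<chi> (ra \<chi>inv x))) = p \<cdot> x \<cdot> pinv"
proof -
  have "ra \<chi> (la \<chi> (ra \<chi>inv x)) = la \<chi> x"
    by (simp add: la_ra[OF chi_linear chi_linear, symmetric] la_chi_simps)
  then show ?thesis by (simp add: antipode_square' la_chi_simps)
qed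

text \<open>By the pair in involution, S^2 is composed of translations by \<chi> and by its inverse
  and of conjugation by \<open>p\<close>. All of these are invertible, which makes S bijective with
  an explicit preimage.\<close>

lemma S_inj: "S x = S y \<Longrightarrow> x = y"
proof -
  assume "S x = S y"
  then have "pinv \<cdot> S (S x) \<cdot> p = pinv \<cdot> S (S y) \<cdot> p" by simp
  then have "la \<chi>inv (ra \<chi> x) = la \<chi>inv (ra \<chi> y)"
    by (simp add: antipode_square' mult_assoc pinv_p pinv_p_assoc mult_unit_right)
  then have "la \<chi> (la \<chi>inv (ra \<chi> x)) = la \<chi> (la \<chi>inv (ra \<chi> y))" by simp
  then have "ra \<chi>inv (ra \<chi> x) = ra \<chi>inv (ra \<chi> y)" by (simp add: la_chi_simps)
  then show "x = y" by (simp add: la_chi_simps)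
qed

lemma S_surj: "\<exists>y. S y = x"
proof -
  have "S (S (la \<chi> (ra \<chi>inv (pinv \<cdot> x \<cdot> p)))) = x"
    unfolding antipode_square_la_ra by (simp add: mult_assoc p_pinv p_pinv_assoc mult_unit_right)
  then show ?thesis by blast
qed

definition "Sinv = inv S"

lemma S_Sinv [simp]: "S (Sinv x) = x"
  unfolding Sinv_def by (metis S_surj f_inv_into_f rangeI)

lemma Sinv_S [simp]: "Sinv (S x) = x"
  by (rule S_inj) simp

lemma Sinv_linear: "lin_map Sinv"
proof (rule lin_mapI)
  show "Sinv (u + v) = Sinv u + Sinv v" for u v
    by (rule S_inj) (simp add: lin_map_add[OF antipode_linear])
  show "Sinv (c *\<^sub>v v) = c *\<^sub>v Sinv v" for c v
    by (rule S_inj) (simp add: lin_map_scale[OF antipode_linear])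
qed

lemma lin_Sinv [lin]: "lin_map f \<Longrightarrow> lin_map (\<lambda>x. Sinv (f x))"
  by (rule lin_map_comp[OF Sinv_linear])

lemma Sinv_mult: "Sinv (x \<cdot> y) = Sinv y \<cdot> Sinv x"
  by (rule S_inj) (simp add: antipode_mult)

lemma Sinv_unit: "Sinv \<one> = \<one>"
  by (rule S_inj) (simp add: antipode_unit)

lemma counit_Sinv: "\<epsilon> (Sinv x) = \<epsilon> x"
  by (metis S_Sinv counit_antipode)

lemma sw2_Sinv_left:
  assumes F: "lin_map F"
  shows "sw2 H x (\<lambda>a b. F (Sinv b \<cdot> a)) = \<epsilon> x *\<^sub>v F \<one>"
proof -
  have "sw2 H x (\<lambda>a b. F (Sinv b \<cdot> a)) = sw2 H x (\<lambda>a b. F (Sinv (S a \<cdot> b)))"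
    by (simp add: Sinv_mult)
  also have "\<dots> = \<epsilon> x *\<^sub>v F (Sinv \<one>)"
    by (rule sw2_antipode_left) (intro lin lin_map_comp[OF F])
  finally show ?thesis by (simp add: Sinv_unit)
qed

lemma sw2_Sinv_right:
  assumes F: "lin_map F"
  shows "sw2 H x (\<lambda>a b. F (b \<cdot> Sinv a)) = \<epsilon> x *\<^sub>v F \<one>"
proof -
  have "sw2 H x (\<lambda>a b. F (b \<cdot> Sinv a)) = sw2 H x (\<lambda>a b. F (Sinv (a \<cdot> S b)))"
    by (simp add: Sinv_mult)
  also have "\<dots> = \<epsilon> x *\<^sub>v F (Sinv \<one>)"
    by (rule sw2_antipode_right) (intro lin lin_map_comp[OF F])
  finally show ?thesis by (simp add: Sinv_unit)
qed

text \<open>Up to a scalar, \<psi>(m) is p^-1 S(m') with m' the \<chi>-translate of m. This identity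
  computes the square of \<psi> and shows that \<psi> carries the right action to the left
  one.\<close>

lemma la_chi_S_la_chi: "pinv \<cdot> S (la \<chi> (S (la \<chi> a))) = a \<cdot> pinv"
proof -
  have "S (la \<chi> (S (la \<chi> a))) = S (S (la \<chi> (ra \<chi>inv a)))"
    by (simp add: la_antipode[OF chi_linear] chiinv[symmetric] la_ra[OF chi_linear chiinv_linear])
  then show ?thesis
    by (simp add: antipode_square_la_ra mult_assoc pinv_p_assoc)
qed

end

section \<open>The algebra of operators at an edge\<close>

text \<open>Laws at an edge are proved for one orientation on one copy of \<open>M\<close> and then
  transported along two such maps: \<open>flip\<close>, which exchanges source and target, and
  \<open>slot\<close>, which places an operator at an edge.\<close>

definition alg_hom :: "(('x, 'k::field) lop \<Rightarrow> ('y, 'k) lop) \<Rightarrow> bool"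
  where "alg_hom \<Phi> \<longleftrightarrow> \<Phi> 1 = 1 \<and> (\<forall>A B. \<Phi> (A * B) = \<Phi> A * \<Phi> B) \<and> (\<forall>A B. \<Phi> (A + B) = \<Phi> A + \<Phi> B) \<and>
    (\<forall>c A. \<Phi> (c *\<^sub>o A) = c *\<^sub>o \<Phi> A)"

lemma alg_hom_slot: "alg_hom (slot e)"
  by (simp add: alg_hom_def slot_times slot_plus slot_lscale)

lemma
  assumes "alg_hom \<Phi>"
  shows alg_hom_one: "\<Phi> 1 = 1" and alg_hom_times: "\<Phi> (A * B) = \<Phi> A * \<Phi> B"
    and alg_hom_plus: "\<Phi> (A + B) = \<Phi> A + \<Phi> B" and alg_hom_lscale: "\<Phi> (c *\<^sub>o A) = c *\<^sub>o \<Phi> A"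
    and alg_hom_zero: "\<Phi> 0 = 0"
proof -
  show "\<Phi> 1 = 1" "\<Phi> (A * B) = \<Phi> A * \<Phi> B" "\<Phi> (A + B) = \<Phi> A + \<Phi> B" and s: "\<Phi> (c *\<^sub>o A) = c *\<^sub>o \<Phi> A" for c A
    using assms by (auto simp: alg_hom_def)
  from s[of 0 0] show "\<Phi> 0 = 0" by simp
qed

lemma alg_hom_sum: "alg_hom \<Phi> \<Longrightarrow> \<Phi> (\<Sum>x\<in>S. f x) = (\<Sum>x\<in>S. \<Phi> (f x))"
  by (induction S rule: infinite_finite_induct) (auto simp: alg_hom_plus alg_hom_zero)

lemma alg_hom_diff: "alg_hom \<Phi> \<Longrightarrow> \<Phi> (A - B) = \<Phi> A - \<Phi> B"
  using alg_hom_plus[of \<Phi> "A - B" B] by simp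

lemmas alg_hom_simps = alg_hom_one alg_hom_times alg_hom_plus alg_hom_lscale alg_hom_zero alg_hom_sum alg_hom_diff

text \<open>
  A family of operators indexed by \<open>'b\<close> stands for the linear map that it defines on $H$, or on $H^*$
  with the dual basis. \<open>cvL\<close> and \<open>cvT\<close> are the convolutions $a \mapsto g(a_{(2)}) f(a_{(1)})$ and
  $\alpha \mapsto g(\alpha_{(1)}) f(\alpha_{(2)})$.
\<close>

definition cvL :: "('b::finite, 'k::field) hopf \<Rightarrow> ('b \<Rightarrow> ('x, 'k) lop) \<Rightarrow> ('b \<Rightarrow> ('x, 'k) lop) \<Rightarrow> 'b \<Rightarrow> ('x, 'k) lop"
  where "cvL H f g i = (\<Sum>j\<in>UNIV. \<Sum>k\<in>UNIV. comult H (unit_vec i) (j, k) *\<^sub>o (g k * f j))"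

definition cvT :: "('b::finite, 'k::field) hopf \<Rightarrow> ('b \<Rightarrow> ('x, 'k) lop) \<Rightarrow> ('b \<Rightarrow> ('x, 'k) lop) \<Rightarrow> 'b \<Rightarrow> ('x, 'k) lop"
  where "cvT H f g i = (\<Sum>r\<in>UNIV. \<Sum>s\<in>UNIV. (unit_vec r \<cdot>\<^bsub>H\<^esub> unit_vec s) i *\<^sub>o (g r * f s))"

definition rep :: "('b::finite, 'k::field) hopf \<Rightarrow> ('b \<Rightarrow> ('x, 'k) lop) \<Rightarrow> bool"
  where "rep H L \<longleftrightarrow> (\<forall>j s. L j * L s = (\<Sum>m\<in>UNIV. (unit_vec j \<cdot>\<^bsub>H\<^esub> unit_vec s) m *\<^sub>o L m)) \<and>
    (\<Sum>i\<in>UNIV. \<one>\<^bsub>H\<^esub> i *\<^sub>o L i) = 1"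

text \<open>A left coaction gives an anti-representation of the convolution algebra; hence the two
  indices appear in the reverse order compared with \<open>rep\<close>.\<close>

definition corep :: "('b::finite, 'k::field) hopf \<Rightarrow> ('b \<Rightarrow> ('x, 'k) lop) \<Rightarrow> bool"
  where "corep H T \<longleftrightarrow> (\<forall>k j. T k * T j = (\<Sum>m\<in>UNIV. comult H (unit_vec m) (j, k) *\<^sub>o T m)) \<and>
    (\<Sum>i\<in>UNIV. counit H (unit_vec i) *\<^sub>o T i) = 1"

text \<open>
  The commutation relations $T(\alpha) L(a) = L(a_{(2)})\, T(\alpha(a_{(1)} \cdot))$ for opposite half-edges and
  $L(a) T(\alpha) = T(\alpha(\cdot\, a_{(2)}))\, L(a_{(1)})$ for one half-edge.
\<close>

definition cross :: "('b::finite, 'k::field) hopf \<Rightarrow> ('b \<Rightarrow> ('x, 'k) lop) \<Rightarrow> ('b \<Rightarrow> ('x, 'k) lop) \<Rightarrow> bool"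
  where "cross H L T \<longleftrightarrow> (\<forall>r i. T r * L i = (\<Sum>j\<in>UNIV. \<Sum>k\<in>UNIV. \<Sum>s\<in>UNIV.
    (comult H (unit_vec i) (j, k) * (unit_vec j \<cdot>\<^bsub>H\<^esub> unit_vec s) r) *\<^sub>o (L k * T s)))"

definition same :: "('b::finite, 'k::field) hopf \<Rightarrow> ('b \<Rightarrow> ('x, 'k) lop) \<Rightarrow> ('b \<Rightarrow> ('x, 'k) lop) \<Rightarrow> bool"
  where "same H L T \<longleftrightarrow> (\<forall>i m. L i * T m = (\<Sum>j\<in>UNIV. \<Sum>l\<in>UNIV. \<Sum>s\<in>UNIV.
    (comult H (unit_vec i) (j, l) * (unit_vec s \<cdot>\<^bsub>H\<^esub> unit_vec l) m) *\<^sub>o (T s * L j)))"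

definition edge_rel where
  "edge_rel H L1 T1 L2 T2 \<longleftrightarrow> rep H L1 \<and> rep H L2 \<and> corep H T1 \<and> corep H T2 \<and>
    (\<forall>i j. L1 i * L2 j = L2 j * L1 i) \<and> (\<forall>i j. T1 i * T2 j = T2 j * T1 i) \<and>
    cross H L1 T2 \<and> cross H L2 T1 \<and> same H L1 T1 \<and> same H L2 T2"

text \<open>
  If a vertex consists of the half-edge \<open>e\<close> and its face is $[e, y, \iota(e)]$, the coinvariants at that
  vertex and the invariants at that face are cut out by rank-one projections at the edges of \<open>e\<close> and
  \<open>y\<close>. The laws of the first one involve \<open>1 - P\<close>, which lies in the span of the relations, and
  coefficients \<open>f\<close> that invert the outer letters of the face word; the word
  $L_y * \chi^{-1} * L_{\iota(y)}$ in the laws of the second one is what remains of $L_y * L_{\iota(e)} * L_{\iota(y)}$.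
\<close>

definition edge_projection_laws where
  "edge_projection_laws H \<phi> \<chi>' w q P L1 T1 L2 T2 \<longleftrightarrow>
    (\<forall>i. P * L1 i = \<phi> (unit_vec i) *\<^sub>o P) \<and> (\<forall>i. P * L2 i = \<chi>' (unit_vec i) *\<^sub>o P) \<and>
    (\<forall>i. T1 i * P = w i *\<^sub>o P) \<and> (\<forall>i. T2 i * P = \<one>\<^bsub>H\<^esub> i *\<^sub>o P) \<and>
    (\<exists>X. 1 - P = (\<Sum>i\<in>UNIV. (L1 i - \<phi> (unit_vec i) *\<^sub>o 1) * X i)) \<and>
    (\<exists>f. (\<forall>b s. (\<Sum>u\<in>UNIV. \<Sum>r\<in>UNIV. \<Sum>i\<in>UNIV.
          ((unit_vec r \<cdot>\<^bsub>H\<^esub> unit_vec s) \<cdot>\<^bsub>H\<^esub> unit_vec u) i *\<^sub>o (f b i * T2 r * T1 u)) = (if s = b then P else 0)) \<and>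
      (\<forall>b. (\<Sum>i\<in>UNIV. q i *\<^sub>o f b i) = w b *\<^sub>o P))"

definition loop_projection_laws where
  "loop_projection_laws H \<chi>' w P L1 T1 L2 T2 \<longleftrightarrow>
    (\<forall>i. T1 i * P = w i *\<^sub>o P) \<and> (\<forall>i. T2 i * P = \<one>\<^bsub>H\<^esub> i *\<^sub>o P) \<and>
    (\<forall>i. cvL H L1 (cvL H (\<lambda>j. \<chi>' (unit_vec j) *\<^sub>o 1) L2) i * P = counit H (unit_vec i) *\<^sub>o P) \<and>
    (\<forall>i. P * cvL H L1 (cvL H (\<lambda>j. \<chi>' (unit_vec j) *\<^sub>o 1) L2) i = counit H (unit_vec i) *\<^sub>o P) \<and>
    (\<exists>g. (\<Sum>i\<in>UNIV. g i * T1 i) = 1 \<and> (\<Sum>i\<in>UNIV. w i *\<^sub>o g i) = P)"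

definition rank_one :: "('m::finite, 'k::field) lop \<Rightarrow> bool"
  where "rank_one P \<longleftrightarrow> (\<exists>u \<phi>. P = ketbra u \<phi> \<and> (\<Sum>i\<in>UNIV. \<phi> i * u i) = 1)"

lemma rank_one_idem: "rank_one P \<Longrightarrow> P * P = P"
  unfolding rank_one_def
  by (auto intro!: lop_eqI simp: app_times app_ketbra fun_eq_iff sum_distrib_left sum_distrib_right mult_ac)

lemma cvL_hom: "alg_hom \<Phi> \<Longrightarrow> cvL H (\<lambda>i. \<Phi> (f i)) (\<lambda>i. \<Phi> (g i)) i = \<Phi> (cvL H f g i)"
  by (simp add: cvL_def alg_hom_simps)

lemma
  assumes h: "alg_hom \<Phi>"
  shows rep_hom: "rep H L \<Longrightarrow> rep H (\<lambda>i. \<Phi> (L i))"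
    and corep_hom: "corep H T \<Longrightarrow> corep H (\<lambda>i. \<Phi> (T i))"
    and cross_hom: "cross H L T \<Longrightarrow> cross H (\<lambda>i. \<Phi> (L i)) (\<lambda>i. \<Phi> (T i))"
    and same_hom: "same H L T \<Longrightarrow> same H (\<lambda>i. \<Phi> (L i)) (\<lambda>i. \<Phi> (T i))"
  unfolding rep_def corep_def cross_def same_def by (simp_all add: alg_hom_simps[OF h, symmetric])

lemma edge_rel_hom:
  assumes h: "alg_hom \<Phi>" and r: "edge_rel H L1 T1 L2 T2"
  shows "edge_rel H (\<lambda>i. \<Phi> (L1 i)) (\<lambda>i. \<Phi> (T1 i)) (\<lambda>i. \<Phi> (L2 i)) (\<lambda>i. \<Phi> (T2 i))"
  using r unfolding edge_rel_def
  by (simp add: rep_hom[OF h] corep_hom[OF h] cross_hom[OF h] same_hom[OF h] alg_hom_times[OF h, symmetric])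

lemma edge_projection_laws_hom:
  assumes h: "alg_hom \<Phi>" and r: "edge_projection_laws H \<phi> \<chi>' w q P L1 T1 L2 T2"
  shows "edge_projection_laws H \<phi> \<chi>' w q (\<Phi> P) (\<lambda>i. \<Phi> (L1 i)) (\<lambda>i. \<Phi> (T1 i)) (\<lambda>i. \<Phi> (L2 i)) (\<lambda>i. \<Phi> (T2 i))"
proof -
  from r obtain X f where
    X: "1 - P = (\<Sum>i\<in>UNIV. (L1 i - \<phi> (unit_vec i) *\<^sub>o 1) * X i)" and
    f: "\<And>b s. (\<Sum>u\<in>UNIV. \<Sum>r\<in>UNIV. \<Sum>i\<in>UNIV.
          ((unit_vec r \<cdot>\<^bsub>H\<^esub> unit_vec s) \<cdot>\<^bsub>H\<^esub> unit_vec u) i *\<^sub>o (f b i * T2 r * T1 u)) = (if s = b then P else 0)"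
       "\<And>b. (\<Sum>i\<in>UNIV. q i *\<^sub>o f b i) = w b *\<^sub>o P"
    unfolding edge_projection_laws_def by blast
  have "1 - \<Phi> P = (\<Sum>i\<in>UNIV. (\<Phi> (L1 i) - \<phi> (unit_vec i) *\<^sub>o 1) * \<Phi> (X i))"
    using arg_cong[OF X, of \<Phi>] by (simp add: alg_hom_simps[OF h])
  moreover have "(\<Sum>u\<in>UNIV. \<Sum>r\<in>UNIV. \<Sum>i\<in>UNIV.
      ((unit_vec r \<cdot>\<^bsub>H\<^esub> unit_vec s) \<cdot>\<^bsub>H\<^esub> unit_vec u) i *\<^sub>o (\<Phi> (f b i) * \<Phi> (T2 r) * \<Phi> (T1 u))) = (if s = b then \<Phi> P else 0)" for b s
    using arg_cong[OF f(1)[of s b], of \<Phi>] by (simp add: alg_hom_simps[OF h] split: if_splits)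
  moreover have "(\<Sum>i\<in>UNIV. q i *\<^sub>o \<Phi> (f b i)) = w b *\<^sub>o \<Phi> P" for b
    using arg_cong[OF f(2)[of b], of \<Phi>] by (simp add: alg_hom_simps[OF h])
  moreover have "(\<forall>i. P * L1 i = \<phi> (unit_vec i) *\<^sub>o P) \<and> (\<forall>i. P * L2 i = \<chi>' (unit_vec i) *\<^sub>o P) \<and>
    (\<forall>i. T1 i * P = w i *\<^sub>o P) \<and> (\<forall>i. T2 i * P = \<one>\<^bsub>H\<^esub> i *\<^sub>o P)"
    using r unfolding edge_projection_laws_def by blast
  ultimately show ?thesis
    unfolding edge_projection_laws_def
    by (intro conjI exI[of _ "\<lambda>i. \<Phi> (X i)"] exI[of _ "\<lambda>b i. \<Phi> (f b i)"])
       (simp_all add: alg_hom_times[OF h, symmetric] alg_hom_lscale[OF h, symmetric])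
qed

lemma loop_projection_laws_hom:
  assumes h: "alg_hom \<Phi>" and r: "loop_projection_laws H \<chi>' w P L1 T1 L2 T2"
  shows "loop_projection_laws H \<chi>' w (\<Phi> P) (\<lambda>i. \<Phi> (L1 i)) (\<lambda>i. \<Phi> (T1 i)) (\<lambda>i. \<Phi> (L2 i)) (\<lambda>i. \<Phi> (T2 i))"
proof -
  from r obtain g where g: "(\<Sum>i\<in>UNIV. g i * T1 i) = 1" "(\<Sum>i\<in>UNIV. w i *\<^sub>o g i) = P"
    unfolding loop_projection_laws_def by blast
  have Z: "cvL H (\<lambda>i. \<Phi> (L1 i)) (cvL H (\<lambda>j. \<chi>' (unit_vec j) *\<^sub>o 1) (\<lambda>i. \<Phi> (L2 i))) i
      = \<Phi> (cvL H L1 (cvL H (\<lambda>j. \<chi>' (unit_vec j) *\<^sub>o 1) L2) i)" for i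
  proof -
    have "(\<lambda>j. \<chi>' (unit_vec j) *\<^sub>o 1) = (\<lambda>j. \<Phi> (\<chi>' (unit_vec j) *\<^sub>o 1))"
      by (simp add: alg_hom_simps[OF h])
    moreover have "cvL H (\<lambda>j. \<Phi> (\<chi>' (unit_vec j) *\<^sub>o 1)) (\<lambda>i. \<Phi> (L2 i))
        = (\<lambda>i. \<Phi> (cvL H (\<lambda>j. \<chi>' (unit_vec j) *\<^sub>o 1) L2 i))"
      by (rule ext) (rule cvL_hom[OF h])
    ultimately show ?thesis by (simp only: cvL_hom[OF h])
  qed
  show ?thesis
    using r arg_cong[OF g(1), of \<Phi>] arg_cong[OF g(2), of \<Phi>] unfolding loop_projection_laws_def Z
    by (intro conjI exI[of _ "\<lambda>i. \<Phi> (g i)"])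
       (simp_all add: alg_hom_simps[OF h, symmetric])
qed

lemma edge_rel_commute: "edge_rel H L1 T1 L2 T2 \<Longrightarrow> edge_rel H L2 T2 L1 T1"
  unfolding edge_rel_def by metis

lemma sw2_unfold: "sw2 H x F = (\<Sum>i\<in>UNIV. \<Sum>j\<in>UNIV. comult H x (i, j) *\<^sub>v F (unit_vec i) (unit_vec j))"
  by (simp add: sw2_def lift2_sum)

lemma sw2_sum: "(\<Sum>k\<in>A. sw2 H x (F k)) = sw2 H x (\<lambda>a b. \<Sum>k\<in>A. F k a b)"
proof
  fix r
  have "(\<Sum>k\<in>A. \<Sum>i\<in>UNIV. \<Sum>j\<in>UNIV. comult H x (i, j) * F k (unit_vec i) (unit_vec j) r)
    = (\<Sum>i\<in>UNIV. \<Sum>k\<in>A. \<Sum>j\<in>UNIV. comult H x (i, j) * F k (unit_vec i) (unit_vec j) r)"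
    by (rule sum.swap)
  also have "\<dots> = (\<Sum>i\<in>UNIV. \<Sum>j\<in>UNIV. \<Sum>k\<in>A. comult H x (i, j) * F k (unit_vec i) (unit_vec j) r)"
    by (rule sum.cong[OF refl], rule sum.swap)
  finally show "(\<Sum>k\<in>A. sw2 H x (F k)) r = sw2 H x (\<lambda>a b. \<Sum>k\<in>A. F k a b) r"
    by (simp add: sum_fun_apply sw2_apply sum_distrib_left)
qed

section \<open>The operators of the induced bimodule at one edge\<close>

context hopf_pair
begin

text \<open>L and T of the induced bimodule at a target (\<open>lt\<close>, \<open>tt\<close>) and
  at a source (\<open>ls\<close>, \<open>ts\<close>). In \<open>ls\<close> the twist \<chi>^-1 of
  the right action has become \<chi> under the antipode; in \<open>tt\<close> the factor p of the
  right coaction has become p^-1 on the left. \<open>psi\<close> is the involution without the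
  scalar \<zeta>.\<close>

definition lt :: "'b \<Rightarrow> ('b, 'k) lop" where "lt i = Lop (\<lambda>m. unit_vec i \<cdot> m)"
definition ls :: "'b \<Rightarrow> ('b, 'k) lop" where "ls i = Lop (\<lambda>m. m \<cdot> S (la \<chi> (unit_vec i)))"
definition ts :: "'b \<Rightarrow> ('b, 'k) lop" where "ts r = Lop (\<lambda>m. sw2 H m (\<lambda>x y. x r *\<^sub>v y))"
definition tt :: "'b \<Rightarrow> ('b, 'k) lop" where "tt r = Lop (\<lambda>m. sw2 H m (\<lambda>x y. (pinv \<cdot> S y) r *\<^sub>v x))"
definition psi :: "('b, 'k) lop" where "psi = Lop (\<lambda>m. pinv \<cdot> S (la \<chi> m))"

lemma lin_component [lin]:
  "lin_form (\<lambda>x. x r)"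
  "lin_map f \<Longrightarrow> lin_form (\<lambda>x. (f x \<cdot> y) r)"
  "lin_map f \<Longrightarrow> lin_form (\<lambda>x. (y \<cdot> f x) r)"
  by (rule lin_form_coord, intro lin; assumption)+

lemma app_lt: "app (lt i) m = unit_vec i \<cdot> m"
  unfolding lt_def by (subst app_Lop) (intro lin refl)+
lemma app_ls: "app (ls i) m = m \<cdot> S (la \<chi> (unit_vec i))"
  unfolding ls_def by (subst app_Lop) (intro lin refl)+
lemma app_ts: "app (ts r) m = sw2 H m (\<lambda>x y. x r *\<^sub>v y)"
  unfolding ts_def by (subst app_Lop) (intro lin refl)+
lemma app_tt: "app (tt r) m = sw2 H m (\<lambda>x y. (pinv \<cdot> S y) r *\<^sub>v x)"
  unfolding tt_def by (subst app_Lop) (intro lin refl)+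
lemma app_psi: "app psi m = pinv \<cdot> S (la \<chi> m)"
  unfolding psi_def by (subst app_Lop) (intro lin refl)+

lemmas la_chi_mult = la_mult[OF chi_linear chi_mult]

lemma psi_lt: "psi * lt i = ls i * psi"
  by (rule lop_eqI) (simp add: app_times app_psi app_lt app_ls la_chi_mult antipode_mult mult_assoc)

lemma psi_ls: "psi * ls i = lt i * psi"
proof (rule lop_eqI)
  fix m
  have "app (psi * ls i) m = (pinv \<cdot> S (la \<chi> (S (la \<chi> (unit_vec i))))) \<cdot> S (la \<chi> m)"
    by (simp add: app_times app_psi app_ls la_chi_mult antipode_mult mult_assoc)
  then show "app (psi * ls i) m = app (lt i * psi) m"
    unfolding la_chi_S_la_chi by (simp add: app_times app_psi app_lt mult_assoc)
qed

lemma la_chi_pinv: "la \<chi> pinv = \<chi> pinv *\<^sub>v pinv"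
  unfolding la_def by (rule sw2_grouplike[OF _ comult_pinv]) (intro conjI allI lin)

lemma psi_psi: "psi * psi = \<chi> pinv *\<^sub>o 1"
proof (rule lop_eqI)
  fix m
  have "app (psi * psi) m = \<chi> pinv *\<^sub>v (pinv \<cdot> S (la \<chi> (S (la \<chi> m))) \<cdot> p)"
    by (simp add: app_times app_psi la_chi_mult antipode_mult la_chi_pinv lin_map_scale[OF mult_linear_left]
        lin_map_scale[OF mult_linear_right] lin_map_scale[OF antipode_linear] S_pinv mult_assoc)
  then show "app (psi * psi) m = app (\<chi> pinv *\<^sub>o 1) m"
    unfolding la_chi_S_la_chi by (simp add: mult_assoc pinv_p mult_unit_right app_lscale app_one)
qed

lemma sw2_pinv_S:
  assumes F: "bilin F"
  shows "sw2 H (pinv \<cdot> S b) F = sw2 H b (\<lambda>x y. F (pinv \<cdot> S y) (pinv \<cdot> S x))"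
proof -
  note [lin] = bilin_left[OF F] bilin_right[OF F]
  have "sw2 H (pinv \<cdot> S b) F = sw2 H pinv (\<lambda>c d. sw2 H (S b) (\<lambda>x y. F (c \<cdot> x) (d \<cdot> y)))"
    by (rule sw2_mult[OF F])
  also have "\<dots> = sw2 H (S b) (\<lambda>x y. F (pinv \<cdot> x) (pinv \<cdot> y))"
    by (rule sw2_grouplike[OF _ comult_pinv]) (intro conjI allI lin)
  also have "\<dots> = sw2 H b (\<lambda>x y. F (pinv \<cdot> S y) (pinv \<cdot> S x))"
    by (rule sw2_antipode) (intro conjI allI lin)
  finally show ?thesis .
qed

lemma ts_psi: "ts r * psi = psi * tt r"
proof (rule lop_eqI)
  fix m
  have "app (ts r * psi) m = sw2 H (la \<chi> m) (\<lambda>x y. (pinv \<cdot> S y) r *\<^sub>v (pinv \<cdot> S x))"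
    unfolding app_times app_psi app_ts by (rule sw2_pinv_S) (intro conjI allI lin)
  also have "\<dots> = sw2 H m (\<lambda>x y. (pinv \<cdot> S y) r *\<^sub>v (pinv \<cdot> S (la \<chi> x)))"
    by (rule sw2_la[OF chi_linear]) (intro conjI allI lin)
  also have "\<dots> = app (psi * tt r) m"
    by (simp add: app_times app_tt sw2_lin[of "app psi"]) (simp add: app_psi)
  finally show "app (ts r * psi) m = app (psi * tt r) m" .
qed

lemma antipode_square_conj: "pinv \<cdot> S (S b) \<cdot> p = la \<chi>inv (ra \<chi> b)"
  by (simp add: antipode_square' mult_assoc pinv_p pinv_p_assoc mult_unit_right)

text \<open>Two antipodes meet here, one from \<open>tt\<close> and one from \<open>psi\<close>.
  Conjugated by \<open>p\<close>, their square is a pair of translations; one of them cancels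
  against the \<chi> inside \<open>psi\<close>, the other moves to the neighbouring leg.\<close>

lemma tt_psi: "tt r * psi = psi * ts r"
proof (rule lop_eqI)
  fix m
  have "app (tt r * psi) m = sw2 H (la \<chi> m) (\<lambda>x y. (pinv \<cdot> S (pinv \<cdot> S x)) r *\<^sub>v (pinv \<cdot> S y))"
    unfolding app_times app_psi app_tt by (rule sw2_pinv_S) (intro conjI allI lin)
  also have "\<dots> = sw2 H (la \<chi> m) (\<lambda>x y. (la \<chi>inv (ra \<chi> x)) r *\<^sub>v (pinv \<cdot> S y))"
    by (simp add: antipode_mult S_pinv mult_assoc[symmetric] antipode_square_conj)
  also have "\<dots> = sw2 H m (\<lambda>x y. (la \<chi>inv (ra \<chi> (la \<chi> x))) r *\<^sub>v (pinv \<cdot> S y))"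
    by (rule sw2_la[OF chi_linear]) (intro conjI allI lin lin_form_coord)
  also have "\<dots> = sw2 H m (\<lambda>x y. (ra \<chi> x) r *\<^sub>v (pinv \<cdot> S y))"
    by (simp add: la_ra[OF chi_linear chi_linear, symmetric] la_chi_simps)
  also have "\<dots> = sw2 H m (\<lambda>x y. x r *\<^sub>v (pinv \<cdot> S (la \<chi> y)))"
    by (rule sw2_ra_la[OF chi_linear]) (intro conjI allI lin)
  also have "\<dots> = app (psi * ts r) m"
    by (simp add: app_times app_ts sw2_lin[of "app psi"]) (simp add: app_psi)
  finally show "app (tt r * psi) m = app (psi * ts r) m" .
qed

text \<open>Conjugation by \<open>psi\<close>, whose inverse is \<chi>(p) times
  \<open>psi\<close>.\<close>

definition flip :: "('b, 'k) lop \<Rightarrow> ('b, 'k) lop"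
  where "flip A = \<chi> p *\<^sub>o (psi * A * psi)"

lemma alg_hom_flip: "alg_hom flip"
  unfolding alg_hom_def
proof (intro conjI allI)
  have pp: "psi * (psi * A) = \<chi> pinv *\<^sub>o A" for A
    by (simp add: mult.assoc[symmetric] psi_psi)
  show "flip 1 = 1" using chi_p_pinv by (simp add: flip_def psi_psi)
  show "flip (A * B) = flip A * flip B" for A B
    using chi_p_pinv by (simp add: flip_def mult.assoc pp) 
  show "flip (A + B) = flip A + flip B" for A B
    by (simp add: flip_def algebra_simps lscale_add_right)
  show "flip (c *\<^sub>o A) = c *\<^sub>o flip A" for c A
    by (simp add: flip_def mult.commute)
qed

lemma flip_simps: "flip (lt i) = ls i" "flip (ls i) = lt i" "flip (tt r) = ts r" "flip (ts r) = tt r"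
  using chi_p_pinv
  by (simp_all add: flip_def psi_lt psi_ls ts_psi[symmetric] tt_psi[symmetric] mult.assoc psi_psi)

lemma rank_one_flip: 
  assumes "rank_one P"
  shows "rank_one (flip P)"
proof -
  from assms obtain u \<phi> where P: "P = ketbra u \<phi>" and n: "(\<Sum>i\<in>UNIV. \<phi> i * u i) = 1"
    unfolding rank_one_def by blast
  let ?f = "\<lambda>v. \<Sum>i\<in>UNIV. \<phi> i * v i"
  let ?g = "\<lambda>v. ?f (app (\<chi> p *\<^sub>o psi) v)"
  have f: "lin_form ?f" by (intro lin)
  have g: "lin_form ?g" by (rule lin_form_comp[OF f]) simp
  have gv: "(\<Sum>i\<in>UNIV. ?g (unit_vec i) * v i) = ?g v" for v
    using lin_form_expand[OF g, of v] by (simp add: mult.commute)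
  have "flip P = ketbra (app psi u) (\<lambda>i. ?g (unit_vec i))"
  proof (rule lop_eqI)
    fix v
    have "app (flip P) v = ?g v *\<^sub>v app psi u"
      by (simp add: flip_def P app_times app_lscale app_ketbra lin_form_scale[OF f] sum_distrib_left mult_ac)
    then show "app (flip P) v = app (ketbra (app psi u) (\<lambda>i. ?g (unit_vec i))) v"
      by (simp only: app_ketbra gv)
  qed
  moreover have "(\<Sum>i\<in>UNIV. ?g (unit_vec i) * app psi u i) = 1"
  proof -
    have "app (\<chi> p *\<^sub>o psi) (app psi u) = u"
      unfolding app_times[symmetric] using chi_p_pinv by (simp add: psi_psi app_one)
    then show ?thesis using n by (simp only: gv)
  qed
  ultimately show ?thesis unfolding rank_one_def by blast
qed

end

context hopf_pair
begin

lemma rep_lt: "rep H lt"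
  unfolding rep_def
proof (intro conjI allI lop_eqI)
  fix j s m
  have "(unit_vec j \<cdot> unit_vec s) \<cdot> m = (\<Sum>i\<in>UNIV. (unit_vec j \<cdot> unit_vec s) i *\<^sub>v (unit_vec i \<cdot> m))"
    by (rule lin_map_expand[OF mult_linear_left])
  then show "app (lt j * lt s) m = app (\<Sum>i\<in>UNIV. (unit_vec j \<cdot> unit_vec s) i *\<^sub>o lt i) m"
    by (simp add: app_times app_lt app_lsum app_lscale mult_assoc)
next
  fix m
  have "\<one> \<cdot> m = (\<Sum>i\<in>UNIV. \<one> i *\<^sub>v (unit_vec i \<cdot> m))"
    by (rule lin_map_expand[OF mult_linear_left])
  then show "app (\<Sum>i\<in>UNIV. \<one> i *\<^sub>o lt i) m = app 1 m"
    by (simp add: app_one app_lt app_lsum app_lscale mult_unit_left)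
qed

lemma comult_coord: "sw2 H x (\<lambda>a b. a j *\<^sub>v b k *\<^sub>v v) = comult H x (j, k) *\<^sub>v v"
proof -
  have l: "lin_map (\<lambda>t. t (j, k) *\<^sub>v v)"
    by (rule lin_mapI) (auto simp: fun_eq_iff algebra_simps)
  show ?thesis
    using sw2_lin[OF l, of H x "\<lambda>a b. a \<otimes>\<^sub>v b", unfolded comult_sw2[symmetric]] by (simp add: tensor_def)
qed

lemma lin_form_comult_coord: "lin_form (\<lambda>w. comult H w (j, k))"
  by (rule lin_form_coord[OF comult_linear])

lemma corep_ts: "corep H ts"
  unfolding corep_def
proof (intro conjI allI lop_eqI)
  fix k j m
  have "app (ts k * ts j) m = sw2 H m (\<lambda>x w. sw2 H w (\<lambda>a b. x j *\<^sub>v a k *\<^sub>v b))"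
    by (simp only: app_times app_ts[of j] sw2_lin[OF lin_map_app] app_scale) (simp add: app_ts sw2_scale[symmetric])
  also have "\<dots> = sw2 H m (\<lambda>w b. sw2 H w (\<lambda>x a. x j *\<^sub>v a k *\<^sub>v b))"
    by (rule sw2_coassoc[symmetric]) (intro conjI allI lin)
  also have "\<dots> = sw2 H m (\<lambda>w b. (\<Sum>i\<in>UNIV. w i * comult H (unit_vec i) (j, k)) *\<^sub>v b)"
    unfolding comult_coord by (subst lin_form_expand[OF lin_form_comult_coord]) (rule refl)
  also have "\<dots> = app (\<Sum>i\<in>UNIV. comult H (unit_vec i) (j, k) *\<^sub>o ts i) m"
    by (simp add: app_lsum app_lscale app_ts sw2_scale[symmetric] sw2_sum fun_vs.scale_sum_left mult.commute)
  finally show "app (ts k * ts j) m = app (\<Sum>i\<in>UNIV. comult H (unit_vec i) (j, k) *\<^sub>o ts i) m" .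
next
  fix m
  have "app (\<Sum>i\<in>UNIV. \<epsilon> (unit_vec i) *\<^sub>o ts i) m = sw2 H m (\<lambda>w b. (\<Sum>i\<in>UNIV. w i * \<epsilon> (unit_vec i)) *\<^sub>v b)"
    by (simp add: app_lsum app_lscale app_ts sw2_scale[symmetric] sw2_sum fun_vs.scale_sum_left mult.commute)
  also have "\<dots> = m"
    unfolding lin_form_expand[OF counit_linear, symmetric] by (rule counit_left)
  finally show "app (\<Sum>i\<in>UNIV. \<epsilon> (unit_vec i) *\<^sub>o ts i) m = app 1 m" by (simp add: app_one)
qed

lemma lt_ls_commute: "lt i * ls j = ls j * lt i"
  by (rule lop_eqI) (simp add: app_times app_lt app_ls mult_assoc)

lemma tt_ts_commute: "tt i * ts j = ts j * tt i"
proof (rule lop_eqI)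
  fix m
  have "app (tt i * ts j) m = sw2 H m (\<lambda>x w. sw2 H w (\<lambda>y z. x j *\<^sub>v (pinv \<cdot> S z) i *\<^sub>v y))"
    by (simp only: app_times app_ts[of j] sw2_lin[OF lin_map_app] app_scale) (simp add: app_tt sw2_scale[symmetric])
  also have "\<dots> = sw2 H m (\<lambda>w z. sw2 H w (\<lambda>x y. x j *\<^sub>v (pinv \<cdot> S z) i *\<^sub>v y))"
    by (rule sw2_coassoc[symmetric]) (intro conjI allI lin)
  also have "\<dots> = app (ts j * tt i) m"
    by (simp only: app_times app_tt[of i] sw2_lin[OF lin_map_app] app_scale) (simp add: app_ts sw2_scale[symmetric] mult.commute)
  finally show "app (tt i * ts j) m = app (ts j * tt i) m" .
qed

lemma mult_component: "(x \<cdot> y) r = (\<Sum>s\<in>UNIV. x s * (unit_vec s \<cdot> y) r)" "(x \<cdot> y) r = (\<Sum>s\<in>UNIV. y s * (x \<cdot> unit_vec s) r)"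
  by (rule lin_form_expand, intro lin)+

text \<open>This is the multiplicativity of the comultiplication, read in coordinates of the first
  tensor factor.\<close>

lemma cross_lt_ts: "cross H lt ts"
  unfolding cross_def
proof (intro allI lop_eqI)
  fix r i m
  have 1: "sw2 H m (\<lambda>c d. (a \<cdot> c) r *\<^sub>v (b \<cdot> d)) = (\<Sum>s\<in>UNIV. (a \<cdot> unit_vec s) r *\<^sub>v (b \<cdot> app (ts s) m))" for a b
  proof -
    have "(\<Sum>s\<in>UNIV. (a \<cdot> unit_vec s) r *\<^sub>v (b \<cdot> app (ts s) m))
      = sw2 H m (\<lambda>c d. (\<Sum>s\<in>UNIV. c s * (a \<cdot> unit_vec s) r) *\<^sub>v (b \<cdot> d))"
      by (simp add: app_ts sw2_lin[OF mult_linear_right] lin_map_scale[OF mult_linear_right] sw2_scale[symmetric] sw2_sum fun_vs.scale_sum_left mult.commute)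
    then show ?thesis by (simp only: mult_component(2)[symmetric])
  qed
  have "app (ts r * lt i) m = sw2 H (unit_vec i) (\<lambda>a b. sw2 H m (\<lambda>c d. (a \<cdot> c) r *\<^sub>v (b \<cdot> d)))"
    unfolding app_times app_lt app_ts by (rule sw2_mult) (intro conjI allI lin)
  also have "\<dots> = (\<Sum>j\<in>UNIV. \<Sum>k\<in>UNIV. \<Sum>s\<in>UNIV. (comult H (unit_vec i) (j, k) * (unit_vec j \<cdot> unit_vec s) r) *\<^sub>v (unit_vec k \<cdot> app (ts s) m))"
    unfolding 1 by (simp add: sw2_unfold[of H "unit_vec i"] fun_vs.scale_sum_right)
  finally show "app (ts r * lt i) m = app (\<Sum>j\<in>UNIV. \<Sum>k\<in>UNIV. \<Sum>s\<in>UNIV. (comult H (unit_vec i) (j, k) * (unit_vec j \<cdot> unit_vec s) r) *\<^sub>o (lt k * ts s)) m"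
    by (simp add: app_lsum app_lscale app_times app_lt)
qed

text \<open>In T at a target, S((a m)_(2)) equals S(m_(2)) S(a_(2)); the letter a_(3) that
  multiplies it from the right cancels S(a_(2)).\<close>

lemma same_lt_tt: "same H lt tt"
  unfolding same_def
proof (intro allI lop_eqI)
  fix i r m
  have 1: "(\<Sum>s\<in>UNIV. (unit_vec s \<cdot> b) r *\<^sub>v app (tt s) z) = sw2 H z (\<lambda>x y. ((pinv \<cdot> S y) \<cdot> b) r *\<^sub>v x)" for b z
  proof -
    have "(\<Sum>s\<in>UNIV. (unit_vec s \<cdot> b) r *\<^sub>v app (tt s) z)
      = sw2 H z (\<lambda>x y. (\<Sum>s\<in>UNIV. (pinv \<cdot> S y) s * (unit_vec s \<cdot> b) r) *\<^sub>v x)"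
      by (simp add: app_tt sw2_scale[symmetric] sw2_sum fun_vs.scale_sum_left mult.commute)
    then show ?thesis by (simp only: mult_component(1)[symmetric])
  qed
  have 2: "sw2 H (a \<cdot> m) (\<lambda>x y. ((pinv \<cdot> S y) \<cdot> b) r *\<^sub>v x)
      = sw2 H a (\<lambda>c d. sw2 H m (\<lambda>x y. (pinv \<cdot> (S y \<cdot> (S d \<cdot> b))) r *\<^sub>v (c \<cdot> x)))" for a b
    by (subst sw2_mult) (intro conjI allI lin, simp add: antipode_mult mult_assoc)
  have "app (\<Sum>j\<in>UNIV. \<Sum>l\<in>UNIV. \<Sum>s\<in>UNIV. (comult H (unit_vec i) (j, l) * (unit_vec s \<cdot> unit_vec l) r) *\<^sub>o (tt s * lt j)) m
      = sw2 H (unit_vec i) (\<lambda>a b. \<Sum>s\<in>UNIV. (unit_vec s \<cdot> b) r *\<^sub>v app (tt s) (a \<cdot> m))"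
    by (simp add: sw2_unfold app_lsum app_lscale app_times app_lt fun_vs.scale_sum_right)
  also have "\<dots> = sw2 H (unit_vec i) (\<lambda>a b. sw2 H a (\<lambda>c d. sw2 H m (\<lambda>x y. (pinv \<cdot> (S y \<cdot> (S d \<cdot> b))) r *\<^sub>v (c \<cdot> x))))"
    unfolding 1 2 ..
  also have "\<dots> = sw2 H (unit_vec i) (\<lambda>c w. sw2 H w (\<lambda>d b. sw2 H m (\<lambda>x y. (pinv \<cdot> (S y \<cdot> (S d \<cdot> b))) r *\<^sub>v (c \<cdot> x))))"
    by (rule sw2_coassoc) (intro conjI allI lin lin_form_coord)
  also have "\<dots> = sw2 H (unit_vec i) (\<lambda>c w. \<epsilon> w *\<^sub>v sw2 H m (\<lambda>x y. (pinv \<cdot> (S y \<cdot> \<one>)) r *\<^sub>v (c \<cdot> x)))"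
    by (subst sw2_antipode_left[where F = "\<lambda>z. sw2 H m (\<lambda>x y. (pinv \<cdot> (S y \<cdot> z)) r *\<^sub>v (_ \<cdot> x))"]) (intro lin refl lin_form_coord)+
  also have "\<dots> = sw2 H m (\<lambda>x y. (pinv \<cdot> (S y \<cdot> \<one>)) r *\<^sub>v (unit_vec i \<cdot> x))"
    by (rule sw2_counit_right) (intro lin)
  also have "\<dots> = app (lt i * tt r) m"
    by (simp add: app_times app_lt app_tt mult_unit_right sw2_lin[OF mult_linear_right] lin_map_scale[OF mult_linear_right])
  finally show "app (lt i * tt r) m = app (\<Sum>j\<in>UNIV. \<Sum>l\<in>UNIV. \<Sum>s\<in>UNIV. (comult H (unit_vec i) (j, l) * (unit_vec s \<cdot> unit_vec l) r) *\<^sub>o (tt s * lt j)) m"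
    by simp
qed

lemma edge_rel_target: "edge_rel H lt tt ls ts"
proof -
  note rep_hom[OF alg_hom_flip rep_lt] corep_hom[OF alg_hom_flip corep_ts]
    cross_hom[OF alg_hom_flip cross_lt_ts] same_hom[OF alg_hom_flip same_lt_tt]
  then show ?thesis
    using rep_lt corep_ts cross_lt_ts same_lt_tt lt_ls_commute tt_ts_commute
    unfolding edge_rel_def flip_simps by blast
qed

text \<open>The character by which the coefficients at the sites other than \<open>pt\<close>
  act.\<close>

definition \<phi> :: "('b \<Rightarrow> 'k) \<Rightarrow> 'k" where "\<phi> = conv H \<chi> \<chi>"

lemma phi_linear: "lin_form \<phi>"
  unfolding \<phi>_def by (rule lin_form_conv[OF chi_linear chi_linear])

lemma phi_eq: "\<phi> x = \<chi> (la \<chi> x)"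
  unfolding \<phi>_def by (rule form_la[OF chi_linear chi_linear, symmetric])

lemma phi_mult: "\<phi> (x \<cdot> y) = \<phi> x * \<phi> y"
  by (simp add: phi_eq la_chi_mult chi_mult)

lemma la_chi_unit: "la \<chi> \<one> = \<one>"
  unfolding la_def by (subst sw2_unit) (intro conjI allI lin, simp add: chi_unit)

lemma phi_unit: "\<phi> \<one> = 1"
  by (simp add: phi_eq la_chi_unit chi_unit)

text \<open>Composed with S, the square of \<chi> becomes the square of \<chi>^-1, and the
  translation by \<chi> inside cancels one factor. This is the origin of the \<chi>^-1 in the laws
  of the projection at e.\<close>

lemma phi_S_la: "\<phi> (S (la \<chi> a)) = \<chi>inv a"
proof -
  have "\<phi> (S (la \<chi> a)) = \<chi>inv (ra \<chi>inv (la \<chi> a))"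
    by (simp add: phi_eq la_antipode[OF chi_linear]) (simp add: chiinv)
  also have "\<dots> = \<epsilon> (ra \<chi>inv a)"
    unfolding la_ra[OF chi_linear chiinv_linear, symmetric]
    by (simp add: form_la[OF chi_linear chiinv_linear] conv_chi_chiinv)
  also have "\<dots> = \<chi>inv a"
    by (simp add: form_ra[OF chiinv_linear counit_linear] conv_counit_left[OF chiinv_linear])
  finally show ?thesis .
qed

lemma counit_la: "lin_form \<alpha> \<Longrightarrow> \<epsilon> (la \<alpha> x) = \<alpha> x"
  by (simp add: form_la counit_linear conv_counit_right)

lemma counit_ra: "lin_form \<alpha> \<Longrightarrow> \<epsilon> (ra \<alpha> x) = \<alpha> x"
  by (simp add: form_ra counit_linear conv_counit_left)

lemma app_ketbra_form: "lin_form \<alpha> \<Longrightarrow> app (ketbra u (\<lambda>i. \<alpha> (unit_vec i))) v = \<alpha> v *\<^sub>v u"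
  by (simp add: app_ketbra lin_form_expand[of \<alpha> v] mult.commute)

text \<open>Since m = m 1, every m is congruent to \<phi>(m) 1 modulo the elements a n - \<phi>(a)
  n; \<open>P\<^sub>e\<close> is the projection onto the line of 1 along these. An element whose
  first coproduct leg is p^-1 is a multiple of p^-1; \<open>P\<^sub>l\<close> projects onto this
  line along the kernel of the counit.\<close>

definition P\<^sub>e :: "('b, 'k) lop" where "P\<^sub>e = ketbra \<one> (\<lambda>i. \<phi> (unit_vec i))"
definition P\<^sub>l :: "('b, 'k) lop" where "P\<^sub>l = ketbra pinv (\<lambda>i. \<epsilon> (unit_vec i))"

lemma app_Pe: "app P\<^sub>e v = \<phi> v *\<^sub>v \<one>"
  unfolding P\<^sub>e_def by (rule app_ketbra_form[OF phi_linear])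
lemma app_Pl: "app P\<^sub>l v = \<epsilon> v *\<^sub>v pinv"
  unfolding P\<^sub>l_def by (rule app_ketbra_form[OF counit_linear])

lemma rank_one_Pe: "rank_one P\<^sub>e"
  unfolding rank_one_def P\<^sub>e_def using lin_form_expand[OF phi_linear, of \<one>] phi_unit
  by (auto simp: mult.commute)
lemma rank_one_Pl: "rank_one P\<^sub>l"
  unfolding rank_one_def P\<^sub>l_def using lin_form_expand[OF counit_linear, of pinv] counit_pinv
  by (auto simp: mult.commute)

text \<open>The coefficients \<open>f\<close> of the edge projection undo the outer letters of the
  face word. Applied to p^-2 they have to return the one factor p^-1 that is left for the middle
  letter.\<close>

lemma sw2_conj_phi: "sw2 H m (\<lambda>c d. Sinv c \<cdot> (pinv \<cdot> (pinv \<cdot> (S (S (la \<phi> d)) \<cdot> p)))) = \<phi> m *\<^sub>v pinv"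
proof -
  have 1: "pinv \<cdot> (S (S (la \<phi> d)) \<cdot> p) = la \<chi> (ra \<chi> d)" for d
  proof -
    have "pinv \<cdot> (S (S (la \<phi> d)) \<cdot> p) = la \<chi>inv (la \<phi> (ra \<chi> d))"
      using antipode_square_conj[of "la \<phi> d"] by (simp add: mult_assoc la_ra[OF phi_linear chi_linear])
    also have "conv H \<phi> \<chi>inv = \<chi>"
      by (simp add: \<phi>_def conv_assoc chi_linear chiinv_linear conv_chi_chiinv conv_counit_right)
    then have "la \<chi>inv (la \<phi> (ra \<chi> d)) = la \<chi> (ra \<chi> d)"
      by (simp add: la_la chiinv_linear phi_linear)
    finally show ?thesis .
  qed
  have 2: "pinv \<cdot> S (S (la \<chi> (ra \<chi> d))) = ra \<phi> d \<cdot> pinv" for d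
  proof -
    have "S (S (la \<chi> (ra \<chi> d))) = p \<cdot> (la \<chi>inv (la \<chi> (ra \<chi> (ra \<chi> d))) \<cdot> pinv)"
      by (simp add: antipode_square' la_ra[OF chi_linear chi_linear] mult_assoc)
    then show ?thesis
      by (simp add: la_chi_simps pinv_p_assoc ra_ra[OF chi_linear chi_linear] \<phi>_def)
  qed
  \<comment> \<open>Applying S^2 replaces S^-1 by S, so that the antipode axiom applies; injectivity
    of S leads back.\<close>
  have "S (S (sw2 H m (\<lambda>c d. Sinv c \<cdot> (pinv \<cdot> la \<chi> (ra \<chi> d))))) = sw2 H m (\<lambda>c d. S c \<cdot> (ra \<phi> d \<cdot> pinv))"
    by (simp add: sw2_lin[OF antipode_linear] antipode_mult S_pinv) (simp add: pinv[symmetric] 2 mult_assoc)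
  also have "\<dots> = sw2 H (ra \<phi> m) (\<lambda>c d. S c \<cdot> (d \<cdot> pinv))"
    by (rule sw2_ra[OF phi_linear, symmetric]) (intro conjI allI lin)
  also have "\<dots> = \<epsilon> (ra \<phi> m) *\<^sub>v (\<one> \<cdot> pinv)"
    unfolding mult_assoc[symmetric] by (rule sw2_antipode_left[where F = "\<lambda>z. z \<cdot> pinv"]) (intro lin)
  also have "\<dots> = S (S (\<phi> m *\<^sub>v pinv))"
    by (simp add: counit_ra phi_linear mult_unit_left lin_map_scale[OF antipode_linear] S_pinv pinv[symmetric])
  finally show ?thesis
    unfolding 1 by (rule S_inj[OF S_inj])
qed

text \<open>The face letters at \<iota>(e) and e multiply \<open>z\<close> from the left by the
  first leg of m and from the right by p^-1 S of the last leg. The factor \<open>Sinv c\<close>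
  cancels the former, S^2 of the inner leg together with p cancels the latter, and \<phi>(m) is what
  remains of the translation.\<close>

lemma sw2_edge_phi:
  "sw2 H m (\<lambda>x y. sw2 H x (\<lambda>a b. sw2 H b (\<lambda>c d. Sinv c \<cdot> (((a \<cdot> z) \<cdot> (pinv \<cdot> S y)) \<cdot> (S (S (la \<phi> d)) \<cdot> p)))))
    = \<phi> m *\<^sub>v z"
proof -
  have "sw2 H x (\<lambda>a b. sw2 H b (\<lambda>c d. Sinv c \<cdot> (((a \<cdot> z) \<cdot> (pinv \<cdot> S y)) \<cdot> (S (S (la \<phi> d)) \<cdot> p))))
    = z \<cdot> (pinv \<cdot> ((S (S (la \<phi> x) \<cdot> y)) \<cdot> p))" for x y
  proof -
    have "sw2 H x (\<lambda>a b. sw2 H b (\<lambda>c d. Sinv c \<cdot> (((a \<cdot> z) \<cdot> (pinv \<cdot> S y)) \<cdot> (S (S (la \<phi> d)) \<cdot> p))))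
      = sw2 H x (\<lambda>w d. sw2 H w (\<lambda>a c. (Sinv c \<cdot> a) \<cdot> ((z \<cdot> (pinv \<cdot> S y)) \<cdot> (S (S (la \<phi> d)) \<cdot> p))))"
      unfolding mult_assoc by (rule sw2_coassoc[symmetric]) (intro conjI allI lin)
    also have "\<dots> = sw2 H x (\<lambda>w d. \<epsilon> w *\<^sub>v (\<one> \<cdot> ((z \<cdot> (pinv \<cdot> S y)) \<cdot> (S (S (la \<phi> d)) \<cdot> p))))"
      by (subst sw2_Sinv_left[where F = "\<lambda>u. u \<cdot> _"]) (intro lin refl)+
    also have "\<dots> = \<one> \<cdot> ((z \<cdot> (pinv \<cdot> S y)) \<cdot> (S (S (la \<phi> x)) \<cdot> p))"
      by (rule sw2_counit_left) (intro lin)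
    finally show ?thesis by (simp add: mult_unit_left mult_assoc antipode_mult)
  qed
  then have "sw2 H m (\<lambda>x y. sw2 H x (\<lambda>a b. sw2 H b (\<lambda>c d. Sinv c \<cdot> (((a \<cdot> z) \<cdot> (pinv \<cdot> S y)) \<cdot> (S (S (la \<phi> d)) \<cdot> p)))))
      = sw2 H m (\<lambda>x y. z \<cdot> (pinv \<cdot> ((S (S (la \<phi> x) \<cdot> y)) \<cdot> p)))"
    by simp
  also have "\<dots> = sw2 H (la \<phi> m) (\<lambda>x y. z \<cdot> (pinv \<cdot> ((S (S x \<cdot> y)) \<cdot> p)))"
    by (rule sw2_la[OF phi_linear, symmetric]) (intro conjI allI lin)
  also have "\<dots> = \<epsilon> (la \<phi> m) *\<^sub>v (z \<cdot> (pinv \<cdot> (S \<one> \<cdot> p)))"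
    by (rule sw2_antipode_left) (intro lin)
  finally show ?thesis
    by (simp add: counit_la phi_linear antipode_unit mult_unit_left mult_unit_right pinv_p)
qed

text \<open>The triple coordinate sum in the laws of the edge projection is evaluation at the
  product of an outer left factor, \<open>z\<close> and an outer right factor.\<close>

lemma mult3_expand:
  assumes G: "lin_map G"
  shows "(\<Sum>u\<in>UNIV. \<Sum>r\<in>UNIV. \<Sum>i\<in>UNIV. ((unit_vec r \<cdot> z) \<cdot> unit_vec u) i *\<^sub>v y u *\<^sub>v a r *\<^sub>v G (unit_vec i))
    = G ((a \<cdot> z) \<cdot> y)"
proof -
  have "(\<Sum>u\<in>UNIV. \<Sum>r\<in>UNIV. \<Sum>i\<in>UNIV. ((unit_vec r \<cdot> z) \<cdot> unit_vec u) i *\<^sub>v y u *\<^sub>v a r *\<^sub>v G (unit_vec i))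
    = (\<Sum>u\<in>UNIV. \<Sum>r\<in>UNIV. y u *\<^sub>v a r *\<^sub>v (\<Sum>i\<in>UNIV. ((unit_vec r \<cdot> z) \<cdot> unit_vec u) i *\<^sub>v G (unit_vec i)))"
    by (simp add: fun_vs.scale_sum_right mult_ac)
  also have "\<dots> = (\<Sum>u\<in>UNIV. y u *\<^sub>v (\<Sum>r\<in>UNIV. a r *\<^sub>v G ((unit_vec r \<cdot> z) \<cdot> unit_vec u)))"
    by (simp only: lin_map_expand[OF G, symmetric] fun_vs.scale_sum_right)
  also have "\<dots> = (\<Sum>u\<in>UNIV. y u *\<^sub>v G ((a \<cdot> z) \<cdot> unit_vec u))"
  proof -
    have "lin_map (\<lambda>a. G ((a \<cdot> z) \<cdot> unit_vec u))" for u by (intro lin_map_comp[OF G] lin)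
    from lin_map_expand[OF this, of a] show ?thesis by simp
  qed
  also have "\<dots> = G ((a \<cdot> z) \<cdot> y)"
  proof -
    have "lin_map (\<lambda>y. G ((a \<cdot> z) \<cdot> y))" by (intro lin_map_comp[OF G] lin)
    from lin_map_expand[OF this, of y] show ?thesis by simp
  qed
  finally show ?thesis .
qed

end

context hopf_pair
begin

lemma edge_projection_laws_target: "edge_projection_laws H \<phi> \<chi>inv pinv (pinv \<cdot> pinv) P\<^sub>e lt tt ls ts"
proof -
  \<comment> \<open>\<open>F b w m\<close> is the b-th coordinate of S^-1(m_(1)) w S^2(d) p, where d
    is the \<phi>-translate of m_(2): this undoes the multiplication by the outer face letters.
    Putting the coordinate on the vector 1 keeps the values in the image of
    \<open>P\<^sub>e\<close>.\<close>
  define G :: "'b \<Rightarrow> ('b \<Rightarrow> 'k) \<Rightarrow> 'b \<Rightarrow> 'k" where "G b z = z b *\<^sub>v \<one>" for b z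
  define F where "F b w m = G b (sw2 H m (\<lambda>c d. Sinv c \<cdot> (w \<cdot> (S (S (la \<phi> d)) \<cdot> p))))" for b w m
  define f where "f b i = Lop (F b (unit_vec i))" for b i
  \<comment> \<open>From m = m 1, where the left factor m is a sum of multiples m_i e_i: the
    difference m - \<phi>(m) 1 is a sum of relations applied to the multiples m_i 1.\<close>
  define X where "X i = ketbra \<one> (unit_vec i)" for i
  have G: "lin_map (G b)" for b unfolding G_def by (intro lin)
  note [lin] = lin_map_comp[OF G]
  have Fm: "lin_map (F b w)" and Fw: "lin_map (\<lambda>w. F b w m)" for b w m
    unfolding F_def by (intro lin)+
  have app_f: "app (f b i) = F b (unit_vec i)" for b i
    unfolding f_def by (rule app_Lop[OF Fm])
  have "P\<^sub>e * lt i = \<phi> (unit_vec i) *\<^sub>o P\<^sub>e" for i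
    by (rule lop_eqI) (simp add: app_times app_Pe app_lt app_lscale phi_mult)
  moreover have "P\<^sub>e * ls i = \<chi>inv (unit_vec i) *\<^sub>o P\<^sub>e" for i
    by (rule lop_eqI) (simp add: app_times app_Pe app_ls app_lscale phi_mult phi_S_la mult.commute)
  moreover have "tt i * P\<^sub>e = pinv i *\<^sub>o P\<^sub>e" for i
  proof -
    have "app (tt i) \<one> = (pinv \<cdot> S \<one>) i *\<^sub>v \<one>"
      unfolding app_tt by (rule sw2_unit) (intro conjI allI lin)
    then show ?thesis
      by (intro lop_eqI) (simp add: app_times app_Pe app_lscale antipode_unit mult_unit_right mult.commute)
  qed
  moreover have "ts i * P\<^sub>e = \<one> i *\<^sub>o P\<^sub>e" for i
  proof -
    have "app (ts i) \<one> = \<one> i *\<^sub>v \<one>"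
      unfolding app_ts by (rule sw2_unit) (intro conjI allI lin)
    then show ?thesis
      by (intro lop_eqI) (simp add: app_times app_Pe app_lscale mult.commute)
  qed
  moreover have "1 - P\<^sub>e = (\<Sum>i\<in>UNIV. (lt i - \<phi> (unit_vec i) *\<^sub>o 1) * X i)"
  proof (rule lop_eqI)
    fix v
    have X: "app (X i) v = v i *\<^sub>v \<one>" for i
    proof -
      have "(\<Sum>j\<in>UNIV. unit_vec i j * v j) = (\<Sum>j\<in>UNIV. if j = i then v j else 0)"
        by (rule sum.cong) (auto simp: unit_vec_def)
      then show ?thesis by (simp add: X_def app_ketbra)
    qed
    have "app (\<Sum>i\<in>UNIV. (lt i - \<phi> (unit_vec i) *\<^sub>o 1) * X i) v
        = (\<Sum>i\<in>UNIV. v i *\<^sub>v unit_vec i) - (\<Sum>i\<in>UNIV. (v i * \<phi> (unit_vec i)) *\<^sub>v \<one>)"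
      by (simp add: app_lsum app_times app_diff app_lscale app_one X app_lt mult_unit_right sum_subtractf fun_vs.scale_right_diff_distrib mult.commute)
    also have "\<dots> = v - \<phi> v *\<^sub>v \<one>"
      by (simp add: unit_vec_expand[symmetric] fun_vs.scale_sum_left[symmetric] lin_form_expand[OF phi_linear, symmetric])
    finally show "app (1 - P\<^sub>e) v = app (\<Sum>i\<in>UNIV. (lt i - \<phi> (unit_vec i) *\<^sub>o 1) * X i) v"
      by (simp add: app_diff app_one app_Pe)
  qed
  moreover have "(\<Sum>u\<in>UNIV. \<Sum>r\<in>UNIV. \<Sum>i\<in>UNIV.
      ((unit_vec r \<cdot> unit_vec s) \<cdot> unit_vec u) i *\<^sub>o (f b i * ts r * tt u)) = (if s = b then P\<^sub>e else 0)" for b s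
  proof (rule lop_eqI)
    fix m
    have "app (f b i * ts r * tt u) m = sw2 H m (\<lambda>x y. sw2 H x (\<lambda>a z. (pinv \<cdot> S y) u *\<^sub>v a r *\<^sub>v F b (unit_vec i) z))" for i r u
      by (simp only: app_times app_tt sw2_lin[OF lin_map_app] app_scale app_ts sw2_scale app_f sw2_lin[OF Fm] lin_map_scale[OF Fm])
    then have "app (\<Sum>u\<in>UNIV. \<Sum>r\<in>UNIV. \<Sum>i\<in>UNIV. ((unit_vec r \<cdot> unit_vec s) \<cdot> unit_vec u) i *\<^sub>o (f b i * ts r * tt u)) m
      = sw2 H m (\<lambda>x y. sw2 H x (\<lambda>a z. \<Sum>u\<in>UNIV. \<Sum>r\<in>UNIV. \<Sum>i\<in>UNIV. ((unit_vec r \<cdot> unit_vec s) \<cdot> unit_vec u) i *\<^sub>v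
          (pinv \<cdot> S y) u *\<^sub>v a r *\<^sub>v F b (unit_vec i) z))"
      by (simp only: app_lsum app_lscale sw2_scale[symmetric] sw2_sum)
    also have "\<dots> = sw2 H m (\<lambda>x y. sw2 H x (\<lambda>a z. F b ((a \<cdot> unit_vec s) \<cdot> (pinv \<cdot> S y)) z))"
      by (simp only: mult3_expand[OF Fw])
    also have "\<dots> = G b (\<phi> m *\<^sub>v unit_vec s)"
      unfolding sw2_edge_phi[symmetric] F_def by (simp only: sw2_lin[OF G])
    finally show "app (\<Sum>u\<in>UNIV. \<Sum>r\<in>UNIV. \<Sum>i\<in>UNIV. ((unit_vec r \<cdot> unit_vec s) \<cdot> unit_vec u) i *\<^sub>o (f b i * ts r * tt u)) m
      = app (if s = b then P\<^sub>e else 0) m"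
      by (auto simp: G_def app_Pe app_zero unit_vec_def fun_eq_iff)
  qed
  moreover have "(\<Sum>i\<in>UNIV. (pinv \<cdot> pinv) i *\<^sub>o f b i) = pinv b *\<^sub>o P\<^sub>e" for b
  proof (rule lop_eqI)
    fix m
    have "app (\<Sum>i\<in>UNIV. (pinv \<cdot> pinv) i *\<^sub>o f b i) m = F b (pinv \<cdot> pinv) m"
      by (simp only: app_lsum app_lscale app_f lin_map_expand[OF Fw, symmetric])
    also have "\<dots> = G b (\<phi> m *\<^sub>v pinv)"
      unfolding F_def mult_assoc sw2_conj_phi ..
    finally show "app (\<Sum>i\<in>UNIV. (pinv \<cdot> pinv) i *\<^sub>o f b i) m = app (pinv b *\<^sub>o P\<^sub>e) m"
      by (simp add: G_def app_Pe app_lscale mult.commute)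
  qed
  ultimately show ?thesis
    unfolding edge_projection_laws_def by (intro conjI allI exI[of _ X] exI[of _ f]) auto
qed

text \<open>The word of the loop law for a half-edge that is a source: its own letter multiplies
  from the right, the \<chi>^-1 in the middle becomes a translation of the left factor coming from
  the target.\<close>

lemma app_cvL_chiinv:
  "app (cvL H ls (cvL H (\<lambda>j. \<chi>inv (unit_vec j) *\<^sub>o 1) lt) i) z
    = sw2 H (unit_vec i) (\<lambda>a w. la \<chi>inv w \<cdot> (z \<cdot> S (la \<chi> a)))"
proof -
  have "app (cvL H (\<lambda>j. \<chi>inv (unit_vec j) *\<^sub>o 1) lt k) v = la \<chi>inv (unit_vec k) \<cdot> v" for k v
    unfolding cvL_def la_def sw2_unfold
    by (simp add: app_lsum app_lscale app_lt lin_map_sum[OF mult_linear_left] lin_map_scale[OF mult_linear_left])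
  then show ?thesis
    unfolding cvL_def[of H ls] sw2_unfold by (simp add: app_lsum app_lscale app_times app_ls)
qed

text \<open>After applying S, the translations and the double antipode combine by the pair in
  involution into conjugation by p, and then x_(1) S(x_(2)) contracts. The twist \<chi>^-1 inherited
  from the removed edge is exactly what this needs.\<close>

lemma sw2_loop_pinv: "sw2 H x (\<lambda>a w. la \<chi>inv w \<cdot> (pinv \<cdot> S (la \<chi> a))) = \<epsilon> x *\<^sub>v pinv"
proof -
  have "sw2 H x (\<lambda>a w. la \<chi>inv w \<cdot> (pinv \<cdot> S (la \<chi> a))) = sw2 H x (\<lambda>a w. w \<cdot> (pinv \<cdot> S (la \<chi> (ra \<chi>inv a))))"
    by (rule sw2_ra_la[OF chiinv_linear, symmetric]) (intro conjI allI lin)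
  then have "S (sw2 H x (\<lambda>a w. la \<chi>inv w \<cdot> (pinv \<cdot> S (la \<chi> a)))) = sw2 H x (\<lambda>a w. p \<cdot> (a \<cdot> S w))"
    by (simp add: sw2_lin[OF antipode_linear] antipode_mult antipode_square_la_ra S_pinv mult_assoc pinv_p_assoc)
  also have "\<dots> = \<epsilon> x *\<^sub>v (p \<cdot> \<one>)"
    by (rule sw2_antipode_right[where F = "\<lambda>z. p \<cdot> z"]) (intro lin)
  also have "\<dots> = S (\<epsilon> x *\<^sub>v pinv)"
    by (simp add: lin_map_scale[OF antipode_linear] S_pinv mult_unit_right)
  finally show ?thesis by (rule S_inj)
qed

lemma loop_projection_laws_source: "loop_projection_laws H \<chi>inv pinv P\<^sub>l ls ts lt tt"
proof -
  \<comment> \<open>Chosen so that the sum of \<open>g i * ts i\<close> is the counit axiom: the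
    first leg is rebuilt from its coordinates and the second one is sent to its counit.\<close>
  define g where "g i = ketbra (unit_vec i) (\<lambda>j. \<epsilon> (unit_vec j))" for i :: 'b
  have app_g: "app (g i) z = \<epsilon> z *\<^sub>v unit_vec i" for i z
    unfolding g_def by (rule app_ketbra_form[OF counit_linear])
  have "ts i * P\<^sub>l = pinv i *\<^sub>o P\<^sub>l" for i
  proof -
    have "app (ts i) pinv = pinv i *\<^sub>v pinv"
      unfolding app_ts by (rule sw2_grouplike[OF _ comult_pinv]) (intro conjI allI lin)
    then show ?thesis
      by (intro lop_eqI) (simp add: app_times app_Pl app_lscale mult.commute)
  qed
  moreover have "tt i * P\<^sub>l = \<one> i *\<^sub>o P\<^sub>l" for i
  proof -
    have "app (tt i) pinv = (pinv \<cdot> S pinv) i *\<^sub>v pinv"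
      unfolding app_tt by (rule sw2_grouplike[OF _ comult_pinv]) (intro conjI allI lin)
    then show ?thesis
      by (intro lop_eqI) (simp add: app_times app_Pl app_lscale S_pinv pinv_p mult.commute)
  qed
  moreover have "cvL H ls (cvL H (\<lambda>j. \<chi>inv (unit_vec j) *\<^sub>o 1) lt) i * P\<^sub>l = \<epsilon> (unit_vec i) *\<^sub>o P\<^sub>l" for i
    by (rule lop_eqI) (simp add: app_times app_Pl app_lscale app_cvL_chiinv sw2_loop_pinv mult.commute)
  moreover have "P\<^sub>l * cvL H ls (cvL H (\<lambda>j. \<chi>inv (unit_vec j) *\<^sub>o 1) lt) i = \<epsilon> (unit_vec i) *\<^sub>o P\<^sub>l" for i
  proof (rule lop_eqI)
    fix z
    have "app P\<^sub>l (sw2 H (unit_vec i) (\<lambda>a w. la \<chi>inv w \<cdot> (z \<cdot> S (la \<chi> a))))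
      = sw2 H (unit_vec i) (\<lambda>a w. \<chi> a *\<^sub>v \<chi>inv w *\<^sub>v (\<epsilon> z *\<^sub>v pinv))"
      unfolding sw2_lin[OF lin_map_app] app_Pl
      by (simp add: counit_mult counit_la chi_linear chiinv_linear counit_antipode mult_ac)
    then show "app (P\<^sub>l * cvL H ls (cvL H (\<lambda>j. \<chi>inv (unit_vec j) *\<^sub>o 1) lt) i) z = app (\<epsilon> (unit_vec i) *\<^sub>o P\<^sub>l) z"
      by (simp only: app_times app_cvL_chiinv chi_chiinv app_lscale app_Pl)
  qed
  moreover have "(\<Sum>i\<in>UNIV. g i * ts i) = 1"
  proof (rule lop_eqI)
    fix z
    have "app (\<Sum>i\<in>UNIV. g i * ts i) z = sw2 H z (\<lambda>x y. \<Sum>i\<in>UNIV. x i *\<^sub>v app (g i) y)"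
      by (simp add: app_lsum app_times app_ts sw2_lin[OF lin_map_app] sw2_sum)
    also have "\<dots> = sw2 H z (\<lambda>x y. \<epsilon> y *\<^sub>v (\<Sum>i\<in>UNIV. x i *\<^sub>v unit_vec i))"
      by (simp add: app_g fun_vs.scale_sum_right mult.commute)
    also have "\<dots> = z"
      unfolding unit_vec_expand[symmetric] by (rule counit_right)
    finally show "app (\<Sum>i\<in>UNIV. g i * ts i) z = app 1 z" by (simp add: app_one)
  qed
  moreover have "(\<Sum>i\<in>UNIV. pinv i *\<^sub>o g i) = P\<^sub>l"
  proof (rule lop_eqI)
    fix z
    have "app (\<Sum>i\<in>UNIV. pinv i *\<^sub>o g i) z = \<epsilon> z *\<^sub>v (\<Sum>i\<in>UNIV. pinv i *\<^sub>v unit_vec i)"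
      by (simp add: app_lsum app_lscale app_g fun_vs.scale_sum_right mult.commute)
    then show "app (\<Sum>i\<in>UNIV. pinv i *\<^sub>o g i) z = app P\<^sub>l z"
      unfolding unit_vec_expand[symmetric] by (simp add: app_Pl)
  qed
  ultimately show ?thesis
    unfolding loop_projection_laws_def by (intro conjI allI exI[of _ g]) auto
qed

text \<open>The flag says whether the half-edge is a source.\<close>

definition loc_L :: "bool \<Rightarrow> 'b \<Rightarrow> ('b, 'k) lop" where "loc_L b = (if b then ls else lt)"
definition loc_T :: "bool \<Rightarrow> 'b \<Rightarrow> ('b, 'k) lop" where "loc_T b = (if b then ts else tt)"

lemma edge_rel_loc: "edge_rel H (loc_L b) (loc_T b) (loc_L (\<not> b)) (loc_T (\<not> b))"
  using edge_rel_target edge_rel_commute[OF edge_rel_target] by (simp add: loc_L_def loc_T_def)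

lemma edge_projection_laws_loc: "\<exists>P. rank_one P \<and> edge_projection_laws H \<phi> \<chi>inv pinv (pinv \<cdot> pinv) P (loc_L b) (loc_T b) (loc_L (\<not> b)) (loc_T (\<not> b))"
  using edge_projection_laws_target edge_projection_laws_hom[OF alg_hom_flip edge_projection_laws_target] rank_one_Pe rank_one_flip[OF rank_one_Pe]
  by (cases b) (auto simp: loc_L_def loc_T_def flip_simps)

lemma loop_projection_laws_loc: "\<exists>P. rank_one P \<and> loop_projection_laws H \<chi>inv pinv P (loc_L b) (loc_T b) (loc_L (\<not> b)) (loc_T (\<not> b))"
  using loop_projection_laws_source loop_projection_laws_hom[OF alg_hom_flip loop_projection_laws_source] rank_one_Pl rank_one_flip[OF rank_one_Pl]
  by (cases b) (auto simp: loc_L_def loc_T_def flip_simps)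

text \<open>With the opposite comultiplication it is S^-1, not S, that inverts the identity under
  convolution; this is the form in which the inverse of a slide uses it.\<close>

lemma Sinv_inverse_left: "(\<Sum>i\<in>UNIV. \<Sum>j\<in>UNIV. comult H x (j, i) *\<^sub>v (unit_vec i \<cdot> Sinv (unit_vec j))) = \<epsilon> x *\<^sub>v \<one>"
  using sw2_Sinv_right[OF lin_map_ident, of x] by (subst sum.swap) (simp add: sw2_unfold)

lemma Sinv_inverse_right: "(\<Sum>i\<in>UNIV. \<Sum>j\<in>UNIV. comult H x (j, i) *\<^sub>v (Sinv (unit_vec i) \<cdot> unit_vec j)) = \<epsilon> x *\<^sub>v \<one>"
  using sw2_Sinv_left[OF lin_map_ident, of x] by (subst sum.swap) (simp add: sw2_unfold)

end

section \<open>Words of operators\<close>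

definition intw :: "('x, 'k::field) lop \<Rightarrow> ('b \<Rightarrow> ('x, 'k) lop) \<Rightarrow> ('b \<Rightarrow> ('x, 'k) lop) \<Rightarrow> bool"
  where "intw \<sigma> f g \<longleftrightarrow> (\<forall>i. \<sigma> * f i = g i * \<sigma>)"

lemma intw_inverse:
  assumes "intw \<sigma> f g" "\<sigma> * \<tau> = 1" "\<tau> * \<sigma> = 1"
  shows "intw \<tau> g f"
  unfolding intw_def
proof
  fix i
  have "\<tau> * g i = \<tau> * (g i * \<sigma>) * \<tau>" using assms(2) by (simp add: mult.assoc)
  also have "\<dots> = \<tau> * \<sigma> * f i * \<tau>" using assms(1) by (simp add: intw_def mult.assoc)
  finally show "\<tau> * g i = f i * \<tau>" using assms(3) by simp
qed

lemma intw_mult: "intw \<sigma> f g \<Longrightarrow> intw \<tau> g h \<Longrightarrow> intw (\<tau> * \<sigma>) f h"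
  unfolding intw_def by (metis mult.assoc)

text \<open>Built from blocks, one for each letter: a slide acts on a word letter by letter, so that
  \<open>intw_word_concat\<close> reduces the claim to single blocks.\<close>

definition insafter :: "'h \<Rightarrow> 'h \<Rightarrow> 'h list \<Rightarrow> 'h list"
  where "insafter h k l = concat (map (\<lambda>z. if z = k then [k, h] else [z]) l)"

definition insbefore :: "'h \<Rightarrow> 'h \<Rightarrow> 'h list \<Rightarrow> 'h list"
  where "insbefore h k l = concat (map (\<lambda>z. if z = k then [h, k] else [z]) l)"

text \<open>\<open>d\<close> and \<open>u\<close> are the structure constants and the counit of a
  coalgebra. Vertex words use H itself; face words use the dual of H with the opposite
  comultiplication, because there the last Sweedler leg belongs to the first letter.\<close>

locale convolution =
  fixes d :: "'b::finite \<Rightarrow> 'b \<Rightarrow> 'b \<Rightarrow> 'k::field" and u :: "'b \<Rightarrow> 'k"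
  assumes coassociative: "(\<Sum>w\<in>UNIV. d x w c * d w a b) = (\<Sum>w\<in>UNIV. d x a w * d w b c)"
    and left_counit: "(\<Sum>j\<in>UNIV. d i j k * u j) = (if i = k then 1 else 0)"
    and right_counit: "(\<Sum>k\<in>UNIV. d i j k * u k) = (if i = j then 1 else 0)"
begin

definition cv :: "('b \<Rightarrow> ('x, 'k) lop) \<Rightarrow> ('b \<Rightarrow> ('x, 'k) lop) \<Rightarrow> 'b \<Rightarrow> ('x, 'k) lop"
  where "cv f g i = (\<Sum>j\<in>UNIV. \<Sum>k\<in>UNIV. d i j k *\<^sub>o (g k * f j))"

primrec word :: "('h \<Rightarrow> 'b \<Rightarrow> ('x, 'k) lop) \<Rightarrow> 'h list \<Rightarrow> 'b \<Rightarrow> ('x, 'k) lop"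
  where "word X [] = (\<lambda>i. u i *\<^sub>o 1)" | "word X (h # hs) = cv (X h) (word X hs)"

lemma cv_unit_left: "cv (\<lambda>i. u i *\<^sub>o 1) g = g"
proof
  fix i
  have "cv (\<lambda>i. u i *\<^sub>o 1) g i = (\<Sum>k\<in>UNIV. (\<Sum>j\<in>UNIV. d i j k * u j) *\<^sub>o g k)"
    unfolding cv_def by (subst sum.swap) (simp add: lscale_sum_left)
  also have "\<dots> = (\<Sum>k\<in>UNIV. if k = i then g k else 0)"
    unfolding left_counit by (rule sum.cong) auto
  finally show "cv (\<lambda>i. u i *\<^sub>o 1) g i = g i" by simp
qed

lemma cv_unit_right: "cv f (\<lambda>i. u i *\<^sub>o 1) = f"
proof
  fix i
  have "cv f (\<lambda>i. u i *\<^sub>o 1) i = (\<Sum>j\<in>UNIV. (\<Sum>k\<in>UNIV. d i j k * u k) *\<^sub>o f j)"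
    unfolding cv_def by (simp add: lscale_sum_left)
  also have "\<dots> = (\<Sum>k\<in>UNIV. if k = i then f k else 0)"
    unfolding right_counit by (rule sum.cong) auto
  finally show "cv f (\<lambda>i. u i *\<^sub>o 1) i = f i" by simp
qed

lemma cv_assoc: "cv (cv f g) h = cv f (cv g h)"
proof
  fix i
  have "cv (cv f g) h i = (\<Sum>w\<in>UNIV. \<Sum>c\<in>UNIV. \<Sum>a\<in>UNIV. \<Sum>b\<in>UNIV. (d i w c * d w a b) *\<^sub>o (h c * g b * f a))"
    unfolding cv_def by (simp add: sum_distrib_left lscale_sum_right mult.assoc)
  also have "\<dots> = (\<Sum>c\<in>UNIV. \<Sum>a\<in>UNIV. \<Sum>b\<in>UNIV. (\<Sum>w\<in>UNIV. d i w c * d w a b) *\<^sub>o (h c * g b * f a))"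
    unfolding lscale_sum_left
    by (subst sum.swap, rule sum.cong[OF refl], subst sum.swap, rule sum.cong[OF refl], rule sum.swap)
  also have "\<dots> = (\<Sum>c\<in>UNIV. \<Sum>a\<in>UNIV. \<Sum>b\<in>UNIV. \<Sum>w\<in>UNIV. (d i a w * d w b c) *\<^sub>o (h c * g b * f a))"
    unfolding coassociative lscale_sum_left ..
  also have "\<dots> = (\<Sum>a\<in>UNIV. \<Sum>c\<in>UNIV. \<Sum>w\<in>UNIV. \<Sum>b\<in>UNIV. (d i a w * d w b c) *\<^sub>o (h c * g b * f a))"
    by (subst sum.swap, rule sum.cong[OF refl], rule sum.cong[OF refl], rule sum.swap)
  also have "\<dots> = (\<Sum>a\<in>UNIV. \<Sum>w\<in>UNIV. \<Sum>b\<in>UNIV. \<Sum>c\<in>UNIV. (d i a w * d w b c) *\<^sub>o (h c * g b * f a))"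
    by (rule sum.cong[OF refl], subst sum.swap, rule sum.cong[OF refl], rule sum.swap)
  also have "\<dots> = cv f (cv g h) i"
    unfolding cv_def by (simp add: sum_distrib_right lscale_sum_right mult.assoc)
  finally show "cv (cv f g) h i = cv f (cv g h) i" .
qed

lemma word_append: "word X (xs @ ys) = cv (word X xs) (word X ys)"
  by (induction xs) (simp_all add: cv_unit_left cv_assoc)

lemma intw_cv: 
  assumes "intw \<sigma> f f'" "intw \<sigma> g g'"
  shows "intw \<sigma> (cv f g) (cv f' g')"
proof -
  have "\<sigma> * (g k * f j) = g' k * f' j * \<sigma>" for j k
    using assms unfolding intw_def by (metis mult.assoc)
  then show ?thesis
    by (simp add: intw_def cv_def sum_distrib_left sum_distrib_right)
qed

lemma intw_word_concat:
  assumes "\<And>z. z \<in> set l \<Longrightarrow> intw \<sigma> (word X (f z)) (word X (g z))"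
  shows "intw \<sigma> (word X (concat (map f l))) (word X (concat (map g l)))"
  using assms
proof (induction l)
  case Nil
  then show ?case by (simp add: intw_def)
next
  case (Cons z l)
  then show ?case by (simp add: word_append intw_cv)
qed

lemma word_commute: "(\<And>z j. z \<in> set l \<Longrightarrow> \<sigma> * X z j = X z j * \<sigma>) \<Longrightarrow> \<sigma> * word X l i = word X l i * \<sigma>"
  using intw_word_concat[of l \<sigma> X "\<lambda>z. [z]" "\<lambda>z. [z]"] by (simp add: cv_unit_right intw_def)

end

context hopf_pair
begin

lemma comult_coassoc_coord:
  "(\<Sum>w\<in>UNIV. comult H x (w, c) * comult H (unit_vec w) (a, b)) = (\<Sum>w\<in>UNIV. comult H x (a, w) * comult H (unit_vec w) (b, c))"
proof -
  let ?u = "\<lambda>_::unit. 1 :: 'k"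
  have "sw2 H x (\<lambda>y z. comult H y (a, b) *\<^sub>v z c *\<^sub>v ?u) = sw2 H x (\<lambda>y z. y a *\<^sub>v comult H z (b, c) *\<^sub>v ?u)"
  proof -
    have "sw2 H x (\<lambda>y z. sw2 H y (\<lambda>m n. m a *\<^sub>v n b *\<^sub>v z c *\<^sub>v ?u)) = sw2 H x (\<lambda>m y. sw2 H y (\<lambda>n z. m a *\<^sub>v n b *\<^sub>v z c *\<^sub>v ?u))"
      by (rule sw2_coassoc) (intro conjI allI lin)
    then show ?thesis by (simp only: comult_coord sw2_scale)
  qed
  moreover have "(sw2 H x (\<lambda>y z. comult H y (a, b) *\<^sub>v z c *\<^sub>v ?u)) () = (\<Sum>w\<in>UNIV. comult H x (w, c) * comult H (unit_vec w) (a, b))"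
  proof -
    have "(\<Sum>j\<in>UNIV. comult H x (w, j) * (comult H (unit_vec w) (a, b) * unit_vec j c)) = comult H x (w, c) * comult H (unit_vec w) (a, b)" for w
    proof -
      have "(\<Sum>j\<in>UNIV. comult H x (w, j) * (comult H (unit_vec w) (a, b) * unit_vec j c))
        = (\<Sum>j\<in>UNIV. if j = c then comult H x (w, c) * comult H (unit_vec w) (a, b) else 0)"
        by (rule sum.cong) (auto simp: unit_vec_def)
      then show ?thesis by simp
    qed
    then show ?thesis by (simp add: sw2_apply)
  qed
  moreover have "(sw2 H x (\<lambda>y z. y a *\<^sub>v comult H z (b, c) *\<^sub>v ?u)) () = (\<Sum>w\<in>UNIV. comult H x (a, w) * comult H (unit_vec w) (b, c))"
  proof -
    have "(\<Sum>i\<in>UNIV. comult H x (i, w) * (unit_vec i a * comult H (unit_vec w) (b, c))) = comult H x (a, w) * comult H (unit_vec w) (b, c)" for w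
    proof -
      have "(\<Sum>i\<in>UNIV. comult H x (i, w) * (unit_vec i a * comult H (unit_vec w) (b, c)))
        = (\<Sum>i\<in>UNIV. if i = a then comult H x (a, w) * comult H (unit_vec w) (b, c) else 0)"
        by (rule sum.cong) (auto simp: unit_vec_def)
      then show ?thesis by simp
    qed
    then show ?thesis unfolding sw2_apply by (subst sum.swap) simp
  qed
  ultimately show ?thesis by simp
qed

lemma comult_counit_coord:
  "(\<Sum>j\<in>UNIV. comult H (unit_vec i) (j, k) * \<epsilon> (unit_vec j)) = (if i = k then 1 else 0)"
  "(\<Sum>k\<in>UNIV. comult H (unit_vec i) (j, k) * \<epsilon> (unit_vec k)) = (if i = j then 1 else 0)"
proof -
  have "unit_vec i k = (\<Sum>l\<in>UNIV. \<Sum>j\<in>UNIV. comult H (unit_vec i) (j, l) * (\<epsilon> (unit_vec j) * unit_vec l k))"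
    by (subst sum.swap, subst counit_left[of "unit_vec i", symmetric]) (simp add: sw2_apply)
  also have "\<dots> = (\<Sum>l\<in>UNIV. if l = k then (\<Sum>j\<in>UNIV. comult H (unit_vec i) (j, k) * \<epsilon> (unit_vec j)) else 0)"
    by (rule sum.cong) (auto simp: unit_vec_def)
  finally show "(\<Sum>j\<in>UNIV. comult H (unit_vec i) (j, k) * \<epsilon> (unit_vec j)) = (if i = k then 1 else 0)"
    by (simp add: unit_vec_def eq_commute)
  have "unit_vec i j = (\<Sum>l\<in>UNIV. \<Sum>k\<in>UNIV. comult H (unit_vec i) (l, k) * (\<epsilon> (unit_vec k) * unit_vec l j))"
    by (subst counit_right[of "unit_vec i", symmetric]) (simp add: sw2_apply)
  also have "\<dots> = (\<Sum>l\<in>UNIV. if l = j then (\<Sum>k\<in>UNIV. comult H (unit_vec i) (j, k) * \<epsilon> (unit_vec k)) else 0)"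
    by (rule sum.cong) (auto simp: unit_vec_def)
  finally show "(\<Sum>k\<in>UNIV. comult H (unit_vec i) (j, k) * \<epsilon> (unit_vec k)) = (if i = j then 1 else 0)"
    by (simp add: unit_vec_def eq_commute)
qed

lemma mult_assoc_coord:
  "(\<Sum>w\<in>UNIV. (unit_vec c \<cdot> unit_vec w) x * (unit_vec b \<cdot> unit_vec a) w) = (\<Sum>w\<in>UNIV. (unit_vec w \<cdot> unit_vec a) x * (unit_vec c \<cdot> unit_vec b) w)"
  using mult_component(2)[of "unit_vec c" "unit_vec b \<cdot> unit_vec a" x] mult_component(1)[of "unit_vec c \<cdot> unit_vec b" "unit_vec a" x]
  by (simp add: mult_assoc mult.commute)

lemma mult_unit_coord:
  "(\<Sum>j\<in>UNIV. (unit_vec k \<cdot> unit_vec j) i * \<one> j) = (if i = k then 1 else 0)"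
  "(\<Sum>k\<in>UNIV. (unit_vec k \<cdot> unit_vec j) i * \<one> k) = (if i = j then 1 else 0)"
  using mult_component(2)[of "unit_vec k" \<one> i] mult_component(1)[of \<one> "unit_vec j" i]
  by (simp_all add: mult_unit_left mult_unit_right mult.commute unit_vec_def)

end

sublocale hopf_pair \<subseteq> cL: convolution "\<lambda>i j k. comult H (unit_vec i) (j, k)" "\<lambda>i. counit H (unit_vec i)"
  by unfold_locales (auto simp: comult_coassoc_coord comult_counit_coord)

sublocale hopf_pair \<subseteq> cT: convolution "\<lambda>i s r. (unit_vec r \<cdot> unit_vec s) i" "\<lambda>i. \<one> i"
  by unfold_locales (auto simp: mult_assoc_coord mult_unit_coord)

context hopf_pair
begin

lemma cvL_cv: "cvL H = cL.cv"
  by (intro ext) (simp add: cvL_def cL.cv_def)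

lemma cvT_cv: "cvT H = cT.cv"
  by (intro ext) (unfold cvT_def cT.cv_def, rule sum.swap)

end

section \<open>Half-edge operators and slides\<close>

text \<open>Only the edges are fixed here. Vertices and faces enter later as lists of half-edges,
  since a slide changes them while the operators at the half-edges stay the same. In
  \<open>edge_eq\<close> the half-edge \<open>k\<close> may lie outside \<open>D\<close>, so no
  foreign half-edge shares an edge with \<open>D\<close>.\<close>

locale half_edge_ops = hopf_pair H p \<chi> for H :: "('b::finite, 'k::field) hopf" (structure) and p \<chi> +
  fixes D :: "'h set" and \<iota> :: "'h \<Rightarrow> 'h" and src :: "'h \<Rightarrow> bool" and edge :: "'h \<Rightarrow> 'e"
  assumes iota_in: "h \<in> D \<Longrightarrow> \<iota> h \<in> D"
    and iota_iota: "h \<in> D \<Longrightarrow> \<iota> (\<iota> h) = h"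
    and iota_neq: "h \<in> D \<Longrightarrow> \<iota> h \<noteq> h"
    and src_iota: "h \<in> D \<Longrightarrow> src (\<iota> h) \<longleftrightarrow> \<not> src h"
    and edge_iota: "h \<in> D \<Longrightarrow> edge (\<iota> h) = edge h"
    and edge_eq: "h \<in> D \<Longrightarrow> edge k = edge h \<Longrightarrow> k = h \<or> k = \<iota> h"
begin

definition L :: "'h \<Rightarrow> 'b \<Rightarrow> ('e \<Rightarrow> 'b, 'k) lop" where "L h i = slot (edge h) (loc_L (src h) i)"
definition T :: "'h \<Rightarrow> 'b \<Rightarrow> ('e \<Rightarrow> 'b, 'k) lop" where "T h i = slot (edge h) (loc_T (src h) i)"

abbreviation "wordL \<equiv> cL.word L"
abbreviation "wordT \<equiv> cT.word T"

lemma edge_rel_LT: "h \<in> D \<Longrightarrow> edge_rel H (L h) (T h) (L (\<iota> h)) (T (\<iota> h))"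
  using edge_rel_hom[OF alg_hom_slot[of "edge h"] edge_rel_loc[of "src h"]]
  by (simp add: L_def[abs_def] T_def[abs_def] edge_iota src_iota)

lemma rep_L: "rep H (L h)"
proof -
  have "rep H (loc_L (src h))"
    using edge_rel_loc[of "src h"] by (simp add: edge_rel_def)
  from rep_hom[OF alg_hom_slot this] show ?thesis by (simp add: L_def[abs_def])
qed

lemma L_mult: "L h j * L h s = (\<Sum>m\<in>UNIV. (unit_vec j \<cdot> unit_vec s) m *\<^sub>o L h m)"
  and L_unit: "(\<Sum>i\<in>UNIV. \<one> i *\<^sub>o L h i) = 1"
  using rep_L[of h] by (auto simp: rep_def)

lemma T_mult: "h \<in> D \<Longrightarrow> T h k * T h j = (\<Sum>m\<in>UNIV. comult H (unit_vec m) (j, k) *\<^sub>o T h m)"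
  and T_counit: "h \<in> D \<Longrightarrow> (\<Sum>i\<in>UNIV. \<epsilon> (unit_vec i) *\<^sub>o T h i) = 1"
  using edge_rel_LT[of h] by (auto simp: edge_rel_def corep_def)

lemma T_L_cross: "h \<in> D \<Longrightarrow> T (\<iota> h) r * L h i = (\<Sum>j\<in>UNIV. \<Sum>k\<in>UNIV. \<Sum>s\<in>UNIV.
    (comult H (unit_vec i) (j, k) * (unit_vec j \<cdot> unit_vec s) r) *\<^sub>o (L h k * T (\<iota> h) s))"
  using edge_rel_LT[of h] by (auto simp: edge_rel_def cross_def)

lemma T_L_cross': "h \<in> D \<Longrightarrow> T h r * L (\<iota> h) i = (\<Sum>j\<in>UNIV. \<Sum>k\<in>UNIV. \<Sum>s\<in>UNIV.
    (comult H (unit_vec i) (j, k) * (unit_vec j \<cdot> unit_vec s) r) *\<^sub>o (L (\<iota> h) k * T h s))"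
  using T_L_cross[of "\<iota> h"] by (simp add: iota_in iota_iota)

lemma L_T_same: "h \<in> D \<Longrightarrow> L h i * T h m = (\<Sum>j\<in>UNIV. \<Sum>l\<in>UNIV. \<Sum>s\<in>UNIV.
    (comult H (unit_vec i) (j, l) * (unit_vec s \<cdot> unit_vec l) m) *\<^sub>o (T h s * L h j))"
  using edge_rel_LT[of h] by (auto simp: edge_rel_def same_def)

lemma edge_neq: "h \<in> D \<Longrightarrow> k \<noteq> h \<Longrightarrow> k \<noteq> \<iota> h \<Longrightarrow> edge h \<noteq> edge k"
  using edge_eq by metis

lemma L_L_commute: "edge h \<noteq> edge k \<Longrightarrow> L h i * L k j = L k j * L h i"
  and L_T_commute: "edge h \<noteq> edge k \<Longrightarrow> L h i * T k j = T k j * L h i"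
  and T_L_commute: "edge h \<noteq> edge k \<Longrightarrow> T h i * L k j = L k j * T h i"
  and T_T_commute: "edge h \<noteq> edge k \<Longrightarrow> T h i * T k j = T k j * T h i"
  by (auto simp: L_def T_def slot_commute)

lemma L_commute: "h \<in> D \<Longrightarrow> k \<noteq> h \<Longrightarrow> L h i * L k j = L k j * L h i"
  using edge_rel_LT[of h] edge_neq[of h k] L_L_commute[of h k] by (cases "k = \<iota> h") (auto simp: edge_rel_def)

lemma T_commute: "h \<in> D \<Longrightarrow> k \<noteq> h \<Longrightarrow> T h i * T k j = T k j * T h i"
  using edge_rel_LT[of h] edge_neq[of h k] T_T_commute[of h k] by (cases "k = \<iota> h") (auto simp: edge_rel_def)

text \<open>
  Conjugation by $\sum_i L_h(e_i) T_k(e^i)$ slides the end \<open>h\<close> of one edge along the edge of \<open>k\<close>: in the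
  vertex words \<open>h\<close> moves from behind \<open>k\<close> to in front of \<open>\<iota> k\<close>, in the face words \<open>k\<close> moves from behind
  \<open>\<iota> h\<close> to in front of \<open>h\<close>.
\<close>

definition slide :: "'h \<Rightarrow> 'h \<Rightarrow> ('e \<Rightarrow> 'b, 'k) lop"
  where "slide h k = (\<Sum>i\<in>UNIV. L h i * T k i)"

text \<open>S^-1 and not S, because \<open>T\<close> reverses the convolution product.\<close>

definition unslide :: "'h \<Rightarrow> 'h \<Rightarrow> ('e \<Rightarrow> 'b, 'k) lop"
  where "unslide h k = (\<Sum>i\<in>UNIV. \<Sum>j\<in>UNIV. Sinv (unit_vec i) j *\<^sub>o (L h j * T k i))"

text \<open>By \<open>cross\<close>, moving T_k past L(a) at the opposite end leaves a_(1) in the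
  argument of T_k; multiplicativity of L_h turns it into the extra letter L_h(a_(1)). Here
  \<open>h\<close> may also be the auxiliary half-edge outside \<open>D\<close> that is used for the
  holonomy.\<close>

lemma slide_L_opposite:
  assumes k: "k \<in> D" and e: "edge h \<noteq> edge k"
  shows "intw (slide h k) (L (\<iota> k)) (cL.cv (L h) (L (\<iota> k)))"
  unfolding intw_def
proof
  fix i
  have e': "edge h \<noteq> edge (\<iota> k)" using e k by (simp add: edge_iota)
  have "slide h k * L (\<iota> k) i = (\<Sum>m\<in>UNIV. \<Sum>j\<in>UNIV. \<Sum>l\<in>UNIV. \<Sum>s\<in>UNIV.
      (comult H (unit_vec i) (j, l) * (unit_vec j \<cdot> unit_vec s) m) *\<^sub>o (L h m * (L (\<iota> k) l * T k s)))"
    by (simp add: slide_def sum_distrib_right mult.assoc T_L_cross'[OF k] sum_distrib_left)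
  also have "\<dots> = (\<Sum>m\<in>UNIV. \<Sum>j\<in>UNIV. \<Sum>l\<in>UNIV. \<Sum>s\<in>UNIV.
      (comult H (unit_vec i) (j, l) * (unit_vec j \<cdot> unit_vec s) m) *\<^sub>o (L (\<iota> k) l * (L h m * T k s)))"
    by (simp add: mult.assoc[symmetric] L_L_commute[OF e'])
  also have "\<dots> = (\<Sum>j\<in>UNIV. \<Sum>l\<in>UNIV. \<Sum>s\<in>UNIV. comult H (unit_vec i) (j, l) *\<^sub>o
      (L (\<iota> k) l * ((\<Sum>m\<in>UNIV. (unit_vec j \<cdot> unit_vec s) m *\<^sub>o L h m) * T k s)))"
    unfolding sum_distrib_right sum_distrib_left lscale_sum_right
    by (subst sum.swap, rule sum.cong[OF refl], subst sum.swap, rule sum.cong[OF refl], subst sum.swap) (simp add: mult.assoc)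
  also have "\<dots> = cL.cv (L h) (L (\<iota> k)) i * slide h k"
  proof -
    have "L (\<iota> k) l * (L h j * slide h k) = (\<Sum>s\<in>UNIV. L (\<iota> k) l * (L h j * (L h s * T k s)))" for j l
      by (simp add: slide_def sum_distrib_left)
    then show ?thesis
      by (simp add: L_mult[symmetric] cL.cv_def sum_distrib_right lscale_sum_right mult.assoc)
  qed
  finally show "slide h k * L (\<iota> k) i = cL.cv (L h) (L (\<iota> k)) i * slide h k" .
qed

text \<open>The letter L_h(a_(2)) multiplies the element paired with T_k from the right; by
  \<open>same\<close> this is what arises when L_k(a) moves past T_k.\<close>

lemma slide_L_same:
  assumes k: "k \<in> D" and e: "edge h \<noteq> edge k"
  shows "intw (slide h k) (cL.cv (L k) (L h)) (L k)"
  unfolding intw_def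
proof
  fix i
  have "slide h k * cL.cv (L k) (L h) i = (\<Sum>m\<in>UNIV. \<Sum>j\<in>UNIV. \<Sum>l\<in>UNIV.
      comult H (unit_vec i) (j, l) *\<^sub>o (L h m * (T k m * L h l) * L k j))"
  proof -
    have "slide h k * cL.cv (L k) (L h) i = (\<Sum>m\<in>UNIV. L h m * (T k m * cL.cv (L k) (L h) i))"
      by (simp add: slide_def sum_distrib_right mult.assoc)
    then show ?thesis by (simp add: cL.cv_def sum_distrib_left mult.assoc)
  qed
  also have "\<dots> = (\<Sum>m\<in>UNIV. \<Sum>j\<in>UNIV. \<Sum>l\<in>UNIV. comult H (unit_vec i) (j, l) *\<^sub>o (L h m * L h l * (T k m * L k j)))"
    by (simp add: T_L_commute[OF e[symmetric]] mult.assoc)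
  also have "\<dots> = (\<Sum>m\<in>UNIV. \<Sum>j\<in>UNIV. \<Sum>l\<in>UNIV. \<Sum>r\<in>UNIV.
      (comult H (unit_vec i) (j, l) * (unit_vec m \<cdot> unit_vec l) r) *\<^sub>o (L h r * (T k m * L k j)))"
    by (simp add: L_mult sum_distrib_right lscale_sum_right)
  also have "\<dots> = (\<Sum>j\<in>UNIV. \<Sum>l\<in>UNIV. \<Sum>r\<in>UNIV. \<Sum>m\<in>UNIV.
      (comult H (unit_vec i) (j, l) * (unit_vec m \<cdot> unit_vec l) r) *\<^sub>o (L h r * (T k m * L k j)))"
    by (subst sum.swap, rule sum.cong[OF refl], subst sum.swap, rule sum.cong[OF refl], rule sum.swap)
  also have "\<dots> = (\<Sum>r\<in>UNIV. \<Sum>j\<in>UNIV. \<Sum>l\<in>UNIV. \<Sum>m\<in>UNIV.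
      (comult H (unit_vec i) (j, l) * (unit_vec m \<cdot> unit_vec l) r) *\<^sub>o (L h r * (T k m * L k j)))"
    by (subst (2) sum.swap, subst sum.swap) (rule refl)
  also have "\<dots> = (\<Sum>r\<in>UNIV. L h r * (L k i * T k r))"
    by (simp add: L_T_same[OF k] sum_distrib_left)
  also have "\<dots> = L k i * slide h k"
    by (simp add: slide_def sum_distrib_left mult.assoc[symmetric] L_L_commute[OF e])
  finally show "slide h k * cL.cv (L k) (L h) i = L k i * slide h k" .
qed

text \<open>By \<open>cross\<close>, moving T past L_h at the opposite end splits the element that
  is paired with T_k; the product rule of T_k separates the two parts, and one of them is the extra
  letter.\<close>

lemma slide_T_opposite:
  assumes h: "h \<in> D" and k: "k \<in> D" and e: "edge h \<noteq> edge k"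
  shows "intw (slide h k) (cT.cv (T (\<iota> h)) (T k)) (T (\<iota> h))"
  unfolding intw_def
proof
  fix i
  have e': "edge (\<iota> h) \<noteq> edge k" using e h by (simp add: edge_iota)
  have "T (\<iota> h) i * slide h k = (\<Sum>m\<in>UNIV. \<Sum>j\<in>UNIV. \<Sum>l\<in>UNIV. \<Sum>s\<in>UNIV.
      (comult H (unit_vec m) (j, l) * (unit_vec j \<cdot> unit_vec s) i) *\<^sub>o (L h l * (T (\<iota> h) s * T k m)))"
    by (simp add: slide_def sum_distrib_left mult.assoc[symmetric] T_L_cross[OF h] sum_distrib_right)
  also have "\<dots> = (\<Sum>m\<in>UNIV. \<Sum>j\<in>UNIV. \<Sum>l\<in>UNIV. \<Sum>s\<in>UNIV.
      (comult H (unit_vec m) (j, l) * (unit_vec j \<cdot> unit_vec s) i) *\<^sub>o (L h l * T k m * T (\<iota> h) s))"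
    by (simp add: T_T_commute[OF e'] mult.assoc)
  also have "\<dots> = (\<Sum>j\<in>UNIV. \<Sum>l\<in>UNIV. \<Sum>s\<in>UNIV. (unit_vec j \<cdot> unit_vec s) i *\<^sub>o
      (L h l * (\<Sum>m\<in>UNIV. comult H (unit_vec m) (j, l) *\<^sub>o T k m) * T (\<iota> h) s))"
    unfolding sum_distrib_right sum_distrib_left lscale_sum_right
    by (subst sum.swap, rule sum.cong[OF refl], subst sum.swap, rule sum.cong[OF refl], subst sum.swap) (simp add: mult.commute)
  also have "\<dots> = (\<Sum>j\<in>UNIV. \<Sum>l\<in>UNIV. \<Sum>s\<in>UNIV. (unit_vec j \<cdot> unit_vec s) i *\<^sub>o (L h l * T k l * (T k j * T (\<iota> h) s)))"
    unfolding T_mult[OF k, symmetric] mult.assoc ..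
  also have "\<dots> = (\<Sum>l\<in>UNIV. \<Sum>j\<in>UNIV. \<Sum>s\<in>UNIV. (unit_vec j \<cdot> unit_vec s) i *\<^sub>o (L h l * T k l * (T k j * T (\<iota> h) s)))"
    by (rule sum.swap)
  also have "\<dots> = slide h k * cvT H (T (\<iota> h)) (T k) i"
  proof -
    have "slide h k * cvT H (T (\<iota> h)) (T k) i = (\<Sum>l\<in>UNIV. L h l * T k l * cvT H (T (\<iota> h)) (T k) i)"
      by (simp add: slide_def sum_distrib_right)
    then show ?thesis by (simp add: cvT_def sum_distrib_left)
  qed
  finally show "slide h k * cT.cv (T (\<iota> h)) (T k) i = T (\<iota> h) i * slide h k"
    by (simp add: cvT_cv)
qed

lemma slide_T_same:
  assumes h: "h \<in> D" and k: "k \<in> D" and e: "edge h \<noteq> edge k"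
  shows "intw (slide h k) (T h) (cT.cv (T k) (T h))"
  unfolding intw_def
proof
  fix i
  have "cvT H (T k) (T h) i * slide h k = (\<Sum>r\<in>UNIV. \<Sum>s\<in>UNIV. \<Sum>m\<in>UNIV.
      (unit_vec r \<cdot> unit_vec s) i *\<^sub>o (T h r * (T k s * L h m) * T k m))"
  proof -
    have "T h r * (T k s * slide h k) = (\<Sum>m\<in>UNIV. T h r * (T k s * (L h m * T k m)))" for r s
      by (simp add: slide_def sum_distrib_left)
    then show ?thesis
      by (simp add: cvT_def sum_distrib_right mult.assoc lscale_sum_right)
  qed
  also have "\<dots> = (\<Sum>r\<in>UNIV. \<Sum>s\<in>UNIV. \<Sum>m\<in>UNIV.
      (unit_vec r \<cdot> unit_vec s) i *\<^sub>o (T h r * L h m * (T k s * T k m)))"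
    by (simp add: T_L_commute[OF e[symmetric]] mult.assoc)
  also have "\<dots> = (\<Sum>r\<in>UNIV. \<Sum>s\<in>UNIV. \<Sum>m\<in>UNIV. \<Sum>u\<in>UNIV.
      ((unit_vec r \<cdot> unit_vec s) i * comult H (unit_vec u) (m, s)) *\<^sub>o (T h r * L h m * T k u))"
    by (simp add: T_mult[OF k] sum_distrib_left lscale_sum_right)
  also have "\<dots> = (\<Sum>m\<in>UNIV. \<Sum>s\<in>UNIV. \<Sum>r\<in>UNIV. \<Sum>u\<in>UNIV.
      ((unit_vec r \<cdot> unit_vec s) i * comult H (unit_vec u) (m, s)) *\<^sub>o (T h r * L h m * T k u))"
    by (subst (2) sum.swap, subst sum.swap, subst (2) sum.swap) (rule refl)
  also have "\<dots> = (\<Sum>m\<in>UNIV. \<Sum>u\<in>UNIV. \<Sum>s\<in>UNIV. \<Sum>r\<in>UNIV.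
      ((unit_vec r \<cdot> unit_vec s) i * comult H (unit_vec u) (m, s)) *\<^sub>o (T h r * L h m * T k u))"
    by (rule sum.cong[OF refl], rule trans[OF sum.cong[OF refl sum.swap] sum.swap])
  also have "\<dots> = (\<Sum>u\<in>UNIV. \<Sum>m\<in>UNIV. \<Sum>s\<in>UNIV. \<Sum>r\<in>UNIV.
      (comult H (unit_vec u) (m, s) * (unit_vec r \<cdot> unit_vec s) i) *\<^sub>o (T h r * L h m) * T k u)"
    by (subst sum.swap) (simp add: mult.commute mult.left_commute mult.assoc)
  also have "\<dots> = (\<Sum>u\<in>UNIV. L h u * T h i * T k u)"
    by (simp add: L_T_same[OF h] sum_distrib_right)
  also have "\<dots> = slide h k * T h i"
    by (simp add: slide_def sum_distrib_right mult.assoc T_T_commute[OF e])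
  finally show "slide h k * T h i = cT.cv (T k) (T h) i * slide h k"
    by (simp add: cvT_cv)
qed

end

lemma sum_swap2: "(\<Sum>a\<in>A. \<Sum>b\<in>B. \<Sum>n\<in>N. G a b n) = (\<Sum>n\<in>N. \<Sum>a\<in>A. \<Sum>b\<in>B. G a b n)"
  by (rule trans[OF sum.cong[OF refl sum.swap] sum.swap])

lemma sum_swap4: "(\<Sum>a\<in>A. \<Sum>b\<in>B. \<Sum>c\<in>C. \<Sum>e\<in>E. \<Sum>n\<in>N. G a b c e n)
    = (\<Sum>n\<in>N. \<Sum>a\<in>A. \<Sum>b\<in>B. \<Sum>c\<in>C. \<Sum>e\<in>E. G a b c e n)"
  by (rule trans[OF sum.cong[OF refl sum.cong[OF refl sum_swap2]] sum_swap2])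

section \<open>Multiplicativity of vertex and face words\<close>

context hopf_pair
begin

lemma comult_mult_coord:
  "(\<Sum>a\<in>UNIV. \<Sum>b\<in>UNIV. \<Sum>c\<in>UNIV. \<Sum>e\<in>UNIV.
      comult H x (a, b) * comult H y (c, e) * ((unit_vec a \<cdot> unit_vec c) m * (unit_vec b \<cdot> unit_vec e) n))
    = comult H (x \<cdot> y) (m, n)"
  unfolding comult_mult by (simp add: sw2_apply tensor_def sum_distrib_left mult_ac)

lemma comult_mult_coord_basis:
  "comult H (x \<cdot> y) (m, n) = (\<Sum>w\<in>UNIV. (x \<cdot> y) w * comult H (unit_vec w) (m, n))"
  by (rule lin_form_expand[OF lin_form_comult_coord])

text \<open>A tensor product of commuting representations; it is one because the comultiplication is
  an algebra map. \<open>corep_cvT\<close> is the dual statement.\<close>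

lemma rep_cvL:
  assumes f: "rep H f" and g: "rep H g" and c: "\<And>i j. f i * g j = g j * f i"
  shows "rep H (cL.cv f g)"
  unfolding rep_def
proof (intro conjI allI)
  have fm: "f a * f b = (\<Sum>m\<in>UNIV. (unit_vec a \<cdot> unit_vec b) m *\<^sub>o f m)"
    and gm: "g a * g b = (\<Sum>m\<in>UNIV. (unit_vec a \<cdot> unit_vec b) m *\<^sub>o g m)" for a b
    using f g by (auto simp: rep_def)
  fix j s
  have gf: "g b * f a * (g e * f c) = (\<Sum>n\<in>UNIV. \<Sum>m\<in>UNIV. ((unit_vec a \<cdot> unit_vec c) m * (unit_vec b \<cdot> unit_vec e) n) *\<^sub>o (g n * f m))" for a b c e
  proof -
    have "g b * f a * (g e * f c) = (g b * g e) * (f a * f c)"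
      using c[of a e] by (metis mult.assoc)
    then show ?thesis
      unfolding fm gm lscale_sum_product by (simp add: mult.commute)
  qed
  have "cL.cv f g j * cL.cv f g s = (\<Sum>a\<in>UNIV. \<Sum>b\<in>UNIV. \<Sum>c\<in>UNIV. \<Sum>e\<in>UNIV.
      (comult H (unit_vec j) (a, b) * comult H (unit_vec s) (c, e)) *\<^sub>o (g b * f a * (g e * f c)))"
    unfolding cL.cv_def sum_distrib_right by (simp add: sum_distrib_left mult.commute)
  also have "\<dots> = (\<Sum>a\<in>UNIV. \<Sum>b\<in>UNIV. \<Sum>c\<in>UNIV. \<Sum>e\<in>UNIV. \<Sum>n\<in>UNIV. \<Sum>m\<in>UNIV.
      (comult H (unit_vec j) (a, b) * comult H (unit_vec s) (c, e) * ((unit_vec a \<cdot> unit_vec c) m * (unit_vec b \<cdot> unit_vec e) n)) *\<^sub>o (g n * f m))"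
    unfolding gf by (simp add: lscale_sum_right)
  also have "\<dots> = (\<Sum>n\<in>UNIV. \<Sum>m\<in>UNIV. comult H (unit_vec j \<cdot> unit_vec s) (m, n) *\<^sub>o (g n * f m))"
    by (subst sum_swap4, rule sum.cong[OF refl], subst sum_swap4, rule sum.cong[OF refl])
       (simp only: lscale_sum_left[symmetric] comult_mult_coord)
  also have "\<dots> = (\<Sum>w\<in>UNIV. (unit_vec j \<cdot> unit_vec s) w *\<^sub>o cL.cv f g w)"
    unfolding comult_mult_coord_basis lscale_sum_left
    by (subst sum_swap2, rule sum.cong[OF refl], subst sum.swap) (simp add: cL.cv_def lscale_sum_right)
  finally show "cL.cv f g j * cL.cv f g s = (\<Sum>w\<in>UNIV. (unit_vec j \<cdot> unit_vec s) w *\<^sub>o cL.cv f g w)" .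
next
  have f1: "(\<Sum>i\<in>UNIV. \<one> i *\<^sub>o f i) = 1" and g1: "(\<Sum>i\<in>UNIV. \<one> i *\<^sub>o g i) = 1"
    using f g by (auto simp: rep_def)
  have "(\<Sum>i\<in>UNIV. \<one> i *\<^sub>o cL.cv f g i)
      = (\<Sum>a\<in>UNIV. \<Sum>b\<in>UNIV. (\<Sum>i\<in>UNIV. \<one> i * comult H (unit_vec i) (a, b)) *\<^sub>o (g b * f a))"
    unfolding lscale_sum_left by (rule trans[OF _ sum_swap2[symmetric]]) (simp add: cL.cv_def lscale_sum_right)
  also have "\<dots> = (\<Sum>a\<in>UNIV. \<Sum>b\<in>UNIV. (\<one> b * \<one> a) *\<^sub>o (g b * f a))"
    unfolding lin_form_expand[OF lin_form_comult_coord, symmetric] by (simp add: comult_unit tensor_def mult.commute)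
  also have "\<dots> = 1"
    by (subst sum.swap, subst lscale_sum_product[symmetric]) (simp add: f1 g1)
  finally show "(\<Sum>i\<in>UNIV. \<one> i *\<^sub>o cL.cv f g i) = 1" .
qed

lemma corep_cvT:
  assumes f: "corep H f" and g: "corep H g" and c: "\<And>i j. f i * g j = g j * f i"
  shows "corep H (cT.cv f g)"
  unfolding corep_def cvT_cv[symmetric]
proof (intro conjI allI)
  have fm: "f a * f b = (\<Sum>m\<in>UNIV. comult H (unit_vec m) (b, a) *\<^sub>o f m)"
    and gm: "g a * g b = (\<Sum>m\<in>UNIV. comult H (unit_vec m) (b, a) *\<^sub>o g m)" for a b
    using f g by (auto simp: corep_def)
  fix k j
  have gf: "g a * f b * (g c * f e) = (\<Sum>n\<in>UNIV. \<Sum>m\<in>UNIV. (comult H (unit_vec n) (c, a) * comult H (unit_vec m) (e, b)) *\<^sub>o (g n * f m))" for a b c e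
  proof -
    have "g a * f b * (g c * f e) = (g a * g c) * (f b * f e)"
      using c[of b c] by (metis mult.assoc)
    then show ?thesis
      unfolding fm gm lscale_sum_product by simp
  qed
  have "cvT H f g k * cvT H f g j = (\<Sum>a\<in>UNIV. \<Sum>b\<in>UNIV. \<Sum>c\<in>UNIV. \<Sum>e\<in>UNIV.
      ((unit_vec a \<cdot> unit_vec b) k * (unit_vec c \<cdot> unit_vec e) j) *\<^sub>o (g a * f b * (g c * f e)))"
    unfolding cvT_def sum_distrib_right by (simp add: sum_distrib_left mult.commute)
  also have "\<dots> = (\<Sum>a\<in>UNIV. \<Sum>b\<in>UNIV. \<Sum>c\<in>UNIV. \<Sum>e\<in>UNIV. \<Sum>n\<in>UNIV. \<Sum>m\<in>UNIV.
      (comult H (unit_vec n) (c, a) * comult H (unit_vec m) (e, b) * ((unit_vec c \<cdot> unit_vec e) j * (unit_vec a \<cdot> unit_vec b) k)) *\<^sub>o (g n * f m))"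
    unfolding gf by (simp add: lscale_sum_right mult_ac)
  also have "\<dots> = (\<Sum>n\<in>UNIV. \<Sum>m\<in>UNIV. comult H (unit_vec n \<cdot> unit_vec m) (j, k) *\<^sub>o (g n * f m))"
  proof -
    have perm: "(\<Sum>a\<in>UNIV. \<Sum>b\<in>UNIV. \<Sum>c\<in>UNIV. \<Sum>e\<in>UNIV. 
        comult H (unit_vec n) (c, a) * comult H (unit_vec m) (e, b) * ((unit_vec c \<cdot> unit_vec e) j * (unit_vec a \<cdot> unit_vec b) k))
      = (\<Sum>c\<in>UNIV. \<Sum>a\<in>UNIV. \<Sum>e\<in>UNIV. \<Sum>b\<in>UNIV. 
        comult H (unit_vec n) (c, a) * comult H (unit_vec m) (e, b) * ((unit_vec c \<cdot> unit_vec e) j * (unit_vec a \<cdot> unit_vec b) k))" for n m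
      by (rule trans[OF sum.cong[OF refl trans[OF sum.swap sum.cong[OF refl sum.swap]]] sum.swap])
    show ?thesis
      by (subst sum_swap4, rule sum.cong[OF refl], subst sum_swap4, rule sum.cong[OF refl])
         (simp only: lscale_sum_left[symmetric] perm comult_mult_coord)
  qed
  also have "\<dots> = (\<Sum>w\<in>UNIV. comult H (unit_vec w) (j, k) *\<^sub>o cvT H f g w)"
    unfolding comult_mult_coord_basis lscale_sum_left
    by (subst sum_swap2) (simp add: cvT_def lscale_sum_right mult.commute)
  finally show "cvT H f g k * cvT H f g j = (\<Sum>w\<in>UNIV. comult H (unit_vec w) (j, k) *\<^sub>o cvT H f g w)" .
next
  have f1: "(\<Sum>i\<in>UNIV. \<epsilon> (unit_vec i) *\<^sub>o f i) = 1" and g1: "(\<Sum>i\<in>UNIV. \<epsilon> (unit_vec i) *\<^sub>o g i) = 1"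
    using f g by (auto simp: corep_def)
  have "(\<Sum>i\<in>UNIV. \<epsilon> (unit_vec i) *\<^sub>o cvT H f g i)
      = (\<Sum>a\<in>UNIV. \<Sum>b\<in>UNIV. (\<Sum>i\<in>UNIV. (unit_vec a \<cdot> unit_vec b) i * \<epsilon> (unit_vec i)) *\<^sub>o (g a * f b))"
    unfolding lscale_sum_left by (rule trans[OF _ sum_swap2[symmetric]]) (simp add: cvT_def lscale_sum_right mult.commute)
  also have "\<dots> = (\<Sum>a\<in>UNIV. \<Sum>b\<in>UNIV. (\<epsilon> (unit_vec a) * \<epsilon> (unit_vec b)) *\<^sub>o (g a * f b))"
    unfolding lin_form_expand[OF counit_linear, symmetric] counit_mult ..
  also have "\<dots> = 1"
    by (subst lscale_sum_product[symmetric]) (simp add: f1 g1)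
  finally show "(\<Sum>i\<in>UNIV. \<epsilon> (unit_vec i) *\<^sub>o cvT H f g i) = 1" .
qed

end

context half_edge_ops
begin

definition L_vec :: "'h \<Rightarrow> ('b \<Rightarrow> 'k) \<Rightarrow> ('e \<Rightarrow> 'b, 'k) lop"
  where "L_vec h x = (\<Sum>i\<in>UNIV. x i *\<^sub>o L h i)"

lemma L_vec_unit_vec: "L_vec h (unit_vec i) = L h i"
proof -
  have "L_vec h (unit_vec i) = (\<Sum>j\<in>UNIV. if j = i then L h j else 0)"
    unfolding L_vec_def by (rule sum.cong) (auto simp: unit_vec_def)
  then show ?thesis by simp
qed

lemma L_vec_unit: "L_vec h \<one> = 1"
  by (simp add: L_vec_def L_unit)

lemma L_vec_scale: "L_vec h (c *\<^sub>v x) = c *\<^sub>o L_vec h x"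
  by (simp add: L_vec_def lscale_sum_right)

lemma L_vec_sum: "L_vec h (\<Sum>a\<in>A. x a) = (\<Sum>a\<in>A. L_vec h (x a))"
  unfolding L_vec_def sum_fun_apply lscale_sum_left by (rule sum.swap)

lemma L_vec_mult: "L_vec h (x \<cdot> y) = L_vec h x * L_vec h y"
proof -
  have "L_vec h (x \<cdot> y) = (\<Sum>i\<in>UNIV. x i *\<^sub>o L_vec h (unit_vec i \<cdot> y))"
    by (subst lin_map_expand[OF mult_linear_left]) (simp only: L_vec_sum L_vec_scale)
  also have "\<dots> = (\<Sum>i\<in>UNIV. x i *\<^sub>o (\<Sum>j\<in>UNIV. y j *\<^sub>o L_vec h (unit_vec i \<cdot> unit_vec j)))"
    by (subst lin_map_expand[OF mult_linear_right, of _ y]) (simp only: L_vec_sum L_vec_scale)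
  also have "\<dots> = (\<Sum>i\<in>UNIV. x i *\<^sub>o (\<Sum>j\<in>UNIV. y j *\<^sub>o (L h i * L h j)))"
    by (simp only: L_mult L_vec_def)
  also have "\<dots> = L_vec h x * L_vec h y"
    by (simp add: L_vec_def lscale_sum_product lscale_sum_right)
  finally show ?thesis .
qed

text \<open>Such sums multiply like maps from H to H under convolution with the opposite
  comultiplication, because T_k is anti-multiplicative. Inverting a slide thus amounts to inverting
  the identity map there.\<close>

lemma slide_product:
  assumes k: "k \<in> D" and e: "edge h \<noteq> edge k"
  shows "(\<Sum>i\<in>UNIV. L_vec h (A i) * T k i) * (\<Sum>j\<in>UNIV. L_vec h (B j) * T k j)
    = (\<Sum>m\<in>UNIV. L_vec h (\<Sum>i\<in>UNIV. \<Sum>j\<in>UNIV. comult H (unit_vec m) (j, i) *\<^sub>v (A i \<cdot> B j)) * T k m)"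
proof -
  have c: "T k i * L_vec h x = L_vec h x * T k i" for i x
    using T_L_commute[OF e[symmetric]] by (simp add: L_vec_def sum_distrib_left sum_distrib_right)
  have "L_vec h (A i) * T k i * (L_vec h (B j) * T k j) = (L_vec h (A i) * L_vec h (B j)) * (T k i * T k j)" for i j
  proof -
    have "T k i * (L_vec h x * Z) = L_vec h x * (T k i * Z)" for i x Z
      by (simp add: mult.assoc[symmetric] c)
    then show ?thesis by (simp add: mult.assoc)
  qed
  then have "(\<Sum>i\<in>UNIV. L_vec h (A i) * T k i) * (\<Sum>j\<in>UNIV. L_vec h (B j) * T k j)
    = (\<Sum>i\<in>UNIV. \<Sum>j\<in>UNIV. L_vec h (A i \<cdot> B j) * (T k i * T k j))"
    by (simp add: sum_product L_vec_mult)
  also have "\<dots> = (\<Sum>m\<in>UNIV. \<Sum>i\<in>UNIV. \<Sum>j\<in>UNIV. comult H (unit_vec m) (j, i) *\<^sub>o (L_vec h (A i \<cdot> B j) * T k m))"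
    unfolding T_mult[OF k] by (subst sum_swap2[symmetric]) (simp add: sum_distrib_left)
  finally show ?thesis
    by (simp add: L_vec_sum L_vec_scale sum_distrib_right)
qed

lemma slide_L_vec: "slide h k = (\<Sum>i\<in>UNIV. L_vec h (unit_vec i) * T k i)"
  by (simp add: slide_def L_vec_unit_vec)

lemma unslide_L_vec: "unslide h k = (\<Sum>i\<in>UNIV. L_vec h (Sinv (unit_vec i)) * T k i)"
  by (simp add: unslide_def L_vec_def sum_distrib_right)

lemma slide_unslide:
  assumes k: "k \<in> D" and e: "edge h \<noteq> edge k"
  shows "slide h k * unslide h k = 1" and "unslide h k * slide h k = 1"
  unfolding slide_L_vec unslide_L_vec slide_product[OF assms] Sinv_inverse_left Sinv_inverse_right L_vec_scale L_vec_unit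
  by (simp_all add: T_counit[OF k])

text \<open>Only the letters \<open>k\<close> and \<open>\<iota> k\<close> interact with the slide,
  each inside its own block; every other letter commutes with it. The list \<open>l\<close> is a
  vertex from which \<open>h\<close> has been taken out.\<close>

lemma slide_wordL:
  assumes k: "k \<in> D" and e: "edge h \<noteq> edge k" and l: "set l \<subseteq> D - {h}"
  shows "intw (slide h k) (wordL (insafter h k l)) (wordL (insbefore h (\<iota> k) l))"
  unfolding insafter_def insbefore_def
proof (rule cL.intw_word_concat)
  fix z assume z: "z \<in> set l"
  then have zD: "z \<in> D" and zh: "h \<noteq> z" using l by auto
  have nk: "\<iota> k \<noteq> k" using iota_neq k by blast
  show "intw (slide h k) (wordL (if z = k then [k, h] else [z])) (wordL (if z = \<iota> k then [h, \<iota> k] else [z]))"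
  proof (cases "z = k \<or> z = \<iota> k")
    case True
    then show ?thesis
      using slide_L_same[OF k e] slide_L_opposite[OF k e] nk by (auto simp: cL.cv_unit_right)
  next
    case False
    then have "edge k \<noteq> edge z" using edge_neq[OF k] by blast
    then have "slide h k * L z i = L z i * slide h k" for i
      using L_commute[OF zD zh] T_L_commute[of k z]
      by (simp add: slide_def sum_distrib_left sum_distrib_right mult.assoc) (simp add: mult.assoc[symmetric])
    with False show ?thesis by (simp add: cL.cv_unit_right intw_def)
  qed
qed

lemma slide_wordT:
  assumes h: "h \<in> D" and k: "k \<in> D" and e: "edge h \<noteq> edge k" and l: "set l \<subseteq> D - {k}"
  shows "intw (slide h k) (wordT (insafter k (\<iota> h) l)) (wordT (insbefore k h l))"
  unfolding insafter_def insbefore_def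
proof (rule cT.intw_word_concat)
  fix z assume z: "z \<in> set l"
  then have zD: "z \<in> D" and zk: "z \<noteq> k" using l by auto
  have nh: "\<iota> h \<noteq> h" using iota_neq h by blast
  show "intw (slide h k) (wordT (if z = \<iota> h then [\<iota> h, k] else [z])) (wordT (if z = h then [k, h] else [z]))"
  proof (cases "z = h \<or> z = \<iota> h")
    case True
    then show ?thesis
      using slide_T_same[OF h k e] slide_T_opposite[OF h k e] nh by (auto simp: cT.cv_unit_right)
  next
    case False
    then have "edge h \<noteq> edge z" using edge_neq[OF h] by blast
    then have "slide h k * T z i = T z i * slide h k" for i
      using T_commute[OF k zk] L_T_commute[of h z]
      by (simp add: slide_def sum_distrib_left sum_distrib_right mult.assoc) (simp add: mult.assoc[symmetric])
    with False show ?thesis by (simp add: cT.cv_unit_right intw_def)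
  qed
qed

lemma rep_wordL: "distinct l \<Longrightarrow> set l \<subseteq> D \<Longrightarrow> rep H (wordL l)"
proof (induction l)
  case Nil
  have "(\<Sum>m\<in>UNIV. ((unit_vec j \<cdot> unit_vec s) m * \<epsilon> (unit_vec m)) *\<^sub>o (1 :: ('e \<Rightarrow> 'b, 'k) lop)) = (\<epsilon> (unit_vec j) * \<epsilon> (unit_vec s)) *\<^sub>o 1" for j s
    by (simp only: lscale_sum_left[symmetric] lin_form_expand[OF counit_linear, symmetric] counit_mult)
  moreover have "(\<Sum>m\<in>UNIV. (\<one> m * \<epsilon> (unit_vec m)) *\<^sub>o (1 :: ('e \<Rightarrow> 'b, 'k) lop)) = 1"
    by (simp only: lscale_sum_left[symmetric] lin_form_expand[OF counit_linear, symmetric] counit_unit lscale_one)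
  ultimately show ?case by (simp add: rep_def mult.commute)
next
  case (Cons h l)
  have "L h i * wordL l j = wordL l j * L h i" for i j
    using Cons.prems by (intro cL.word_commute L_commute) auto
  with Cons show ?case by (simp add: rep_cvL rep_L)
qed

lemma corep_T: "h \<in> D \<Longrightarrow> corep H (T h)"
  using edge_rel_LT by (auto simp: edge_rel_def)

lemma corep_wordT: "distinct l \<Longrightarrow> set l \<subseteq> D \<Longrightarrow> corep H (wordT l)"
proof (induction l)
  case Nil
  have "(\<Sum>m\<in>UNIV. (comult H (unit_vec m) (j, k) * \<one> m) *\<^sub>o (1 :: ('e \<Rightarrow> 'b, 'k) lop)) = (\<one> j * \<one> k) *\<^sub>o 1" for j k
    using lin_form_expand[OF lin_form_comult_coord, of \<one> j k]
    by (simp add: lscale_sum_left[symmetric] comult_unit tensor_def mult.commute)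
  moreover have "(\<Sum>m\<in>UNIV. (\<epsilon> (unit_vec m) * \<one> m) *\<^sub>o (1 :: ('e \<Rightarrow> 'b, 'k) lop)) = 1"
    using lin_form_expand[OF counit_linear, of \<one>]
    by (simp add: lscale_sum_left[symmetric] counit_unit mult.commute)
  ultimately show ?case by (simp add: corep_def mult.commute)
next
  case (Cons h l)
  have "T h i * wordT l j = wordT l j * T h i" for i j
    using Cons.prems by (intro cT.word_commute T_commute) auto
  with Cons show ?case by (simp add: corep_cvT corep_T)
qed

end

lemma commute_mult:
  fixes Z A B :: "'r::semigroup_mult"
  assumes "Z * A = A * Z" "Z * B = B * Z"
  shows "Z * (A * B) = A * B * Z"
proof -
  have "Z * (A * B) = A * (Z * B)" using assms(1) by (simp only: mult.assoc[symmetric])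
  then show ?thesis using assms(2) by (simp only: mult.assoc)
qed

section \<open>Holonomy of a face, commutation of vertex and face words\<close>

context half_edge_ops
begin

text \<open>
  Sliding an auxiliary half-edge \<open>l\<close> along all edges of a face is the product of the slides, and it
  is the face word paired with the action at \<open>l\<close>. Its effect on the words at the vertices gives the
  commutation relations of vertex and face words.
\<close>

definition holonomy :: "'h \<Rightarrow> 'h list \<Rightarrow> ('e \<Rightarrow> 'b, 'k) lop"
  where "holonomy l ks = (\<Sum>i\<in>UNIV. L l i * wordT ks i)"

text \<open>Consecutive half-edges k, k' of a face satisfy k' = rho^-1(iota(k)): after the slide
  along k the auxiliary half-edge sits in front of \<open>\<iota> k\<close>, which is already the
  place behind k' where the next slide starts.\<close>

definition path_moves :: "'h \<Rightarrow> 'h list \<Rightarrow> 'h list \<Rightarrow> bool"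
  where "path_moves l ks vs \<longleftrightarrow> (\<forall>us k k' ws. ks = us @ k # k' # ws \<longrightarrow> insbefore l (\<iota> k) vs = insafter l k' vs)"

context
  fixes l :: 'h
  assumes l_D: "l \<notin> D" and l_edge: "edge l \<notin> edge ` D" and l_src: "\<not> src l"
begin

lemma fresh_edge: "h \<in> D \<Longrightarrow> edge l \<noteq> edge h"
  using l_edge by blast

lemma fresh_commute_wordT: "set ks \<subseteq> D \<Longrightarrow> slot (edge l) A * wordT ks i = wordT ks i * slot (edge l) A"
  by (rule cT.word_commute) (auto simp: T_def intro!: slot_commute dest!: subsetD fresh_edge)

lemma fresh_commute_wordL: "set ks \<subseteq> D \<Longrightarrow> slot (edge l) A * wordL ks i = wordL ks i * slot (edge l) A"
  by (rule cL.word_commute) (auto simp: L_def intro!: slot_commute dest!: subsetD fresh_edge)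

lemma fresh_L_commute_wordT: "set ks \<subseteq> D \<Longrightarrow> L l j * wordT ks i = wordT ks i * L l j"
  by (simp add: L_def[of l] fresh_commute_wordT)

lemma fresh_L_commute_wordL: "set ks \<subseteq> D \<Longrightarrow> L l j * wordL ks i = wordL ks i * L l j"
  by (simp add: L_def[of l] fresh_commute_wordL)

lemma holonomy_Nil: "holonomy l [] = 1"
  using L_unit[of l] by (simp add: holonomy_def)

lemma holonomy_Cons:
  assumes "set ks \<subseteq> D"
  shows "holonomy l (k # ks) = holonomy l ks * slide l k"
proof -
  have "holonomy l (k # ks) = (\<Sum>i\<in>UNIV. \<Sum>r\<in>UNIV. \<Sum>s\<in>UNIV. (unit_vec r \<cdot> unit_vec s) i *\<^sub>o (L l i * (wordT ks r * T k s)))"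
    by (simp add: holonomy_def cvT_cv[symmetric] cvT_def sum_distrib_left)
  also have "\<dots> = (\<Sum>r\<in>UNIV. \<Sum>s\<in>UNIV. \<Sum>i\<in>UNIV. (unit_vec r \<cdot> unit_vec s) i *\<^sub>o (L l i * (wordT ks r * T k s)))"
    by (rule sum_swap2[symmetric])
  also have "\<dots> = (\<Sum>r\<in>UNIV. \<Sum>s\<in>UNIV. L l r * L l s * (wordT ks r * T k s))"
    by (simp add: L_mult sum_distrib_right)
  also have "\<dots> = (\<Sum>r\<in>UNIV. \<Sum>s\<in>UNIV. L l r * wordT ks r * (L l s * T k s))"
    using fresh_L_commute_wordT[OF assms] by (simp add: mult.assoc) (simp add: mult.assoc[symmetric])
  also have "\<dots> = holonomy l ks * slide l k"
    by (simp add: holonomy_def slide_def sum_product)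
  finally show ?thesis .
qed

lemma holonomy_path:
  assumes "ks \<noteq> []" "set ks \<subseteq> D" "set vs \<subseteq> D" "path_moves l ks vs"
  shows "intw (holonomy l ks) (wordL (insafter l (hd ks) vs)) (wordL (insbefore l (\<iota> (last ks)) vs))"
  using assms
proof (induction ks)
  case (Cons k ks)
  have 1: "intw (slide l k) (wordL (insafter l k vs)) (wordL (insbefore l (\<iota> k) vs))"
    using Cons.prems l_D fresh_edge by (intro slide_wordL) auto
  show ?case
  proof (cases ks)
    case Nil
    then show ?thesis using 1 by (simp add: holonomy_Cons holonomy_Nil)
  next
    case (Cons k' ks')
    have "path_moves l ks vs"
      using Cons.prems(4) unfolding path_moves_def by (metis append_Cons)
    then have "intw (holonomy l ks) (wordL (insafter l (hd ks) vs)) (wordL (insbefore l (\<iota> (last ks)) vs))"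
      using Cons.IH Cons.prems Cons by auto
    moreover have "insbefore l (\<iota> k) vs = insafter l k' vs"
      using Cons.prems(4) Cons unfolding path_moves_def by (metis append_Nil)
    ultimately show ?thesis
      using 1 Cons Cons.prems by (simp add: holonomy_Cons intw_mult)
  qed
qed simp

text \<open>Comparison of coefficients. As \<open>l\<close> is a target on a tensor factor of its
  own, \<open>L l m\<close> is left multiplication by e_m there, and these are linearly independent
  over the operators that commute with this factor.\<close>

lemma fresh_cancel:
  assumes X: "\<And>n A. slot (edge l) A * X n = X n * slot (edge l) A"
    and Y: "\<And>n A. slot (edge l) A * Y n = Y n * slot (edge l) A"
    and eq: "(\<Sum>m\<in>UNIV. L l m * X m) = (\<Sum>m\<in>UNIV. L l m * Y m)"
  shows "X n = Y n"
proof -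
  define c where "c i = (\<epsilon> (unit_vec i) :: 'k)" for i
  \<comment> \<open>\<open>?R\<close> prepares the vector 1 and \<open>?Q\<close> reads off the n-th
    coordinate, so that \<open>?Q\<close> times left multiplication by e_m times \<open>?R\<close>
    vanishes unless m = n.\<close>
  let ?R = "ketbra \<one> c" and ?Q = "ketbra \<one> (unit_vec n)"
  let ?U = "\<lambda>j. ketbra (unit_vec j) c" and ?V = "\<lambda>j. ketbra \<one> (unit_vec j)"
  have c1: "(\<Sum>i\<in>UNIV. c i * \<one> i) = 1"
    using lin_form_expand[OF counit_linear, of \<one>] by (simp add: c_def counit_unit mult.commute)
  have uv: "(\<Sum>i\<in>UNIV. unit_vec j i * v i) = v j" for j and v :: "'b \<Rightarrow> 'k"
  proof -
    have "(\<Sum>i\<in>UNIV. unit_vec j i * v i) = (\<Sum>i\<in>UNIV. if i = j then v j else 0)"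
      by (rule sum.cong) (auto simp: unit_vec_def)
    then show ?thesis by simp
  qed
  have QLR: "?Q * (loc_L (src l) m * ?R) = (if m = n then ?R else 0)" for m
  proof -
    have "(unit_vec m n :: 'k) = (if m = n then 1 else 0)" by (simp add: unit_vec_def)
    then show ?thesis
      using l_src by (intro lop_eqI) (simp add: app_times app_ketbra loc_L_def app_lt uv lin_map_scale[OF mult_linear_right]
        mult_unit_right app_zero)
  qed
  have QR: "slot (edge l) ?Q * (\<Sum>m\<in>UNIV. L l m * Z m) * slot (edge l) ?R = slot (edge l) ?R * Z n"
    if Z: "\<And>n A. slot (edge l) A * Z n = Z n * slot (edge l) A" for Z
  proof -
    have "slot (edge l) ?Q * (L l m * Z m) * slot (edge l) ?R = slot (edge l) (?Q * (loc_L (src l) m * ?R)) * Z m" for m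
    proof -
      have "slot (edge l) A * (Z m * Y) = Z m * (slot (edge l) A * Y)" for A Y
        using Z[of A m] by (simp add: mult.assoc[symmetric])
      then show ?thesis by (simp add: L_def slot_times mult.assoc Z)
    qed
    then have "slot (edge l) ?Q * (\<Sum>m\<in>UNIV. L l m * Z m) * slot (edge l) ?R
      = (\<Sum>m\<in>UNIV. slot (edge l) (if m = n then ?R else 0) * Z m)"
      by (simp add: sum_distrib_left sum_distrib_right QLR)
    also have "\<dots> = (\<Sum>m\<in>UNIV. if m = n then slot (edge l) ?R * Z m else 0)"
      by (rule sum.cong) auto
    finally show ?thesis by simp
  qed
  have RXY: "slot (edge l) ?R * X n = slot (edge l) ?R * Y n"
    using QR[of X, OF X] QR[of Y, OF Y] eq by simp
  \<comment> \<open>A resolution of the identity through the rank-one operator \<open>?R\<close>, by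
    which \<open>?R\<close> is removed from the equation \<open>RXY\<close>.\<close>
  have one: "(\<Sum>j\<in>UNIV. ?U j * (?R * ?V j)) = 1"
  proof (rule lop_eqI)
    fix v
    have "app (?U j * (?R * ?V j)) v = v j *\<^sub>v unit_vec j" for j
      using c1 by (simp add: app_times app_ketbra uv sum_distrib_left[symmetric] mult.left_commute[of _ "v j"] fun_eq_iff)
    then show "app (\<Sum>j\<in>UNIV. ?U j * (?R * ?V j)) v = app 1 v"
      by (simp add: app_lsum app_one unit_vec_expand[symmetric])
  qed
  have exp: "Z n = (\<Sum>j\<in>UNIV. slot (edge l) (?U j) * (slot (edge l) ?R * Z n) * slot (edge l) (?V j))"
    if Z: "\<And>n A. slot (edge l) A * Z n = Z n * slot (edge l) A" for Z
  proof -
    have "Z n = slot (edge l) (\<Sum>j\<in>UNIV. ?U j * (?R * ?V j)) * Z n"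
      by (simp add: one)
    also have "\<dots> = (\<Sum>j\<in>UNIV. slot (edge l) (?U j) * (slot (edge l) ?R * Z n) * slot (edge l) (?V j))"
    proof -
      have "slot (edge l) A * (Z n * Y) = Z n * (slot (edge l) A * Y)" for A Y
        using Z[of A n] by (simp add: mult.assoc[symmetric])
      then show ?thesis by (simp add: slot_sum slot_times sum_distrib_right mult.assoc Z)
    qed
    finally show ?thesis .
  qed
  show ?thesis
    using exp[of X, OF X] exp[of Y, OF Y] RXY by simp
qed

lemma sum_slot_commute:
  "(\<And>a. a \<in> A \<Longrightarrow> Z * f a = f a * Z) \<Longrightarrow> Z * (\<Sum>a\<in>A. f a) = (\<Sum>a\<in>A. f a) * (Z :: ('e \<Rightarrow> 'b, 'k) lop)"
  by (simp add: sum_distrib_left sum_distrib_right)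

text \<open>The auxiliary half-edge starts and ends outside the vertex \<open>vs\<close>, and
  whenever it enters \<open>vs\<close> in between it leaves again. So the holonomy commutes with the
  vertex word, and the coefficients at \<open>l\<close> can be compared.\<close>

lemma wordL_wordT_commute:
  assumes "set ks \<subseteq> D" "set vs \<subseteq> D" "ks \<noteq> []" "path_moves l ks vs" "hd ks \<notin> set vs" "\<iota> (last ks) \<notin> set vs"
  shows "wordL vs i * wordT ks n = wordT ks n * wordL vs i"
proof -
  have n: "insafter l x vs = vs" "insbefore l x vs = vs" if "x \<notin> set vs" for x
    using that by (induction vs) (auto simp: insafter_def insbefore_def)
  have "holonomy l ks * wordL vs i = wordL vs i * holonomy l ks"
    using holonomy_path[OF assms(3,1,2,4)] n[OF assms(5)] n[OF assms(6)] by (simp add: intw_def)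
  then have "(\<Sum>m\<in>UNIV. L l m * (wordT ks m * wordL vs i)) = (\<Sum>m\<in>UNIV. L l m * (wordL vs i * wordT ks m))"
    using fresh_L_commute_wordL[OF assms(2)]
    by (simp add: holonomy_def sum_distrib_left sum_distrib_right mult.assoc[symmetric])
  moreover have "slot (edge l) A * (wordT ks m * wordL vs i) = (wordT ks m * wordL vs i) * slot (edge l) A"
      "slot (edge l) A * (wordL vs i * wordT ks m) = (wordL vs i * wordT ks m) * slot (edge l) A" for m A
    by (intro commute_mult fresh_commute_wordT[OF assms(1)] fresh_commute_wordL[OF assms(2)])+
  ultimately show ?thesis
    using fresh_cancel[of "\<lambda>m. wordT ks m * wordL vs i" "\<lambda>m. wordL vs i * wordT ks m" n] by simp
qed

text \<open>Here the face starts behind the last half-edge of the vertex and ends in front of the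
  first one, so the holonomy carries the auxiliary half-edge from the end of the vertex word to its
  beginning. Comparing coefficients at \<open>l\<close> turns this into the Yetter--Drinfeld
  condition.\<close>

lemma yetter_drinfeld:
  assumes "set ks \<subseteq> D" "set vs \<subseteq> D" "distinct vs" "ks \<noteq> []" "vs \<noteq> []" "path_moves l ks vs" "hd ks = last vs" "\<iota> (last ks) = hd vs"
  shows "(\<Sum>j\<in>UNIV. \<Sum>k\<in>UNIV. \<Sum>m\<in>UNIV. (comult H (unit_vec i) (j, k) * (unit_vec m \<cdot> unit_vec k) n) *\<^sub>o (wordT ks m * wordL vs j))
    = (\<Sum>j\<in>UNIV. \<Sum>k\<in>UNIV. \<Sum>m\<in>UNIV. (comult H (unit_vec i) (j, k) * (unit_vec j \<cdot> unit_vec m) n) *\<^sub>o (wordL vs k * wordT ks m))"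
proof -
  have a: "insafter l (last vs) vs = vs @ [l]"
    using assms(3,5) by (induction vs) (auto simp: insafter_def)
  have b: "insbefore l (hd vs) vs = l # vs"
  proof -
    obtain v vs' where vs: "vs = v # vs'" using assms(5) by (cases vs) auto
    then have "v \<notin> set vs'" using assms(3) by auto
    then have "concat (map (\<lambda>z. if z = v then [l, v] else [z]) vs') = vs'"
      by (induction vs') auto
    then show ?thesis by (simp add: vs insbefore_def)
  qed
  have cT: "slot (edge l) A * wordT ks m = wordT ks m * slot (edge l) A" for A m
    by (rule fresh_commute_wordT[OF assms(1)])
  have cL: "slot (edge l) A * wordL vs m = wordL vs m * slot (edge l) A" for A m
    by (rule fresh_commute_wordL[OF assms(2)])
  have eq: "holonomy l ks * cL.cv (wordL vs) (L l) i = cL.cv (L l) (wordL vs) i * holonomy l ks"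
    using holonomy_path[OF assms(4,1,2,6)] assms(7,8) by (simp add: a b cL.word_append cL.cv_unit_right intw_def)
  have "holonomy l ks * cL.cv (wordL vs) (L l) i = (\<Sum>j\<in>UNIV. \<Sum>k\<in>UNIV. \<Sum>m\<in>UNIV.
      comult H (unit_vec i) (j, k) *\<^sub>o (L l m * L l k * (wordT ks m * wordL vs j)))"
  proof -
    have "holonomy l ks * (L l k * wordL vs j) = (\<Sum>m\<in>UNIV. L l m * L l k * (wordT ks m * wordL vs j))" for j k
    proof -
      have c: "wordT ks m * (L l k * Z) = L l k * (wordT ks m * Z)" for m Z
        using fresh_L_commute_wordT[OF assms(1)] by (simp add: mult.assoc[symmetric])
      show ?thesis by (simp add: holonomy_def sum_distrib_right mult.assoc c)
    qed
    then show ?thesis by (simp add: cL.cv_def sum_distrib_left lscale_sum_right)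
  qed
  also have "\<dots> = (\<Sum>j\<in>UNIV. \<Sum>k\<in>UNIV. \<Sum>m\<in>UNIV. \<Sum>r\<in>UNIV.
      (comult H (unit_vec i) (j, k) * (unit_vec m \<cdot> unit_vec k) r) *\<^sub>o (L l r * (wordT ks m * wordL vs j)))"
    by (simp add: L_mult sum_distrib_right lscale_sum_right)
  also have "\<dots> = (\<Sum>r\<in>UNIV. L l r * (\<Sum>j\<in>UNIV. \<Sum>k\<in>UNIV. \<Sum>m\<in>UNIV.
      (comult H (unit_vec i) (j, k) * (unit_vec m \<cdot> unit_vec k) r) *\<^sub>o (wordT ks m * wordL vs j)))"
    by (rule trans[OF sum.cong[OF refl sum_swap2] trans[OF sum.swap]]) (simp add: sum_distrib_left)
  finally have 1: "holonomy l ks * cL.cv (wordL vs) (L l) i = (\<Sum>r\<in>UNIV. L l r * (\<Sum>j\<in>UNIV. \<Sum>k\<in>UNIV. \<Sum>m\<in>UNIV.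
      (comult H (unit_vec i) (j, k) * (unit_vec m \<cdot> unit_vec k) r) *\<^sub>o (wordT ks m * wordL vs j)))" .
  have "cL.cv (L l) (wordL vs) i * holonomy l ks = (\<Sum>j\<in>UNIV. \<Sum>k\<in>UNIV. \<Sum>m\<in>UNIV.
      comult H (unit_vec i) (j, k) *\<^sub>o (L l j * L l m * (wordL vs k * wordT ks m)))"
  proof -
    have "wordL vs k * (L l j * holonomy l ks) = (\<Sum>m\<in>UNIV. L l j * L l m * (wordL vs k * wordT ks m))" for j k
    proof -
      have c: "wordL vs k * (L l j * Z) = L l j * (wordL vs k * Z)" for j Z
        using fresh_L_commute_wordL[OF assms(2)] by (simp add: mult.assoc[symmetric])
      show ?thesis by (simp add: holonomy_def sum_distrib_left mult.assoc c)
    qed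
    then show ?thesis by (simp add: cL.cv_def sum_distrib_right lscale_sum_right mult.assoc)
  qed
  also have "\<dots> = (\<Sum>j\<in>UNIV. \<Sum>k\<in>UNIV. \<Sum>m\<in>UNIV. \<Sum>r\<in>UNIV.
      (comult H (unit_vec i) (j, k) * (unit_vec j \<cdot> unit_vec m) r) *\<^sub>o (L l r * (wordL vs k * wordT ks m)))"
    by (simp add: L_mult sum_distrib_right lscale_sum_right)
  also have "\<dots> = (\<Sum>r\<in>UNIV. L l r * (\<Sum>j\<in>UNIV. \<Sum>k\<in>UNIV. \<Sum>m\<in>UNIV.
      (comult H (unit_vec i) (j, k) * (unit_vec j \<cdot> unit_vec m) r) *\<^sub>o (wordL vs k * wordT ks m)))"
    by (rule trans[OF sum.cong[OF refl sum_swap2] trans[OF sum.swap]]) (simp add: sum_distrib_left)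
  finally have 2: "cL.cv (L l) (wordL vs) i * holonomy l ks = (\<Sum>r\<in>UNIV. L l r * (\<Sum>j\<in>UNIV. \<Sum>k\<in>UNIV. \<Sum>m\<in>UNIV.
      (comult H (unit_vec i) (j, k) * (unit_vec j \<cdot> unit_vec m) r) *\<^sub>o (wordL vs k * wordT ks m)))" .
  show ?thesis
    by (rule fresh_cancel[OF _ _ eq[unfolded 1 2]]; intro sum_slot_commute) (simp_all add: commute_mult cT cL)
qed

end

end

section \<open>Sites and slides\<close>

fun adj :: "'a list \<Rightarrow> 'a \<Rightarrow> 'a \<Rightarrow> bool" where
  "adj (a # b # l) x y \<longleftrightarrow> (x = a \<and> y = b) \<or> adj (b # l) x y"
| "adj _ x y \<longleftrightarrow> False"

lemma adj_Cons: "adj (a # l) x y \<longleftrightarrow> l \<noteq> [] \<and> x = a \<and> y = hd l \<or> adj l x y"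
  by (cases l) auto

lemma adj_append: "adj (xs @ ys) x y \<longleftrightarrow> adj xs x y \<or> adj ys x y \<or> xs \<noteq> [] \<and> ys \<noteq> [] \<and> x = last xs \<and> y = hd ys"
  by (induction xs) (auto simp: adj_Cons hd_append)

lemma adj_in_set: "adj l x y \<Longrightarrow> x \<in> set l \<and> y \<in> set l"
  by (induction l x y rule: adj.induct) auto

lemma adj_iff: "adj l x y \<longleftrightarrow> (\<exists>us ws. l = us @ x # y # ws)"
proof
  show "adj l x y \<Longrightarrow> \<exists>us ws. l = us @ x # y # ws"
  proof (induction l)
    case (Cons a l)
    then consider "l \<noteq> []" "x = a" "y = hd l" | "adj l x y" by (auto simp: adj_Cons)
    then show ?case
    proof cases
      case 1
      then have "a # l = [] @ x # y # tl l" by simp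
      then show ?thesis by blast
    next
      case 2
      with Cons.IH obtain us ws where "l = us @ x # y # ws" by blast
      then have "a # l = (a # us) @ x # y # ws" by simp
      then show ?thesis by blast
    qed
  qed simp
qed (auto simp: adj_append adj_Cons)

lemma insafter_simps [simp]: "insafter h k [] = []" "insafter h k (z # l) = (if z = k then k # h # insafter h k l else z # insafter h k l)"
  by (auto simp: insafter_def)

lemma insbefore_simps [simp]: "insbefore h k [] = []" "insbefore h k (z # l) = (if z = k then h # k # insbefore h k l else z # insbefore h k l)"
  by (auto simp: insbefore_def)

lemma insafter_append [simp]: "insafter h k (xs @ ys) = insafter h k xs @ insafter h k ys"
  by (simp add: insafter_def)

lemma insbefore_append [simp]: "insbefore h k (xs @ ys) = insbefore h k xs @ insbefore h k ys"
  by (simp add: insbefore_def)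

lemma insafter_eq_Nil [simp]: "insafter h k l = [] \<longleftrightarrow> l = []" and insbefore_eq_Nil [simp]: "insbefore h k l = [] \<longleftrightarrow> l = []"
  by (cases l; simp)+

lemma hd_insafter: "l \<noteq> [] \<Longrightarrow> hd (insafter h k l) = hd l"
  by (cases l) auto

lemma set_insafter: "set (insafter h k l) = (if k \<in> set l then insert h (set l) else set l)"
  by (induction l) auto

lemma set_insbefore: "set (insbefore h k l) = (if k \<in> set l then insert h (set l) else set l)"
  by (induction l) auto

lemma insafter_notin: "k \<notin> set l \<Longrightarrow> insafter h k l = l"
  by (induction l) auto

lemma insbefore_notin: "k \<notin> set l \<Longrightarrow> insbefore h k l = l"
  by (induction l) auto

lemma distinct_insafter: "distinct l \<Longrightarrow> h \<notin> set l \<Longrightarrow> distinct (insafter h k l)"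
  by (induction l) (auto simp: set_insafter insafter_notin)

lemma distinct_insbefore: "distinct l \<Longrightarrow> h \<notin> set l \<Longrightarrow> distinct (insbefore h k l)"
  by (induction l) (auto simp: set_insbefore insbefore_notin)

lemma map_insafter: "inj f \<Longrightarrow> map f (insafter h k l) = insafter (f h) (f k) (map f l)"
  by (induction l) (auto dest: injD)

lemma map_insbefore: "inj f \<Longrightarrow> map f (insbefore h k l) = insbefore (f h) (f k) (map f l)"
  by (induction l) (auto dest: injD)

text \<open>As \<open>k\<close> is not the last element it has a successor wherever it occurs, and
  \<open>h\<close> takes this successor over.\<close>

lemma adj_insafter: "l \<noteq> [] \<Longrightarrow> last l \<noteq> k \<Longrightarrow>
  adj (insafter h k l) x y \<longleftrightarrow> adj l x y \<and> x \<noteq> k \<or> k \<in> set l \<and> x = k \<and> y = h \<or> x = h \<and> adj l k y"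
proof (induction l)
  case (Cons a l)
  show ?case
  proof (cases "l = []")
    case False
    then have IH: "adj (insafter h k l) x y \<longleftrightarrow> adj l x y \<and> x \<noteq> k \<or> k \<in> set l \<and> x = k \<and> y = h \<or> x = h \<and> adj l k y"
      using Cons by auto
    show ?thesis using False by (auto simp: adj_Cons IH hd_insafter)
  qed (use Cons in auto)
qed simp

lemma adj_insbefore: "l \<noteq> [] \<Longrightarrow> hd l \<noteq> k \<Longrightarrow>
  adj (insbefore h k l) x y \<longleftrightarrow> adj l x y \<and> y \<noteq> k \<or> k \<in> set l \<and> x = h \<and> y = k \<or> y = h \<and> adj l x k"
proof (induction l rule: rev_induct)
  case (snoc a l)
  show ?case
  proof (cases "l = []")
    case False
    then have IH: "adj (insbefore h k l) x y \<longleftrightarrow> adj l x y \<and> y \<noteq> k \<or> k \<in> set l \<and> x = h \<and> y = k \<or> y = h \<and> adj l x k"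
      using snoc by auto
    have "last (insbefore h k l) = last l"
      using False by (induction l rule: rev_induct) auto
    then show ?thesis using False by (auto simp: adj_append adj_Cons IH)
  qed (use snoc in auto)
qed simp

text \<open>
  A site \<open>c\<close> is a node in the cyclic order of its vertex, between the last and the first half-edge,
  and in the cyclic order of its face.
\<close>

definition ext :: "'c \<Rightarrow> 'h list \<Rightarrow> ('h + 'c) list"
  where "ext c l = Inr c # map Inl l @ [Inr c]"

definition succs :: "'c set \<Rightarrow> ('c \<Rightarrow> 'h list) \<Rightarrow> 'h + 'c \<Rightarrow> 'h + 'c \<Rightarrow> bool"
  where "succs I vl x y \<longleftrightarrow> (\<exists>c\<in>I. adj (ext c (vl c)) x y)"

definition parts :: "'c set \<Rightarrow> ('c \<Rightarrow> 'h list) \<Rightarrow> 'h set \<Rightarrow> bool"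
  where "parts I vl D \<longleftrightarrow> (\<forall>c\<in>I. distinct (vl c)) \<and> (\<forall>c\<in>I. \<forall>d\<in>I. c \<noteq> d \<longrightarrow> set (vl c) \<inter> set (vl d) = {}) \<and>
    (\<Union>c\<in>I. set (vl c)) = D"

text \<open>Connectivity of the graph in terms of sites. Used for vertex lists and for face lists
  alike.\<close>

definition conn :: "('h \<Rightarrow> 'h) \<Rightarrow> 'c set \<Rightarrow> ('c \<Rightarrow> 'h list) \<Rightarrow> bool"
  where "conn \<iota> I vl \<longleftrightarrow> (\<forall>J\<subseteq>I. J \<noteq> {} \<longrightarrow> \<iota> ` (\<Union>c\<in>J. set (vl c)) \<subseteq> (\<Union>c\<in>J. set (vl c)) \<longrightarrow> J = I)"

text \<open>The equation (face permutation) = rho^-1 iota, for the permutations enlarged by the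
  sites and with \<iota> fixing every site. As a relation between neighbours it also makes sense for
  a site without half-edges.\<close>

definition compat :: "('h \<Rightarrow> 'h) \<Rightarrow> 'c set \<Rightarrow> 'h set \<Rightarrow> ('c \<Rightarrow> 'h list) \<Rightarrow> ('c \<Rightarrow> 'h list) \<Rightarrow> bool"
  where "compat \<iota> I D vl fl \<longleftrightarrow> (\<forall>u\<in>Inl ` D \<union> Inr ` I. \<forall>w. succs I fl u w \<longleftrightarrow> succs I vl w (map_sum \<iota> id u))"

text \<open>The graph data on which the reduction runs. Connectivity is recorded for vertices and
  for faces, because the normalisation of a vertex uses the one and that of a face the
  other.\<close>

definition config :: "('h \<Rightarrow> 'h) \<Rightarrow> 'c set \<Rightarrow> 'h set \<Rightarrow> ('c \<Rightarrow> 'h list) \<Rightarrow> ('c \<Rightarrow> 'h list) \<Rightarrow> bool"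
  where "config \<iota> I D vl fl \<longleftrightarrow> finite I \<and> \<iota> ` D \<subseteq> D \<and> (\<forall>h\<in>D. \<iota> (\<iota> h) = h \<and> \<iota> h \<noteq> h) \<and>
    parts I vl D \<and> parts I fl D \<and> compat \<iota> I D vl fl \<and> conn \<iota> I vl \<and> conn \<iota> I fl"

lemma ext_insafter: "ext c (insafter h k l) = insafter (Inl h) (Inl k) (ext c l)"
  by (simp add: ext_def map_insafter)

lemma ext_insbefore: "ext c (insbefore h k l) = insbefore (Inl h) (Inl k) (ext c l)"
  by (simp add: ext_def map_insbefore)

lemma succs_insafter:
  assumes "k \<in> (\<Union>c\<in>I. set (l c))"
  shows "succs I (\<lambda>c. insafter h k (l c)) x y \<longleftrightarrow>
    succs I l x y \<and> x \<noteq> Inl k \<or> x = Inl k \<and> y = Inl h \<or> x = Inl h \<and> succs I l (Inl k) y"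
proof -
  have "adj (ext c (insafter h k (l c))) x y \<longleftrightarrow> adj (ext c (l c)) x y \<and> x \<noteq> Inl k \<or>
    k \<in> set (l c) \<and> x = Inl k \<and> y = Inl h \<or> x = Inl h \<and> adj (ext c (l c)) (Inl k) y" for c
    unfolding ext_insafter by (subst adj_insafter) (auto simp: ext_def)
  then show ?thesis using assms unfolding succs_def by blast
qed

lemma succs_insbefore:
  assumes "k \<in> (\<Union>c\<in>I. set (l c))"
  shows "succs I (\<lambda>c. insbefore h k (l c)) x y \<longleftrightarrow>
    succs I l x y \<and> y \<noteq> Inl k \<or> x = Inl h \<and> y = Inl k \<or> y = Inl h \<and> succs I l x (Inl k)"
proof -
  have "adj (ext c (insbefore h k (l c))) x y \<longleftrightarrow> adj (ext c (l c)) x y \<and> y \<noteq> Inl k \<or>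
    k \<in> set (l c) \<and> x = Inl h \<and> y = Inl k \<or> y = Inl h \<and> adj (ext c (l c)) x (Inl k)" for c
    unfolding ext_insbefore by (subst adj_insbefore) (auto simp: ext_def)
  then show ?thesis using assms unfolding succs_def by blast
qed

lemma succs_nodes: "succs I l x y \<Longrightarrow> x \<in> Inl ` (\<Union>c\<in>I. set (l c)) \<union> Inr ` I \<and> y \<in> Inl ` (\<Union>c\<in>I. set (l c)) \<union> Inr ` I"
proof -
  assume "succs I l x y"
  then obtain c where c: "c \<in> I" "adj (ext c (l c)) x y" unfolding succs_def by blast
  have "set (ext c (l c)) \<subseteq> Inl ` (\<Union>c\<in>I. set (l c)) \<union> Inr ` I"
    using c(1) by (fastforce simp: ext_def)
  then show ?thesis using adj_in_set[OF c(2)] by blast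
qed

lemma parts_ins:
  assumes "parts I l (D - {h})" "h \<in> D" "k \<in> D" "k \<noteq> h"
  shows "parts I (\<lambda>c. insafter h k (l c)) D" "parts I (\<lambda>c. insbefore h k (l c)) D"
proof -
  have d: "distinct (l c)" and h: "h \<notin> set (l c)" if "c \<in> I" for c using assms(1) that by (auto simp: parts_def)
  have disj: "set (l c) \<inter> set (l d) = {}" if "c \<in> I" "d \<in> I" "c \<noteq> d" for c d using assms(1) that by (auto simp: parts_def)
  have u: "(\<Union>c\<in>I. set (l c)) = D - {h}" using assms(1) by (simp add: parts_def)
  then obtain e where e: "e \<in> I" "k \<in> set (l e)" using assms by blast
  have *: "(\<Union>c\<in>I. if k \<in> set (l c) then insert h (set (l c)) else set (l c)) = D"
    using e u assms(2) by (auto split: if_splits)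
  show "parts I (\<lambda>c. insafter h k (l c)) D" "parts I (\<lambda>c. insbefore h k (l c)) D"
    unfolding parts_def set_insafter set_insbefore *
    using d h disj by (auto simp: distinct_insafter distinct_insbefore split: if_splits; blast)+
qed

text \<open>A union of lists that is closed under \<iota> contains both \<open>k\<close> and
  \<open>\<iota> k\<close> or neither of them, so it does not matter to which of the two
  \<open>h\<close> is attached.\<close>

lemma conn_ins:
  assumes p: "parts I l (D - {h})" and k: "k \<in> D" "\<iota> k \<in> D" "k \<noteq> h" "\<iota> k \<noteq> h" "\<iota> (\<iota> k) = k"
  shows "conn \<iota> I (\<lambda>c. insafter h k (l c)) \<longleftrightarrow> conn \<iota> I (\<lambda>c. insbefore h (\<iota> k) (l c))"
proof -
  have "\<iota> ` (\<Union>c\<in>J. set (insafter h k (l c))) \<subseteq> (\<Union>c\<in>J. set (insafter h k (l c))) \<longleftrightarrow>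
    \<iota> ` (\<Union>c\<in>J. set (insbefore h (\<iota> k) (l c))) \<subseteq> (\<Union>c\<in>J. set (insbefore h (\<iota> k) (l c)))" for J
  proof -
    let ?B = "\<Union>c\<in>J. set (l c)"
    have a: "(\<Union>c\<in>J. set (insafter h k (l c))) = ?B \<union> (if k \<in> ?B then {h} else {})"
      by (auto simp: set_insafter split: if_splits)
    have b: "(\<Union>c\<in>J. set (insbefore h (\<iota> k) (l c))) = ?B \<union> (if \<iota> k \<in> ?B then {h} else {})"
      by (auto simp: set_insbefore split: if_splits)
    have key: "k \<in> ?B \<longleftrightarrow> \<iota> k \<in> ?B" if i: "\<iota> ` (?B \<union> E) \<subseteq> ?B \<union> E" and E: "E \<subseteq> {h}" for E
    proof -
      have "\<iota> x \<in> ?B \<union> {h}" if "x \<in> ?B" for x using i E that by blast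
      from this[of k] this[of "\<iota> k"] show ?thesis using k by auto
    qed
    define E1 where "E1 = (if k \<in> ?B then {h} else {})"
    define E2 where "E2 = (if \<iota> k \<in> ?B then {h} else {})"
    have E: "E1 \<subseteq> {h}" "E2 \<subseteq> {h}" by (auto simp: E1_def E2_def)
    show ?thesis
    proof (cases "k \<in> ?B \<longleftrightarrow> \<iota> k \<in> ?B")
      case True
      then have "E1 = E2" by (simp add: E1_def E2_def)
      then show ?thesis unfolding a b E1_def[symmetric] E2_def[symmetric] by simp
    next
      case False
      then show ?thesis unfolding a b E1_def[symmetric] E2_def[symmetric] using key[OF _ E(1)] key[OF _ E(2)] by blast
    qed
  qed
  then show ?thesis unfolding conn_def by simp
qed

text \<open>The purely logical part of \<open>config_slide\<close>. \<open>Pb\<close> and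
  \<open>Pg\<close> are the neighbour relations of the vertices without \<open>h\<close> and of the
  faces without \<open>k\<close>; each instance of one compatibility follows from instances of the
  other at the given nodes and at \<open>h\<close>, \<open>k\<close> and \<open>j h\<close>.\<close>

lemma slide_relation:
  assumes Pb: "\<And>x y. Pb x y \<Longrightarrow> x \<noteq> h \<and> y \<noteq> h" and Pg: "\<And>x y. Pg x y \<Longrightarrow> x \<noteq> k \<and> y \<noteq> k"
    and j: "\<And>u. u \<in> N \<Longrightarrow> j u \<in> N \<and> j (j u) = u" and N: "h \<in> N" "k \<in> N" and neq: "h \<noteq> k" "j h \<noteq> h" "j k \<noteq> k" "j h \<noteq> k"
  shows "(\<forall>u\<in>N. \<forall>w. (Pg u w \<and> u \<noteq> j h \<or> u = j h \<and> w = k \<or> u = k \<and> Pg (j h) w) \<longleftrightarrow>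
      (Pb w (j u) \<and> w \<noteq> k \<or> w = k \<and> j u = h \<or> w = h \<and> Pb k (j u))) \<longleftrightarrow>
    (\<forall>u\<in>N. \<forall>w. (Pg u w \<and> w \<noteq> h \<or> u = k \<and> w = h \<or> w = k \<and> Pg u h) \<longleftrightarrow>
      (Pb w (j u) \<and> j u \<noteq> j k \<or> w = h \<and> j u = j k \<or> j u = h \<and> Pb w (j k)))"
    (is "(\<forall>u\<in>N. \<forall>w. ?A u w) \<longleftrightarrow> (\<forall>u\<in>N. \<forall>w. ?B u w)")
proof -
  have jj: "j u = j v \<longleftrightarrow> u = v" if "u \<in> N" "v \<in> N" for u v using j that by metis
  have jh: "j u = h \<longleftrightarrow> u = j h" if "u \<in> N" for u using j N that by metis
  have jk: "j h \<in> N" "j k \<noteq> h" using j N neq by metis+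
  have n: "\<not> Pb h y" "\<not> Pb x h" "\<not> Pg k y" "\<not> Pg x k" for x y using Pb Pg by blast+
  show ?thesis
  proof (rule iffI; intro ballI allI)
    fix u w assume A: "\<forall>u\<in>N. \<forall>w. ?A u w" and u: "u \<in> N"
    note [simp] = n jk(2)[symmetric] jh[OF u] jj[OF u N(2)] jh[OF N(2)] jj[OF jk(1) N(2)]
    have "?A u w" "?A u h" "?A u k" "?A k w" "?A k h" "?A (j h) w" "?A (j h) h" "?A (j h) k" "?A k k"
      using A u N jk by blast+
    then show "?B u w" using neq jk j[OF N(1)] by (cases "u = k"; cases "u = j h"; cases "w = h"; cases "w = k") simp_all
  next
    fix u w assume A: "\<forall>u\<in>N. \<forall>w. ?B u w" and u: "u \<in> N"
    note [simp] = n jk(2)[symmetric] jh[OF u] jj[OF u N(2)] jh[OF N(2)] jj[OF jk(1) N(2)]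
    have "?B u w" "?B u h" "?B u k" "?B k w" "?B k h" "?B (j h) w" "?B (j h) h" "?B (j h) k" "?B k k"
      using A u N jk by blast+
    then show "?A u w" using neq jk j[OF N(1)] by (cases "u = k"; cases "u = j h"; cases "w = h"; cases "w = k") simp_all
  qed
qed

text \<open>An equivalence, so that it serves for slides in both directions.\<close>

lemma config_slide:
  fixes h :: 'h and I :: "'c set"
  assumes b: "parts I b (D - {h})" and g: "parts I g (D - {k})" and hk: "h \<in> D" "k \<in> D" "h \<noteq> k" "\<iota> h \<noteq> k"
  shows "config \<iota> I D (\<lambda>c. insafter h k (b c)) (\<lambda>c. insafter k (\<iota> h) (g c)) \<longleftrightarrow>
    config \<iota> I D (\<lambda>c. insbefore h (\<iota> k) (b c)) (\<lambda>c. insbefore k h (g c))"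
proof (cases "\<iota> ` D \<subseteq> D \<and> (\<forall>h\<in>D. \<iota> (\<iota> h) = h \<and> \<iota> h \<noteq> h)")
  case True
  then have iD: "\<iota> h \<in> D" "\<iota> k \<in> D" and ii: "\<iota> (\<iota> h) = h" "\<iota> (\<iota> k) = k" and ne: "\<iota> h \<noteq> h" "\<iota> k \<noteq> k" using hk by auto
  have ikh: "\<iota> k \<noteq> h" using hk(4) ii by blast
  have ub: "(\<Union>c\<in>I. set (b c)) = D - {h}" and ug: "(\<Union>c\<in>I. set (g c)) = D - {k}" using b g by (auto simp: parts_def)
  have P: "parts I (\<lambda>c. insafter h k (b c)) D" "parts I (\<lambda>c. insbefore h (\<iota> k) (b c)) D"
    "parts I (\<lambda>c. insafter k (\<iota> h) (g c)) D" "parts I (\<lambda>c. insbefore k h (g c)) D"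
    using parts_ins[OF b, of k] parts_ins[OF b, of "\<iota> k"] parts_ins[OF g, of "\<iota> h"] parts_ins[OF g, of h] hk iD ikh by auto
  have C: "conn \<iota> I (\<lambda>c. insafter h k (b c)) \<longleftrightarrow> conn \<iota> I (\<lambda>c. insbefore h (\<iota> k) (b c))"
    using conn_ins[OF b, of k \<iota>] hk iD ii ikh by auto
  have C': "conn \<iota> I (\<lambda>c. insafter k (\<iota> h) (g c)) \<longleftrightarrow> conn \<iota> I (\<lambda>c. insbefore k h (g c))"
    using conn_ins[OF g, of "\<iota> h" \<iota>] hk iD ii by auto
  have "compat \<iota> I D (\<lambda>c. insafter h k (b c)) (\<lambda>c. insafter k (\<iota> h) (g c)) \<longleftrightarrow>
    compat \<iota> I D (\<lambda>c. insbefore h (\<iota> k) (b c)) (\<lambda>c. insbefore k h (g c))"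
  proof -
    have s: "succs I (\<lambda>c. insafter h k (b c)) x y \<longleftrightarrow> succs I b x y \<and> x \<noteq> Inl k \<or> x = Inl k \<and> y = Inl h \<or> x = Inl h \<and> succs I b (Inl k) y"
      "succs I (\<lambda>c. insafter k (\<iota> h) (g c)) x y \<longleftrightarrow> succs I g x y \<and> x \<noteq> Inl (\<iota> h) \<or> x = Inl (\<iota> h) \<and> y = Inl k \<or> x = Inl k \<and> succs I g (Inl (\<iota> h)) y"
      "succs I (\<lambda>c. insbefore h (\<iota> k) (b c)) x y \<longleftrightarrow> succs I b x y \<and> y \<noteq> Inl (\<iota> k) \<or> x = Inl h \<and> y = Inl (\<iota> k) \<or> y = Inl h \<and> succs I b x (Inl (\<iota> k))"
      "succs I (\<lambda>c. insbefore k h (g c)) x y \<longleftrightarrow> succs I g x y \<and> y \<noteq> Inl h \<or> x = Inl k \<and> y = Inl h \<or> y = Inl k \<and> succs I g x (Inl h)" for x y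
      using hk iD ikh ub ug by (subst succs_insafter succs_insbefore; auto)+
    let ?j = "map_sum \<iota> id :: 'h + 'c \<Rightarrow> 'h + 'c"
    let ?N = "Inl ` D \<union> Inr ` I"
    have "succs I b x y \<Longrightarrow> x \<noteq> Inl h \<and> y \<noteq> Inl h" "succs I g x y \<Longrightarrow> x \<noteq> Inl k \<and> y \<noteq> Inl k" for x y
      using succs_nodes[of I b x y] succs_nodes[of I g x y] unfolding ub ug by auto
    moreover have "u \<in> ?N \<Longrightarrow> ?j u \<in> ?N \<and> ?j (?j u) = u" for u using True by auto
    ultimately show ?thesis
      using slide_relation[of "succs I b" "Inl h" "succs I g" "Inl k" ?N ?j] hk ne unfolding compat_def s by simp
  qed
  with P C C' show ?thesis unfolding config_def by blast
qed (auto simp: config_def)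

lemma config_cong:
  assumes "\<And>c. c \<in> I \<Longrightarrow> vl c = vl' c" "\<And>c. c \<in> I \<Longrightarrow> fl c = fl' c"
  shows "config \<iota> I D vl fl \<longleftrightarrow> config \<iota> I D vl' fl'"
proof -
  have 1: "conn \<iota> I l \<longleftrightarrow> conn \<iota> I l'" if "\<And>c. c \<in> I \<Longrightarrow> l c = l' c" for l l' :: "'a \<Rightarrow> 'b list"
  proof -
    have "(\<Union>c\<in>J. set (l c)) = (\<Union>c\<in>J. set (l' c))" if "J \<subseteq> I" for J
      using \<open>\<And>c. c \<in> I \<Longrightarrow> l c = l' c\<close> that by (intro SUP_cong) auto
    then show ?thesis unfolding conn_def by auto
  qed
  have 2: "succs I l = succs I l'" "parts I l D \<longleftrightarrow> parts I l' D" if "\<And>c. c \<in> I \<Longrightarrow> l c = l' c" for l l' :: "'a \<Rightarrow> 'b list"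
    using that by (auto simp: succs_def fun_eq_iff parts_def)
  show ?thesis
    using 1[of vl vl', OF assms(1)] 1[of fl fl', OF assms(2)] 2[of vl vl', OF assms(1)] 2[of fl fl', OF assms(2)]
    by (simp add: config_def compat_def)
qed

lemma removeAll_parts: "parts I l D \<Longrightarrow> parts I (\<lambda>c. removeAll h (l c)) (D - {h})"
  unfolding parts_def by (auto simp: distinct_removeAll)

lemma adj_ext_Inl: "adj (ext c l) (Inl k) (Inl h) \<longleftrightarrow> adj l k h"
proof -
  have "adj (map Inl l) (Inl k) (Inl h) \<longleftrightarrow> adj l k h"
    by (induction l k h rule: adj.induct) auto
  then show ?thesis by (simp add: ext_def adj_Cons adj_append)
qed

text \<open>Brings a given configuration into the shape of \<open>config_slide\<close>, which speaks
  of lists with \<open>h\<close> inserted into lists without \<open>h\<close>.\<close>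

lemma restore_insafter:
  assumes "parts I vl D" "succs I vl (Inl k) (Inl h)" "c \<in> I"
  shows "insafter h k (removeAll h (vl c)) = vl c"
proof -
  from assms(2) obtain d where d: "d \<in> I" "adj (vl d) k h" unfolding succs_def adj_ext_Inl by blast
  then obtain us ws where e: "vl d = us @ k # h # ws" by (auto simp: adj_iff)
  have "distinct (vl d)" using assms(1) d by (auto simp: parts_def)
  show ?thesis
  proof (cases "c = d")
    case True
    then show ?thesis using e \<open>distinct (vl d)\<close> by (auto simp: insafter_notin removeAll_id)
  next
    case False
    then have "set (vl c) \<inter> set (vl d) = {}" using assms d by (auto simp: parts_def)
    then show ?thesis using e by (auto simp: insafter_notin)
  qed
qed

lemma restore_insbefore:
  assumes "parts I vl D" "succs I vl (Inl h) (Inl k)" "c \<in> I"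
  shows "insbefore h k (removeAll h (vl c)) = vl c"
proof -
  from assms(2) obtain d where d: "d \<in> I" "adj (vl d) h k" unfolding succs_def adj_ext_Inl by blast
  then obtain us ws where e: "vl d = us @ h # k # ws" by (auto simp: adj_iff)
  have "distinct (vl d)" using assms(1) d by (auto simp: parts_def)
  show ?thesis
  proof (cases "c = d")
    case True
    then show ?thesis using e \<open>distinct (vl d)\<close> by (auto simp: insbefore_notin removeAll_id)
  next
    case False
    then have "set (vl c) \<inter> set (vl d) = {}" using assms d by (auto simp: parts_def)
    then show ?thesis using e by (auto simp: insbefore_notin)
  qed
qed

lemma config_succs:
  assumes "config \<iota> I D vl fl" "u \<in> Inl ` D \<union> Inr ` I"
  shows "succs I fl u w \<longleftrightarrow> succs I vl w (map_sum \<iota> id u)"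
  using assms by (simp add: config_def compat_def)

lemma config_forward:
  assumes C: "config \<iota> I D vl fl" and s: "succs I vl (Inl k) (Inl h)" and hk: "h \<noteq> k" "\<iota> h \<noteq> k"
  defines "b \<equiv> \<lambda>c. removeAll h (vl c)" and "g \<equiv> \<lambda>c. removeAll k (fl c)"
  shows "config \<iota> I D (\<lambda>c. insbefore h (\<iota> k) (b c)) (\<lambda>c. insbefore k h (g c))"
    and "c \<in> I \<Longrightarrow> vl c = insafter h k (b c)" and "c \<in> I \<Longrightarrow> fl c = insafter k (\<iota> h) (g c)"
proof -
  have p: "parts I vl D" "parts I fl D" using C by (auto simp: config_def)
  have kD: "k \<in> D" "h \<in> D" using succs_nodes[OF s] p by (auto simp: parts_def)
  then have ih: "\<iota> h \<in> D" "\<iota> (\<iota> h) = h" using C by (auto simp: config_def)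
  then have s': "succs I fl (Inl (\<iota> h)) (Inl k)" using config_succs[OF C, of "Inl (\<iota> h)"] s by simp
  show 1: "vl c = insafter h k (b c)" "fl c = insafter k (\<iota> h) (g c)" if "c \<in> I" for c
    using restore_insafter[OF p(1) s that] restore_insafter[OF p(2) s' that] by (simp_all add: b_def g_def)
  have "config \<iota> I D (\<lambda>c. insafter h k (b c)) (\<lambda>c. insafter k (\<iota> h) (g c))"
    using C config_cong[of I vl "\<lambda>c. insafter h k (b c)" fl "\<lambda>c. insafter k (\<iota> h) (g c)"] 1 by blast
  then show "config \<iota> I D (\<lambda>c. insbefore h (\<iota> k) (b c)) (\<lambda>c. insbefore k h (g c))"
    using config_slide[of I b D h g k \<iota>] p kD hk by (simp add: b_def g_def removeAll_parts)
qed

lemma config_backward: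
  assumes C: "config \<iota> I D vl fl" and s: "succs I fl (Inl k) (Inl h)" and hk: "h \<noteq> k" "\<iota> h \<noteq> k"
  defines "b \<equiv> \<lambda>c. removeAll h (vl c)" and "g \<equiv> \<lambda>c. removeAll k (fl c)"
  shows "config \<iota> I D (\<lambda>c. insafter h k (b c)) (\<lambda>c. insafter k (\<iota> h) (g c))"
    and "c \<in> I \<Longrightarrow> vl c = insbefore h (\<iota> k) (b c)" and "c \<in> I \<Longrightarrow> fl c = insbefore k h (g c)"
proof -
  have p: "parts I vl D" "parts I fl D" using C by (auto simp: config_def)
  have kD: "k \<in> D" "h \<in> D" using succs_nodes[OF s] p by (auto simp: parts_def)
  then have s': "succs I vl (Inl h) (Inl (\<iota> k))" using config_succs[OF C, of "Inl k"] s by simp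
  show 1: "vl c = insbefore h (\<iota> k) (b c)" "fl c = insbefore k h (g c)" if "c \<in> I" for c
    using restore_insbefore[OF p(1) s' that] restore_insbefore[OF p(2) s that] by (simp_all add: b_def g_def)
  have "config \<iota> I D (\<lambda>c. insbefore h (\<iota> k) (b c)) (\<lambda>c. insbefore k h (g c))"
    using C config_cong[of I vl "\<lambda>c. insbefore h (\<iota> k) (b c)" fl "\<lambda>c. insbefore k h (g c)"] 1 by blast
  then show "config \<iota> I D (\<lambda>c. insafter h k (b c)) (\<lambda>c. insafter k (\<iota> h) (g c))"
    using config_slide[of I b D h g k \<iota>] p kD hk by (simp add: b_def g_def removeAll_parts)
qed

section \<open>Subquotients\<close>

text \<open>A linear map that induces an isomorphism of the images of \<open>V\<close> modulo \<open>R\<close> and \<open>W\<close> modulo \<open>Q\<close>.\<close>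

definition subquot_iso :: "('x \<Rightarrow> 'k::field) set \<Rightarrow> ('x \<Rightarrow> 'k) set \<Rightarrow> ('y \<Rightarrow> 'k) set \<Rightarrow> ('y \<Rightarrow> 'k) set \<Rightarrow> bool"
  where "subquot_iso V R W Q \<longleftrightarrow> (\<exists>G. lin_map G \<and> G ` V = W \<and> (\<forall>v\<in>V. G v \<in> Q \<longleftrightarrow> v \<in> R))"

lemma subquot_iso_trans: "subquot_iso V R W Q \<Longrightarrow> subquot_iso W Q X Y \<Longrightarrow> subquot_iso V R X Y"
proof -
  assume "subquot_iso V R W Q" "subquot_iso W Q X Y"
  then obtain F G where F: "lin_map F" "F ` V = W" "\<forall>v\<in>V. F v \<in> Q \<longleftrightarrow> v \<in> R"
    and G: "lin_map G" "G ` W = X" "\<forall>v\<in>W. G v \<in> Y \<longleftrightarrow> v \<in> Q" unfolding subquot_iso_def by blast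
  have "lin_map (\<lambda>v. G (F v)) \<and> (\<lambda>v. G (F v)) ` V = X \<and> (\<forall>v\<in>V. G (F v) \<in> Y \<longleftrightarrow> v \<in> R)"
    using F G lin_map_comp[OF G(1) F(1)] by (auto simp: image_iff)
  then show ?thesis unfolding subquot_iso_def by blast
qed

lemma subquot_iso_refl: "subquot_iso V R V R"
  unfolding subquot_iso_def by (rule exI[of _ "\<lambda>v. v"]) (auto intro: lin)

definition pres :: "('x \<Rightarrow> 'k::field) set \<Rightarrow> ('x, 'k) lop set"
  where "pres X = {A. \<forall>n\<in>X. app A n \<in> X}"

lemma pres_app: "A \<in> pres X \<Longrightarrow> n \<in> X \<Longrightarrow> app A n \<in> X"
  by (simp add: pres_def)

lemma
  assumes "fun_vs.subspace X"
  shows pres_one: "1 \<in> pres X" and pres_mult: "A \<in> pres X \<Longrightarrow> B \<in> pres X \<Longrightarrow> A * B \<in> pres X"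
    and pres_lscale: "A \<in> pres X \<Longrightarrow> c *\<^sub>o A \<in> pres X"
    and pres_sum: "(\<And>a. a \<in> S \<Longrightarrow> f a \<in> pres X) \<Longrightarrow> sum f S \<in> pres X"
  using assms by (auto simp: pres_def app_one app_times app_lscale app_lsum intro: fun_vs.subspace_scale fun_vs.subspace_sum)

context convolution
begin

lemma word_pres:
  assumes "fun_vs.subspace X" "\<And>h i. h \<in> set l \<Longrightarrow> Y h i \<in> pres X"
  shows "word Y l i \<in> pres X"
  using assms(2)
  by (induction l arbitrary: i) (auto simp: cv_def intro!: pres_sum pres_lscale pres_mult pres_one assms(1))

end

context half_edge_ops
begin

text \<open>During the reduction the ambient space \<open>X\<close> shrinks to the common image of
  projections at the removed edges; stability says that every operator at a remaining edge still
  acts on it.\<close>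

definition stable :: "'h set \<Rightarrow> (('e \<Rightarrow> 'b) \<Rightarrow> 'k) set \<Rightarrow> bool"
  where "stable D' X \<longleftrightarrow> fun_vs.subspace X \<and> (\<forall>h\<in>D'. \<forall>A. slot (edge h) A \<in> pres X)"

definition Inv where
  "Inv X I c0 fl = {n \<in> X. \<forall>c\<in>I - {c0}. \<forall>i. app (wordT (fl c) i) n = (pinv \<cdot> pinv) i *\<^sub>v n}"

definition Rel where
  "Rel X I c0 vl = fun_vs.span {app (wordL (vl c) i) n - \<phi> (unit_vec i) *\<^sub>v n | c i n. c \<in> I - {c0} \<and> n \<in> X}"

lemma stable_subspace: "stable D' X \<Longrightarrow> fun_vs.subspace X"
  by (simp add: stable_def)

lemma stable_LT: "stable D' X \<Longrightarrow> h \<in> D' \<Longrightarrow> L h i \<in> pres X" "stable D' X \<Longrightarrow> h \<in> D' \<Longrightarrow> T h i \<in> pres X"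
  by (auto simp: stable_def L_def T_def)

lemma stable_wordL: "stable D' X \<Longrightarrow> set l \<subseteq> D' \<Longrightarrow> wordL l i \<in> pres X"
  by (rule cL.word_pres) (auto simp: stable_subspace stable_LT)

lemma stable_wordT: "stable D' X \<Longrightarrow> set l \<subseteq> D' \<Longrightarrow> wordT l i \<in> pres X"
  by (rule cT.word_pres) (auto simp: stable_subspace stable_LT)

text \<open>Conjugation by \<sigma> transforms the conditions at all sites simultaneously, so
  \<sigma> carries invariants onto invariants and relations onto relations.\<close>

lemma subquot_iso_intertwine:
  assumes st: "\<sigma> * \<tau> = 1" "\<tau> * \<sigma> = 1" and X: "\<sigma> \<in> pres X" "\<tau> \<in> pres X"
    and L: "\<And>c. c \<in> I \<Longrightarrow> intw \<sigma> (wordL (vl c)) (wordL (vl' c))"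
    and T: "\<And>c. c \<in> I \<Longrightarrow> intw \<sigma> (wordT (fl c)) (wordT (fl' c))"
  shows "subquot_iso (Inv X I c0 fl) (Rel X I c0 vl) (Inv X I c0 fl') (Rel X I c0 vl')"
proof -
  have st': "app \<sigma> (app \<tau> n) = n" "app \<tau> (app \<sigma> n) = n" for n
    using st by (simp_all add: app_times[symmetric] app_one)
  have T': "intw \<tau> (wordT (fl' c)) (wordT (fl c))" if "c \<in> I" for c
    by (rule intw_inverse[OF T[OF that] st])
  have inv: "app \<rho> n \<in> Inv X I c0 l'" if "n \<in> Inv X I c0 l" "\<rho> \<in> pres X" "\<And>c. c \<in> I \<Longrightarrow> intw \<rho> (wordT (l c)) (wordT (l' c))" for \<rho> n l l'
  proof -
    have "app (wordT (l' c) i) (app \<rho> n) = app \<rho> (app (wordT (l c) i) n)" if "c \<in> I" for c i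
      using \<open>\<And>c. c \<in> I \<Longrightarrow> intw \<rho> (wordT (l c)) (wordT (l' c))\<close>[OF that] by (simp add: intw_def app_times[symmetric])
    then show ?thesis using that by (auto simp: Inv_def pres_app)
  qed
  have I: "app \<sigma> ` Inv X I c0 fl = Inv X I c0 fl'"
  proof
    show "app \<sigma> ` Inv X I c0 fl \<subseteq> Inv X I c0 fl'" using inv[of _ fl \<sigma> fl', OF _ X(1) T] by blast
    show "Inv X I c0 fl' \<subseteq> app \<sigma> ` Inv X I c0 fl"
    proof
      fix n assume "n \<in> Inv X I c0 fl'"
      then have "app \<tau> n \<in> Inv X I c0 fl" by (rule inv[OF _ X(2) T'])
      then show "n \<in> app \<sigma> ` Inv X I c0 fl" using imageI[of "app \<tau> n" _ "app \<sigma>"] st'(1) by simp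
    qed
  qed
  let ?S = "\<lambda>vl. {app (wordL (vl c) i) n - \<phi> (unit_vec i) *\<^sub>v n | c i n. c \<in> I - {c0} \<and> n \<in> X}"
  have c: "app \<sigma> (app (wordL (vl c) i) n - \<phi> (unit_vec i) *\<^sub>v n) = app (wordL (vl' c) i) (app \<sigma> n) - \<phi> (unit_vec i) *\<^sub>v app \<sigma> n" if "c \<in> I" for c i n
    using L[OF that] by (simp add: intw_def app_times[symmetric])
  have "app \<sigma> ` ?S vl = ?S vl'"
  proof
    show "app \<sigma> ` ?S vl \<subseteq> ?S vl'"
    proof (rule image_subsetI)
      fix x assume "x \<in> ?S vl"
      then obtain d i n where "x = app (wordL (vl d) i) n - \<phi> (unit_vec i) *\<^sub>v n" "d \<in> I - {c0}" "n \<in> X" by blast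
      then show "app \<sigma> x \<in> ?S vl'" using c[of d i n] pres_app[OF X(1), of n] by blast
    qed
    show "?S vl' \<subseteq> app \<sigma> ` ?S vl"
    proof
      fix x assume "x \<in> ?S vl'"
      then obtain d i n where x: "x = app (wordL (vl' d) i) n - \<phi> (unit_vec i) *\<^sub>v n" "d \<in> I - {c0}" "n \<in> X" by blast
      then have "x = app \<sigma> (app (wordL (vl d) i) (app \<tau> n) - \<phi> (unit_vec i) *\<^sub>v app \<tau> n)" using c[of d i "app \<tau> n"] by (simp add: st')
      then show "x \<in> app \<sigma> ` ?S vl" using x pres_app[OF X(2), of n] by blast
    qed
  qed
  moreover have "app \<sigma> ` fun_vs.span (?S vl) = fun_vs.span (app \<sigma> ` ?S vl)"
  proof -
    interpret s: Vector_Spaces.linear fscale fscale "app \<sigma>" by (rule lin_map_app)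
    show ?thesis by (rule s.span_image[symmetric])
  qed
  ultimately have R: "app \<sigma> ` Rel X I c0 vl = Rel X I c0 vl'"
    by (simp add: Rel_def)
  have "\<forall>v\<in>Inv X I c0 fl. app \<sigma> v \<in> Rel X I c0 vl' \<longleftrightarrow> v \<in> Rel X I c0 vl"
  proof -
    have "v = w" if "app \<sigma> v = app \<sigma> w" for v w
      using arg_cong[OF that, of "app \<tau>"] by (simp add: st')
    then show ?thesis unfolding R[symmetric] by blast
  qed
  with I show ?thesis unfolding subquot_iso_def using lin_map_app by blast
qed

lemma slide_pres:
  assumes s: "stable D' X" and "h \<in> D'" "k \<in> D'"
  shows "slide h k \<in> pres X" "unslide h k \<in> pres X"
  unfolding slide_def unslide_def
  by (intro pres_sum pres_lscale pres_mult stable_subspace[OF s] stable_LT[OF s] assms)+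

lemma subquot_iso_slide:
  assumes s: "stable D' X" and D': "D' \<subseteq> D" and b: "parts I b (D' - {h})" and g: "parts I g (D' - {k})"
    and hk: "h \<in> D'" "k \<in> D'" "h \<noteq> k" "h \<noteq> \<iota> k"
  shows "subquot_iso (Inv X I c0 (\<lambda>c. insafter k (\<iota> h) (g c))) (Rel X I c0 (\<lambda>c. insafter h k (b c)))
      (Inv X I c0 (\<lambda>c. insbefore k h (g c))) (Rel X I c0 (\<lambda>c. insbefore h (\<iota> k) (b c)))"
    and "subquot_iso (Inv X I c0 (\<lambda>c. insbefore k h (g c))) (Rel X I c0 (\<lambda>c. insbefore h (\<iota> k) (b c)))
      (Inv X I c0 (\<lambda>c. insafter k (\<iota> h) (g c))) (Rel X I c0 (\<lambda>c. insafter h k (b c)))"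
proof -
  have kD: "h \<in> D" "k \<in> D" using hk D' by auto
  have e: "edge h \<noteq> edge k" using edge_neq[OF kD(2) hk(3,4)] by metis
  have bD: "set (b c) \<subseteq> D - {h}" "set (g c) \<subseteq> D - {k}" if "c \<in> I" for c using b g D' that by (auto simp: parts_def)
  note st = slide_unslide[OF kD(2) e]
  note p = slide_pres[OF s hk(1,2)]
  have L: "intw (slide h k) (wordL (insafter h k (b c))) (wordL (insbefore h (\<iota> k) (b c)))" if "c \<in> I" for c
    by (rule slide_wordL[OF kD(2) e bD(1)[OF that]])
  have T: "intw (slide h k) (wordT (insafter k (\<iota> h) (g c))) (wordT (insbefore k h (g c)))" if "c \<in> I" for c
    by (rule slide_wordT[OF kD e bD(2)[OF that]])
  show "subquot_iso (Inv X I c0 (\<lambda>c. insafter k (\<iota> h) (g c))) (Rel X I c0 (\<lambda>c. insafter h k (b c)))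
      (Inv X I c0 (\<lambda>c. insbefore k h (g c))) (Rel X I c0 (\<lambda>c. insbefore h (\<iota> k) (b c)))"
    by (rule subquot_iso_intertwine[OF st p]) (auto intro: L T)
  show "subquot_iso (Inv X I c0 (\<lambda>c. insbefore k h (g c))) (Rel X I c0 (\<lambda>c. insbefore h (\<iota> k) (b c)))
      (Inv X I c0 (\<lambda>c. insafter k (\<iota> h) (g c))) (Rel X I c0 (\<lambda>c. insafter h k (b c)))"
    by (rule subquot_iso_intertwine[OF st(2,1) p(2,1)]) (auto intro: intw_inverse[OF L st] intw_inverse[OF T st])
qed

lemma Inv_Rel_cong:
  assumes "\<And>c. c \<in> I \<Longrightarrow> vl c = vl' c" "\<And>c. c \<in> I \<Longrightarrow> fl c = fl' c"
  shows "Inv X I c0 fl = Inv X I c0 fl'" "Rel X I c0 vl = Rel X I c0 vl'"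
proof -
  show "Inv X I c0 fl = Inv X I c0 fl'" using assms by (auto simp: Inv_def)
  show "Rel X I c0 vl = Rel X I c0 vl'" unfolding Rel_def using assms(1)
    by (intro arg_cong[where f = fun_vs.span]) (metis (no_types, lifting) DiffD1)
qed

abbreviation "sq X I c0 vl fl vl' fl' \<equiv> subquot_iso (Inv X I c0 fl) (Rel X I c0 vl) (Inv X I c0 fl') (Rel X I c0 vl')"

lemma slide_forward:
  assumes s: "stable D' X" and D': "D' \<subseteq> D" and C: "config \<iota> I D' vl fl"
    and S: "succs I vl (Inl k) (Inl h)" and hk: "h \<noteq> k" "h \<noteq> \<iota> k"
  defines "vl' \<equiv> \<lambda>c. insbefore h (\<iota> k) (removeAll h (vl c))" and "fl' \<equiv> \<lambda>c. insbefore k h (removeAll k (fl c))"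
  shows "config \<iota> I D' vl' fl'" and "sq X I c0 vl fl vl' fl'"
proof -
  have p: "parts I vl D'" "parts I fl D'" using C by (auto simp: config_def)
  have kD: "k \<in> D'" "h \<in> D'" using succs_nodes[OF S] p by (auto simp: parts_def)
  have ih: "\<iota> h \<noteq> k" using hk kD D' iota_iota by (metis subsetD)
  note f = config_forward[OF C S hk(1) ih]
  show "config \<iota> I D' vl' fl'" using f(1) by (simp add: vl'_def fl'_def)
  show "sq X I c0 vl fl vl' fl'"
    using subquot_iso_slide(1)[OF s D' removeAll_parts[OF p(1)] removeAll_parts[OF p(2)] kD(2,1) hk, of c0]
      Inv_Rel_cong[of I vl "\<lambda>c. insafter h k (removeAll h (vl c))" fl "\<lambda>c. insafter k (\<iota> h) (removeAll k (fl c))", OF f(2,3)]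
    by (simp add: vl'_def fl'_def)
qed

lemma slide_backward:
  assumes s: "stable D' X" and D': "D' \<subseteq> D" and C: "config \<iota> I D' vl fl"
    and S: "succs I fl (Inl k) (Inl h)" and hk: "h \<noteq> k" "h \<noteq> \<iota> k"
  defines "vl' \<equiv> \<lambda>c. insafter h k (removeAll h (vl c))" and "fl' \<equiv> \<lambda>c. insafter k (\<iota> h) (removeAll k (fl c))"
  shows "config \<iota> I D' vl' fl'" and "sq X I c0 vl fl vl' fl'"
proof -
  have p: "parts I vl D'" "parts I fl D'" using C by (auto simp: config_def)
  have kD: "k \<in> D'" "h \<in> D'" using succs_nodes[OF S] p by (auto simp: parts_def)
  have ih: "\<iota> h \<noteq> k" using hk kD D' iota_iota by (metis subsetD)
  note f = config_backward[OF C S hk(1) ih]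
  show "config \<iota> I D' vl' fl'" using f(1) by (simp add: vl'_def fl'_def)
  show "sq X I c0 vl fl vl' fl'"
    using subquot_iso_slide(2)[OF s D' removeAll_parts[OF p(1)] removeAll_parts[OF p(2)] kD(2,1) hk, of c0]
      Inv_Rel_cong[of I vl "\<lambda>c. insbefore h (\<iota> k) (removeAll h (vl c))" fl "\<lambda>c. insbefore k h (removeAll k (fl c))", OF f(2,3)]
    by (simp add: vl'_def fl'_def)
qed

lemma removeAll_shorter: "distinct l \<Longrightarrow> h \<in> set l \<Longrightarrow> length (removeAll h l) < length l"
  by (simp add: distinct_remove1_removeAll[symmetric] length_remove1) (metis length_pos_if_in_set Suc_pred lessI)

text \<open>Some half-edge \<open>e\<close> at \<open>c\<close> belongs to an edge that ends at
  another site. The neighbours of \<open>e\<close> are slid along this edge, away from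
  \<open>c\<close>, until \<open>e\<close> is alone; the length of the list decreases with each
  slide.\<close>

lemma normalize_vertex:
  assumes "stable D' X" "D' \<subseteq> D" "config \<iota> I D' vl fl" "c0 \<in> I" "c \<in> I" "c \<noteq> c0"
  shows "\<exists>vl' fl' e. config \<iota> I D' vl' fl' \<and> sq X I c0 vl fl vl' fl' \<and> vl' c = [e]"
  using assms(3)
proof (induction "length (vl c)" arbitrary: vl fl rule: less_induct)
  case less
  note C = less.prems
  have p: "parts I vl D'" using C by (auto simp: config_def)
  have d: "distinct (vl c)" "set (vl c) \<subseteq> D'" using p assms(5) by (auto simp: parts_def)
  have ii: "\<iota> (\<iota> x) = x" "\<iota> x \<in> D'" if "x \<in> D'" for x using C that by (auto simp: config_def)
  \<comment> \<open>Otherwise \<open>{c}\<close> would be closed under \<iota> and hence be the set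
    of all sites, which also contains \<open>c0\<close>.\<close>
  have "\<exists>e\<in>set (vl c). \<iota> e \<notin> set (vl c)"
  proof (rule ccontr)
    assume "\<not> ?thesis"
    then have "{c} = I" using C assms(5) unfolding config_def conn_def by (metis (no_types, lifting) UN_insert UN_empty Un_empty_right empty_subsetI image_subsetI insert_not_empty insert_subset)
    then show False using assms by blast
  qed
  then obtain e where e: "e \<in> set (vl c)" "\<iota> e \<notin> set (vl c)" by blast
  then obtain xs ys where l: "vl c = xs @ e # ys" by (meson split_list)
  consider "xs = []" "ys = []" | h ys' where "ys = h # ys'" | h xs' where "xs = xs' @ [h]"
    by (metis list.exhaust rev_exhaust)
  then show ?case
  proof cases
    case 1
    then show ?thesis using C l subquot_iso_refl by fastforce
  next
    case 2
    have S: "succs I vl (Inl e) (Inl h)"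
      unfolding succs_def using assms(5) l 2 by (intro bexI[of _ c]) (auto simp: adj_ext_Inl adj_append adj_Cons)
    have hk: "h \<noteq> e" "h \<noteq> \<iota> e" "h \<in> set (vl c)" using l 2 d(1) e(2) by auto
    define vl' fl' where "vl' = (\<lambda>c. insbefore h (\<iota> e) (removeAll h (vl c)))" and "fl' = (\<lambda>c. insbefore e h (removeAll e (fl c)))"
    note f = slide_forward[OF assms(1,2) C S hk(1,2), folded vl'_def fl'_def]
    have "vl' c = removeAll h (vl c)" using e by (simp add: vl'_def insbefore_notin)
    then have "length (vl' c) < length (vl c)" using removeAll_shorter[OF d(1) hk(3)] by simp
    from less.hyps[OF this f(1)] show ?thesis using subquot_iso_trans[OF f(2)] by blast
  next
    case 3
    have eD: "e \<in> D'" using e d by auto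
    have hc: "h \<in> set (vl c)" using l 3 by auto
    have "succs I vl (Inl h) (Inl e)"
      unfolding succs_def using assms(5) l 3 by (intro bexI[of _ c]) (auto simp: adj_ext_Inl adj_append adj_Cons)
    \<comment> \<open>\<open>h\<close> in front of \<open>e\<close> at the vertex is
      \<open>h\<close> behind \<open>\<iota> e\<close> on the face, the form in which a backward
      slide needs it.\<close>
    then have S: "succs I fl (Inl (\<iota> e)) (Inl h)" using config_succs[OF C, of "Inl (\<iota> e)"] ii[OF eD] by simp
    have hk: "h \<noteq> \<iota> e" "h \<noteq> \<iota> (\<iota> e)" using l 3 d(1) e(2) hc ii[OF eD] by auto
    define vl' fl' where "vl' = (\<lambda>c. insafter h (\<iota> e) (removeAll h (vl c)))" and "fl' = (\<lambda>c. insafter (\<iota> e) (\<iota> h) (removeAll (\<iota> e) (fl c)))"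
    note f = slide_backward[OF assms(1,2) C S hk, folded vl'_def fl'_def]
    have "vl' c = removeAll h (vl c)" using e by (simp add: vl'_def insafter_notin)
    then have "length (vl' c) < length (vl c)" using removeAll_shorter[OF d(1) hc] by simp
    from less.hyps[OF this f(1)] show ?thesis using subquot_iso_trans[OF f(2)] by blast
  qed
qed

text \<open>A face starts with the last half-edge of the vertex at its site and ends with the
  opposite of the first one; for a leaf both are \<open>e\<close>.\<close>

lemma leaf_face:
  assumes C: "config \<iota> I D' vl fl" and c: "c \<in> I" "vl c = [e]"
  shows "\<exists>zs. fl c = e # zs @ [\<iota> e]" and "e \<in> D'"
proof -
  have p: "parts I vl D'" "parts I fl D'" using C by (auto simp: config_def)
  show eD: "e \<in> D'" using p c by (force simp: parts_def)
  then have ii: "\<iota> (\<iota> e) = e" "\<iota> e \<in> D'" "\<iota> e \<noteq> e" using C by (auto simp: config_def)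
  have adjr: "adj (ext d l) (Inr c') (Inl x) \<Longrightarrow> d = c' \<and> l \<noteq> [] \<and> hd l = x" for d c' x and l :: "'h list"
    by (cases l) (auto simp: ext_def adj_Cons adj_append dest: adj_in_set)
  have adjl: "adj (ext d l) (Inl x) (Inr c') \<Longrightarrow> d = c' \<and> l \<noteq> [] \<and> last l = x" for d c' x and l :: "'h list"
    by (cases l rule: rev_cases) (auto simp: ext_def adj_Cons adj_append dest: adj_in_set)
  have "succs I vl (Inl e) (Inr c)" "succs I vl (Inr c) (Inl e)"
    unfolding succs_def using c by (auto intro!: bexI[of _ c] simp: ext_def)
  then have "succs I fl (Inr c) (Inl e)" "succs I fl (Inl (\<iota> e)) (Inr c)"
    using config_succs[OF C, of "Inr c"] config_succs[OF C, of "Inl (\<iota> e)"] c ii by auto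
  then have "fl c \<noteq> []" "hd (fl c) = e" "last (fl c) = \<iota> e"
    unfolding succs_def by (auto dest: adjr adjl)
  then obtain zs where "fl c = e # zs" "zs \<noteq> []" "last zs = \<iota> e" using ii(3) by (cases "fl c") (auto split: if_splits)
  then have "fl c = e # butlast zs @ [\<iota> e]" by (metis append_butlast_last_id)
  then show "\<exists>zs. fl c = e # zs @ [\<iota> e]" by blast
qed

text \<open>Dual to \<open>normalize_vertex\<close>: connectivity of the faces yields a letter
  \<open>y\<close> whose opposite lies on another face, and the inner neighbours of \<open>y\<close>
  are slid off the face. Neither \<open>e\<close> nor \<open>\<iota> e\<close> is moved, so the leaf
  at \<open>c\<close> persists.\<close>

lemma normalize_face:
  assumes "stable D' X" "D' \<subseteq> D" "config \<iota> I D' vl fl" "c0 \<in> I" "c \<in> I" "c \<noteq> c0" "vl c = [e]"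
  shows "\<exists>vl' fl' y. config \<iota> I D' vl' fl' \<and> sq X I c0 vl fl vl' fl' \<and> vl' c = [e] \<and> fl' c = [e, y, \<iota> e] \<and> \<iota> y \<notin> set (fl' c)"
  using assms(3,7)
proof (induction "length (fl c)" arbitrary: vl fl rule: less_induct)
  case less
  note C = less.prems(1)
  have p: "parts I fl D'" using C by (auto simp: config_def)
  have d: "distinct (fl c)" "set (fl c) \<subseteq> D'" using p assms(5) by (auto simp: parts_def)
  have ii: "\<iota> (\<iota> x) = x" "\<iota> x \<in> D'" if "x \<in> D'" for x using C that by (auto simp: config_def)
  obtain zs where z: "fl c = e # zs @ [\<iota> e]" using leaf_face[OF C assms(5) less.prems(2)] by blast
  have eD: "e \<in> D'" by (rule leaf_face[OF C assms(5) less.prems(2)])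
  have "\<exists>y\<in>set (fl c). \<iota> y \<notin> set (fl c)"
  proof (rule ccontr)
    assume "\<not> ?thesis"
    then have "{c} = I" using C assms(5) unfolding config_def conn_def by (metis (no_types, lifting) UN_insert UN_empty Un_empty_right empty_subsetI image_subsetI insert_not_empty insert_subset)
    then show False using assms by blast
  qed
  then obtain y where y: "y \<in> set (fl c)" "\<iota> y \<notin> set (fl c)" by blast
  then have yz: "y \<in> set zs" "y \<noteq> e" "\<iota> y \<noteq> e" using z ii[OF eD] by auto
  then obtain us ws where l: "zs = us @ y # ws" by (meson split_list)
  have yD: "y \<in> D'" using y d by auto
  consider "us = []" "ws = []" | k ws' where "ws = k # ws'" | k us' where "us = us' @ [k]"
    by (metis list.exhaust rev_exhaust)
  then show ?case
  proof cases
    case 1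
    have "fl c = [e, y, \<iota> e]" using z l 1 by simp
    then show ?thesis using C less.prems y subquot_iso_refl by blast
  next
    case 2
    have k: "k \<in> set zs" "k \<in> set (fl c)" "k \<noteq> \<iota> e" "k \<noteq> y" using z l 2 d by auto
    have "succs I fl (Inl y) (Inl k)"
      unfolding succs_def using assms(5) z l 2 by (intro bexI[of _ c]) (auto simp: adj_ext_Inl adj_append adj_Cons)
    then have S: "succs I vl (Inl k) (Inl (\<iota> y))" using config_succs[OF C, of "Inl y"] yD by simp
    have ikk: "\<iota> (\<iota> k) = k" using ii(1) k(2) d(2) by blast
    have hk: "\<iota> y \<noteq> k" "\<iota> y \<noteq> \<iota> k" using y(2) k(2,4) ii(1)[OF yD] ikk by metis+
    define vl' fl' where "vl' = (\<lambda>c. insbefore (\<iota> y) (\<iota> k) (removeAll (\<iota> y) (vl c)))" and "fl' = (\<lambda>c. insbefore k (\<iota> y) (removeAll k (fl c)))"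
    note f = slide_forward[OF assms(1,2) C S hk, folded vl'_def fl'_def]
    have "fl' c = removeAll k (fl c)" using y by (simp add: fl'_def insbefore_notin)
    then have "length (fl' c) < length (fl c)" using removeAll_shorter[OF d(1) k(2)] by simp
    moreover have "\<iota> k \<noteq> e" using k ikk by metis
    then have "vl' c = [e]" using less.prems(2) yz(3) by (simp add: vl'_def)
    ultimately show ?thesis using less.hyps[of fl' vl'] f(1) subquot_iso_trans[OF f(2)] by blast
  next
    case 3
    have k: "k \<in> set zs" "k \<in> set (fl c)" "k \<noteq> e" "k \<noteq> y" using z l 3 d by auto
    have S: "succs I fl (Inl k) (Inl y)"
      unfolding succs_def using assms(5) z l 3 by (intro bexI[of _ c]) (auto simp: adj_ext_Inl adj_append adj_Cons)
    have ikk: "\<iota> (\<iota> k) = k" using ii(1) k(2) d(2) by blast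
    have hk: "y \<noteq> k" "y \<noteq> \<iota> k" using y(2) k(2,4) ikk by metis+
    define vl' fl' where "vl' = (\<lambda>c. insafter y k (removeAll y (vl c)))" and "fl' = (\<lambda>c. insafter k (\<iota> y) (removeAll k (fl c)))"
    note f = slide_backward[OF assms(1,2) C S hk, folded vl'_def fl'_def]
    have "fl' c = removeAll k (fl c)" using y by (simp add: fl'_def insafter_notin)
    then have "length (fl' c) < length (fl c)" using removeAll_shorter[OF d(1) k(2)] by simp
    moreover have "vl' c = [e]" using less.prems(2) yz(2) k(3) by (simp add: vl'_def)
    ultimately show ?thesis using less.hyps[of fl' vl'] f(1) subquot_iso_trans[OF f(2)] by blast
  qed
qed

end

section \<open>Combinatorics of removing a site\<close>

lemma adj_distinct: "distinct l \<Longrightarrow> \<not> adj l x (hd l)" "distinct l \<Longrightarrow> \<not> adj l (last l) x"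
proof -
  show "distinct l \<Longrightarrow> \<not> adj l x (hd l)"
    by (cases l) (auto simp: adj_Cons dest: adj_in_set)
  show "distinct l \<Longrightarrow> \<not> adj l (last l) x"
    by (cases l rule: rev_cases) (auto simp: adj_append dest: adj_in_set)
qed

text \<open>Deleting an inner block joins the predecessor of its first element to the successor of
  its last one; the disjointness conditions exclude other occurrences of these two.\<close>

lemma adj_remove_block:
  assumes "us \<noteq> []" "b \<noteq> []" "ws \<noteq> []" "distinct b" "set b \<inter> set us = {}" "set b \<inter> set ws = {}"
  shows "adj (us @ ws) x z \<longleftrightarrow> x \<notin> set b \<and> z \<notin> set b \<and>
    (adj (us @ b @ ws) x z \<or> adj (us @ b @ ws) x (hd b) \<and> adj (us @ b @ ws) (last b) z)"
proof -
  have s: "hd b \<in> set b" "last b \<in> set b" "last us \<in> set us" "hd ws \<in> set ws" using assms by auto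
  then have n: "hd b \<notin> set us" "hd b \<notin> set ws" "last b \<notin> set us" "last b \<notin> set ws" "hd b \<noteq> hd ws" "last b \<noteq> last us"
    using assms by (metis disjoint_iff)+
  have a: "adj (us @ b @ ws) x (hd b) \<longleftrightarrow> x = last us" for x
    using adj_distinct[OF assms(4)] adj_in_set[of us x "hd b"] adj_in_set[of ws x "hd b"] s n assms by (auto simp: adj_append)
  have b: "adj (us @ b @ ws) (last b) z \<longleftrightarrow> z = hd ws" for z
    using adj_distinct[OF assms(4)] adj_in_set[of us "last b" z] adj_in_set[of ws "last b" z] s n assms by (auto simp: adj_append)
  show ?thesis unfolding a b
    using adj_in_set[of us x z] adj_in_set[of ws x z] adj_in_set[of b x z] s assms by (auto simp: adj_append)
qed

lemma adj_ext_remove_block: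
  assumes "b \<noteq> []" "distinct (us @ b @ ws)"
  shows "adj (ext c (us @ ws)) x z \<longleftrightarrow> x \<notin> Inl ` set b \<and> z \<notin> Inl ` set b \<and>
    (adj (ext c (us @ b @ ws)) x z \<or> adj (ext c (us @ b @ ws)) x (Inl (hd b)) \<and> adj (ext c (us @ b @ ws)) (Inl (last b)) z)"
  using adj_remove_block[of "Inr c # map Inl us" "map Inl b" "map Inl ws @ [Inr c]" x z] assms
  by (auto simp: ext_def hd_map last_map distinct_map)

lemma adj_ext_removeAll:
  assumes "distinct l" "h \<in> set l"
  shows "adj (ext c (removeAll h l)) x z \<longleftrightarrow> x \<noteq> Inl h \<and> z \<noteq> Inl h \<and>
    (adj (ext c l) x z \<or> adj (ext c l) x (Inl h) \<and> adj (ext c l) (Inl h) z)"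
proof -
  obtain us ws where l: "l = us @ h # ws" using assms(2) by (meson split_list)
  then have "removeAll h l = us @ ws" using assms(1) by (simp add: removeAll_id)
  then show ?thesis using adj_ext_remove_block[of "[h]" us ws c x z] assms(1) l by simp
qed

locale leaf_loop =
  fixes \<iota> :: "'h \<Rightarrow> 'h" and I :: "'c set" and D vl fl c e y
  assumes C: "config \<iota> I D vl fl" and c: "c \<in> I" and vc: "vl c = [e]" and fc: "fl c = [e, y, \<iota> e]" and y': "\<iota> y \<notin> set (fl c)"
begin

lemma pV: "parts I vl D" and pF: "parts I fl D" and inv: "x \<in> D \<Longrightarrow> \<iota> (\<iota> x) = x" "x \<in> D \<Longrightarrow> \<iota> x \<in> D" "x \<in> D \<Longrightarrow> \<iota> x \<noteq> x"
  using C by (auto simp: config_def)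

lemma in_D: "e \<in> D" "y \<in> D" "\<iota> e \<in> D" "\<iota> y \<in> D"
proof -
  have "set (fl c) \<subseteq> D" using pF c by (auto simp: parts_def)
  then show "e \<in> D" "y \<in> D" "\<iota> e \<in> D" by (auto simp: fc)
  then show "\<iota> y \<in> D" using inv by blast
qed

lemma four: "distinct [e, \<iota> e, y, \<iota> y]"
proof -
  have "distinct (fl c)" using pF c by (auto simp: parts_def)
  then show ?thesis using y' inv[OF in_D(2)] by (auto simp: fc)
qed

definition "B = {e, \<iota> e, y, \<iota> y}"
definition "vl2 d = filter (\<lambda>x. x \<notin> B) (vl d)"
definition "fl2 d = filter (\<lambda>x. x \<notin> B) (fl d)"

text \<open>Three of the four removed half-edges lie on the face of \<open>c\<close>; on other faces
  only \<open>\<iota> y\<close> can disappear.\<close>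

lemma fl2: "d \<in> I \<Longrightarrow> d \<noteq> c \<Longrightarrow> fl2 d = removeAll (\<iota> y) (fl d)"
proof -
  assume d: "d \<in> I" "d \<noteq> c"
  then have "set (fl d) \<inter> {e, y, \<iota> e} = {}" using pF c fc unfolding parts_def by (metis list.set(1,2))
  then show "fl2 d = removeAll (\<iota> y) (fl d)"
    unfolding fl2_def removeAll_filter_not_eq by (intro filter_cong) (auto simp: B_def)
qed

text \<open>By compatibility, the face [e, y, \<iota>(e)] forces \<iota>(e) directly behind y and
  \<iota>(y) directly behind \<iota>(e) at a vertex. So everything that is removed outside
  \<open>c\<close> is one contiguous block.\<close>

lemma vertex_block: "\<exists>d us ws. d \<in> I \<and> d \<noteq> c \<and> vl d = us @ [y, \<iota> e, \<iota> y] @ ws \<and> vl2 d = us @ ws \<and> 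
    (\<forall>d'\<in>I. d' \<noteq> c \<and> d' \<noteq> d \<longrightarrow> set (vl d') \<inter> B = {} \<and> vl2 d' = vl d') \<and> set (us @ ws) \<inter> B = {}"
proof -
  have "succs I fl (Inl e) (Inl y)" "succs I fl (Inl y) (Inl (\<iota> e))"
    unfolding succs_def using c by (auto intro!: bexI[of _ c] simp: adj_ext_Inl fc)
  then have "succs I vl (Inl y) (Inl (\<iota> e))" "succs I vl (Inl (\<iota> e)) (Inl (\<iota> y))"
    using config_succs[OF C, of "Inl e"] config_succs[OF C, of "Inl y"] in_D by auto
  then obtain d d2 where d: "d \<in> I" "adj (vl d) y (\<iota> e)" "d2 \<in> I" "adj (vl d2) (\<iota> e) (\<iota> y)"
    unfolding succs_def adj_ext_Inl by blast
  then have "\<iota> e \<in> set (vl d)" "\<iota> e \<in> set (vl d2)" by (auto dest: adj_in_set)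
  then have "d2 = d" using d pV unfolding parts_def by blast
  obtain us ws us2 ws2 where l: "vl d = us @ y # \<iota> e # ws" "vl d = us2 @ \<iota> e # \<iota> y # ws2"
    using d \<open>d2 = d\<close> by (auto simp: adj_iff)
  have dd: "distinct (vl d)" using pV d by (auto simp: parts_def)
  have "ws = \<iota> y # ws2"
  proof -
    have "(us @ [y]) @ \<iota> e # ws = us2 @ \<iota> e # (\<iota> y # ws2)" using l by simp
    moreover have "\<iota> e \<notin> set (us @ [y])" "\<iota> e \<notin> set ws" using dd l(1) by auto
    ultimately show ?thesis using append_Cons_eq_iff[of "\<iota> e" "us @ [y]" ws us2 "\<iota> y # ws2"] by simp
  qed
  then have vd: "vl d = us @ [y, \<iota> e, \<iota> y] @ ws2" using l by simp
  have dc: "d \<noteq> c" using vd vc by (auto simp: append_eq_Cons_conv)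
  have "e \<notin> set (vl d)" using pV d dc c vc unfolding parts_def by (metis disjoint_iff list.set_intros(1))
  then have 1: "set (us @ ws2) \<inter> B = {}" using dd vd by (auto simp: B_def)
  have "filter (\<lambda>x. x \<notin> B) us = us" "filter (\<lambda>x. x \<notin> B) ws2 = ws2"
    using 1 by (intro filter_True; auto)+
  moreover have "y \<in> B" "\<iota> e \<in> B" "\<iota> y \<in> B" by (auto simp: B_def)
  ultimately have 2: "vl2 d = us @ ws2" unfolding vl2_def vd by simp
  have 3: "set (vl d') \<inter> B = {}" if "d' \<in> I" "d' \<noteq> c" "d' \<noteq> d" for d'
  proof -
    have "set (vl d') \<inter> set (vl d) = {}" "set (vl d') \<inter> set (vl c) = {}"
      using pV that d c unfolding parts_def by metis+
    then show ?thesis using vd vc by (auto simp: B_def)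
  qed
  then have "vl2 d' = vl d'" if "d' \<in> I" "d' \<noteq> c" "d' \<noteq> d" for d'
    using that unfolding vl2_def by (intro filter_True) blast
  then show ?thesis using d dc vd 1 2 3 by blast
qed

lemma config2: "config \<iota> (I - {c}) (D - B) vl2 fl2"
proof -
  obtain d us ws where d: "d \<in> I" "d \<noteq> c" and vd: "vl d = us @ [y, \<iota> e, \<iota> y] @ ws" and v2d: "vl2 d = us @ ws"
    and other: "\<And>d'. d' \<in> I \<Longrightarrow> d' \<noteq> c \<Longrightarrow> d' \<noteq> d \<Longrightarrow> set (vl d') \<inter> B = {} \<and> vl2 d' = vl d'"
    using vertex_block by blast
  obtain d2 where d2: "d2 \<in> I" "\<iota> y \<in> set (fl d2)" using in_D(4) pF unfolding parts_def by blast
  then have d2c: "d2 \<noteq> c" using y' by blast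
  have iB: "\<iota> ` (D - B) \<subseteq> D - B"
  proof (rule image_subsetI)
    fix x assume "x \<in> D - B"
    then show "\<iota> x \<in> D - B" using inv[of x] inv[of e] inv[of y] in_D unfolding B_def by (metis DiffD1 DiffD2 DiffI insert_iff empty_iff)
  qed
  have parts2: "parts (I - {c}) (\<lambda>d. filter (\<lambda>x. x \<notin> B) (l d)) (D - B)" if p: "parts I l D" and lc: "set (l c) \<subseteq> B" for l
  proof -
    have dj: "set (l a) \<inter> set (l b) = {}" if "a \<in> I" "b \<in> I" "a \<noteq> b" for a b using p that by (auto simp: parts_def)
    have u: "(\<Union>d\<in>I. set (l d)) = D" and di: "\<And>d. d \<in> I \<Longrightarrow> distinct (l d)" using p by (auto simp: parts_def)
    have "(\<Union>d\<in>I - {c}. set (filter (\<lambda>x. x \<notin> B) (l d))) = (\<Union>d\<in>I. set (l d)) - B"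
      using lc by auto
    moreover have "set (filter (\<lambda>x. x \<notin> B) (l a)) \<inter> set (filter (\<lambda>x. x \<notin> B) (l b)) = {}" if "a \<in> I" "b \<in> I" "a \<noteq> b" for a b
      using dj[OF that] by auto
    ultimately show ?thesis unfolding parts_def u using di by auto
  qed
  have P: "parts (I - {c}) vl2 (D - B)" "parts (I - {c}) fl2 (D - B)"
    using parts2[OF pV] parts2[OF pF] by (auto simp: vl2_def[abs_def] fl2_def[abs_def] vc fc B_def)
  have conn2: "conn \<iota> (I - {c}) (\<lambda>d. filter (\<lambda>x. x \<notin> B) (l d))"
    if cn: "conn \<iota> I l" and p: "parts I l D" and lc: "set (l c) \<subseteq> B" and a: "a \<in> I" "a \<noteq> c" "B \<subseteq> set (l c) \<union> set (l a)" for l a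
    unfolding conn_def
  proof (intro allI impI)
    fix J assume J: "J \<subseteq> I - {c}" "J \<noteq> {}"
      and cl: "\<iota> ` (\<Union>d\<in>J. set (filter (\<lambda>x. x \<notin> B) (l d))) \<subseteq> (\<Union>d\<in>J. set (filter (\<lambda>x. x \<notin> B) (l d)))"
    \<comment> \<open>A closed set of remaining sites is closed in the old graph once
      \<open>c\<close> is added to it in case it contains \<open>a\<close>, the site that carries
      the rest of \<open>B\<close>.\<close>
    define J' where "J' = (if a \<in> J then insert c J else J)"
    have J': "J' \<subseteq> I" "J' \<noteq> {}" using J c by (auto simp: J'_def)
    have BB: "\<iota> x \<in> B" if "x \<in> B" for x using that inv in_D by (auto simp: B_def)
    have "\<iota> ` (\<Union>d\<in>J'. set (l d)) \<subseteq> (\<Union>d\<in>J'. set (l d))"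
    proof (rule image_subsetI)
      fix x assume "x \<in> (\<Union>d\<in>J'. set (l d))"
      then obtain d where d: "d \<in> J'" "x \<in> set (l d)" by blast
      show "\<iota> x \<in> (\<Union>d\<in>J'. set (l d))"
      proof (cases "x \<in> B")
        case True
        then have aJ: "a \<in> J"
        proof -
          have "x \<in> set (l c) \<or> x \<in> set (l a)" using True a by blast
          then have "d = c \<or> d = a" using p d(2) J'(1) d(1) c a unfolding parts_def by blast
          then show ?thesis using d(1) J(1) by (auto simp: J'_def split: if_splits)
        qed
        then show ?thesis using a(3) BB[OF True] by (auto simp: J'_def)
      next
        case False
        then have "d \<in> J" using d lc by (auto simp: J'_def split: if_splits)
        then have "\<iota> x \<in> (\<Union>d\<in>J. set (filter (\<lambda>x. x \<notin> B) (l d)))" using cl d False by auto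
        then show ?thesis by (auto simp: J'_def)
      qed
    qed
    then have "J' = I" using cn J' unfolding conn_def by blast
    then show "J = I - {c}" using J c by (auto simp: J'_def split: if_splits)
  qed
  have "conn \<iota> I vl" "conn \<iota> I fl" using C by (auto simp: config_def)
  then have Cn: "conn \<iota> (I - {c}) vl2" "conn \<iota> (I - {c}) fl2"
    using conn2[OF _ pV, of d] conn2[OF _ pF, of d2] d d2 d2c by (auto simp: vl2_def[abs_def] fl2_def[abs_def] vc fc vd B_def)
  let ?V = "succs I vl" and ?F = "succs I fl"
  let ?bad = "Inl ` B \<union> {Inr c}"
  \<comment> \<open>New neighbours at a vertex are old ones or are joined across the block from y to
    \<iota>(y).\<close>
  have V2: "succs (I - {c}) vl2 x z \<longleftrightarrow> ?V x z \<or> ?V x (Inl y) \<and> ?V (Inl (\<iota> y)) z" if xz: "x \<notin> ?bad" "z \<notin> ?bad" for x z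
  proof -
    have dist: "distinct (us @ [y, \<iota> e, \<iota> y] @ ws)" using pV d vd by (metis parts_def)
    have a: "adj (ext d (vl2 d)) x z \<longleftrightarrow> adj (ext d (vl d)) x z \<or> adj (ext d (vl d)) x (Inl y) \<and> adj (ext d (vl d)) (Inl (\<iota> y)) z"
      unfolding v2d vd using adj_ext_remove_block[OF _ dist, of d x z] xz by (auto simp: B_def)
    have b: "adj (ext d' (vl2 d')) x z \<longleftrightarrow> adj (ext d' (vl d')) x z" "\<not> adj (ext d' (vl d')) x (Inl y)" "\<not> adj (ext d' (vl d')) (Inl (\<iota> y)) z"
      if "d' \<in> I" "d' \<noteq> c" "d' \<noteq> d" for d'
      using other[OF that] by (auto dest!: adj_in_set simp: ext_def B_def)
    have cc: "\<not> adj (ext c (vl c)) x z" "\<not> adj (ext c (vl c)) x (Inl y)" "\<not> adj (ext c (vl c)) (Inl (\<iota> y)) z"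
      using xz four by (auto simp: ext_def vc B_def)
    show ?thesis
    proof
      assume "succs (I - {c}) vl2 x z"
      then obtain d' where "d' \<in> I" "d' \<noteq> c" "adj (ext d' (vl2 d')) x z" unfolding succs_def by blast
      then show "?V x z \<or> ?V x (Inl y) \<and> ?V (Inl (\<iota> y)) z"
        using a b d unfolding succs_def by (cases "d' = d") blast+
    next
      assume "?V x z \<or> ?V x (Inl y) \<and> ?V (Inl (\<iota> y)) z"
      then show "succs (I - {c}) vl2 x z"
      proof
        assume "?V x z"
        then obtain d' where d': "d' \<in> I" "adj (ext d' (vl d')) x z" unfolding succs_def by blast
        then have "d' \<noteq> c" using cc by blast
        then have "adj (ext d' (vl2 d')) x z" using a b(1)[OF d'(1)] d'(2) by (cases "d' = d") simp_all
        then show ?thesis using d' \<open>d' \<noteq> c\<close> unfolding succs_def by blast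
      next
        assume "?V x (Inl y) \<and> ?V (Inl (\<iota> y)) z"
        then have "adj (ext d (vl d)) x (Inl y) \<and> adj (ext d (vl d)) (Inl (\<iota> y)) z"
          using b(2,3) cc(2,3) unfolding succs_def by blast
        then show ?thesis using a d unfolding succs_def by blast
      qed
    qed
  qed
  \<comment> \<open>On the faces the gap to be bridged is the single letter \<iota>(y).\<close>
  have F2: "succs (I - {c}) fl2 x z \<longleftrightarrow> ?F x z \<or> ?F x (Inl (\<iota> y)) \<and> ?F (Inl (\<iota> y)) z" if xz: "x \<notin> ?bad" "z \<notin> ?bad" for x z
  proof -
    have dist: "distinct (fl d2)" using pF d2 by (auto simp: parts_def)
    have a: "adj (ext d2 (fl2 d2)) x z \<longleftrightarrow> adj (ext d2 (fl d2)) x z \<or> adj (ext d2 (fl d2)) x (Inl (\<iota> y)) \<and> adj (ext d2 (fl d2)) (Inl (\<iota> y)) z"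
      unfolding fl2[OF d2(1) d2c] using adj_ext_removeAll[OF dist d2(2), of d2 x z] xz by (auto simp: B_def)
    have b: "adj (ext d' (fl2 d')) x z \<longleftrightarrow> adj (ext d' (fl d')) x z" "\<not> adj (ext d' (fl d')) x (Inl (\<iota> y))" "\<not> adj (ext d' (fl d')) (Inl (\<iota> y)) z"
      if "d' \<in> I" "d' \<noteq> c" "d' \<noteq> d2" for d'
    proof -
      have "\<iota> y \<notin> set (fl d')" using pF that d2 unfolding parts_def by blast
      then show "adj (ext d' (fl2 d')) x z \<longleftrightarrow> adj (ext d' (fl d')) x z" "\<not> adj (ext d' (fl d')) x (Inl (\<iota> y))" "\<not> adj (ext d' (fl d')) (Inl (\<iota> y)) z"
        using fl2[OF that(1,2)] by (auto dest!: adj_in_set simp: ext_def)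
    qed
    have cc: "\<not> adj (ext c (fl c)) x z" "\<not> adj (ext c (fl c)) x (Inl (\<iota> y))" "\<not> adj (ext c (fl c)) (Inl (\<iota> y)) z"
      using xz four by (auto simp: ext_def fc B_def)
    show ?thesis
    proof
      assume "succs (I - {c}) fl2 x z"
      then obtain d' where "d' \<in> I" "d' \<noteq> c" "adj (ext d' (fl2 d')) x z" unfolding succs_def by blast
      then show "?F x z \<or> ?F x (Inl (\<iota> y)) \<and> ?F (Inl (\<iota> y)) z"
        using a b d2 unfolding succs_def by (cases "d' = d2") blast+
    next
      assume "?F x z \<or> ?F x (Inl (\<iota> y)) \<and> ?F (Inl (\<iota> y)) z"
      then show "succs (I - {c}) fl2 x z"
      proof
        assume "?F x z"
        then obtain d' where d': "d' \<in> I" "adj (ext d' (fl d')) x z" unfolding succs_def by blast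
        then have "d' \<noteq> c" using cc by blast
        then have "adj (ext d' (fl2 d')) x z" using a b(1)[OF d'(1)] d'(2) by (cases "d' = d2") simp_all
        then show ?thesis using d' \<open>d' \<noteq> c\<close> unfolding succs_def by blast
      next
        assume "?F x (Inl (\<iota> y)) \<and> ?F (Inl (\<iota> y)) z"
        then have "adj (ext d2 (fl d2)) x (Inl (\<iota> y)) \<and> adj (ext d2 (fl d2)) (Inl (\<iota> y)) z"
          using b(2,3) cc(2,3) unfolding succs_def by blast
        then show ?thesis using a d2 d2c unfolding succs_def by blast
      qed
    qed
  qed
  have "compat \<iota> (I - {c}) (D - B) vl2 fl2"
    unfolding compat_def
  proof (intro ballI allI)
    fix u w assume u: "u \<in> Inl ` (D - B) \<union> Inr ` (I - {c})"
    let ?j = "map_sum \<iota> id :: 'h + 'c \<Rightarrow> 'h + 'c"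
    have uN: "u \<in> Inl ` D \<union> Inr ` I" and ub: "u \<notin> ?bad" using u by auto
    have jb: "?j u \<notin> ?bad" using u iB by fastforce
    show "succs (I - {c}) fl2 u w \<longleftrightarrow> succs (I - {c}) vl2 w (?j u)"
    proof (cases "w \<in> ?bad")
      case True
      have "\<not> succs (I - {c}) fl2 u w" "\<not> succs (I - {c}) vl2 w (?j u)"
        using True succs_nodes[of "I - {c}" fl2 u w] succs_nodes[of "I - {c}" vl2 w "?j u"] P unfolding parts_def by auto
      then show ?thesis by simp
    next
      case False
      \<comment> \<open>Compatibility matches the gap \<iota>(y) on the faces with the gap from y to
        \<iota>(y) at the vertices.\<close>
      have "?F u w \<longleftrightarrow> ?V w (?j u)" "?F u (Inl (\<iota> y)) \<longleftrightarrow> ?V (Inl (\<iota> y)) (?j u)" "?F (Inl (\<iota> y)) w \<longleftrightarrow> ?V w (Inl y)"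
        using config_succs[OF C uN] config_succs[OF C, of "Inl (\<iota> y)" w] in_D inv by auto
      then show ?thesis unfolding V2[OF False jb] F2[OF ub False] by blast
    qed
  qed
  moreover have "\<forall>h\<in>D - B. \<iota> (\<iota> h) = h \<and> \<iota> h \<noteq> h" using inv by blast
  moreover have "finite (I - {c})" using C by (simp add: config_def)
  ultimately show ?thesis using P Cn iB unfolding config_def by simp
qed

end

section \<open>Removing a site: projections and the subquotient\<close>

context half_edge_ops
begin

abbreviation "q \<equiv> pinv \<cdot> pinv"

lemma span_image_subset:
  assumes "lin_map f" "\<And>x. x \<in> G1 \<Longrightarrow> f x \<in> fun_vs.span G2" "v \<in> fun_vs.span G1"
  shows "f v \<in> fun_vs.span G2"
proof -
  interpret f: Vector_Spaces.linear fscale fscale f by (rule assms(1))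
  have "f ` G1 \<subseteq> fun_vs.span G2" using assms(2) by blast
  then have "fun_vs.span (f ` G1) \<subseteq> fun_vs.span G2" by (simp add: fun_vs.span_minimal fun_vs.subspace_span)
  then show ?thesis using assms(3) unfolding f.span_image by blast
qed

text \<open>Unlike in the abstract laws, the witnesses are kept as operators at the edge of
  \<open>e\<close>: the reduction needs those for 1 - E to preserve the ambient space.\<close>

lemma edge_projection:
  assumes "e \<in> D"
  shows "\<exists>P. rank_one P \<and> (let E = slot (edge e) P in
    (\<forall>i. E * L e i = \<phi> (unit_vec i) *\<^sub>o E) \<and> (\<forall>i. E * L (\<iota> e) i = \<chi>inv (unit_vec i) *\<^sub>o E) \<and>
    (\<forall>i. T e i * E = pinv i *\<^sub>o E) \<and> (\<forall>i. T (\<iota> e) i * E = \<one> i *\<^sub>o E) \<and>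
    (\<exists>X. 1 - E = (\<Sum>i\<in>UNIV. (L e i - \<phi> (unit_vec i) *\<^sub>o 1) * slot (edge e) (X i))) \<and>
    (\<exists>f. (\<forall>b s. (\<Sum>u\<in>UNIV. \<Sum>r\<in>UNIV. \<Sum>i\<in>UNIV.
          ((unit_vec r \<cdot> unit_vec s) \<cdot> unit_vec u) i *\<^sub>o (slot (edge e) (f b i) * T (\<iota> e) r * T e u)) = (if s = b then E else 0)) \<and>
      (\<forall>b. (\<Sum>i\<in>UNIV. q i *\<^sub>o slot (edge e) (f b i)) = pinv b *\<^sub>o E)))"
proof -
  obtain P where P: "rank_one P" "edge_projection_laws H \<phi> \<chi>inv pinv q P (loc_L (src e)) (loc_T (src e)) (loc_L (\<not> src e)) (loc_T (\<not> src e))"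
    using edge_projection_laws_loc by blast
  then obtain X f where
    X: "1 - P = (\<Sum>i\<in>UNIV. (loc_L (src e) i - \<phi> (unit_vec i) *\<^sub>o 1) * X i)" and
    f: "\<And>b s. (\<Sum>u\<in>UNIV. \<Sum>r\<in>UNIV. \<Sum>i\<in>UNIV.
          ((unit_vec r \<cdot> unit_vec s) \<cdot> unit_vec u) i *\<^sub>o (f b i * loc_T (\<not> src e) r * loc_T (src e) u)) = (if s = b then P else 0)"
       "\<And>b. (\<Sum>i\<in>UNIV. q i *\<^sub>o f b i) = pinv b *\<^sub>o P"
    unfolding edge_projection_laws_def by blast
  let ?s = "slot (edge e)"
  note h = alg_hom_slot[of "edge e"]
  have LT: "L e i = ?s (loc_L (src e) i)" "T e i = ?s (loc_T (src e) i)" "L (\<iota> e) i = ?s (loc_L (\<not> src e) i)" "T (\<iota> e) i = ?s (loc_T (\<not> src e) i)" for i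
    using assms by (simp_all add: L_def T_def edge_iota src_iota)
  have "(\<Sum>u\<in>UNIV. \<Sum>r\<in>UNIV. \<Sum>i\<in>UNIV.
          ((unit_vec r \<cdot> unit_vec s) \<cdot> unit_vec u) i *\<^sub>o (?s (f b i) * T (\<iota> e) r * T e u)) = (if s = b then ?s P else 0)" for b s
    using arg_cong[OF f(1)[of s b], of ?s] unfolding LT alg_hom_simps[OF h] by (simp split: if_splits)
  moreover have "(\<Sum>i\<in>UNIV. q i *\<^sub>o ?s (f b i)) = pinv b *\<^sub>o ?s P" for b
    using arg_cong[OF f(2)[of b], of ?s] unfolding alg_hom_simps[OF h] .
  moreover have "1 - ?s P = (\<Sum>i\<in>UNIV. (L e i - \<phi> (unit_vec i) *\<^sub>o 1) * ?s (X i))"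
    using arg_cong[OF X, of ?s] unfolding LT alg_hom_simps[OF h] .
  moreover have "(\<forall>i. ?s P * L e i = \<phi> (unit_vec i) *\<^sub>o ?s P) \<and> (\<forall>i. ?s P * L (\<iota> e) i = \<chi>inv (unit_vec i) *\<^sub>o ?s P) \<and>
    (\<forall>i. T e i * ?s P = pinv i *\<^sub>o ?s P) \<and> (\<forall>i. T (\<iota> e) i * ?s P = \<one> i *\<^sub>o ?s P)"
    using P(2) unfolding edge_projection_laws_def LT slot_times[symmetric] slot_lscale[symmetric] by simp
  ultimately show ?thesis using P(1) unfolding Let_def by blast
qed

lemma loop_projection:
  assumes "y \<in> D"
  shows "\<exists>P. rank_one P \<and> (let Y = slot (edge y) P in
    loop_projection_laws H \<chi>inv pinv Y (L y) (T y) (L (\<iota> y)) (T (\<iota> y)))"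
proof -
  obtain P where P: "rank_one P" "loop_projection_laws H \<chi>inv pinv P (loc_L (src y)) (loc_T (src y)) (loc_L (\<not> src y)) (loc_T (\<not> src y))"
    using loop_projection_laws_loc by blast
  have "loop_projection_laws H \<chi>inv pinv (slot (edge y) P) (L y) (T y) (L (\<iota> y)) (T (\<iota> y))"
    using loop_projection_laws_hom[OF alg_hom_slot[of "edge y"] P(2)] assms
    by (simp add: L_def[abs_def] T_def[abs_def] edge_iota src_iota)
  then show ?thesis using P(1) unfolding Let_def by blast
qed

lemma wordT_absorb:
  assumes Y: "\<And>i. T z i * Y = \<one> i *\<^sub>o Y" and c: "\<And>x i. x \<in> set l \<Longrightarrow> x \<noteq> z \<Longrightarrow> T x i * Y = Y * T x i"
  shows "wordT l i * Y = wordT (removeAll z l) i * Y"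
  using c
proof (induction l arbitrary: i)
  case (Cons x l)
  have IH: "wordT l r * Y = wordT (removeAll z l) r * Y" for r using Cons by auto
  show ?case
  proof (cases "x = z")
    case True
    have "wordT (z # l) i * Y = (\<Sum>s\<in>UNIV. \<Sum>r\<in>UNIV. ((unit_vec r \<cdot> unit_vec s) i * \<one> s) *\<^sub>o (wordT l r * Y))"
      by (simp add: cT.cv_def sum_distrib_right mult.assoc Y)
    also have "\<dots> = (\<Sum>r\<in>UNIV. (\<Sum>s\<in>UNIV. (unit_vec r \<cdot> unit_vec s) i * \<one> s) *\<^sub>o (wordT l r * Y))"
      by (subst sum.swap) (simp add: lscale_sum_left)
    also have "\<dots> = (\<Sum>r\<in>UNIV. if r = i then wordT l r * Y else 0)"
      unfolding mult_unit_coord by (rule sum.cong) auto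
    finally show ?thesis using True IH by simp
  next
    case False
    have "wordT l r * (T x s * Y) = wordT (removeAll z l) r * (T x s * Y)" for r s
    proof -
      have c: "T x s * Y = Y * T x s" using Cons.prems False by simp
      show ?thesis unfolding c mult.assoc[symmetric] IH ..
    qed
    then show ?thesis using False by (simp add: cT.cv_def sum_distrib_right mult.assoc)
  qed
qed simp

lemma wordT_three:
  "wordT [e, y, z] i = (\<Sum>u\<in>UNIV. \<Sum>r\<in>UNIV. \<Sum>s\<in>UNIV. ((unit_vec r \<cdot> unit_vec s) \<cdot> unit_vec u) i *\<^sub>o (T z r * T y s * T e u))"
proof -
  have "wordT [e, y, z] i = (\<Sum>u\<in>UNIV. \<Sum>v\<in>UNIV. \<Sum>s\<in>UNIV. \<Sum>r\<in>UNIV. ((unit_vec r \<cdot> unit_vec s) v * (unit_vec v \<cdot> unit_vec u) i) *\<^sub>o (T z r * T y s * T e u))"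
    by (simp add: cT.cv_unit_right cT.cv_def[of "T e"]) (simp add: cT.cv_def sum_distrib_right lscale_sum_right mult.commute)
  also have "\<dots> = (\<Sum>u\<in>UNIV. \<Sum>s\<in>UNIV. \<Sum>r\<in>UNIV. (\<Sum>v\<in>UNIV. (unit_vec r \<cdot> unit_vec s) v * (unit_vec v \<cdot> unit_vec u) i) *\<^sub>o (T z r * T y s * T e u))"
    unfolding lscale_sum_left by (rule sum.cong[OF refl], subst sum_swap2) (rule refl)
  also have "\<dots> = (\<Sum>u\<in>UNIV. \<Sum>r\<in>UNIV. \<Sum>s\<in>UNIV. ((unit_vec r \<cdot> unit_vec s) \<cdot> unit_vec u) i *\<^sub>o (T z r * T y s * T e u))"
    unfolding mult_component(1)[symmetric] by (rule sum.cong[OF refl], rule sum.swap)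
  finally show ?thesis .
qed

text \<open>The isomorphism is induced by \<open>E * Y\<close>. On the invariants it agrees with
  \<open>E\<close>, because the face condition at \<open>c\<close> forces \<open>E v\<close> into
  the image of \<open>Y\<close>; modulo relations \<open>E\<close> is the identity, because 1 - E
  consists of relations at \<open>c\<close>; and after \<open>E\<close> has been applied, the block
  [y, \<iota>(e), \<iota>(y)] acts trivially on the image of \<open>Y\<close>.\<close>

lemma reduction:
  assumes st: "stable D' X" and D': "D' \<subseteq> D" and C: "config \<iota> I D' vl fl" and c: "c \<in> I" and c0: "c \<noteq> c0"
    and vc: "vl c = [e]" and fc: "fl c = [e, y, \<iota> e]" and y': "\<iota> y \<notin> set (fl c)"
  shows "\<exists>P Q vl' fl'. rank_one P \<and> rank_one Q \<and> e \<in> D' \<and> y \<in> D' \<and> edge e \<noteq> edge y \<and>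
    (let D'' = D' - {e, \<iota> e, y, \<iota> y}; X' = {n \<in> X. app (slot (edge e) P) n = n \<and> app (slot (edge y) Q) n = n} in
      config \<iota> (I - {c}) D'' vl' fl' \<and> stable D'' X' \<and>
      subquot_iso (Inv X I c0 fl) (Rel X I c0 vl) (Inv X' (I - {c}) c0 fl') (Rel X' (I - {c}) c0 vl'))"
proof -
  interpret leaf_loop \<iota> I D' vl fl c e y
    by unfold_locales (fact C c vc fc y')+
  have eD: "e \<in> D" "y \<in> D" "\<iota> e \<in> D" "\<iota> y \<in> D" using in_D D' by auto
  have ey: "edge e \<noteq> edge y" using edge_neq[OF eD(1), of y] four by auto
  obtain P where P: "rank_one P" and Ep: "let E = slot (edge e) P in
    (\<forall>i. E * L e i = \<phi> (unit_vec i) *\<^sub>o E) \<and> (\<forall>i. E * L (\<iota> e) i = \<chi>inv (unit_vec i) *\<^sub>o E) \<and>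
    (\<forall>i. T e i * E = pinv i *\<^sub>o E) \<and> (\<forall>i. T (\<iota> e) i * E = \<one> i *\<^sub>o E) \<and>
    (\<exists>X. 1 - E = (\<Sum>i\<in>UNIV. (L e i - \<phi> (unit_vec i) *\<^sub>o 1) * slot (edge e) (X i))) \<and>
    (\<exists>f. (\<forall>b s. (\<Sum>u\<in>UNIV. \<Sum>r\<in>UNIV. \<Sum>i\<in>UNIV.
          ((unit_vec r \<cdot> unit_vec s) \<cdot> unit_vec u) i *\<^sub>o (slot (edge e) (f b i) * T (\<iota> e) r * T e u)) = (if s = b then E else 0)) \<and>
      (\<forall>b. (\<Sum>i\<in>UNIV. q i *\<^sub>o slot (edge e) (f b i)) = pinv b *\<^sub>o E))"
    using edge_projection[OF eD(1)] by blast
  obtain Q where Q: "rank_one Q" and Yp: "let Y = slot (edge y) Q in loop_projection_laws H \<chi>inv pinv Y (L y) (T y) (L (\<iota> y)) (T (\<iota> y))"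
    using loop_projection[OF eD(2)] by blast
  define E where "E = slot (edge e) P"
  define Y where "Y = slot (edge y) Q"
  from Ep obtain Xs f where EL: "\<And>i. E * L e i = \<phi> (unit_vec i) *\<^sub>o E" and EL': "\<And>i. E * L (\<iota> e) i = \<chi>inv (unit_vec i) *\<^sub>o E"
    and TE: "\<And>i. T e i * E = pinv i *\<^sub>o E" and TE': "\<And>i. T (\<iota> e) i * E = \<one> i *\<^sub>o E"
    and EX: "1 - E = (\<Sum>i\<in>UNIV. (L e i - \<phi> (unit_vec i) *\<^sub>o 1) * slot (edge e) (Xs i))"
    and Ef: "\<And>b s. (\<Sum>u\<in>UNIV. \<Sum>r\<in>UNIV. \<Sum>i\<in>UNIV.
          ((unit_vec r \<cdot> unit_vec s) \<cdot> unit_vec u) i *\<^sub>o (slot (edge e) (f b i) * T (\<iota> e) r * T e u)) = (if s = b then E else 0)"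
    and Eq: "\<And>b. (\<Sum>i\<in>UNIV. q i *\<^sub>o slot (edge e) (f b i)) = pinv b *\<^sub>o E"
    unfolding Let_def E_def[symmetric] by auto
  have loop: "loop_projection_laws H \<chi>inv pinv Y (L y) (T y) (L (\<iota> y)) (T (\<iota> y))"
    using Yp by (simp add: Y_def)
  define Z where "Z = cL.cv (L y) (cL.cv (\<lambda>j. \<chi>inv (unit_vec j) *\<^sub>o 1) (L (\<iota> y)))"
  from loop obtain g where TY: "\<And>i. T y i * Y = pinv i *\<^sub>o Y" and TY': "\<And>i. T (\<iota> y) i * Y = \<one> i *\<^sub>o Y"
    and ZY: "\<And>i. Z i * Y = \<epsilon> (unit_vec i) *\<^sub>o Y" and YZ: "\<And>i. Y * Z i = \<epsilon> (unit_vec i) *\<^sub>o Y"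
    and g: "(\<Sum>i\<in>UNIV. g i * T y i) = 1" "(\<Sum>i\<in>UNIV. pinv i *\<^sub>o g i) = Y"
    unfolding loop_projection_laws_def cvL_cv Z_def by blast
  have EE: "E * E = E" and YY: "Y * Y = Y"
    using rank_one_idem[OF P] rank_one_idem[OF Q] by (simp_all add: E_def Y_def slot_times[symmetric])
  have EY: "E * Y = Y * E" unfolding E_def Y_def by (rule slot_commute[OF ey])
  have Ec: "E * slot f A = slot f A * E" if "edge e \<noteq> f" for f A unfolding E_def by (rule slot_commute[OF that])
  have Yc: "Y * slot f A = slot f A * Y" if "edge y \<noteq> f" for f A unfolding Y_def by (rule slot_commute[OF that])
  have EcL: "E * L x i = L x i * E" "E * T x i = T x i * E" if "x \<noteq> e" "x \<noteq> \<iota> e" for x i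
    using Ec[OF edge_neq[OF eD(1) that]] by (simp_all add: L_def T_def)
  have YcL: "Y * L x i = L x i * Y" "Y * T x i = T x i * Y" if "x \<noteq> y" "x \<noteq> \<iota> y" for x i
    using Yc[OF edge_neq[OF eD(2) that]] by (simp_all add: L_def T_def)
  have presE: "slot (edge e) A \<in> pres X" "slot (edge y) A \<in> pres X" for A
    using st in_D by (auto simp: stable_def)
  have sub: "fun_vs.subspace X" by (rule stable_subspace[OF st])
  define X' where "X' = {n \<in> X. app E n = n \<and> app Y n = n}"
  have X'X: "X' \<subseteq> X" by (auto simp: X'_def)
  have sub': "fun_vs.subspace X'"
    using sub unfolding fun_vs.subspace_def X'_def by auto
  have stab: "stable (D' - B) X'"
    unfolding stable_def
  proof (intro conjI ballI allI sub')
    fix h A assume h: "h \<in> D' - B"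
    then have hn: "edge e \<noteq> edge h" "edge y \<noteq> edge h" using edge_neq[OF eD(1), of h] edge_neq[OF eD(2), of h] by (auto simp: B_def)
    have "slot (edge h) A \<in> pres X" using st h by (auto simp: stable_def)
    then show "slot (edge h) A \<in> pres X'"
      using Ec[OF hn(1), of A] Yc[OF hn(2), of A] by (auto simp: pres_def X'_def app_times[symmetric]) (simp_all add: app_times)
  qed
  have PX': "app (E * Y) n \<in> X'" if "n \<in> X" for n
  proof -
    have "app (E * Y) n \<in> X" using that presE unfolding E_def Y_def by (simp add: app_times pres_app)
    moreover have "E * (E * Y) = E * Y" "Y * (E * Y) = E * Y"
      using EE YY EY by (simp_all add: mult.assoc[symmetric]) (simp add: mult.assoc)
    ultimately show ?thesis unfolding X'_def by (simp add: app_times[symmetric])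
  qed
  have fixX': "app (E * Y) n = n" "app E n = n" "app Y n = n" if "n \<in> X'" for n
    using that by (auto simp: X'_def app_times)
  have inD: "set (vl d) \<subseteq> D'" "set (fl d) \<subseteq> D'" if "d \<in> I" for d using pV pF that by (auto simp: parts_def)
  have fB: "set (fl d) \<inter> {e, y, \<iota> e} = {}" if "d \<in> I" "d \<noteq> c" for d
    using pF c fc that unfolding parts_def by (metis list.set(1,2))
  have fE: "wordT (fl d) i * E = E * wordT (fl d) i" if "d \<in> I" "d \<noteq> c" for d i
    by (rule cT.word_commute[symmetric]) (use fB[OF that] in \<open>auto intro!: EcL(2)\<close>)
  have f2Y: "wordT (fl2 d) i * Y = Y * wordT (fl2 d) i" if "d \<in> I" "d \<noteq> c" for d i
    by (rule cT.word_commute[symmetric]) (use fB[OF that] fl2[OF that] in \<open>auto intro!: YcL(2)\<close>)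
  have fY: "wordT (fl d) i * Y = wordT (fl2 d) i * Y" if "d \<in> I" "d \<noteq> c" for d i
    unfolding fl2[OF that] by (rule wordT_absorb[OF TY']) (use fB[OF that] in \<open>auto intro!: YcL(2)[symmetric]\<close>)
  \<comment> \<open>The coefficients \<open>f\<close> strip the outer letters off the face word and
    leave T_y on the image of \<open>E\<close>. Hence T_y acts on \<open>E v\<close> through p^-1,
    and \<open>g\<close> turns this into membership in the image of \<open>Y\<close>.\<close>
  have face1: "app E v = app Y (app E v)" if v: "\<And>i. app (wordT (fl c) i) v = q i *\<^sub>v v" for v
  proof -
    have "E * T y b = (\<Sum>i\<in>UNIV. slot (edge e) (f b i) * wordT [e, y, \<iota> e] i)" for b
    proof -
      have comm: "T y s * T e u = T e u * T y s" for s u using T_commute[OF eD(2), of e] four by auto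
      have "slot (edge e) (f b i) * wordT [e, y, \<iota> e] i = (\<Sum>u\<in>UNIV. \<Sum>r\<in>UNIV. \<Sum>s\<in>UNIV. ((unit_vec r \<cdot> unit_vec s) \<cdot> unit_vec u) i *\<^sub>o
          (slot (edge e) (f b i) * T (\<iota> e) r * T e u * T y s))" for i
        unfolding wordT_three by (simp add: sum_distrib_left mult.assoc comm)
      then have "(\<Sum>i\<in>UNIV. slot (edge e) (f b i) * wordT [e, y, \<iota> e] i) = (\<Sum>i\<in>UNIV. \<Sum>u\<in>UNIV. \<Sum>r\<in>UNIV. \<Sum>s\<in>UNIV. ((unit_vec r \<cdot> unit_vec s) \<cdot> unit_vec u) i *\<^sub>o
          (slot (edge e) (f b i) * T (\<iota> e) r * T e u * T y s))" by simp
      also have "\<dots> = (\<Sum>s\<in>UNIV. \<Sum>i\<in>UNIV. \<Sum>u\<in>UNIV. \<Sum>r\<in>UNIV. ((unit_vec r \<cdot> unit_vec s) \<cdot> unit_vec u) i *\<^sub>o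
          (slot (edge e) (f b i) * T (\<iota> e) r * T e u * T y s))"
        by (rule trans[OF sum.cong[OF refl sum_swap2] sum.swap])
      also have "\<dots> = (\<Sum>s\<in>UNIV. (\<Sum>u\<in>UNIV. \<Sum>r\<in>UNIV. \<Sum>i\<in>UNIV. ((unit_vec r \<cdot> unit_vec s) \<cdot> unit_vec u) i *\<^sub>o
          (slot (edge e) (f b i) * T (\<iota> e) r * T e u)) * T y s)"
        unfolding sum_distrib_right lscale_mult_left by (rule sum.cong[OF refl], rule sum_swap2[symmetric])
      also have "\<dots> = (\<Sum>s\<in>UNIV. if s = b then E * T y s else 0)"
        unfolding Ef by (rule sum.cong) auto
      finally show ?thesis by simp
    qed
    then have "app (E * T y b) v = (\<Sum>i\<in>UNIV. q i *\<^sub>v app (slot (edge e) (f b i)) v)" for b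
      using v by (simp add: app_lsum app_times fc)
    also have "\<dots> b = pinv b *\<^sub>v app E v" for b
      using arg_cong[OF Eq[of b], of "\<lambda>A. app A v"] by (simp add: app_lsum app_lscale)
    finally have ff: "app (E * T y b) v = pinv b *\<^sub>v app E v" for b .
    have "app (T y b) (app E v) = pinv b *\<^sub>v app E v" for b
      using ff[of b] EcL(2)[of y b] four by (auto simp: app_times[symmetric])
    moreover have "app E v = (\<Sum>b\<in>UNIV. app (g b) (app (T y b) (app E v)))"
      using arg_cong[OF g(1), of "\<lambda>A. app A (app E v)"] by (simp add: app_lsum app_times app_one)
    ultimately have "app E v = app (\<Sum>b\<in>UNIV. pinv b *\<^sub>o g b) (app E v)"
      by (simp add: app_lsum app_lscale)
    then show ?thesis by (simp add: g(2))
  qed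
  \<comment> \<open>Conversely, on the image of both projections the letters e, y and \<iota>(e) act
    through p^-1, p^-1 and 1, whose product is \<open>q\<close>.\<close>
  have face2: "app (wordT (fl c) i) v = q i *\<^sub>v v" if v: "v \<in> X'" for v i
  proof -
    have "T (\<iota> e) r * T y s * T e u * (E * Y) = (pinv u * pinv s * \<one> r) *\<^sub>o (E * Y)" for r s u
    proof -
      have "T (\<iota> e) r * T y s * T e u * (E * Y) = pinv u *\<^sub>o (T (\<iota> e) r * (T y s * E) * Y)"
        by (simp add: mult.assoc) (simp add: mult.assoc[symmetric] TE)
      also have "T y s * E = E * T y s" using EcL(2)[of y s] four by auto
      also have "T (\<iota> e) r * (E * T y s) * Y = (T (\<iota> e) r * E) * (T y s * Y)" by (simp only: mult.assoc)
      finally show ?thesis by (simp add: TY TE' mult.left_commute mult.commute)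
    qed
    then have "wordT [e, y, \<iota> e] i * (E * Y) = (\<Sum>u\<in>UNIV. \<Sum>r\<in>UNIV. \<Sum>s\<in>UNIV. ((unit_vec r \<cdot> unit_vec s) \<cdot> unit_vec u) i * (pinv u * pinv s * \<one> r)) *\<^sub>o (E * Y)"
      unfolding wordT_three by (simp add: sum_distrib_right lscale_sum_left)
    also have "(\<Sum>u\<in>UNIV. \<Sum>r\<in>UNIV. \<Sum>s\<in>UNIV. ((unit_vec r \<cdot> unit_vec s) \<cdot> unit_vec u) i * (pinv u * pinv s * \<one> r)) = q i"
    proof -
      have l: "lin_form (\<lambda>a. ((a \<cdot> b) \<cdot> c) i)" "lin_form (\<lambda>b. ((a \<cdot> b) \<cdot> c) i)" for a b c
        by (rule lin_form_coord, intro lin)+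
      have "(\<Sum>u\<in>UNIV. \<Sum>r\<in>UNIV. \<Sum>s\<in>UNIV. ((unit_vec r \<cdot> unit_vec s) \<cdot> unit_vec u) i * (pinv u * pinv s * \<one> r))
        = (\<Sum>u\<in>UNIV. pinv u * (\<Sum>r\<in>UNIV. \<one> r * (\<Sum>s\<in>UNIV. pinv s * ((unit_vec r \<cdot> unit_vec s) \<cdot> unit_vec u) i)))"
        by (simp add: sum_distrib_left mult_ac)
      also have "\<dots> = ((\<one> \<cdot> pinv) \<cdot> pinv) i"
        by (simp only: lin_form_expand[OF l(2), symmetric] lin_form_expand[OF l(1), symmetric] mult_component(2)[symmetric])
      finally show ?thesis by (simp add: mult_unit_left)
    qed
    finally have "app (wordT [e, y, \<iota> e] i) (app (E * Y) v) = q i *\<^sub>v app (E * Y) v"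
      by (simp only: app_times[symmetric] app_lscale[symmetric])
    then show ?thesis unfolding fc fixX'(1)[OF v] .
  qed
  obtain d us ws where d: "d \<in> I" "d \<noteq> c" and vd: "vl d = us @ [y, \<iota> e, \<iota> y] @ ws" and v2d: "vl2 d = us @ ws"
    and other: "\<And>d'. d' \<in> I \<Longrightarrow> d' \<noteq> c \<Longrightarrow> d' \<noteq> d \<Longrightarrow> set (vl d') \<inter> B = {} \<and> vl2 d' = vl d'" and uw: "set (us @ ws) \<inter> B = {}"
    using vertex_block by blast
  have cB: "E * wordL l i = wordL l i * E" "Y * wordL l i = wordL l i * Y" if "set l \<inter> B = {}" for l i
    using that by (auto intro!: cL.word_commute EcL YcL simp: B_def)
  have uB: "set us \<inter> B = {}" "set ws \<inter> B = {}" using uw by auto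
  have EZ: "intw E (wordL [y, \<iota> e, \<iota> y]) Z"
  proof -
    have "intw E (L y) (L y)" "intw E (L (\<iota> y)) (L (\<iota> y))" "intw E (L (\<iota> e)) (\<lambda>j. \<chi>inv (unit_vec j) *\<^sub>o 1)"
      using EcL four EL' by (auto simp: intw_def)
    then show ?thesis by (simp add: Z_def cL.cv_unit_right cL.intw_cv)
  qed
  have usws: "cL.cv (wordL us) (cL.cv (\<lambda>i. \<epsilon> (unit_vec i) *\<^sub>o 1) (wordL ws)) = wordL (us @ ws)"
    by (simp add: cL.cv_unit_left cL.word_append)
  have EW: "intw E (wordL (vl d)) (cL.cv (wordL us) (cL.cv Z (wordL ws)))"
    unfolding vd cL.word_append
    by (intro cL.intw_cv EZ) (use cB[OF uB(1)] cB[OF uB(2)] in \<open>auto simp: intw_def\<close>)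
  have YW: "intw Y (cL.cv (wordL us) (cL.cv Z (wordL ws))) (wordL (us @ ws))"
    unfolding usws[symmetric]
    by (intro cL.intw_cv) (use cB[OF uB(1)] cB[OF uB(2)] YZ in \<open>auto simp: intw_def\<close>)
  have YW': "intw Y (wordL (us @ ws)) (cL.cv (wordL us) (cL.cv Z (wordL ws)))"
    unfolding usws[symmetric]
    by (intro cL.intw_cv) (use cB[OF uB(1)] cB[OF uB(2)] ZY in \<open>auto simp: intw_def\<close>)
  \<comment> \<open>At the site \<open>d\<close> this goes in two steps, through the word with
    \<open>Z\<close> in place of the block; at the other sites no letter meets the removed
    edges.\<close>
  have PW: "E * Y * wordL (vl d') i = wordL (vl2 d') i * (E * Y)" if "d' \<in> I" "d' \<noteq> c" for d' i
  proof (cases "d' = d")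
    case True
    have "intw (Y * E) (wordL (vl d)) (wordL (us @ ws))" by (rule intw_mult[OF EW YW])
    then show ?thesis unfolding True v2d EY by (simp add: intw_def)
  next
    case False
    then have "E * (Y * wordL (vl d') i) = wordL (vl d') i * (E * Y)"
      using cB[of "vl d'"] other[OF that] by (simp add: mult.assoc[symmetric])
    then show ?thesis using other[OF that False] by (simp add: mult.assoc)
  qed
  let ?R = "{app (wordL (vl c) i) n - \<phi> (unit_vec i) *\<^sub>v n | c i n. c \<in> I - {c0} \<and> n \<in> X}"
  let ?R' = "{app (wordL (vl2 c') i) n - \<phi> (unit_vec i) *\<^sub>v n | c' i n. c' \<in> I - {c} - {c0} \<and> n \<in> X'}"
  have RelR: "Rel X I c0 vl = fun_vs.span ?R" "Rel X' (I - {c}) c0 vl2 = fun_vs.span ?R'"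
    by (simp_all add: Rel_def)
  \<comment> \<open>Relations at \<open>c\<close> are killed, since \<open>E\<close> turns L_e into
    \<phi>; relations at other sites go to relations of the smaller graph.\<close>
  have down: "app (E * Y) v \<in> fun_vs.span ?R'" if "v \<in> fun_vs.span ?R" for v
  proof (rule span_image_subset[OF lin_map_app _ that])
    fix x assume "x \<in> ?R"
    then obtain d' i n where x: "x = app (wordL (vl d') i) n - \<phi> (unit_vec i) *\<^sub>v n" "d' \<in> I" "d' \<noteq> c0" "n \<in> X" by blast
    show "app (E * Y) x \<in> fun_vs.span ?R'"
    proof (cases "d' = c")
      case True
      have "E * Y * L e i = \<phi> (unit_vec i) *\<^sub>o (E * Y)"
        unfolding EY using EL[of i] by (simp add: mult.assoc)
      then have "app (E * Y) x = 0"
        unfolding x True vc by (simp add: cL.cv_unit_right app_times[symmetric] app_lscale)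
      then show ?thesis by (simp add: fun_vs.span_zero)
    next
      case False
      have "app (E * Y) x = app (wordL (vl2 d') i) (app (E * Y) n) - \<phi> (unit_vec i) *\<^sub>v app (E * Y) n"
        unfolding x using PW[OF x(2) False, of i] by (simp add: app_times[symmetric])
      then have "app (E * Y) x \<in> ?R'" using x False PX'[OF x(4)] by blast
      then show ?thesis by (rule fun_vs.span_base)
    qed
  qed
  \<comment> \<open>1 - E is a sum of relations at \<open>c\<close>, and these are present because
    \<open>c\<close> is not \<open>c0\<close>.\<close>
  have E1: "v - app E v \<in> fun_vs.span ?R" if v: "v \<in> X" for v
  proof -
    have "v - app E v = (\<Sum>i\<in>UNIV. app (wordL (vl c) i) (app (slot (edge e) (Xs i)) v) - \<phi> (unit_vec i) *\<^sub>v app (slot (edge e) (Xs i)) v)"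
      using arg_cong[OF EX, of "\<lambda>A. app A v"] by (simp add: app_diff app_one app_lsum app_times app_lscale vc cL.cv_unit_right)
    also have "\<dots> \<in> fun_vs.span ?R"
    proof (rule fun_vs.span_sum)
      fix i :: 'b
      have "app (slot (edge e) (Xs i)) v \<in> X" using presE v by (simp add: pres_app)
      then have "app (wordL (vl c) i) (app (slot (edge e) (Xs i)) v) - \<phi> (unit_vec i) *\<^sub>v app (slot (edge e) (Xs i)) v \<in> ?R"
        using c c0 by blast
      then show "app (wordL (vl c) i) (app (slot (edge e) (Xs i)) v) - \<phi> (unit_vec i) *\<^sub>v app (slot (edge e) (Xs i)) v \<in> fun_vs.span ?R"
        by (rule fun_vs.span_base)
    qed
    finally show ?thesis .
  qed
  have up: "v \<in> fun_vs.span ?R" if "v \<in> fun_vs.span ?R'" for v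
  proof -
    have "?R' \<subseteq> fun_vs.span ?R"
    proof
      fix x assume "x \<in> ?R'"
      then obtain d' i n where x: "x = app (wordL (vl2 d') i) n - \<phi> (unit_vec i) *\<^sub>v n" "d' \<in> I" "d' \<noteq> c" "d' \<noteq> c0" "n \<in> X'" by blast
      have nX: "n \<in> X" using x(5) X'X by blast
      have base: "app (wordL (vl d') i) n - \<phi> (unit_vec i) *\<^sub>v n \<in> fun_vs.span ?R"
        using x nX by (intro fun_vs.span_base) blast
      show "x \<in> fun_vs.span ?R"
      proof (cases "d' = d")
        case False
        then show ?thesis using base other[OF x(2,3)] x(1) by simp
      next
        case True
        have "wordL (vl d) i \<in> pres X" using inD[OF d(1)] by (intro stable_wordL[OF st])
        then have a: "app (wordL (vl d) i) n - app E (app (wordL (vl d) i) n) \<in> fun_vs.span ?R"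
          using nX by (intro E1) (simp add: pres_app)
        \<comment> \<open>Modulo relations the old word may be preceded by \<open>E\<close>; on
          \<open>X'\<close> the result is the new word, as \<open>Z\<close> is trivial on the image
          of \<open>Y\<close>.\<close>
        have "app E (app (wordL (vl d) i) n) = app (wordL (us @ ws) i) n"
        proof -
          have "app E (app (wordL (vl d) i) n) = app (cL.cv (wordL us) (cL.cv Z (wordL ws)) i) (app E n)"
            using EW by (simp add: intw_def app_times[symmetric])
          also have "\<dots> = app (cL.cv (wordL us) (cL.cv Z (wordL ws)) i) (app Y n)"
            using fixX'[OF x(5)] by simp
          also have "\<dots> = app (Y * wordL (us @ ws) i) n"
            using YW' by (simp add: intw_def app_times[symmetric])
          also have "\<dots> = app (wordL (us @ ws) i) n"
            using cB(2)[OF uw] fixX'[OF x(5)] by (simp add: app_times)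
          finally show ?thesis .
        qed
        then show ?thesis using fun_vs.span_diff[OF base a] True v2d x(1) by simp
      qed
    qed
    then show ?thesis using that fun_vs.span_minimal[OF _ fun_vs.subspace_span] by blast
  qed
  have "subquot_iso (Inv X I c0 fl) (Rel X I c0 vl) (Inv X' (I - {c}) c0 fl2) (Rel X' (I - {c}) c0 vl2)"
    unfolding subquot_iso_def
  proof (intro exI[of _ "app (E * Y)"] conjI lin_map_app ballI)
    have EvY: "app (E * Y) v = app E v" if "v \<in> Inv X I c0 fl" for v
      using face1[of v] that c c0 by (simp add: Inv_def EY app_times)
    have to: "app (E * Y) v \<in> Inv X' (I - {c}) c0 fl2" if v: "v \<in> Inv X I c0 fl" for v
    proof -
      have "app (wordT (fl2 d') i) (app (E * Y) v) = q i *\<^sub>v app (E * Y) v" if d': "d' \<in> I - {c} - {c0}" for d' i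
      proof -
        have dd: "d' \<in> I" "d' \<noteq> c" "d' \<noteq> c0" using d' by auto
        have "app (wordT (fl2 d') i) (app (E * Y) v) = app (wordT (fl d') i) (app Y (app E v))"
          using arg_cong[OF fY[OF dd(1,2), of i], of "\<lambda>A. app A (app E v)"] by (simp add: EY app_times)
        also have "\<dots> = app (wordT (fl d') i) (app E v)" using EvY[OF v] by (simp add: EY app_times)
        also have "\<dots> = app E (app (wordT (fl d') i) v)" using fE[OF dd(1,2), of i] by (simp add: app_times[symmetric])
        also have "\<dots> = q i *\<^sub>v app E v" using v dd by (simp add: Inv_def)
        finally show ?thesis using EvY[OF v] by simp
      qed
      then show ?thesis using PX' v by (auto simp: Inv_def)
    qed
    show "app (E * Y) ` Inv X I c0 fl = Inv X' (I - {c}) c0 fl2"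
    proof
      show "app (E * Y) ` Inv X I c0 fl \<subseteq> Inv X' (I - {c}) c0 fl2" using to by blast
      show "Inv X' (I - {c}) c0 fl2 \<subseteq> app (E * Y) ` Inv X I c0 fl"
      proof
        fix r assume r: "r \<in> Inv X' (I - {c}) c0 fl2"
        then have rX: "r \<in> X'" by (simp add: Inv_def)
        have "app (wordT (fl d') i) r = q i *\<^sub>v r" if d': "d' \<in> I - {c0}" for d' i
        proof (cases "d' = c")
          case True
          then show ?thesis using face2[OF rX] by simp
        next
          case False
          have dd: "d' \<in> I" "d' \<noteq> c" "d' \<noteq> c0" using d' False by auto
          have "app (wordT (fl d') i) r = app (wordT (fl d') i * Y) r" using fixX'[OF rX] by (simp add: app_times)
          also have "\<dots> = app (wordT (fl2 d') i) r" unfolding fY[OF dd(1,2)] using fixX'[OF rX] by (simp add: app_times)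
          finally show ?thesis using r dd by (simp add: Inv_def)
        qed
        then have "r \<in> Inv X I c0 fl" using rX X'X by (auto simp: Inv_def)
        then show "r \<in> app (E * Y) ` Inv X I c0 fl" using fixX'(1)[OF rX] by (metis imageI)
      qed
    qed
    fix v assume v: "v \<in> Inv X I c0 fl"
    show "app (E * Y) v \<in> Rel X' (I - {c}) c0 vl2 \<longleftrightarrow> v \<in> Rel X I c0 vl"
    proof
      show "v \<in> Rel X I c0 vl \<Longrightarrow> app (E * Y) v \<in> Rel X' (I - {c}) c0 vl2"
        unfolding RelR by (rule down)
      assume "app (E * Y) v \<in> Rel X' (I - {c}) c0 vl2"
      then have "app E v \<in> fun_vs.span ?R" using up EvY[OF v] unfolding RelR by simp
      moreover have "v - app E v \<in> fun_vs.span ?R" using E1 v by (simp add: Inv_def)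
      ultimately have "app E v + (v - app E v) \<in> fun_vs.span ?R" by (rule fun_vs.span_add)
      then show "v \<in> Rel X I c0 vl" unfolding RelR by simp
    qed
  qed
  then show ?thesis
    using P Q in_D ey config2 stab unfolding X'_def E_def Y_def B_def Let_def by blast
qed

end

section \<open>Splitting off rank-one factors and the induction over the sites\<close>

lemma lin_map_zero_fun: "lin_map f \<Longrightarrow> f (\<lambda>i. 0) = 0"
  using lin_map_0[of f] by (simp add: zero_fun_def)

lemma subquot_iso_bij:
  assumes "lin_map G" "\<And>v. v \<in> V \<Longrightarrow> G v \<in> W" "\<And>w. w \<in> W \<Longrightarrow> K w \<in> V \<and> G (K w) = w" "\<And>v. v \<in> V \<Longrightarrow> G v = 0 \<Longrightarrow> v = 0"
  shows "subquot_iso V {0} W {0}"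
proof -
  have "G 0 = 0" by (rule lin_map_0[OF assms(1)])
  then show ?thesis unfolding subquot_iso_def using assms by (intro exI[of _ G]) (force simp: image_iff)
qed

lemma subquot_iso_coord_space:
  assumes "bij_betw h B A"
  shows "subquot_iso (coord_space A :: ('x \<Rightarrow> 'k::field) set) {0} (coord_space B) {0}"
proof (rule subquot_iso_bij)
  let ?G = "\<lambda>n y. if y \<in> B then (n :: 'x \<Rightarrow> 'k) (h y) else 0"
  let ?K = "\<lambda>m x. if x \<in> A then (m :: _ \<Rightarrow> 'k) (inv_into B h x) else 0"
  show "lin_map ?G" by (rule lin_mapI) (auto simp: fscale_apply)
  show "?G v \<in> coord_space B" for v by (simp add: coord_space_def)
  have h: "inv_into B h (h y) = y" "h y \<in> A" if "y \<in> B" for y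
    using assms that by (auto simp: bij_betw_def)
  show "?K w \<in> coord_space A \<and> ?G (?K w) = w" if "w \<in> coord_space B" for w
    using that h by (auto simp: coord_space_def fun_eq_iff)
  fix v assume v: "v \<in> coord_space A" "?G v = 0"
  show "v = 0"
  proof
    fix x
    show "v x = 0 x"
    proof (cases "x \<in> A")
      case True
      then obtain y where "y \<in> B" "x = h y" using assms by (auto simp: bij_betw_def)
      then show ?thesis using fun_cong[OF v(2), of y] by simp
    qed (use v(1) in \<open>simp add: coord_space_def\<close>)
  qed
qed

text \<open>The image of a rank-one projection at the factor \<open>f\<close> is u tensored with the
  space on the other factors. \<open>G\<close> contracts with \<phi> and \<open>K\<close> tensors
  with u; the projection is \<open>K\<close> after \<open>G\<close>, and \<open>G\<close> after
  \<open>K\<close> is the identity on the smaller space.\<close>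

lemma subquot_iso_rank_one:
  fixes P :: "'e \<Rightarrow> ('m::finite, 'k::field) lop"
  assumes P: "rank_one (P f)" and f: "f \<in> E" "f \<notin> R"
  shows "subquot_iso {n \<in> coord_space (PiE E (\<lambda>_. UNIV)). \<forall>g\<in>insert f R. app (slot g (P g)) n = n} {0}
    {n \<in> coord_space (PiE (E - {f}) (\<lambda>_. UNIV)). \<forall>g\<in>R. app (slot g (P g)) n = n} {0}"
proof -
  obtain u \<phi> where Pf: "P f = ketbra u \<phi>" and u: "(\<Sum>i\<in>UNIV. \<phi> i * u i) = 1"
    using P unfolding rank_one_def by blast
  \<comment> \<open>Index functions are \<open>undefined\<close> outside their domain, so on the
    smaller space the coordinate at \<open>f\<close> must be \<open>undefined\<close>; this is an
    ordinary value of the finite type, which is why it has to be tested.\<close>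
  define G where "G = (\<lambda>n x. if x f = undefined then \<Sum>i\<in>UNIV. \<phi> i * (n :: ('e \<Rightarrow> 'm) \<Rightarrow> 'k) (x(f := i)) else 0)"
  define K where "K = (\<lambda>m x. u (x f) * (m :: ('e \<Rightarrow> 'm) \<Rightarrow> 'k) (x(f := undefined)))"
  have lG: "lin_map G" unfolding G_def by (rule lin_mapI) (auto simp: fscale_apply sum.distrib distrib_left sum_distrib_left mult_ac)
  have lK: "lin_map K" unfolding K_def by (rule lin_mapI) (auto simp: fscale_apply distrib_left mult_ac)
  have ext: "x \<in> PiE A (\<lambda>_. UNIV) \<longleftrightarrow> x \<in> extensional A" for A and x :: "'e \<Rightarrow> 'm" by (simp add: PiE_def)
  have GK: "G (K m) = m" if "m \<in> coord_space (PiE (E - {f}) (\<lambda>_. UNIV))" for m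
  proof
    fix x
    show "G (K m) x = m x"
    proof (cases "x f = undefined")
      case True
      then have "x(f := undefined) = x" by (metis fun_upd_triv)
      then show ?thesis using True u by (simp add: G_def K_def mult.assoc[symmetric] sum_distrib_right[symmetric])
    next
      case False
      then have "x \<notin> extensional (E - {f})" by (auto simp: extensional_def)
      then have "m x = 0" using that by (simp add: coord_space_def ext)
      then show ?thesis using False by (simp add: G_def)
    qed
  qed
  have P_eq: "app (slot f (P f)) n = K (G n)" for n
    by (simp add: app_slot at_edge_def Pf app_ketbra fscale_apply K_def G_def fun_eq_iff mult.commute)
  have Gs: "G (app (slot g A) n) = app (slot g A) (G n)" if "g \<noteq> f" for g A n
  proof
    fix x
    have l: "lin_map (app A)" by (rule lin_map_app)
    have "app A (\<lambda>i. 0) = 0" by (rule lin_map_zero_fun[OF l])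
    moreover have "(\<Sum>i\<in>UNIV. \<phi> i * app A (\<lambda>j. n (x(f := i, g := j))) (x g)) = app A (\<lambda>j. \<Sum>i\<in>UNIV. \<phi> i * n (x(f := i, g := j))) (x g)"
    proof -
      have "(\<lambda>j. \<Sum>i\<in>UNIV. \<phi> i * n (x(f := i, g := j))) = (\<Sum>i\<in>UNIV. \<phi> i *\<^sub>v (\<lambda>j. n (x(f := i, g := j))))"
        by (simp add: fun_eq_iff sum_fun_apply fscale_apply)
      then show ?thesis by (simp add: lin_map_sum[OF l] lin_map_scale[OF l] sum_fun_apply fscale_apply)
    qed
    ultimately show "G (app (slot g A) n) x = app (slot g A) (G n) x"
      using that by (simp add: app_slot at_edge_def G_def fun_upd_twist[OF that])
  qed
  have Ks: "K (app (slot g A) n) = app (slot g A) (K n)" if "g \<noteq> f" for g A n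
  proof
    fix x
    have l: "lin_map (app A)" by (rule lin_map_app)
    have "(\<lambda>j. u (x f) * n (x(f := undefined, g := j))) = u (x f) *\<^sub>v (\<lambda>j. n (x(f := undefined, g := j)))"
      by (simp add: fun_eq_iff fscale_apply)
    then show "K (app (slot g A) n) x = app (slot g A) (K n) x"
      using that by (simp add: app_slot at_edge_def K_def fun_upd_twist[OF that] lin_map_scale[OF l] fscale_apply)
  qed
  have gf: "g \<noteq> f" if "g \<in> R" for g using that f by blast
  show ?thesis
  proof (rule subquot_iso_bij[OF lG, where K = K])
    fix v assume v: "v \<in> {n \<in> coord_space (PiE E (\<lambda>_. UNIV)). \<forall>g\<in>insert f R. app (slot g (P g)) n = n}"
    then have fix_v: "app (slot g (P g)) v = v" if "g \<in> insert f R" for g using that by blast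
    show "v = 0" if "G v = 0"
      using P_eq[of v] that fix_v[of f] lin_map_0[OF lK] by simp
    have "app (slot g (P g)) (G v) = G v" if "g \<in> R" for g
      using Gs[OF gf[OF that], of "P g" v] fix_v[of g] that by simp
    moreover have "G v \<in> coord_space (PiE (E - {f}) (\<lambda>_. UNIV))"
    proof -
      have "G v x = 0" if x: "x \<notin> extensional (E - {f})" for x
      proof (cases "x f = undefined")
        case True
        then have "x(f := i) \<notin> extensional E" for i using x by (auto simp: extensional_def)
        then have "v (x(f := i)) = 0" for i using v by (simp add: coord_space_def ext)
        then show ?thesis by (simp add: G_def)
      qed (simp add: G_def)
      then show ?thesis by (simp add: coord_space_def ext)
    qed
    ultimately show "G v \<in> {n \<in> coord_space (PiE (E - {f}) (\<lambda>_. UNIV)). \<forall>g\<in>R. app (slot g (P g)) n = n}" by blast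
  next
    fix m assume m: "m \<in> {n \<in> coord_space (PiE (E - {f}) (\<lambda>_. UNIV)). \<forall>g\<in>R. app (slot g (P g)) n = n}"
    then have GKm: "G (K m) = m" using GK by blast
    have "app (slot g (P g)) (K m) = K m" if "g \<in> R" for g
      using Ks[OF gf[OF that], of "P g" m] m that by simp
    moreover have "app (slot f (P f)) (K m) = K m" by (simp add: P_eq GKm)
    moreover have "K m x = 0" if x: "x \<notin> extensional E" for x
    proof -
      have "x(f := undefined) \<notin> extensional (E - {f})" using x f by (auto simp: extensional_def)
      then show ?thesis using m by (simp add: K_def coord_space_def ext)
    qed
    ultimately show "K m \<in> {n \<in> coord_space (PiE E (\<lambda>_. UNIV)). \<forall>g\<in>insert f R. app (slot g (P g)) n = n} \<and> G (K m) = m"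
      using GKm by (simp add: coord_space_def ext)
  qed
qed

lemma subquot_iso_rank_ones:
  fixes P :: "'e \<Rightarrow> ('m::finite, 'k::field) lop"
  assumes "finite R" "R \<subseteq> E" "\<And>f. f \<in> R \<Longrightarrow> rank_one (P f)"
  shows "subquot_iso {n \<in> coord_space (PiE E (\<lambda>_. UNIV)). \<forall>f\<in>R. app (slot f (P f)) n = n} {0}
    (coord_space (PiE (E - R) (\<lambda>_. UNIV)) :: (('e \<Rightarrow> 'm) \<Rightarrow> 'k) set) {0}"
  using assms
proof (induction R arbitrary: E)
  case (insert f R)
  have "R \<subseteq> E - {f}" using insert by blast
  then have 1: "subquot_iso {n \<in> coord_space (PiE (E - {f}) (\<lambda>_. UNIV)). \<forall>g\<in>R. app (slot g (P g)) n = n} {0}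
      (coord_space (PiE (E - {f} - R) (\<lambda>_. UNIV)) :: (('e \<Rightarrow> 'm) \<Rightarrow> 'k) set) {0}"
    by (rule insert.IH) (use insert.prems in auto)
  have 2: "E - {f} - R = E - insert f R" by blast
  show ?case by (rule subquot_iso_trans[OF subquot_iso_rank_one 1[unfolded 2]]) (use insert.prems insert.hyps in auto)
qed (simp add: subquot_iso_refl)

context half_edge_ops
begin

text \<open>Each round removes one site and two edges. The projections are only collected, as a
  family indexed by the removed edges, and their factors are split off afterwards: in this way all
  operators live on one function space throughout the induction.\<close>

lemma reduce_to_point:
  assumes "stable D' X" "D' \<subseteq> D" "config \<iota> I D' vl fl" "c0 \<in> I"
  shows "\<exists>D'' vl' fl' P. D'' \<subseteq> D' \<and> config \<iota> {c0} D'' vl' fl' \<and> (\<forall>f\<in>edge ` D' - edge ` D''. rank_one (P f)) \<and>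
    card (edge ` D') = card (edge ` D'') + 2 * (card I - 1) \<and>
    subquot_iso (Inv X I c0 fl) (Rel X I c0 vl) {n \<in> X. \<forall>f\<in>edge ` D' - edge ` D''. app (slot f (P f)) n = n} {0}"
  using assms
proof (induction "card I" arbitrary: I D' X vl fl)
  case 0
  then show ?case by (auto simp: config_def)
next
  case (Suc m)
  have fI: "finite I" using Suc.prems(3) by (simp add: config_def)
  show ?case
  proof (cases "I = {c0}")
    case True
    have "Inv X I c0 fl = X" "Rel X I c0 vl = {0}" by (auto simp: Inv_def Rel_def True)
    then show ?thesis using Suc.prems True by (intro exI[of _ D'] exI[of _ vl] exI[of _ fl]) (simp add: subquot_iso_refl)
  next
    case False
    then obtain c where c: "c \<in> I" "c \<noteq> c0" using Suc.prems(4) by blast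
    obtain vl1 fl1 e where 1: "config \<iota> I D' vl1 fl1" "sq X I c0 vl fl vl1 fl1" "vl1 c = [e]"
      using normalize_vertex[OF Suc.prems c] by blast
    obtain vl2 fl2 y where 2: "config \<iota> I D' vl2 fl2" "sq X I c0 vl1 fl1 vl2 fl2" "vl2 c = [e]" "fl2 c = [e, y, \<iota> e]" "\<iota> y \<notin> set (fl2 c)"
      using normalize_face[OF Suc.prems(1,2) 1(1) Suc.prems(4) c 1(3)] by blast
    obtain P Q vl3 fl3 where PQ: "rank_one P" "rank_one Q" and ey: "e \<in> D'" "y \<in> D'" "edge e \<noteq> edge y"
      and 3: "let D'' = D' - {e, \<iota> e, y, \<iota> y}; X' = {n \<in> X. app (slot (edge e) P) n = n \<and> app (slot (edge y) Q) n = n} in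
      config \<iota> (I - {c}) D'' vl3 fl3 \<and> stable D'' X' \<and>
      subquot_iso (Inv X I c0 fl2) (Rel X I c0 vl2) (Inv X' (I - {c}) c0 fl3) (Rel X' (I - {c}) c0 vl3)"
      using reduction[OF Suc.prems(1,2) 2(1) c 2(3-5)] by blast
    define D1 where "D1 = D' - {e, \<iota> e, y, \<iota> y}"
    define X1 where "X1 = {n \<in> X. app (slot (edge e) P) n = n \<and> app (slot (edge y) Q) n = n}"
    have 4: "config \<iota> (I - {c}) D1 vl3 fl3" "stable D1 X1"
      "subquot_iso (Inv X I c0 fl2) (Rel X I c0 vl2) (Inv X1 (I - {c}) c0 fl3) (Rel X1 (I - {c}) c0 vl3)"
      using 3 unfolding D1_def X1_def Let_def by auto
    have m: "m = card (I - {c})" using Suc(2) c fI by simp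
    have "D1 \<subseteq> D" "c0 \<in> I - {c}" using Suc.prems c by (auto simp: D1_def)
    then obtain D'' vl' fl' R where IH: "D'' \<subseteq> D1" "config \<iota> {c0} D'' vl' fl'" "\<forall>f\<in>edge ` D1 - edge ` D''. rank_one (R f)"
      "card (edge ` D1) = card (edge ` D'') + 2 * (card (I - {c}) - 1)"
      "subquot_iso (Inv X1 (I - {c}) c0 fl3) (Rel X1 (I - {c}) c0 vl3) {n \<in> X1. \<forall>f\<in>edge ` D1 - edge ` D''. app (slot f (R f)) n = n} {0}"
      using Suc.hyps(1)[OF m 4(2) _ 4(1)] by blast
    have edges: "edge ` D' = insert (edge e) (insert (edge y) (edge ` D1))"
    proof -
      have "\<iota> e \<in> D'" "\<iota> y \<in> D'" "edge (\<iota> e) = edge e" "edge (\<iota> y) = edge y"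
        using ey Suc.prems(2,3) edge_iota by (auto simp: config_def)
      then have "D' = {e, \<iota> e, y, \<iota> y} \<union> D1" using ey by (auto simp: D1_def)
      then show ?thesis using \<open>edge (\<iota> e) = edge e\<close> \<open>edge (\<iota> y) = edge y\<close> by auto
    qed
    have new: "edge e \<notin> edge ` D1" "edge y \<notin> edge ` D1"
    proof -
      have "edge k \<noteq> edge e \<and> edge k \<noteq> edge y" if "k \<in> D1" for k
        using that edge_eq[of e k] edge_eq[of y k] ey Suc.prems(2) by (auto simp: D1_def)
      then show "edge e \<notin> edge ` D1" "edge y \<notin> edge ` D1" by (metis imageE)+
    qed
    have new': "edge e \<notin> edge ` D''" "edge y \<notin> edge ` D''" using new IH(1) by blast+
    define P' where "P' = R(edge e := P, edge y := Q)"
    have P': "P' (edge e) = P" "P' (edge y) = Q" "f \<in> edge ` D1 \<Longrightarrow> P' f = R f" for f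
      using ey(3) new unfolding P'_def by (simp_all, metis)
    have diff: "edge ` D' - edge ` D'' = insert (edge e) (insert (edge y) (edge ` D1 - edge ` D''))"
      using new' by (simp add: edges insert_Diff_if)
    have fD: "finite (edge ` D1)"
    proof -
      have "parts I vl D'" using Suc.prems(3) by (simp add: config_def)
      then have "finite D'" using fI by (auto simp: parts_def)
      then show ?thesis by (simp add: D1_def)
    qed
    have "card (edge ` D') = card (edge ` D'') + 2 * (card I - 1)"
    proof -
      \<comment> \<open>\<open>c0\<close> remains, so the subtractions of natural numbers in the
        count of edges do not truncate.\<close>
      have "card (I - {c}) \<ge> 1" using \<open>c0 \<in> I - {c}\<close> fI by (simp add: Suc_le_eq card_gt_0_iff) blast
      then show ?thesis unfolding edges using new ey(3) fD IH(4) m Suc(2) by simp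
    qed
    moreover have "{n \<in> X1. \<forall>f\<in>edge ` D1 - edge ` D''. app (slot f (R f)) n = n} = {n \<in> X. \<forall>f\<in>edge ` D' - edge ` D''. app (slot f (P' f)) n = n}"
    proof -
      have "(\<forall>f\<in>edge ` D1 - edge ` D''. app (slot f (P' f)) n = n) = (\<forall>f\<in>edge ` D1 - edge ` D''. app (slot f (R f)) n = n)" for n
        by (rule ball_cong) (use P'(3) in \<open>simp_all del: image_iff\<close>)
      then show ?thesis unfolding diff X1_def ball_simps P'(1,2) by auto
    qed
    moreover have "\<forall>f\<in>edge ` D' - edge ` D''. rank_one (P' f)"
      unfolding diff using P' PQ IH(3) by (metis DiffD1 insertE)
    moreover have "D'' \<subseteq> D'" using IH(1) by (auto simp: D1_def)
    moreover have "subquot_iso (Inv X I c0 fl) (Rel X I c0 vl) {n \<in> X1. \<forall>f\<in>edge ` D1 - edge ` D''. app (slot f (R f)) n = n} {0}"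
      by (rule subquot_iso_trans[OF subquot_iso_trans[OF subquot_iso_trans[OF 1(2) 2(2)] 4(3)] IH(5)])
    ultimately show ?thesis
      using IH(2) by (intro exI[of _ D''] exI[of _ vl'] exI[of _ fl'] exI[of _ P'] conjI) simp_all
  qed
qed

lemma stable_coord_space: "stable D (coord_space (PiE (edge ` D) (\<lambda>_. UNIV)))"
proof -
  let ?X = "coord_space (PiE (edge ` D) (\<lambda>_. UNIV)) :: (('e \<Rightarrow> 'b) \<Rightarrow> 'k) set"
  have "fun_vs.subspace ?X" by (auto simp: fun_vs.subspace_def coord_space_def fscale_apply)
  moreover have "slot (edge h) A \<in> pres ?X" if "h \<in> D" for h A
  proof -
    have "app A (\<lambda>i. 0) = 0" by (rule lin_map_zero_fun[OF lin_map_app])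
    then have "app (slot (edge h) A) n x = 0" if n: "n \<in> ?X" and x: "x \<notin> PiE (edge ` D) (\<lambda>_. UNIV)" for n x
    proof -
      have "x(edge h := i) \<notin> PiE (edge ` D) (\<lambda>_. UNIV)" for i
        using x \<open>h \<in> D\<close> by (auto simp: PiE_def extensional_def)
      then have "n (x(edge h := i)) = 0" for i using n unfolding coord_space_def by blast
      then show ?thesis using \<open>app A (\<lambda>i. 0) = 0\<close> by (simp add: app_slot at_edge_def)
    qed
    then show ?thesis by (auto simp: pres_def coord_space_def)
  qed
  ultimately show ?thesis by (simp add: stable_def)
qed

lemma reduce_to_coord_space:
  assumes "finite D" "config \<iota> I D vl fl" "c0 \<in> I"
  shows "\<exists>D'' vl' fl'. D'' \<subseteq> D \<and> config \<iota> {c0} D'' vl' fl' \<and>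
    card (edge ` D) = card (edge ` D'') + 2 * (card I - 1) \<and>
    subquot_iso (Inv (coord_space (PiE (edge ` D) (\<lambda>_. UNIV))) I c0 fl) (Rel (coord_space (PiE (edge ` D) (\<lambda>_. UNIV))) I c0 vl)
      (coord_space (PiE {..<card (edge ` D'')} (\<lambda>_. UNIV :: 'b set)) :: ((nat \<Rightarrow> 'b) \<Rightarrow> 'k) set) {0}"
proof -
  let ?X = "coord_space (PiE (edge ` D) (\<lambda>_. UNIV)) :: (('e \<Rightarrow> 'b) \<Rightarrow> 'k) set"
  have "stable D ?X" by (rule stable_coord_space)
  then obtain D'' vl' fl' P where D'': "D'' \<subseteq> D" "config \<iota> {c0} D'' vl' fl'"
    "\<forall>f\<in>edge ` D - edge ` D''. rank_one (P f)" "card (edge ` D) = card (edge ` D'') + 2 * (card I - 1)"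
    and S: "subquot_iso (Inv ?X I c0 fl) (Rel ?X I c0 vl) {n \<in> ?X. \<forall>f\<in>edge ` D - edge ` D''. app (slot f (P f)) n = n} {0}"
    using reduce_to_point[OF \<open>stable D ?X\<close> subset_refl assms(2,3)] by (elim exE conjE) (rule that)
  have E: "edge ` D - (edge ` D - edge ` D'') = edge ` D''" using D''(1) by blast
  have S2: "subquot_iso {n \<in> ?X. \<forall>f\<in>edge ` D - edge ` D''. app (slot f (P f)) n = n} {0}
    (coord_space (PiE (edge ` D'') (\<lambda>_. UNIV)) :: (('e \<Rightarrow> 'b) \<Rightarrow> 'k) set) {0}"
  proof -
    have "subquot_iso {n \<in> ?X. \<forall>f\<in>edge ` D - edge ` D''. app (slot f (P f)) n = n} {0}
        (coord_space (PiE (edge ` D - (edge ` D - edge ` D'')) (\<lambda>_. UNIV)) :: (('e \<Rightarrow> 'b) \<Rightarrow> 'k) set) {0}"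
      by (rule subquot_iso_rank_ones) (use D''(3) assms(1) in auto)
    then show ?thesis unfolding E .
  qed
  have f: "finite (edge ` D'')" using D''(1) assms(1) finite_subset by blast
  \<comment> \<open>Only the number of remaining edges matters: index sets of equal finite size give
    a bijection of the bases.\<close>
  have "card (PiE {..<card (edge ` D'')} (\<lambda>_. UNIV :: 'b set)) = card (PiE (edge ` D'') (\<lambda>_. UNIV :: 'b set))"
    using f by (simp add: card_PiE)
  then obtain h where "bij_betw h (PiE {..<card (edge ` D'')} (\<lambda>_. UNIV :: 'b set)) (PiE (edge ` D'') (\<lambda>_. UNIV :: 'b set))"
    using f finite_same_card_bij by (metis finite finite_PiE finite_lessThan)
  from subquot_iso_trans[OF subquot_iso_trans[OF S S2] subquot_iso_coord_space[OF this]] show ?thesis using D'' by blast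
qed

end

section \<open>Permutations\<close>

lemma sign_cycle_of_list: "distinct cs \<Longrightarrow> sign (cycle_of_list cs) = (- 1) ^ (length cs - 1)"
proof (induction cs rule: cycle_of_list.induct)
  case (1 i j cs)
  then have "i \<noteq> j" by simp
  then show ?case
    using 1 unfolding cycle_of_list.simps by (subst sign_compose[OF permutation_swap_id permutation_of_cycle]) (simp add: sign_swap_id)
qed simp_all

text \<open>Induction on \<open>D\<close>, splitting off the transposition of one point with its
  image.\<close>

lemma sign_involution:
  assumes "finite D" "\<And>x. x \<in> D \<Longrightarrow> j x \<in> D \<and> j (j x) = x \<and> j x \<noteq> x" "\<And>x. x \<notin> D \<Longrightarrow> j x = x"
  shows "\<exists>m. card D = 2 * m \<and> permutation j \<and> sign j = (- 1) ^ m"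
  using assms
proof (induction "card D" arbitrary: D j rule: less_induct)
  case less
  show ?case
  proof (cases "D = {}")
    case True
    then have "j = id" using less.prems(3) by auto
    then show ?thesis using True by auto
  next
    case False
    then obtain x where x: "x \<in> D" by blast
    define D' where "D' = D - {x, j x}"
    define j' where "j' = (\<lambda>y. if y \<in> D' then j y else y)"
    have jx: "j x \<in> D" "j (j x) = x" "j x \<noteq> x" using less.prems(2)[OF x] by auto
    have c: "card D = card D' + 2"
    proof -
      have "{x, j x} \<subseteq> D" "card {x, j x} = 2" using x jx by auto
      then show ?thesis using less.prems(1) card_Diff_subset[of "{x, j x}" D] card_mono[of D "{x, j x}"] by (simp add: D'_def)
    qed
    have "j' y \<in> D' \<and> j' (j' y) = y \<and> j' y \<noteq> y" if "y \<in> D'" for y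
      using that less.prems(2)[of y] jx by (auto simp: D'_def j'_def)
    moreover have "j' y = y" if "y \<notin> D'" for y using that by (simp add: j'_def)
    ultimately obtain m where m: "card D' = 2 * m" "permutation j'" "sign j' = (- 1) ^ m"
      using less.hyps[of D' j'] c less.prems(1) by (auto simp: D'_def)
    have j: "j = transpose x (j x) \<circ> j'"
    proof
      fix y
      have "j y \<noteq> x" "j y \<noteq> j x" if "y \<in> D'" using that less.prems(2)[of y] jx by (auto simp: D'_def)
      then show "j y = (transpose x (j x) \<circ> j') y"
        using less.prems(3)[of y] jx by (cases "y \<in> D'") (auto simp: j'_def D'_def transpose_def)
    qed
    have "permutation j" by (subst j) (intro permutation_compose permutation_swap_id m)
    moreover have "sign j = (- 1) ^ Suc m"
      using jx(3) by (subst j, subst sign_compose[OF permutation_swap_id m(2)]) (simp add: sign_swap_id m(3))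
    ultimately show ?thesis using c m(1) by (intro exI[of _ "Suc m"]) simp
  qed
qed

lemma adj_zip: "adj l x y \<longleftrightarrow> (x, y) \<in> set (zip l (tl l))"
  by (induction l x y rule: adj.induct) auto

lemma adj_map:
  assumes "tl cs @ [z] = map f cs" "cs \<noteq> []"
  shows "adj (cs @ [z]) x y \<longleftrightarrow> x \<in> set cs \<and> y = f x"
proof -
  have "zip (cs @ [z]) (tl (cs @ [z])) = zip cs (map f cs)"
    using assms by (simp add: zip_append1)
  also have "\<dots> = map (\<lambda>x. (x, f x)) cs" by (induction cs) auto
  finally show ?thesis by (auto simp: adj_zip)
qed

lemma adj_cycle_of_list:
  assumes "distinct (a # l)"
  shows "adj (a # l @ [a]) x y \<longleftrightarrow> x \<in> set (a # l) \<and> y = cycle_of_list (a # l) x"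
proof -
  have "tl (a # l) @ [a] = map (cycle_of_list (a # l)) (a # l)" using cyclic_rotation[OF assms, of 1] by simp
  from adj_map[OF this] show ?thesis by simp
qed

text \<open>
  With one site, vertex and face are two cycles of equal length, whose product is the involution;
  hence the involution is an even permutation.
\<close>

lemma even_half_edges:
  assumes C: "config \<iota> {c} D vl fl"
  shows "\<exists>m. card D = 4 * m"
proof -
  \<comment> \<open>The site is adjoined to both cycles as one more element, so that compatibility
    becomes an equation of permutations without exceptions, with the site as a fixed point of the
    involution.\<close>
  let ?P = "cycle_of_list (Inr c # map Inl (vl c)) :: 'a + 'b \<Rightarrow> _"
  let ?Q = "cycle_of_list (Inr c # map Inl (fl c)) :: 'a + 'b \<Rightarrow> _"
  let ?j = "?P \<circ> ?Q"
  have p: "distinct (vl c)" "distinct (fl c)" "set (vl c) = D" "set (fl c) = D"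
    using C by (auto simp: config_def parts_def)
  have d: "distinct (Inr c # map Inl (vl c) :: ('a + 'b) list)" "distinct (Inr c # map Inl (fl c) :: ('a + 'b) list)"
    using p by (auto simp: distinct_map)
  have V: "succs {c} vl u w \<longleftrightarrow> u \<in> insert (Inr c) (Inl ` D) \<and> w = ?P u" for u w
    using adj_cycle_of_list[OF d(1)] p by (simp add: succs_def ext_def)
  have F: "succs {c} fl u w \<longleftrightarrow> u \<in> insert (Inr c) (Inl ` D) \<and> w = ?Q u" for u w
    using adj_cycle_of_list[OF d(2)] p by (simp add: succs_def ext_def)
  have PQ: "?j u = map_sum \<iota> id u" if "u \<in> insert (Inr c) (Inl ` D)" for u
  proof -
    have "succs {c} vl (?Q u) (map_sum \<iota> id u)"
      using C that F[of u "?Q u"] by (auto simp: config_def compat_def)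
    then show ?thesis unfolding V by simp
  qed
  have "?j x \<in> Inl ` D \<and> ?j (?j x) = x \<and> ?j x \<noteq> x" if "x \<in> Inl ` D" for x
  proof -
    obtain h where h: "x = Inl h" "h \<in> D" using \<open>x \<in> Inl ` D\<close> by blast
    then have i: "\<iota> h \<in> D" "\<iota> (\<iota> h) = h" "\<iota> h \<noteq> h" using C by (auto simp: config_def)
    then show ?thesis using h PQ[of x] PQ[of "Inl (\<iota> h)"] by (auto simp del: cycle_of_list.simps)
  qed
  moreover have "?j x = x" if "x \<notin> Inl ` D" for x
  proof (cases "x = Inr c")
    case True
    then show ?thesis using PQ[of x] by (simp del: cycle_of_list.simps)
  next
    case False
    then have "x \<notin> set (Inr c # map Inl (vl c))" "x \<notin> set (Inr c # map Inl (fl c))" using that p by auto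
    then show ?thesis by (simp add: id_outside_supp del: cycle_of_list.simps)
  qed
  moreover have "finite (Inl ` D :: ('a + 'b) set)" using p(3) by (metis List.finite_set finite_imageI)
  ultimately obtain m where m: "card (Inl ` D :: ('a + 'b) set) = 2 * m" "sign ?j = (- 1) ^ m"
    using sign_involution[of "Inl ` D" ?j] by blast
  have D: "card D = 2 * m" using m(1) by (simp add: card_image)
  have "length (vl c) = card D" "length (fl c) = card D" using p by (metis distinct_card)+
  then have "sign ?j = 1"
    using sign_compose[OF permutation_of_cycle permutation_of_cycle, of "Inr c # map Inl (vl c)" "Inr c # map Inl (fl c)"]
      sign_cycle_of_list[OF d(1)] sign_cycle_of_list[OF d(2)] by (simp del: cycle_of_list.simps flip: power_add)
  then have "even m" using m(2) by (metis neg_one_odd_power one_neq_neg_one)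
  then show ?thesis using D by (auto elim!: evenE)
qed

text \<open>Every edge has two half-edges, so a number of half-edges divisible by four means an even
  number of edges.\<close>

lemma (in half_edge_ops) card_edges:
  assumes "config \<iota> {c} D' vl fl" "D' \<subseteq> D"
  shows "even (card (edge ` D'))"
proof -
  have "\<forall>h\<in>D'. \<iota> h \<in> D'" using assms(1) by (auto simp: config_def)
  have fin: "finite D'" using assms(1) by (auto simp: config_def parts_def)
  have "card D' = (\<Sum>f\<in>edge ` D'. card {h \<in> D'. edge h = f})"
  proof -
    have "card D' = card (\<Union>f\<in>edge ` D'. {h \<in> D'. edge h = f})" by (rule arg_cong[of _ _ card]) auto
    also have "\<dots> = (\<Sum>f\<in>edge ` D'. card {h \<in> D'. edge h = f})"
      using fin by (intro card_UN_disjoint) auto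
    finally show ?thesis .
  qed
  also have "\<dots> = (\<Sum>f\<in>edge ` D'. 2)"
  proof (rule sum.cong[OF refl])
    fix f assume "f \<in> edge ` D'"
    then obtain h where h: "h \<in> D'" "f = edge h" by blast
    then have "{k \<in> D'. edge k = f} = {h, \<iota> h}"
      using edge_eq[of h] edge_iota[of h] assms(2) \<open>\<forall>h\<in>D'. \<iota> h \<in> D'\<close> by auto
    then show "card {k \<in> D'. edge k = f} = 2" using iota_neq[of h] h assms(2) by auto
  qed
  finally show ?thesis using even_half_edges[OF assms(1)] by auto
qed


section \<open>The configuration of a Kitaev graph\<close>

lemma cycle_list:
  assumes "f permutes D" "finite D"
  shows "distinct (cycle_list f x)" "set (cycle_list f x) = orbit f x"
    "map f (cycle_list f x) = tl (cycle_list f x) @ [x]" "cycle_list f x = x # tl (cycle_list f x)"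
proof -
  have s: "x \<in> orbit f x" using permutation_self_in_orbit permutation_permutes assms by metis
  define d where "d = funpow_dist1 f x x"
  have o: "orbit f x = (\<lambda>n. (f ^^ n) x) ` {0..<d}" unfolding d_def by (rule orbit_conv_funpow_dist1[OF s])
  have i: "inj_on (\<lambda>n. (f ^^ n) x) {0..<d}" unfolding d_def by (rule inj_on_funpow_dist1[OF s])
  have card: "card (orbit f x) = d" unfolding o using card_image[OF i] by simp
  have fd: "(f ^^ d) x = x" unfolding d_def by (rule funpow_dist1_prop[OF s])
  have l: "cycle_list f x = map (\<lambda>r. (f ^^ r) x) [0..<d]" by (simp add: cycle_list_def card)
  show "distinct (cycle_list f x)" using i by (simp add: l distinct_map)
  show "set (cycle_list f x) = orbit f x" by (simp add: l o)
  have d: "d = Suc (d - 1)" by (simp add: d_def)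
  have u: "[0..<d] = 0 # map Suc [0..<d - 1]" by (subst d) (simp add: upt_conv_Cons map_Suc_upt del: upt_Suc)
  show x: "cycle_list f x = x # tl (cycle_list f x)" by (simp add: l u)
  have "map f (cycle_list f x) = map (\<lambda>r. (f ^^ r) x) (map Suc [0..<d])" by (simp add: l)
  also have "map Suc [0..<d] = map Suc [0..<d - 1] @ [d]" by (subst d, subst d) simp
  finally show "map f (cycle_list f x) = tl (cycle_list f x) @ [x]" by (simp add: l u fd)
qed

text \<open>Covers vertices and faces at once: cycles of rho started at the cilia, and cycles of the
  face permutation started at rho^-1 of the cilia.\<close>

locale cycle_family =
  fixes f :: "'h \<Rightarrow> 'h" and D and C :: "'c set" and s :: "'c \<Rightarrow> 'h"
  assumes perm: "f permutes D" and fin: "finite D" and start: "s ` C \<subseteq> D"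
    and inj: "inj_on (\<lambda>c. orbit f (s c)) C" and cover: "D \<subseteq> (\<Union>c\<in>C. orbit f (s c))"
begin

abbreviation "l \<equiv> \<lambda>c. cycle_list f (s c)"

lemma self: "x \<in> orbit f x"
  using permutation_self_in_orbit permutation_permutes perm fin by metis

lemma orbit_eq: "x \<in> orbit f y \<Longrightarrow> orbit f x = orbit f y"
  using orbit_cyclic_eq3[OF cyclic_on_orbit[OF perm fin]] by metis

lemma orbit_D: "c \<in> C \<Longrightarrow> orbit f (s c) \<subseteq> D"
  using permutes_orbit_subset[OF perm] start by blast

lemma same: "c \<in> C \<Longrightarrow> d \<in> C \<Longrightarrow> x \<in> orbit f (s c) \<Longrightarrow> x \<in> orbit f (s d) \<Longrightarrow> c = d"
  using inj orbit_eq by (metis inj_onD)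

lemma parts: "parts C l D"
proof -
  have "(\<Union>c\<in>C. orbit f (s c)) = D" using orbit_D cover by blast
  then show ?thesis using same unfolding parts_def cycle_list(2)[OF perm fin]
    by (auto simp: cycle_list(1)[OF perm fin])
qed

lemma start_inj: "inj_on s C"
  using same self by (metis inj_onI)

text \<open>A site sits just in front of its starting point: the step from \<open>h\<close> to
  \<open>f h\<close> meets a site exactly if \<open>f h\<close> is a starting point.\<close>

lemma succs: "succs C l u w \<longleftrightarrow> (case u of Inr c \<Rightarrow> c \<in> C \<and> w = Inl (s c)
    | Inl h \<Rightarrow> h \<in> D \<and> w = (if f h \<in> s ` C then Inr (inv_into C s (f h)) else Inl (f h)))"
proof -
  have A: "adj (ext c (l c)) u w \<longleftrightarrow> (case u of Inr d \<Rightarrow> d = c \<and> w = Inl (s c)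
    | Inl h \<Rightarrow> h \<in> orbit f (s c) \<and> w = (if f h = s c then Inr c else Inl (f h)))" if "c \<in> C" for c
  proof -
    define g where "g = (\<lambda>u :: 'h + 'c. case u of Inr d \<Rightarrow> Inl (s c) | Inl h \<Rightarrow> (if f h = s c then Inr c else Inl (f h)))"
    note cl = cycle_list[OF perm fin, of "s c"]
    have "s c \<notin> set (tl (l c))" using cl(1,4) by (metis distinct.simps(2))
    then have "map Inl (tl (l c)) @ [Inr c] = map (\<lambda>y. if y = s c then Inr c else Inl y) (map f (l c))"
      unfolding cl(3) by auto
    moreover have "map Inl (l c) = Inl (s c) # map Inl (tl (l c))" by (subst cl(4)) simp
    ultimately have "map Inl (l c) @ [Inr c] = Inl (s c) # map (\<lambda>y. if y = s c then Inr c else Inl y) (map f (l c))"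
      by (metis append_Cons)
    then have "tl (Inr c # map Inl (l c)) @ [Inr c] = map g (Inr c # map Inl (l c))"
      by (simp add: g_def comp_def)
    from adj_map[OF this] show ?thesis by (auto simp: ext_def cl(2) g_def split: sum.splits)
  qed
  show ?thesis
  proof (cases u)
    case (Inr c)
    then show ?thesis using A by (auto simp: succs_def)
  next
    case (Inl h)
    show ?thesis
    proof (cases "h \<in> D")
      case True
      then obtain c where c: "c \<in> C" "h \<in> orbit f (s c)" using cover by blast
      have "f h \<in> orbit f (s c)" using c(2) by (rule orbit.step)
      then have fh: "f h = s d \<longleftrightarrow> d = c \<and> f h = s c" if "d \<in> C" for d
        using same[OF c(1) that, of "f h"] self[of "s d"] by metis
      have "succs C l u w \<longleftrightarrow> w = (if f h = s c then Inr c else Inl (f h))"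
        unfolding succs_def using A c same Inl by (auto split: if_splits)
      also have "\<dots> \<longleftrightarrow> w = (if f h \<in> s ` C then Inr (inv_into C s (f h)) else Inl (f h))"
      proof (cases "f h = s c")
        case True
        then have "inv_into C s (f h) = c" using start_inj c(1) by simp
        then show ?thesis using True c(1) by auto
      next
        case False
        then have "f h \<notin> s ` C" using fh by blast
        then show ?thesis using False by simp
      qed
      finally show ?thesis using True Inl by simp
    next
      case False
      then show ?thesis unfolding succs_def using A orbit_D Inl by auto
    qed
  qed
qed

lemma conn:
  assumes conn: "\<And>U. U \<subseteq> D \<Longrightarrow> U \<noteq> {} \<Longrightarrow> \<iota> ` U \<subseteq> U \<Longrightarrow> f ` U \<subseteq> U \<Longrightarrow> U = D"
  shows "conn \<iota> C l"
  unfolding conn_def cycle_list(2)[OF perm fin]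
proof (intro allI impI)
  fix J assume J: "J \<subseteq> C" "J \<noteq> {}" and i: "\<iota> ` (\<Union>c\<in>J. orbit f (s c)) \<subseteq> (\<Union>c\<in>J. orbit f (s c))"
  let ?U = "\<Union>c\<in>J. orbit f (s c)"
  have "?U = D"
  proof (rule conn[OF _ _ i])
    show "?U \<subseteq> D" using J orbit_D by blast
    show "?U \<noteq> {}" using J self by blast
    show "f ` ?U \<subseteq> ?U" using orbit.step by fastforce
  qed
  then have "c \<in> J" if "c \<in> C" for c
    using that start same[of c] self[of "s c"] J(1) by blast
  then show "J = C" using J(1) by blast
qed

end

locale kitaev = hopf_pair H p \<chi> for H :: "('b::finite, 'k::field) hopf" (structure) and p \<chi> +
  fixes \<Gamma> :: "nat kitaev_graph"
  assumes RK: "\<Gamma> \<in> RK"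
begin

abbreviation "V \<equiv> half_edges \<Gamma>"
abbreviation "C \<equiv> cilia \<Gamma>"
abbreviation "c0 \<equiv> pt \<Gamma>"

lemma graph: "is_kitaev_graph \<Gamma>" and order: "order \<Gamma> = {(h, k). h \<in> V \<and> k \<in> V \<and> h \<le> k}"
  using RK by (auto simp: RK_def)

lemma finite_V: "finite V" and iota_permutes: "iota \<Gamma> permutes V" and rho_permutes: "rho \<Gamma> permutes V"
  and iota: "h \<in> V \<Longrightarrow> iota \<Gamma> (iota \<Gamma> h) = h" "h \<in> V \<Longrightarrow> iota \<Gamma> h \<noteq> h"
  using graph by (auto simp: is_kitaev_graph_def is_ribbon_graph_def)

lemma cilia_V: "C \<subseteq> V" and pt: "c0 \<in> C"
  and vertex_bij: "bij_betw (vertex_of \<Gamma>) C (vertices \<Gamma>)"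
  and face_bij: "bij_betw (\<lambda>c. face_of \<Gamma> (inv (rho \<Gamma>) c)) C (faces \<Gamma>)"
  using graph by (auto simp: is_kitaev_graph_def)

lemma finite_C: "finite C"
  using cilia_V finite_V finite_subset by blast

lemma iota_V: "h \<in> V \<Longrightarrow> iota \<Gamma> h \<in> V" and rho_V: "h \<in> V \<Longrightarrow> rho \<Gamma> h \<in> V" and rho_inv_V: "h \<in> V \<Longrightarrow> inv (rho \<Gamma>) h \<in> V"
  using iota_permutes rho_permutes permutes_inv[OF rho_permutes] by (simp_all add: permutes_in_image)

lemma rho_inv: "rho \<Gamma> (inv (rho \<Gamma>) h) = h" "inv (rho \<Gamma>) (rho \<Gamma> h) = h"
  using permutes_inverses[OF rho_permutes] by simp_all

lemma self_in_edge: "h \<in> edge_of \<Gamma> h"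
  unfolding edge_of_def using permutation_self_in_orbit permutation_permutes iota_permutes finite_V by metis

lemma edge_of: "h \<in> V \<Longrightarrow> edge_of \<Gamma> h = {h, iota \<Gamma> h}"
proof -
  assume h: "h \<in> V"
  have "(iota \<Gamma> ^^ 2) h = h" using iota(1)[OF h] by (simp add: numeral_2_eq_2)
  from orbit_altdef_bounded[OF this] have "edge_of \<Gamma> h = {(iota \<Gamma> ^^ m) h |m. m < 2}" by (simp add: edge_of_def)
  also have "\<dots> = {h, iota \<Gamma> h}" by (auto simp: less_2_cases_iff intro: exI[of _ 0] exI[of _ 1])
  finally show ?thesis .
qed

sublocale half_edge_ops H p \<chi> V "iota \<Gamma>" "is_source \<Gamma>" "edge_of \<Gamma>"
proof unfold_locales
  fix h k assume h: "h \<in> V"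
  show "is_source \<Gamma> (iota \<Gamma> h) \<longleftrightarrow> \<not> is_source \<Gamma> h"
    using h iota_V[OF h] iota[OF h] by (auto simp: is_source_def order)
  show "edge_of \<Gamma> (iota \<Gamma> h) = edge_of \<Gamma> h" using h iota_V[OF h] iota[OF h] by (auto simp: edge_of)
  assume "edge_of \<Gamma> k = edge_of \<Gamma> h"
  then show "k = h \<or> k = iota \<Gamma> h" using self_in_edge[of k] edge_of[OF h] by auto
qed (use iota iota_V in auto)

text \<open>On a finite set, closure under a permutation implies closure under its inverse. The two
  alternatives serve the vertex permutation and the face permutation.\<close>

lemma connected:
  assumes "U \<subseteq> V" "U \<noteq> {}" "iota \<Gamma> ` U \<subseteq> U" "rho \<Gamma> ` U \<subseteq> U \<or> inv (rho \<Gamma>) ` U \<subseteq> U"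
  shows "U = V"
proof -
  have f: "finite U" using assms(1) finite_V finite_subset by blast
  have closed: "\<forall>x\<in>U. g x \<in> U" if "\<And>x. f (g x) = x" "\<And>x. g (f x) = x" "f ` U \<subseteq> U" for f g :: "nat \<Rightarrow> nat"
  proof -
    have "inj_on f U" using that(2) by (metis inj_onI)
    then have "f ` U = U" using endo_inj_surj[OF f that(3)] by blast
    then show ?thesis using that(2) by (metis imageE)
  qed
  have r: "\<forall>x\<in>U. rho \<Gamma> x \<in> U \<and> inv (rho \<Gamma>) x \<in> U"
    using assms(4) closed[of "rho \<Gamma>" "inv (rho \<Gamma>)"] closed[of "inv (rho \<Gamma>)" "rho \<Gamma>"] rho_inv by blast
  obtain h where h: "h \<in> U" using assms(2) by blast
  have "k \<in> U" if "k \<in> V" for k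
  proof -
    have "(h, k) \<in> {(x, y). y = iota \<Gamma> x \<or> y = rho \<Gamma> x \<or> y = inv (rho \<Gamma>) x}\<^sup>*"
      using graph h assms(1) that by (auto simp: is_kitaev_graph_def connected_ribbon_graph_def)
    then show "k \<in> U" using h r assms(3) by (induction rule: rtrancl_induct) auto
  qed
  then show ?thesis using assms(1) by blast
qed

lemma face_perm_permutes: "face_perm \<Gamma> permutes V"
  unfolding face_perm_def by (rule permutes_compose[OF iota_permutes permutes_inv[OF rho_permutes]])

sublocale vertex: cycle_family "rho \<Gamma>" V C "\<lambda>c. c"
proof unfold_locales
  show "inj_on (\<lambda>c. orbit (rho \<Gamma>) c) C" using vertex_bij by (simp add: bij_betw_def vertex_of_def[abs_def])
  have "orbit (rho \<Gamma>) h \<in> orbit (rho \<Gamma>) ` C" if "h \<in> V" for h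
    using vertex_bij that by (auto simp: bij_betw_def vertex_of_def[abs_def] vertices_def)
  moreover have "h \<in> orbit (rho \<Gamma>) h" for h
    using permutation_self_in_orbit permutation_permutes rho_permutes finite_V by metis
  ultimately show "V \<subseteq> (\<Union>c\<in>C. orbit (rho \<Gamma>) c)" by blast
qed (use rho_permutes finite_V cilia_V in auto)

sublocale face: cycle_family "face_perm \<Gamma>" V C "inv (rho \<Gamma>)"
proof unfold_locales
  show "inj_on (\<lambda>c. orbit (face_perm \<Gamma>) (inv (rho \<Gamma>) c)) C" using face_bij by (simp add: bij_betw_def face_of_def[abs_def])
  have "orbit (face_perm \<Gamma>) h \<in> (\<lambda>c. orbit (face_perm \<Gamma>) (inv (rho \<Gamma>) c)) ` C" if "h \<in> V" for h
    using face_bij that by (auto simp: bij_betw_def face_of_def[abs_def] faces_def)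
  moreover have "h \<in> orbit (face_perm \<Gamma>) h" for h
    using permutation_self_in_orbit permutation_permutes face_perm_permutes finite_V by metis
  ultimately show "V \<subseteq> (\<Union>c\<in>C. orbit (face_perm \<Gamma>) (inv (rho \<Gamma>) c))" by blast
qed (use face_perm_permutes finite_V cilia_V rho_inv_V in auto)

lemma config: "config (iota \<Gamma>) C V (vertex_list \<Gamma>) (face_list \<Gamma>)"
proof -
  have v: "vertex_list \<Gamma> = (\<lambda>c. cycle_list (rho \<Gamma>) c)" "face_list \<Gamma> = (\<lambda>c. cycle_list (face_perm \<Gamma>) (inv (rho \<Gamma>) c))"
    by (simp_all add: fun_eq_iff vertex_list_def face_list_def)
  \<comment> \<open>Faces start at rho^-1 of a cilium; therefore the face through \<open>h\<close>
    returns to a site after \<open>h\<close> exactly if the opposite half-edge is a cilium.\<close>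
  have F: "face_perm \<Gamma> h \<in> inv (rho \<Gamma>) ` C \<longleftrightarrow> iota \<Gamma> h \<in> C" "face_perm \<Gamma> h \<in> inv (rho \<Gamma>) ` C \<Longrightarrow> inv_into C (inv (rho \<Gamma>)) (face_perm \<Gamma> h) = iota \<Gamma> h" for h
  proof -
    have i: "inv (rho \<Gamma>) x = inv (rho \<Gamma>) y \<longleftrightarrow> x = y" for x y using rho_inv(1) by metis
    show *: "face_perm \<Gamma> h \<in> inv (rho \<Gamma>) ` C \<longleftrightarrow> iota \<Gamma> h \<in> C" by (auto simp: face_perm_def image_iff i)
    show "inv_into C (inv (rho \<Gamma>)) (face_perm \<Gamma> h) = iota \<Gamma> h" if "face_perm \<Gamma> h \<in> inv (rho \<Gamma>) ` C"
      by (rule inv_into_f_eq[OF face.start_inj]) (use that * in \<open>simp_all add: face_perm_def\<close>)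
  qed
  have "compat (iota \<Gamma>) C V (vertex_list \<Gamma>) (face_list \<Gamma>)"
    unfolding compat_def
  proof (intro ballI allI)
    fix u w assume u: "u \<in> Inl ` V \<union> Inr ` C"
    have id: "inv_into C (\<lambda>c. c) x = x" if "x \<in> C" for x using that by (intro inv_into_f_eq) auto
    have VV: "succs C (vertex_list \<Gamma>) (Inl k) (Inl x) \<longleftrightarrow> k \<in> V \<and> x = rho \<Gamma> k \<and> x \<notin> C"
      "succs C (vertex_list \<Gamma>) (Inl k) (Inr x) \<longleftrightarrow> k \<in> V \<and> x = rho \<Gamma> k \<and> x \<in> C"
      "succs C (vertex_list \<Gamma>) (Inr c) (Inl x) \<longleftrightarrow> c \<in> C \<and> x = c"
      "\<not> succs C (vertex_list \<Gamma>) (Inr c) (Inr d)" for k x c d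
      unfolding v(1) vertex.succs using id by auto
    show "succs C (face_list \<Gamma>) u w \<longleftrightarrow> succs C (vertex_list \<Gamma>) w (map_sum (iota \<Gamma>) id u)"
    proof (cases u)
      case (Inr c)
      then have "succs C (face_list \<Gamma>) u w \<longleftrightarrow> w = Inl (inv (rho \<Gamma>) c)" using u unfolding v(2) face.succs by auto
      also have "\<dots> \<longleftrightarrow> succs C (vertex_list \<Gamma>) w (Inr c)"
        using u Inr rho_inv cilia_V rho_inv_V by (cases w) (auto simp: VV)
      finally show ?thesis using Inr by simp
    next
      case (Inl h)
      then have h: "h \<in> V" using u by auto
      have "succs C (face_list \<Gamma>) u w \<longleftrightarrow> w = (if iota \<Gamma> h \<in> C then Inr (iota \<Gamma> h) else Inl (face_perm \<Gamma> h))"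
        unfolding v(2) face.succs using h Inl F by auto
      also have "\<dots> \<longleftrightarrow> succs C (vertex_list \<Gamma>) w (Inl (iota \<Gamma> h))"
        using h rho_inv iota_V rho_inv_V by (cases w) (auto simp: VV face_perm_def)
      finally show ?thesis using Inl by simp
    qed
  qed
  moreover have "conn (iota \<Gamma>) C (vertex_list \<Gamma>)"
    unfolding v(1) by (rule vertex.conn) (use connected in blast)
  moreover have "conn (iota \<Gamma>) C (face_list \<Gamma>)"
    unfolding v(2)
  proof (rule face.conn)
    fix U assume U: "U \<subseteq> V" "U \<noteq> {}" "iota \<Gamma> ` U \<subseteq> U" "face_perm \<Gamma> ` U \<subseteq> U"
    have "inv (rho \<Gamma>) x \<in> U" if x: "x \<in> U" for x
    proof -
      have "face_perm \<Gamma> (iota \<Gamma> x) \<in> U" using U(3,4) x by blast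
      then show ?thesis using iota(1) x U(1) by (auto simp: face_perm_def)
    qed
    then show "U = V" using connected[OF U(1-3)] by blast
  qed
  ultimately show ?thesis
    using finite_C iota iota_V vertex.parts face.parts unfolding config_def v by auto
qed

lemma genus_eq:
  assumes "config (iota \<Gamma>) {c} D'' vl fl" "D'' \<subseteq> V"
    "card (edge_of \<Gamma> ` V) = card (edge_of \<Gamma> ` D'') + 2 * (card C - 1)"
  shows "2 * genus \<Gamma> = card (edge_of \<Gamma> ` D'')"
proof -
  obtain m where m: "card (edge_of \<Gamma> ` D'') = 2 * m" using card_edges[OF assms(1,2)] by (auto elim: evenE)
  have c: "card (vertices \<Gamma>) = card C" "card (faces \<Gamma>) = card C"
    using bij_betw_same_card[OF vertex_bij] bij_betw_same_card[OF face_bij] by simp_all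
  have "card C \<ge> 1" using pt finite_C by (metis card_gt_0_iff One_nat_def Suc_leI empty_iff)
  then have "int (card (vertices \<Gamma>)) - int (card (edges \<Gamma>)) + int (card (faces \<Gamma>)) = 2 - 2 * int m"
    using assms(3) m c by (simp add: edges_def of_nat_diff)
  then have "genus \<Gamma> = m" unfolding genus_def by simp
  then show ?thesis using m by simp
qed

abbreviation "X \<equiv> coord_space (PiE (edges \<Gamma>) (\<lambda>_. UNIV)) :: ((nat set \<Rightarrow> 'b) \<Rightarrow> 'k) set"

lemma subquot_iso_coord:
  "subquot_iso (Inv X C c0 (face_list \<Gamma>)) (Rel X C c0 (vertex_list \<Gamma>))
    (coord_space (PiE {..<2 * genus \<Gamma>} (\<lambda>_. UNIV :: 'b set)) :: ((nat \<Rightarrow> 'b) \<Rightarrow> 'k) set) {0}"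
proof -
  obtain D'' vl fl where D'': "D'' \<subseteq> V" "config (iota \<Gamma>) {c0} D'' vl fl"
    "card (edge_of \<Gamma> ` V) = card (edge_of \<Gamma> ` D'') + 2 * (card C - 1)"
    and S: "subquot_iso (Inv X C c0 (face_list \<Gamma>)) (Rel X C c0 (vertex_list \<Gamma>))
      (coord_space (PiE {..<card (edge_of \<Gamma> ` D'')} (\<lambda>_. UNIV :: 'b set)) :: ((nat \<Rightarrow> 'b) \<Rightarrow> 'k) set) {0}"
    using reduce_to_coord_space[OF finite_V config pt] unfolding edges_def by blast
  show ?thesis using S genus_eq[OF D''(2,1,3)] by simp
qed

text \<open>The antipode in the operator at a source reverses the two legs in the twisted right
  action; \<chi>^-1 S = \<chi> then produces the translation in \<open>ls\<close>.\<close>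

lemma L_op_unit: "L_op H (induced_bimodule H p \<chi> \<zeta>) \<Gamma> h (unit_vec i) = app (L h i)"
proof -
  have "sw2 H (S a) (\<lambda>x y. \<chi>inv y *\<^sub>v (m \<cdot> x)) = m \<cdot> S (la \<chi> a)" for a m :: "'b \<Rightarrow> 'k"
  proof -
    have "sw2 H (S a) (\<lambda>x y. \<chi>inv y *\<^sub>v (m \<cdot> x)) = sw2 H a (\<lambda>x y. \<chi> x *\<^sub>v (m \<cdot> S y))"
      by (subst sw2_antipode) (intro conjI allI lin, simp add: chiinv_S)
    also have "\<dots> = m \<cdot> S (sw2 H a (\<lambda>x y. \<chi> x *\<^sub>v y))"
      by (subst sw2_lin[of "\<lambda>z. m \<cdot> S z"]) (intro lin, simp add: lin_map_scale[of "\<lambda>z. m \<cdot> S z"] lin)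
    finally show ?thesis by (simp add: la_def)
  qed
  then show ?thesis
    by (simp add: L_op_def L_def app_slot induced_bimodule_def loc_L_def app_ls app_lt fun_eq_iff at_edge_def)
qed

lemma T_op_coord: "T_op H (induced_bimodule H p \<chi> \<zeta>) \<Gamma> h (coord i) = app (T h i)"
proof -
  have 1: "lift2 (\<lambda>x y. coord i x *\<^sub>v y) (sw2 H m (\<lambda>x y. x \<otimes>\<^sub>v y)) = sw2 H m (\<lambda>x y. x i *\<^sub>v y)" for m :: "'b \<Rightarrow> 'k"
    unfolding comult_sw2[symmetric] by (simp add: sw2_def coord_def)
  have 2: "lift2 (\<lambda>x y. coord i (S y) *\<^sub>v x) (sw2 H m (\<lambda>x y. x \<otimes>\<^sub>v (y \<cdot> p))) = sw2 H m (\<lambda>x y. (pinv \<cdot> S y) i *\<^sub>v x)" for m :: "'b \<Rightarrow> 'k"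
  proof -
    have b: "lin_map (\<lambda>x. coord i (S y) *\<^sub>v x)" "lin_map (\<lambda>y. coord i (S y) *\<^sub>v (x :: 'b \<Rightarrow> 'k))" for x y
      unfolding coord_def by (intro lin lin_form_coord)+
    have "lift2 (\<lambda>x y. coord i (S y) *\<^sub>v x) (sw2 H m (\<lambda>x y. x \<otimes>\<^sub>v (y \<cdot> p))) = sw2 H m (\<lambda>x y. coord i (S (y \<cdot> p)) *\<^sub>v x)"
      by (simp add: sw2_lin[OF lift2_linear[OF lin_map_ident]] lift2_tensor b) (simp add: fscale_def)
    then show ?thesis by (simp add: coord_def antipode_mult pinv)
  qed
  show ?thesis
    by (simp add: T_op_def T_def app_slot induced_bimodule_def loc_T_def app_ts app_tt 1 2 fun_eq_iff at_edge_def)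
qed

lemma L_word_unit: "L_word H (induced_bimodule H p \<chi> \<zeta>) \<Gamma> hs (unit_vec i) t = app (wordL hs i) t"
  by (induction hs arbitrary: i t) (simp_all add: app_lscale app_one sw2_unfold L_op_unit cL.cv_def app_lsum app_times)

lemma T_word_coord: "T_word H (induced_bimodule H p \<chi> \<zeta>) \<Gamma> ks (coord i) t = app (wordT ks i) t"
proof (induction ks arbitrary: i t)
  case (Cons k ks)
  have "T_word H (induced_bimodule H p \<chi> \<zeta>) \<Gamma> (k # ks) (coord i) t
    = (\<Sum>(r, s)\<in>UNIV. coord i (unit_vec r \<cdot> unit_vec s) *\<^sub>v app (wordT ks r) (app (T k s) t))"
    by (simp add: Cons T_op_coord)
  also have "\<dots> = (\<Sum>r\<in>UNIV. \<Sum>s\<in>UNIV. coord i (unit_vec r \<cdot> unit_vec s) *\<^sub>v app (wordT ks r) (app (T k s) t))"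
    by (simp add: sum.cartesian_product UNIV_Times_UNIV[symmetric] del: UNIV_Times_UNIV)
  also have "\<dots> = app (wordT (k # ks) i) t"
    by (subst sum.swap) (simp add: cT.cv_def app_lsum app_times app_lscale coord_def)
  finally show ?case .
qed (simp add: coord_def app_lscale app_one)

end

section \<open>The actions and coactions at the sites\<close>

lemma lin_map_eqI:
  fixes v :: "'i::finite \<Rightarrow> 'k::field"
  assumes "lin_map f" "lin_map g" "\<And>i. f (unit_vec i) = g (unit_vec i)"
  shows "f v = g v"
  unfolding lin_map_expand[OF assms(1), of v] lin_map_expand[OF assms(2), of v] assms(3) ..

lemma tensor_unit_vec: "unit_vec i \<otimes>\<^sub>v unit_vec j = (unit_vec (i, j) :: 'i \<times> 'j \<Rightarrow> 'k::field)"
  by (auto simp: tensor_def unit_vec_def fun_eq_iff)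

context half_edge_ops
begin

text \<open>Consecutive half-edges k, k' of a face have k' directly in front of
  \<open>\<iota> k\<close> at some vertex; at every other vertex both insertions change
  nothing.\<close>

lemma config_path_moves:
  assumes C: "config \<iota> I D vl fl" and c: "c \<in> I" "d \<in> I" and l: "l \<notin> D"
  shows "path_moves l (fl c) (vl d)"
  unfolding path_moves_def
proof (intro allI impI)
  fix us k k' ws assume e: "fl c = us @ k # k' # ws"
  have p: "parts I vl D" "parts I fl D" using C by (auto simp: config_def)
  have "set (fl c) \<subseteq> D" using p(2) c by (auto simp: parts_def)
  then have k: "k \<in> D" "k' \<in> D" using e by auto
  have "adj (fl c) k k'" unfolding adj_iff using e by blast
  then have "succs I fl (Inl k) (Inl k')" using c unfolding succs_def adj_ext_Inl by blast
  then have "succs I vl (Inl k') (Inl (\<iota> k))" using config_succs[OF C, of "Inl k"] k by simp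
  then obtain b where "b \<in> I" "adj (vl b) k' (\<iota> k)" unfolding succs_def adj_ext_Inl by blast
  then obtain us' ws' where b: "b \<in> I" "vl b = us' @ k' # \<iota> k # ws'" unfolding adj_iff by blast
  show "insbefore l (\<iota> k) (vl d) = insafter l k' (vl d)"
  proof (cases "b = d")
    case True
    have "distinct (vl d)" using p(1) c by (auto simp: parts_def)
    then show ?thesis unfolding b(2)[unfolded True] by (auto simp: insafter_notin insbefore_notin)
  next
    case False
    then have "set (vl b) \<inter> set (vl d) = {}" using p(1) b(1) c(2) by (auto simp: parts_def)
    then have "k' \<notin> set (vl d)" "\<iota> k \<notin> set (vl d)" using b(2) by auto
    then show ?thesis by (simp add: insafter_notin insbefore_notin)
  qed
qed

text \<open>Compatibility at the node of the site itself: vertex and face share the corner that the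
  cilium marks.\<close>

lemma config_ends:
  assumes C: "config \<iota> I D vl fl" and c: "c \<in> I" and n: "fl c \<noteq> []"
  shows "hd (fl c) = last (vl c)" "\<iota> (last (fl c)) = hd (vl c)" "vl c \<noteq> []"
proof -
  have A: "adj (ext d l) (Inl x) (Inr e) \<longleftrightarrow> l \<noteq> [] \<and> x = last l \<and> e = d" "adj (ext d l) (Inr e) (Inl x) \<longleftrightarrow> l \<noteq> [] \<and> x = hd l \<and> e = d" for d e l and x :: 'h
  proof -
    have "\<not> adj (map Inl l) (Inl x) (Inr e)" "\<not> adj (map Inl l) (Inr e) (Inl x)" for e :: 'b
      by (auto dest!: adj_in_set)
    then show "adj (ext d l) (Inl x) (Inr e) \<longleftrightarrow> l \<noteq> [] \<and> x = last l \<and> e = d" "adj (ext d l) (Inr e) (Inl x) \<longleftrightarrow> l \<noteq> [] \<and> x = hd l \<and> e = d"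
      by (auto simp: ext_def adj_Cons adj_append last_map hd_append hd_map dest: adj_in_set)
  qed
  have "set (fl c) \<subseteq> D" using C c by (auto simp: config_def parts_def)
  then have D: "last (fl c) \<in> D" using n by auto
  have "succs I fl (Inr c) (Inl (hd (fl c)))" using c n by (auto simp: succs_def A)
  then have "succs I vl (Inl (hd (fl c))) (Inr c)" using config_succs[OF C, of "Inr c"] c by simp
  then show "hd (fl c) = last (vl c)" "vl c \<noteq> []" by (auto simp: succs_def A)
  have "succs I fl (Inl (last (fl c))) (Inr c)" using c n by (auto simp: succs_def A)
  then have "succs I vl (Inr c) (Inl (\<iota> (last (fl c))))" using config_succs[OF C, of "Inl (last (fl c))"] D by simp
  then show "\<iota> (last (fl c)) = hd (vl c)" by (auto simp: succs_def A)
qed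

end

context kitaev
begin

abbreviation "A c i \<equiv> wordL (vertex_list \<Gamma> c) i"
abbreviation "B c i \<equiv> wordT (face_list \<Gamma> c) i"

lemma lists:
  assumes "c \<in> C"
  shows "set (vertex_list \<Gamma> c) \<subseteq> V" "set (face_list \<Gamma> c) \<subseteq> V" "distinct (vertex_list \<Gamma> c)" "distinct (face_list \<Gamma> c)"
    "face_list \<Gamma> c \<noteq> []" "vertex_list \<Gamma> c \<noteq> []"
proof -
  have p: "parts C (vertex_list \<Gamma>) V" "parts C (face_list \<Gamma>) V" using config by (auto simp: config_def)
  then show "set (vertex_list \<Gamma> c) \<subseteq> V" "set (face_list \<Gamma> c) \<subseteq> V" "distinct (vertex_list \<Gamma> c)" "distinct (face_list \<Gamma> c)"
    using assms by (auto simp: parts_def)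
  show "face_list \<Gamma> c \<noteq> []" using cycle_list(4)[OF face_perm_permutes finite_V, of "inv (rho \<Gamma>) c"] by (auto simp: face_list_def)
  show "vertex_list \<Gamma> c \<noteq> []" using cycle_list(4)[OF rho_permutes finite_V, of c] by (auto simp: vertex_list_def)
qed

lemma disjoint:
  assumes "c \<in> C" "d \<in> C" "c \<noteq> d"
  shows "set (vertex_list \<Gamma> c) \<inter> set (vertex_list \<Gamma> d) = {}" "set (face_list \<Gamma> c) \<inter> set (face_list \<Gamma> d) = {}"
  using config assms by (auto simp: config_def parts_def)

lemma rep_A: "c \<in> C \<Longrightarrow> rep H (A c)" and corep_B: "c \<in> C \<Longrightarrow> corep H (B c)"
  using rep_wordL corep_wordT lists by blast+

lemma A_commute: "c \<in> C \<Longrightarrow> d \<in> C \<Longrightarrow> c \<noteq> d \<Longrightarrow> A c i * A d j = A d j * A c i"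
proof -
  assume c: "c \<in> C" "d \<in> C" "c \<noteq> d"
  have "A c i * L z k = L z k * A c i" if "z \<in> set (vertex_list \<Gamma> d)" for z k
    using that lists(1)[OF c(2)] disjoint(1)[OF c]
    by (intro cL.word_commute[symmetric] L_commute) auto
  then show ?thesis by (rule cL.word_commute)
qed

lemma B_commute: "c \<in> C \<Longrightarrow> d \<in> C \<Longrightarrow> c \<noteq> d \<Longrightarrow> B c i * B d j = B d j * B c i"
proof -
  assume c: "c \<in> C" "d \<in> C" "c \<noteq> d"
  have "B c i * T z k = T z k * B c i" if "z \<in> set (face_list \<Gamma> d)" for z k
    using that lists(2)[OF c(2)] disjoint(2)[OF c]
    by (intro cT.word_commute[symmetric] T_commute) auto
  then show ?thesis by (rule cT.word_commute)
qed

text \<open>Half-edges are natural numbers and \<open>V\<close> is finite, so there is room for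
  another one; it counts as a target because the order relates nothing outside
  \<open>V\<close>.\<close>

lemma fresh: "\<exists>l. l \<notin> V \<and> edge_of \<Gamma> l \<notin> edge_of \<Gamma> ` V \<and> \<not> is_source \<Gamma> l"
proof -
  obtain l where l: "l \<notin> V" using finite_V by (metis ex_new_if_finite infinite_UNIV_nat)
  then have "edge_of \<Gamma> l \<notin> edge_of \<Gamma> ` V" using edge_eq iota_in by blast
  then show ?thesis using l by (auto simp: is_source_def order)
qed

text \<open>The face of \<open>c\<close> starts and ends at the corner of \<open>c\<close>, and the
  half-edges of this corner are absent from the vertex of \<open>d\<close>.\<close>

lemma A_B_commute:
  assumes c: "c \<in> C" "d \<in> C" "c \<noteq> d"
  shows "A d i * B c j = B c j * A d i"
proof -
  obtain l where l: "l \<notin> V" "edge_of \<Gamma> l \<notin> edge_of \<Gamma> ` V" "\<not> is_source \<Gamma> l" using fresh by blast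
  note e = config_ends[OF config c(1) lists(5)[OF c(1)]]
  have "last (vertex_list \<Gamma> c) \<in> set (vertex_list \<Gamma> c)" "hd (vertex_list \<Gamma> c) \<in> set (vertex_list \<Gamma> c)" using e(3) by auto
  then have "hd (face_list \<Gamma> c) \<notin> set (vertex_list \<Gamma> d)" "iota \<Gamma> (last (face_list \<Gamma> c)) \<notin> set (vertex_list \<Gamma> d)"
    unfolding e using disjoint(1)[OF c] by blast+
  then show ?thesis
    by (intro wordL_wordT_commute[OF l lists(2)[OF c(1)] lists(1)[OF c(2)] lists(5)[OF c(1)] config_path_moves[OF config c(1,2) l(1)]])
qed

lemma A_B_same:
  assumes c: "c \<in> C"
  shows "(\<Sum>j\<in>UNIV. \<Sum>k\<in>UNIV. \<Sum>m\<in>UNIV. (comult H (unit_vec i) (j, k) * (unit_vec m \<cdot> unit_vec k) n) *\<^sub>o (B c m * A c j))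
    = (\<Sum>j\<in>UNIV. \<Sum>k\<in>UNIV. \<Sum>m\<in>UNIV. (comult H (unit_vec i) (j, k) * (unit_vec j \<cdot> unit_vec m) n) *\<^sub>o (A c k * B c m))"
proof -
  obtain l where l: "l \<notin> V" "edge_of \<Gamma> l \<notin> edge_of \<Gamma> ` V" "\<not> is_source \<Gamma> l" using fresh by blast
  note e = config_ends[OF config c lists(5)[OF c]]
  show ?thesis
    by (rule yetter_drinfeld[OF l lists(2)[OF c] lists(1)[OF c] lists(3)[OF c] lists(5)[OF c] e(3) config_path_moves[OF config c c l(1)] e(1,2)])
qed

definition act :: "nat \<Rightarrow> ('b \<Rightarrow> 'k) \<Rightarrow> ((nat set \<Rightarrow> 'b) \<Rightarrow> 'k) \<Rightarrow> (nat set \<Rightarrow> 'b) \<Rightarrow> 'k"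
  where "act c a n = (\<Sum>i\<in>UNIV. a i *\<^sub>v app (A c i) n)"

lemma act_unit_vec: "act c (unit_vec i) n = app (A c i) n"
proof -
  have "act c (unit_vec i) n = (\<Sum>j\<in>UNIV. if j = i then app (A c j) n else 0)"
    unfolding act_def by (rule sum.cong[OF refl]) (simp add: unit_vec_def)
  then show ?thesis by simp
qed

lemma act_lin_left [lin]: "lin_map f \<Longrightarrow> lin_map (\<lambda>a. act c (f a) n)"
  unfolding act_def by (intro lin lin_form_coord) assumption

lemma act_lin_right [lin]: "lin_map f \<Longrightarrow> lin_map (\<lambda>n. act c a (f n))"
  unfolding act_def by (intro lin lin_map_comp[OF lin_map_app]) assumption

lemma act_one: "c \<in> C \<Longrightarrow> act c \<one> n = n"
proof -
  assume "c \<in> C"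
  then have "(\<Sum>i\<in>UNIV. \<one> i *\<^sub>o A c i) = 1" using rep_A by (simp add: rep_def)
  from arg_cong[OF this, of "\<lambda>X. app X n"] show ?thesis by (simp add: act_def app_lsum app_lscale app_one)
qed

lemma act_mult: "c \<in> C \<Longrightarrow> act c (x \<cdot> y) n = act c x (act c y n)"
proof -
  assume c: "c \<in> C"
  have 1: "act c (unit_vec j \<cdot> unit_vec s) n = act c (unit_vec j) (act c (unit_vec s) n)" for j s n
    using c rep_A[OF c] by (simp add: act_unit_vec app_times[symmetric] rep_def) (simp add: act_def app_lsum app_lscale)
  have 2: "act c (unit_vec j \<cdot> y) n = act c (unit_vec j) (act c y n)" for j
    by (rule lin_map_eqI[of "\<lambda>y. act c (unit_vec j \<cdot> y) n" "\<lambda>y. act c (unit_vec j) (act c y n)"]) (intro lin | simp add: 1)+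
  show ?thesis
    by (rule lin_map_eqI[of "\<lambda>x. act c (x \<cdot> y) n" "\<lambda>x. act c x (act c y n)"]) (intro lin | simp add: 2)+
qed

text \<open>
  The Yetter--Drinfeld condition: applying \<open>\<Psi>\<close> to both sides of
  $(a_{(1)} n)_{[-1]} a_{(2)} \otimes (a_{(1)} n)_{[0]} = a_{(1)} n_{[-1]} \otimes a_{(2)} n_{[0]}$.
\<close>

lemma yetter_drinfeld_bilinear:
  assumes c: "c \<in> C" and \<Psi>: "bilin \<Psi>"
  shows "sw2 H a (\<lambda>x y. \<Sum>m\<in>UNIV. \<Psi> (unit_vec m \<cdot> y) (app (B c m) (act c x n)))
    = sw2 H a (\<lambda>x y. \<Sum>m\<in>UNIV. \<Psi> (x \<cdot> unit_vec m) (act c y (app (B c m) n)))"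
proof -
  note b = bilin_left[OF \<Psi>] bilin_right[OF \<Psi>]
  have E: "\<Psi> v w = (\<Sum>r\<in>UNIV. v r *\<^sub>v \<Psi> (unit_vec r) w)" for v w
    by (rule lin_map_expand[of "\<lambda>v. \<Psi> v w"]) (use \<Psi> in blast)
  \<comment> \<open>Exchanges the sum over the coordinates of the first argument of \<Psi> with the
    other sums, so that \<open>A_B_same\<close> can be applied in each coordinate.\<close>
  have S: "(\<Sum>r\<in>UNIV. \<Psi> (unit_vec r) (app (f r) n)) = (\<Sum>j\<in>UNIV. \<Sum>k\<in>UNIV. \<Sum>m\<in>UNIV. d j k *\<^sub>v (\<Sum>r\<in>UNIV. e j k m r *\<^sub>v \<Psi> (unit_vec r) (app (g j k m) n)))"
    if "\<And>r. f r = (\<Sum>j\<in>UNIV. \<Sum>k\<in>UNIV. \<Sum>m\<in>UNIV. (d j k * e j k m r) *\<^sub>o g j k m)"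
    for f :: "'b \<Rightarrow> _" and g :: "'b \<Rightarrow> 'b \<Rightarrow> 'b \<Rightarrow> _" and d e
  proof -
    have l: "lin_map (\<Psi> (unit_vec r))" for r using \<Psi> by blast
    have "(\<Sum>r\<in>UNIV. \<Psi> (unit_vec r) (app (f r) n)) = (\<Sum>r\<in>UNIV. \<Sum>j\<in>UNIV. \<Sum>k\<in>UNIV. \<Sum>m\<in>UNIV. d j k *\<^sub>v e j k m r *\<^sub>v \<Psi> (unit_vec r) (app (g j k m) n))"
      by (simp add: that app_lsum app_lscale lin_map_sum[OF l] lin_map_scale[OF l])
    also have "\<dots> = (\<Sum>j\<in>UNIV. \<Sum>k\<in>UNIV. \<Sum>m\<in>UNIV. \<Sum>r\<in>UNIV. d j k *\<^sub>v e j k m r *\<^sub>v \<Psi> (unit_vec r) (app (g j k m) n))"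
      by (subst sum.swap, rule sum.cong[OF refl], subst sum.swap, rule sum.cong[OF refl], subst sum.swap) (rule refl)
    finally show ?thesis by (simp add: fun_vs.scale_sum_right)
  qed
  have "sw2 H (unit_vec i) (\<lambda>x y. \<Sum>m\<in>UNIV. \<Psi> (unit_vec m \<cdot> y) (app (B c m) (act c x n)))
    = sw2 H (unit_vec i) (\<lambda>x y. \<Sum>m\<in>UNIV. \<Psi> (x \<cdot> unit_vec m) (act c y (app (B c m) n)))" for i
  proof -
    have "sw2 H (unit_vec i) (\<lambda>x y. \<Sum>m\<in>UNIV. \<Psi> (unit_vec m \<cdot> y) (app (B c m) (act c x n)))
      = (\<Sum>j\<in>UNIV. \<Sum>k\<in>UNIV. \<Sum>m\<in>UNIV. comult H (unit_vec i) (j, k) *\<^sub>v (\<Sum>r\<in>UNIV. (unit_vec m \<cdot> unit_vec k) r *\<^sub>v \<Psi> (unit_vec r) (app (B c m * A c j) n)))"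
      unfolding sw2_unfold act_unit_vec fun_vs.scale_sum_right E[symmetric] app_times ..
    also have "\<dots> = (\<Sum>r\<in>UNIV. \<Psi> (unit_vec r) (app (\<Sum>j\<in>UNIV. \<Sum>k\<in>UNIV. \<Sum>m\<in>UNIV. (comult H (unit_vec i) (j, k) * (unit_vec m \<cdot> unit_vec k) r) *\<^sub>o (B c m * A c j)) n))"
      by (rule S[OF refl, symmetric])
    also have "\<dots> = (\<Sum>j\<in>UNIV. \<Sum>k\<in>UNIV. \<Sum>m\<in>UNIV. comult H (unit_vec i) (j, k) *\<^sub>v (\<Sum>r\<in>UNIV. (unit_vec j \<cdot> unit_vec m) r *\<^sub>v \<Psi> (unit_vec r) (app (A c k * B c m) n)))"
      unfolding A_B_same[OF c] by (rule S[OF refl])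
    also have "\<dots> = sw2 H (unit_vec i) (\<lambda>x y. \<Sum>m\<in>UNIV. \<Psi> (x \<cdot> unit_vec m) (act c y (app (B c m) n)))"
      unfolding sw2_unfold act_unit_vec fun_vs.scale_sum_right E[symmetric] app_times ..
    finally show ?thesis .
  qed
  then show ?thesis
    by (rule lin_map_eqI[of "\<lambda>a. sw2 H a (\<lambda>x y. \<Sum>m\<in>UNIV. \<Psi> (unit_vec m \<cdot> y) (app (B c m) (act c x n)))"
      "\<lambda>a. sw2 H a (\<lambda>x y. \<Sum>m\<in>UNIV. \<Psi> (x \<cdot> unit_vec m) (act c y (app (B c m) n)))", rotated 2]) (intro lin)+
qed

text \<open>The condition solved for the coaction of a n: multiplying by the antipode of one more
  leg of a lets a_(2) S(a_(3)) contract.\<close>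

lemma yetter_drinfeld_conjugate:
  assumes c: "c \<in> C" and \<Psi>: "bilin \<Psi>"
  shows "sw2 H a (\<lambda>x w. sw2 H w (\<lambda>y z. \<Sum>l\<in>UNIV. \<Psi> (x \<cdot> unit_vec l \<cdot> S z) (act c y (app (B c l) n))))
    = (\<Sum>m\<in>UNIV. \<Psi> (unit_vec m) (app (B c m) (act c a n)))"
proof -
  note b = bilin_left[OF \<Psi>] bilin_right[OF \<Psi>] lin_map_comp[OF lin_map_app]
  have "sw2 H a (\<lambda>x w. sw2 H w (\<lambda>y z. \<Sum>l\<in>UNIV. \<Psi> (x \<cdot> unit_vec l \<cdot> S z) (act c y (app (B c l) n))))
    = sw2 H a (\<lambda>w z. sw2 H w (\<lambda>x y. \<Sum>l\<in>UNIV. \<Psi> (x \<cdot> unit_vec l \<cdot> S z) (act c y (app (B c l) n))))"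
    by (rule sw2_coassoc[symmetric]) (intro conjI allI lin b)
  also have "\<dots> = sw2 H a (\<lambda>w z. sw2 H w (\<lambda>x y. \<Sum>m\<in>UNIV. \<Psi> (unit_vec m \<cdot> y \<cdot> S z) (app (B c m) (act c x n))))"
    by (intro arg_cong[of _ _ "sw2 H a"] ext yetter_drinfeld_bilinear[OF c, symmetric, of "\<lambda>v. \<Psi> (v \<cdot> S _)"]) (intro conjI allI lin b)
  also have "\<dots> = sw2 H a (\<lambda>x w. sw2 H w (\<lambda>y z. \<Sum>m\<in>UNIV. \<Psi> (unit_vec m \<cdot> y \<cdot> S z) (app (B c m) (act c x n))))"
    by (rule sw2_coassoc) (intro conjI allI lin b)
  also have "\<dots> = sw2 H a (\<lambda>x w. \<epsilon> w *\<^sub>v (\<Sum>m\<in>UNIV. \<Psi> (unit_vec m) (app (B c m) (act c x n))))"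
  proof (intro arg_cong[of _ _ "sw2 H a"] ext)
    fix x w :: "'b \<Rightarrow> 'k" and r
    have "sw2 H w (\<lambda>y z. \<Sum>m\<in>UNIV. \<Psi> (unit_vec m \<cdot> (y \<cdot> S z)) (app (B c m) (act c x n)))
      = \<epsilon> w *\<^sub>v (\<Sum>m\<in>UNIV. \<Psi> (unit_vec m \<cdot> \<one>) (app (B c m) (act c x n)))"
      by (rule sw2_antipode_right[of "\<lambda>v. \<Sum>m\<in>UNIV. \<Psi> (unit_vec m \<cdot> v) (app (B c m) (act c x n))"]) (intro lin b)
    then show "sw2 H w (\<lambda>y z. \<Sum>m\<in>UNIV. \<Psi> (unit_vec m \<cdot> y \<cdot> S z) (app (B c m) (act c x n))) r
      = (\<epsilon> w *\<^sub>v (\<Sum>m\<in>UNIV. \<Psi> (unit_vec m) (app (B c m) (act c x n)))) r"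
      by (simp add: mult_assoc mult_unit_right)
  qed
  also have "\<dots> = (\<Sum>m\<in>UNIV. \<Psi> (unit_vec m) (app (B c m) (act c a n)))"
    by (rule sw2_counit_right) (intro lin b)
  finally show ?thesis .
qed

end

subsection \<open>The coefficient module-comodule\<close>

context hopf_pair
begin

abbreviation "uact \<equiv> r_act (U_mc H)"

lemma uact_sw2: "uact t h = lift2 (\<lambda>k l. sw2 H h (\<lambda>x w. sw2 H w (\<lambda>y z. (k \<cdot> y) \<otimes>\<^sub>v (Sinv x \<cdot> l \<cdot> S (S z))))) t"
  by (simp add: U_mc_def sw3_def Sinv_def)

lemma uact_lin_left [lin]: "lin_map f \<Longrightarrow> lin_map (\<lambda>t. uact (f t) h)"
  unfolding uact_sw2 by (intro lin)

lemma uact_lin_right [lin]: "lin_map f \<Longrightarrow> lin_map (\<lambda>h. uact t (f h))"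
  unfolding uact_sw2 lift2_sum by (intro lin)

lemma uact_tensor: "uact (k \<otimes>\<^sub>v l) h = sw2 H h (\<lambda>x w. sw2 H w (\<lambda>y z. (k \<cdot> y) \<otimes>\<^sub>v (Sinv x \<cdot> l \<cdot> S (S z))))"
  unfolding uact_sw2 by (rule lift2_tensor) (intro lin)+

lemma uact_one: "uact t \<one> = t"
proof -
  have "uact (unit_vec k \<otimes>\<^sub>v unit_vec l) \<one> = unit_vec k \<otimes>\<^sub>v unit_vec l" for k l
  proof -
    have "uact (unit_vec k \<otimes>\<^sub>v unit_vec l) \<one> = sw2 H \<one> (\<lambda>y z. (unit_vec k \<cdot> y) \<otimes>\<^sub>v (Sinv \<one> \<cdot> unit_vec l \<cdot> S (S z)))"
      unfolding uact_tensor by (rule sw2_unit) (intro conjI allI lin)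
    also have "\<dots> = (unit_vec k \<cdot> \<one>) \<otimes>\<^sub>v (Sinv \<one> \<cdot> unit_vec l \<cdot> S (S \<one>))"
      by (rule sw2_unit) (intro conjI allI lin)
    finally show ?thesis by (simp add: mult_unit_right mult_unit_left Sinv_unit antipode_unit)
  qed
  then have "uact (unit_vec kl) \<one> = unit_vec kl" for kl :: "'b \<times> 'b"
    by (cases kl) (metis tensor_unit_vec)
  then show ?thesis
    by (rule lin_map_eqI[of "\<lambda>t. uact t \<one>" "\<lambda>t. t", rotated 2]) (intro lin)+
qed

text \<open>The sense in which \<open>U\<close> is induced: it is generated by the vectors 1
  \<otimes> l under the action. In the five legs of k, S^-1(k_(2)) k_(1) and S(S(k_(4)) k_(5))
  contract, and k_(3) survives.\<close>

lemma uact_conjugate: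
  "sw2 H k (\<lambda>x w. sw2 H w (\<lambda>y z. uact (\<one> \<otimes>\<^sub>v (x \<cdot> l \<cdot> S z)) y)) = k \<otimes>\<^sub>v l"
proof -
  define G where "G x a b c z = b \<otimes>\<^sub>v ((Sinv a \<cdot> x) \<cdot> l \<cdot> (S z \<cdot> S (S c)))" for x a b c z :: "'b \<Rightarrow> 'k"
  have G [lin]: "lin_map f \<Longrightarrow> lin_map (\<lambda>x. G (f x) a b c z)" "lin_map f \<Longrightarrow> lin_map (\<lambda>a. G x (f a) b c z)"
    "lin_map f \<Longrightarrow> lin_map (\<lambda>b. G x a (f b) c z)" "lin_map f \<Longrightarrow> lin_map (\<lambda>c. G x a b (f c) z)" "lin_map f \<Longrightarrow> lin_map (\<lambda>z. G x a b c (f z))"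
    for x a b c z and f :: "('b \<Rightarrow> 'k) \<Rightarrow> 'b \<Rightarrow> 'k"
    unfolding G_def by (intro lin; assumption)+
  have "sw2 H k (\<lambda>x w. sw2 H w (\<lambda>y z. uact (\<one> \<otimes>\<^sub>v (x \<cdot> l \<cdot> S z)) y))
    = sw2 H k (\<lambda>x w. sw2 H w (\<lambda>y z. sw2 H y (\<lambda>a r. sw2 H r (\<lambda>b c. G x a b c z))))"
    by (simp add: uact_tensor G_def mult_unit_left mult_assoc)
  also have "\<dots> = sw2 H k (\<lambda>x w. sw2 H w (\<lambda>a r. sw2 H r (\<lambda>r z. sw2 H r (\<lambda>b c. G x a b c z))))"
    by (intro arg_cong[of _ _ "sw2 H k"] ext fun_cong[OF sw2_coassoc]) (intro conjI allI lin)
  also have "\<dots> = sw2 H k (\<lambda>w r. sw2 H w (\<lambda>x a. sw2 H r (\<lambda>r z. sw2 H r (\<lambda>b c. G x a b c z))))"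
    by (rule sw2_coassoc[symmetric]) (intro conjI allI lin)
  also have "\<dots> = sw2 H k (\<lambda>w r. \<epsilon> w *\<^sub>v sw2 H r (\<lambda>r z. sw2 H r (\<lambda>b c. b \<otimes>\<^sub>v (\<one> \<cdot> l \<cdot> (S z \<cdot> S (S c))))))"
    unfolding G_def
    by (intro arg_cong[of _ _ "sw2 H k"] ext fun_cong[OF sw2_Sinv_left[of "\<lambda>v. sw2 H _ (\<lambda>r z. sw2 H r (\<lambda>b c. b \<otimes>\<^sub>v (v \<cdot> l \<cdot> (S z \<cdot> S (S c)))))"]]) (intro lin)
  also have "\<dots> = sw2 H k (\<lambda>r z. sw2 H r (\<lambda>b c. b \<otimes>\<^sub>v (\<one> \<cdot> l \<cdot> (S z \<cdot> S (S c)))))"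
    by (rule sw2_counit_left) (intro lin)
  also have "\<dots> = sw2 H k (\<lambda>b r. sw2 H r (\<lambda>c z. b \<otimes>\<^sub>v (l \<cdot> S (S c \<cdot> z))))"
    unfolding antipode_mult mult_unit_left by (rule sw2_coassoc) (intro conjI allI lin)
  also have "\<dots> = sw2 H k (\<lambda>b r. \<epsilon> r *\<^sub>v (b \<otimes>\<^sub>v (l \<cdot> S \<one>)))"
    by (intro arg_cong[of _ _ "sw2 H k"] ext fun_cong[OF sw2_antipode_left[of "\<lambda>v. _ \<otimes>\<^sub>v (l \<cdot> S v)"]]) (intro lin)
  also have "\<dots> = k \<otimes>\<^sub>v (l \<cdot> S \<one>)"
    by (rule sw2_counit_right) (intro lin)
  finally show ?thesis by (simp add: antipode_unit mult_unit_right)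
qed

text \<open>Under the counit the conjugation on the second tensor factor disappears, so that sending
  k \<otimes> l to \<epsilon>(l) k respects the actions.\<close>

lemma lift2_uact:
  fixes K :: "('b \<Rightarrow> 'k) \<Rightarrow> 'n \<Rightarrow> 'k"
  assumes K: "lin_map K"
  shows "lift2 (\<lambda>u v. \<epsilon> v *\<^sub>v K u) (uact (k \<otimes>\<^sub>v l) h) = \<epsilon> l *\<^sub>v K (k \<cdot> h)"
proof -
  note [lin] = lin_map_comp[OF K] lin_form_comp[OF counit_linear]
  have l2: "lin_map (lift2 (\<lambda>u v. \<epsilon> v *\<^sub>v K u))" by (rule lift2_linear[OF lin_map_ident])
  have t: "lift2 (\<lambda>u v. \<epsilon> v *\<^sub>v K u) (a \<otimes>\<^sub>v b) = \<epsilon> b *\<^sub>v K a" for a b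
    by (rule lift2_tensor) (intro lin)+
  have "lift2 (\<lambda>u v. \<epsilon> v *\<^sub>v K u) (uact (k \<otimes>\<^sub>v l) h)
    = sw2 H h (\<lambda>x w. sw2 H w (\<lambda>y z. \<epsilon> (Sinv x \<cdot> l \<cdot> S (S z)) *\<^sub>v K (k \<cdot> y)))"
    unfolding uact_tensor sw2_lin[OF l2] t ..
  also have "\<dots> = sw2 H h (\<lambda>x w. \<epsilon> x *\<^sub>v sw2 H w (\<lambda>y z. \<epsilon> z *\<^sub>v \<epsilon> l *\<^sub>v K (k \<cdot> y)))"
    by (simp add: counit_mult counit_antipode counit_Sinv sw2_scale[symmetric] mult_ac)
  also have "\<dots> = sw2 H h (\<lambda>x w. \<epsilon> x *\<^sub>v \<epsilon> l *\<^sub>v K (k \<cdot> w))"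
    by (intro arg_cong[of _ _ "sw2 H h"] ext) (subst sw2_counit_right, intro lin, simp)
  also have "\<dots> = \<epsilon> l *\<^sub>v K (k \<cdot> h)" by (rule sw2_counit_left) (intro lin)
  finally show ?thesis .
qed

end

section \<open>The protected space\<close>

text \<open>A distributive law for factors that need not commute; the list fixes their
  order.\<close>

lemma sum_PiE_prod_list:
  fixes Y :: "'c \<Rightarrow> 'i::finite \<Rightarrow> ('x, 'k::field) lop"
  assumes "distinct cs"
  shows "(\<Sum>b\<in>PiE (set cs) (\<lambda>_. UNIV). (\<Prod>c\<in>set cs. f c (b c)) *\<^sub>o prod_list (map (\<lambda>c. Y c (b c)) cs))
    = prod_list (map (\<lambda>c. \<Sum>i\<in>UNIV. f c i *\<^sub>o Y c i) cs)"
  using assms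
proof (induction cs)
  case (Cons c cs)
  let ?P = "PiE (set cs) (\<lambda>_. UNIV :: 'i set)"
  have c: "c \<notin> set cs" using Cons.prems by simp
  have "(\<Sum>b\<in>PiE (set (c # cs)) (\<lambda>_. UNIV). (\<Prod>c\<in>set (c # cs). f c (b c)) *\<^sub>o prod_list (map (\<lambda>c. Y c (b c)) (c # cs)))
    = (\<Sum>(i, b)\<in>UNIV \<times> ?P. (\<Prod>d\<in>set (c # cs). f d ((b(c := i)) d)) *\<^sub>o prod_list (map (\<lambda>d. Y d ((b(c := i)) d)) (c # cs)))"
    by (simp only: list.set PiE_insert_eq) (subst sum.reindex[OF inj_combinator[OF c, of "\<lambda>_. UNIV"]], simp add: comp_def case_prod_beta')
  also have "\<dots> = (\<Sum>(i, b)\<in>UNIV \<times> ?P. (f c i *\<^sub>o Y c i) * ((\<Prod>d\<in>set cs. f d (b d)) *\<^sub>o prod_list (map (\<lambda>d. Y d (b d)) cs)))"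
  proof (rule sum.cong[OF refl], clarify)
    fix i b
    have m: "(\<Prod>d\<in>set cs. f d ((b(c := i)) d)) = (\<Prod>d\<in>set cs. f d (b d))" "map (\<lambda>d. Y d ((b(c := i)) d)) cs = map (\<lambda>d. Y d (b d)) cs"
      using c by (auto intro!: prod.cong)
    then show "(\<Prod>d\<in>set (c # cs). f d ((b(c := i)) d)) *\<^sub>o prod_list (map (\<lambda>d. Y d ((b(c := i)) d)) (c # cs))
      = (f c i *\<^sub>o Y c i) * ((\<Prod>d\<in>set cs. f d (b d)) *\<^sub>o prod_list (map (\<lambda>d. Y d (b d)) cs))"
      using c by (simp add: m mult.commute fun_upd_same del: fun_upd_apply)
  qed
  also have "\<dots> = (\<Sum>i\<in>UNIV. f c i *\<^sub>o Y c i) * (\<Sum>b\<in>?P. (\<Prod>d\<in>set cs. f d (b d)) *\<^sub>o prod_list (map (\<lambda>d. Y d (b d)) cs))"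
    by (simp add: sum_product sum.cartesian_product)
  finally show ?case using Cons by simp
qed simp

lemma prod_list_single:
  fixes f :: "'c \<Rightarrow> 'a::monoid_mult"
  shows "distinct cs \<Longrightarrow> d \<in> set cs \<Longrightarrow> (\<And>c. c \<in> set cs \<Longrightarrow> c \<noteq> d \<Longrightarrow> f c = 1) \<Longrightarrow> prod_list (map f cs) = f d"
proof (induction cs)
  case (Cons c cs)
  show ?case
  proof (cases "c = d")
    case True
    then have "prod_list (map f cs) = 1" using Cons.prems by (induction cs) auto
    then show ?thesis using True by simp
  qed (use Cons in auto)
qed simp

context kitaev
begin

abbreviation "sites \<equiv> sorted_list_of_set C"

lemma sites [simp]: "set sites = C" "distinct sites"
  using finite_C by simp_all

lemma foldr_L_word: "foldr (\<lambda>c. L_word H (induced_bimodule H p \<chi> \<zeta>) \<Gamma> (vertex_list \<Gamma> c) (unit_vec (b c))) cs t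
    = app (prod_list (map (\<lambda>c. A c (b c)) cs)) t"
  and foldr_T_word: "foldr (\<lambda>c. T_word H (induced_bimodule H p \<chi> \<zeta>) \<Gamma> (face_list \<Gamma> c) (coord (b c))) cs t
    = app (prod_list (map (\<lambda>c. B c (b c)) cs)) t"
  by (induction cs) (simp_all add: L_word_unit T_word_coord app_times app_one)

definition site_mc :: "nat \<Rightarrow> (('b \<times> 'b) option, 'b, 'k) right_mc"
  where "site_mc c = (if c = c0 then some_mc (U_mc H) else one_dim_mc (pinv \<cdot> pinv) \<phi>)"

lemma coefficient_mc_site_mc: "coefficient_mc H p \<chi> \<Gamma> (U_mc H) = tensor_mc C site_mc"
  unfolding coefficient_mc_def site_mc_def[abs_def] \<phi>_def ..

text \<open>All coefficient spaces except the one at \<open>c0\<close> are one-dimensional, so the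
  basis of their tensor product is that of \<open>U\<close>, with \<open>None\<close> at every other
  site.\<close>

definition node :: "'b \<times> 'b \<Rightarrow> nat \<Rightarrow> ('b \<times> 'b) option"
  where "node kl = (\<lambda>c\<in>C. if c = c0 then Some kl else None)"

lemma node_c0 [simp]: "node kl c0 = Some kl"
  using pt by (simp add: node_def)

lemma node_other [simp]: "c \<in> C - {c0} \<Longrightarrow> node kl c = None"
  by (auto simp: node_def)

lemma node_ext [simp]: "node kl \<in> extensional C"
  by (simp add: node_def)

lemma inj_node: "inj node"
  by (metis injI node_c0 option.inject)

lemma basis: "PiE C (\<lambda>c. r_basis (site_mc c)) = range node"
proof (intro equalityI subsetI)
  fix w assume w: "w \<in> PiE C (\<lambda>c. r_basis (site_mc c))"
  then have "w c0 \<in> Some ` UNIV" using PiE_mem[OF w pt] by (simp add: site_mc_def some_mc_def U_mc_def)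
  then obtain kl where kl: "w c0 = Some kl" by blast
  have "w = node kl"
  proof
    fix c
    show "w c = node kl c"
    proof (cases "c \<in> C")
      case True
      then show ?thesis using w kl PiE_mem[OF w True] by (cases "c = c0") (auto simp: site_mc_def one_dim_mc_def)
    next
      case False
      then show ?thesis using w by (auto simp: node_def PiE_def extensional_def)
    qed
  qed
  then show "w \<in> range node" by blast
qed (auto simp: node_def site_mc_def one_dim_mc_def some_mc_def U_mc_def)

lemma not_node: "w \<in> extensional C \<Longrightarrow> w \<notin> range node \<Longrightarrow> w c0 = None \<or> (\<exists>c\<in>C - {c0}. w c \<noteq> None)"
proof (rule ccontr)
  assume w: "w \<in> extensional C" "w \<notin> range node" "\<not> (w c0 = None \<or> (\<exists>c\<in>C - {c0}. w c \<noteq> None))"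
  then obtain kl where "w c0 = Some kl" by auto
  then have "w = node kl" using w by (auto simp: fun_eq_iff node_def extensional_def)
  then show False using w by blast
qed

lemma prod_not_node:
  fixes g :: "'b \<times> 'b \<Rightarrow> 'k"
  assumes "w \<in> extensional C" "w \<notin> range node"
  shows "(case w c0 of None \<Rightarrow> 0 | Some x \<Rightarrow> g x) * (\<Prod>c\<in>C - {c0}. h c * (if w c = None then 1 else 0)) = 0"
proof (cases "w c0 = None")
  case False
  then obtain c where c: "c \<in> C - {c0}" "w c \<noteq> None" using not_node[OF assms] by (elim disjE bexE) auto
  have "(\<Prod>c\<in>C - {c0}. h c * (if w c = None then 1 else 0)) = 0"
    by (rule prod_zero) (use finite_C c in \<open>auto intro!: bexI[of _ c]\<close>)
  then show ?thesis by simp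
qed simp

lemma prod_split: "(\<Prod>c\<in>C. g c) = g c0 * (\<Prod>c\<in>C - {c0}. g c)"
  by (rule prod.remove[OF finite_C pt])

definition embed :: "('b \<times> 'b \<Rightarrow> 'k) \<Rightarrow> (nat \<Rightarrow> ('b \<times> 'b) option) \<Rightarrow> 'k"
  where "embed x = (\<Sum>kl\<in>UNIV. x kl *\<^sub>v unit_vec (node kl))"

lemma embed_node: "embed x (node kl) = x kl"
proof -
  have "embed x (node kl) = (\<Sum>kl'\<in>UNIV. if kl' = kl then x kl' else 0)"
    unfolding embed_def sum_fun_apply using inj_node by (intro sum.cong) (auto simp: fscale_apply unit_vec_def dest: injD)
  then show ?thesis by simp
qed

lemma embed_other: "w \<notin> range node \<Longrightarrow> embed x w = 0"
  unfolding embed_def sum_fun_apply by (intro sum.neutral) (auto simp: fscale_apply unit_vec_def)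

lemma embed_lin [lin]: "lin_map f \<Longrightarrow> lin_map (\<lambda>x. embed (f x))"
  unfolding embed_def by (intro lin lin_form_coord) assumption

lemma embed_restrict: "v \<in> coord_space (range node) \<Longrightarrow> embed (\<lambda>kl. v (node kl)) = v"
proof
  fix w assume "v \<in> coord_space (range node)"
  then show "embed (\<lambda>kl. v (node kl)) w = v w"
    by (cases "w \<in> range node") (auto simp: embed_node embed_other coord_space_def)
qed

lemma embed_coord_space: "embed x \<in> coord_space (range node)"
  by (simp add: coord_space_def embed_other)

lemma pure_tensor_act:
  "pure_tensor C (\<lambda>c. r_act (site_mc c) (unit_vec (node kl c)) (unit_vec (b c)))
    = (\<Prod>c\<in>C - {c0}. \<phi> (unit_vec (b c))) *\<^sub>v embed (uact (unit_vec kl) (unit_vec (b c0)))"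
proof
  fix w
  have u: "(unit_vec (Some kl) \<circ> Some :: _ \<Rightarrow> 'k) = unit_vec kl" by (simp add: unit_vec_def fun_eq_iff)
  have c0: "r_act (site_mc c0) (unit_vec (node kl c0)) (unit_vec (b c0)) y = (case y of None \<Rightarrow> 0 | Some x \<Rightarrow> uact (unit_vec kl) (unit_vec (b c0)) x)" for y
    by (simp add: site_mc_def some_mc_def u)
  have c: "r_act (site_mc c) (unit_vec (node kl c)) (unit_vec (b c)) y = \<phi> (unit_vec (b c)) * (if y = None then 1 else 0)" if "c \<in> C - {c0}" for c y
    using that by (simp add: site_mc_def one_dim_mc_def fscale_apply) (simp add: unit_vec_def)
  have pr: "(\<Prod>c\<in>C. r_act (site_mc c) (unit_vec (node kl c)) (unit_vec (b c)) (w c))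
    = (case w c0 of None \<Rightarrow> 0 | Some x \<Rightarrow> uact (unit_vec kl) (unit_vec (b c0)) x) * (\<Prod>c\<in>C - {c0}. \<phi> (unit_vec (b c)) * (if w c = None then 1 else 0))"
    unfolding prod_split c0 using c by simp
  show "pure_tensor C (\<lambda>c. r_act (site_mc c) (unit_vec (node kl c)) (unit_vec (b c))) w
    = ((\<Prod>c\<in>C - {c0}. \<phi> (unit_vec (b c))) *\<^sub>v embed (uact (unit_vec kl) (unit_vec (b c0)))) w"
  proof (cases "w \<in> range node")
    case True
    then obtain kl' where w: "w = node kl'" by blast
    show ?thesis unfolding pure_tensor_def w
      using pr unfolding w by (simp add: fscale_apply embed_node)
  next
    case False
    have "(\<Prod>c\<in>C. r_act (site_mc c) (unit_vec (node kl c)) (unit_vec (b c)) (w c)) = 0" if "w \<in> extensional C"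
      unfolding pr by (rule prod_not_node[OF that False])
    then show ?thesis using False by (simp add: pure_tensor_def fscale_apply embed_other)
  qed
qed

lemma r_act_tensor: "r_act (tensor_mc C site_mc) v a = embed (\<Sum>kl\<in>UNIV. \<Sum>b\<in>PiE C (\<lambda>_. UNIV).
    (v (node kl) * a b * (\<Prod>c\<in>C - {c0}. \<phi> (unit_vec (b c)))) *\<^sub>v uact (unit_vec kl) (unit_vec (b c0)))"
proof -
  have l: "lin_map embed" using embed_lin[OF lin_map_ident] .
  have "r_act (tensor_mc C site_mc) v a = (\<Sum>z\<in>range node. \<Sum>b\<in>PiE C (\<lambda>_. UNIV).
       (v z * a b) *\<^sub>v pure_tensor C (\<lambda>c. r_act (site_mc c) (unit_vec (z c)) (unit_vec (b c))))"
    by (simp add: tensor_mc_def basis)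
  also have "\<dots> = (\<Sum>kl\<in>UNIV. \<Sum>b\<in>PiE C (\<lambda>_. UNIV). (v (node kl) * a b) *\<^sub>v pure_tensor C (\<lambda>c. r_act (site_mc c) (unit_vec (node kl c)) (unit_vec (b c))))"
    by (subst sum.reindex[OF inj_node]) (simp add: comp_def)
  finally show ?thesis
    unfolding pure_tensor_act by (simp add: lin_map_sum[OF l] lin_map_scale[OF l] mult.assoc)
qed

lemma l_act_hilbert_space: "l_act (hilbert_space H (induced_bimodule H p \<chi> \<zeta>) \<Gamma>) a t
    = (\<Sum>b\<in>PiE C (\<lambda>_. UNIV). a b *\<^sub>v app (prod_list (map (\<lambda>c. A c (b c)) sites)) t)"
  by (simp add: hilbert_space_def foldr_L_word)

lemma r_coact_site:
  assumes w: "w \<in> extensional C"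
  shows "(\<Prod>c\<in>C. r_coact (site_mc c) (unit_vec (node (k, l) c)) (w c, b c))
    = (if w \<in> range node then unit_vec k (fst (the (w c0))) * comult H (unit_vec l) (snd (the (w c0)), b c0) * (\<Prod>c\<in>C - {c0}. (pinv \<cdot> pinv) (b c)) else 0)"
proof -
  have u: "(unit_vec (Some (k, l)) \<circ> Some :: _ \<Rightarrow> 'k) = unit_vec (k, l)" by (simp add: unit_vec_def fun_eq_iff)
  have U: "r_coact (U_mc H) (unit_vec (k, l)) ((k', l'), i) = unit_vec k k' * comult H (unit_vec l) (l', i)" for k' l' i
  proof -
    have "r_coact (U_mc H) (unit_vec (k, l)) = sw2 H (unit_vec l) (\<lambda>x y. (unit_vec k \<otimes>\<^sub>v x) \<otimes>\<^sub>v y)"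
      unfolding tensor_unit_vec[symmetric] by (simp add: U_mc_def) (rule lift2_tensor, (intro lin)+)
    then have "r_coact (U_mc H) (unit_vec (k, l)) ((k', l'), i) = unit_vec k k' * sw2 H (unit_vec l) (\<lambda>x y. x \<otimes>\<^sub>v y) (l', i)"
      by (simp add: sw2_apply tensor_def sum_distrib_left mult_ac)
    then show ?thesis by (simp add: comult_sw2[symmetric])
  qed
  have c0: "r_coact (site_mc c0) (unit_vec (node (k, l) c0)) (y, i) = (case y of None \<Rightarrow> 0 | Some x \<Rightarrow> unit_vec k (fst x) * comult H (unit_vec l) (snd x, i))" for y i
    by (auto simp: site_mc_def some_mc_def u U split: option.split)
  have c: "r_coact (site_mc c) (unit_vec (node (k, l) c)) (y, i) = (pinv \<cdot> pinv) i * (if y = None then 1 else 0)" if "c \<in> C - {c0}" for c y i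
    using that by (simp add: site_mc_def one_dim_mc_def tensor_def) (simp add: unit_vec_def)
  have pr: "(\<Prod>c\<in>C. r_coact (site_mc c) (unit_vec (node (k, l) c)) (w c, b c))
    = (case w c0 of None \<Rightarrow> 0 | Some x \<Rightarrow> unit_vec k (fst x) * comult H (unit_vec l) (snd x, b c0)) * (\<Prod>c\<in>C - {c0}. (pinv \<cdot> pinv) (b c) * (if w c = None then 1 else 0))"
    unfolding prod_split c0 using c by simp
  show ?thesis
  proof (cases "w \<in> range node")
    case True
    then show ?thesis using pr by auto
  next
    case False
    then show ?thesis unfolding pr prod_not_node[OF w False] by simp
  qed
qed

text \<open>The component of \<open>t\<close> at the basis vector e_k \<otimes> e_l of
  \<open>U\<close>.\<close>

definition slice :: "'b \<Rightarrow> 'b \<Rightarrow> ((nat \<Rightarrow> ('b \<times> 'b) option) \<times> (nat set \<Rightarrow> 'b) \<Rightarrow> 'k) \<Rightarrow> (nat set \<Rightarrow> 'b) \<Rightarrow> 'k"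
  where "slice k l t = (\<lambda>x. t (node (k, l), x))"

lemma slice_lin [lin]: "lin_map f \<Longrightarrow> lin_map (\<lambda>t. slice k l (f t))"
  by (rule lin_mapI) (simp_all add: slice_def lin_map_add lin_map_scale fscale_apply fun_eq_iff)

lemma slice_embed: "slice k l (embed x \<otimes>\<^sub>v n) = x (k, l) *\<^sub>v n"
  by (simp add: slice_def tensor_def embed_node fscale_def)

abbreviation "big \<equiv> coord_space (range node \<times> PiE (edges \<Gamma>) (\<lambda>_. UNIV)) ::
  ((nat \<Rightarrow> ('b \<times> 'b) option) \<times> (nat set \<Rightarrow> 'b) \<Rightarrow> 'k) set"

lemma slice_X: "t \<in> big \<Longrightarrow> slice k l t \<in> X"
  by (simp add: coord_space_def slice_def)

lemma expand_big: "t \<in> big \<Longrightarrow> t = (\<Sum>k\<in>UNIV. \<Sum>l\<in>UNIV. embed (unit_vec (k, l)) \<otimes>\<^sub>v slice k l t)"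
proof
  fix wx :: "(nat \<Rightarrow> ('b \<times> 'b) option) \<times> (nat set \<Rightarrow> 'b)" assume t: "t \<in> big"
  obtain w x where wx: "wx = (w, x)" by fastforce
  show "t wx = (\<Sum>k\<in>UNIV. \<Sum>l\<in>UNIV. embed (unit_vec (k, l)) \<otimes>\<^sub>v slice k l t) wx"
  proof (cases "w \<in> range node")
    case True
    then obtain k l where w: "w = node (k, l)" by auto
    have "(\<Sum>k'\<in>UNIV. \<Sum>l'\<in>UNIV. embed (unit_vec (k', l')) \<otimes>\<^sub>v slice k' l' t) wx
      = (\<Sum>k'\<in>UNIV. \<Sum>l'\<in>UNIV. (if (k', l') = (k, l) then 1 else 0) * t (node (k', l'), x))"
      unfolding wx w by (simp add: sum_fun_apply tensor_def embed_node slice_def unit_vec_def eq_commute)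
    also have "\<dots> = (\<Sum>k'\<in>UNIV. if k' = k then \<Sum>l'\<in>UNIV. if l' = l then t (node (k', l'), x) else 0 else 0)"
      by (intro sum.cong[OF refl]) (auto simp: if_distrib[of "\<lambda>c. c * _"] cong: if_cong)
    also have "\<dots> = t (node (k, l), x)" by simp
    finally show ?thesis by (simp add: wx w)
  next
    case False
    then have "t wx = 0" using t by (simp add: coord_space_def wx)
    moreover have "(\<Sum>k\<in>UNIV. \<Sum>l\<in>UNIV. embed (unit_vec (k, l)) \<otimes>\<^sub>v slice k l t) wx = 0"
      using False by (simp add: wx sum_fun_apply tensor_def embed_other)
    ultimately show ?thesis by simp
  qed
qed

lemma embed_tensor_big: "n \<in> X \<Longrightarrow> embed x \<otimes>\<^sub>v n \<in> big"
  using embed_coord_space[of x] by (auto simp: coord_space_def tensor_def)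

abbreviation "prot_cotensor \<zeta> \<equiv> cotensor (coefficient_mc H p \<chi> \<Gamma> (U_mc H)) (hilbert_space H (induced_bimodule H p \<chi> \<zeta>) \<Gamma>)"

lemma cotensor_prod_iff:
  "t \<in> prot_cotensor \<zeta> \<longleftrightarrow> t \<in> big \<and> (\<forall>k l. \<forall>b\<in>PiE C (\<lambda>_. UNIV). app (prod_list (map (\<lambda>c. B c (b c)) sites)) (slice k l t)
    = (\<Sum>l'\<in>UNIV. (comult H (unit_vec l') (l, b c0) * (\<Prod>c\<in>C - {c0}. (pinv \<cdot> pinv) (b c))) *\<^sub>v slice k l' t))"
proof -
  let ?N = "hilbert_space H (induced_bimodule H p \<chi> \<zeta>) \<Gamma>"
  have E: "b \<in> PiE C (\<lambda>_. UNIV) \<longleftrightarrow> b \<in> extensional C" for b :: "nat \<Rightarrow> 'b" by (simp add: PiE_def)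
  have ES: "PiE C (\<lambda>_. UNIV :: 'b set) = extensional C" by (simp add: PiE_def)
  have lhs: "coact_fst (r_coact (tensor_mc C site_mc)) t (w, b, x)
    = (\<Sum>kl\<in>UNIV. t (node kl, x) * (if w \<in> extensional C \<and> b \<in> extensional C then \<Prod>c\<in>C. r_coact (site_mc c) (unit_vec (node kl c)) (w c, b c) else 0))" for w b x
    by (simp add: coact_fst_def tensor_mc_def basis sum.reindex[OF inj_node])
  have rhs: "coact_snd (l_coact ?N) t (w, b, x) = (if b \<in> extensional C then app (prod_list (map (\<lambda>c. B c (b c)) sites)) (\<lambda>n'. t (w, n')) x else 0)" for w b x
    by (simp add: coact_snd_def hilbert_space_def foldr_T_word E)
  have node: "coact_fst (r_coact (tensor_mc C site_mc)) t (node (k, l), b, x)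
    = (\<Sum>l'\<in>UNIV. (comult H (unit_vec l') (l, b c0) * (\<Prod>c\<in>C - {c0}. (pinv \<cdot> pinv) (b c))) *\<^sub>v slice k l' t) x" if b: "b \<in> extensional C" for k l b x
  proof -
    let ?f = "\<lambda>k' l'. t (node (k', l'), x) * (unit_vec k' k * comult H (unit_vec l') (l, b c0) * (\<Prod>c\<in>C - {c0}. (pinv \<cdot> pinv) (b c)))"
    have "coact_fst (r_coact (tensor_mc C site_mc)) t (node (k, l), b, x) = (\<Sum>(k', l')\<in>UNIV. ?f k' l')"
      unfolding lhs using b by (intro sum.cong) (auto simp: r_coact_site)
    also have "\<dots> = (\<Sum>k'\<in>UNIV. \<Sum>l'\<in>UNIV. ?f k' l')"
      by (simp add: sum.cartesian_product UNIV_Times_UNIV[symmetric] del: UNIV_Times_UNIV)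
    also have "\<dots> = (\<Sum>k'\<in>UNIV. if k' = k then \<Sum>l'\<in>UNIV. t (node (k', l'), x) * (comult H (unit_vec l') (l, b c0) * (\<Prod>c\<in>C - {c0}. (pinv \<cdot> pinv) (b c))) else 0)"
      by (intro sum.cong[OF refl]) (auto simp: unit_vec_def)
    finally show ?thesis by (simp add: sum_fun_apply fscale_apply slice_def mult.commute)
  qed
  \<comment> \<open>Off the basis both sides of the cotensor condition vanish, so that only the
    indices \<open>node (k, l)\<close> carry information.\<close>
  have other: "coact_fst (r_coact (tensor_mc C site_mc)) t (w, b, x) = coact_snd (l_coact ?N) t (w, b, x)"
    if t: "t \<in> big" and w: "w \<notin> range node \<or> b \<notin> extensional C" for w b x
  proof (cases "b \<in> extensional C")
    case True
    then have w: "w \<notin> range node" using w by blast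
    then have "(\<lambda>n'. t (w, n')) = 0" using t by (auto simp: coord_space_def fun_eq_iff)
    moreover have "app Y 0 = 0" for Y :: "(nat set \<Rightarrow> 'b, 'k) lop" by (rule lin_map_0[OF lin_map_app])
    moreover have "w \<in> extensional C \<Longrightarrow> (\<Prod>c\<in>C. r_coact (site_mc c) (unit_vec (node kl c)) (w c, b c)) = 0" for kl
      using r_coact_site[of w "fst kl" "snd kl"] w by simp
    ultimately show ?thesis unfolding lhs rhs by (auto intro!: sum.neutral)
  qed (simp add: lhs rhs)
  have "t \<in> prot_cotensor \<zeta> \<longleftrightarrow> t \<in> big \<and> coact_fst (r_coact (tensor_mc C site_mc)) t = coact_snd (l_coact ?N) t"
    by (simp add: cotensor_def coefficient_mc_site_mc) (simp add: tensor_mc_def basis hilbert_space_def)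
  also have "\<dots> \<longleftrightarrow> t \<in> big \<and> (\<forall>k l. \<forall>b\<in>extensional C. \<forall>x. coact_fst (r_coact (tensor_mc C site_mc)) t (node (k, l), b, x) = coact_snd (l_coact ?N) t (node (k, l), b, x))"
    (is "?P \<longleftrightarrow> ?Q")
  proof
    assume Q: ?Q
    have "coact_fst (r_coact (tensor_mc C site_mc)) t wbx = coact_snd (l_coact ?N) t wbx" for wbx
    proof -
      obtain w b x where e: "wbx = (w, b, x)" by (cases wbx) auto
      show ?thesis
      proof (cases "w \<in> range node \<and> b \<in> extensional C")
        case True
        then show ?thesis using Q e by fastforce
      qed (use other[of w b x] Q e in blast)
    qed
    then show ?P using Q by blast
  qed simp
  also have "\<dots> \<longleftrightarrow> t \<in> big \<and> (\<forall>k l. \<forall>b\<in>PiE C (\<lambda>_. UNIV). app (prod_list (map (\<lambda>c. B c (b c)) sites)) (slice k l t)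
    = (\<Sum>l'\<in>UNIV. (comult H (unit_vec l') (l, b c0) * (\<Prod>c\<in>C - {c0}. (pinv \<cdot> pinv) (b c))) *\<^sub>v slice k l' t))"
    unfolding ES by (simp add: node rhs fun_eq_iff slice_def[symmetric] eq_commute cong: conj_cong)
  finally show ?thesis .
qed

end

lemma unit_vec_sum: "(\<Sum>j\<in>UNIV. unit_vec i j * g j) = (g i :: 'k::field)" for i :: "'i::finite"
proof -
  have "(\<Sum>j\<in>UNIV. unit_vec i j * g j) = (\<Sum>j\<in>UNIV. if j = i then g j else 0)"
    by (rule sum.cong) (auto simp: unit_vec_def)
  then show ?thesis by simp
qed

lemma unit_vec_lscale_sum: "(\<Sum>j\<in>UNIV. unit_vec i j *\<^sub>o Y j) = Y i" for i :: "'i::finite"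
proof -
  have "(\<Sum>j\<in>UNIV. unit_vec i j *\<^sub>o Y j) = (\<Sum>j\<in>UNIV. if j = i then Y j else 0)"
    by (rule sum.cong) (auto simp: unit_vec_def)
  then show ?thesis by simp
qed

lemma sw2_diff: "sw2 H x F - sw2 H x G = sw2 H x (\<lambda>a b. F a b - G a b)"
  unfolding sw2_unfold by (simp add: sum_subtractf fun_vs.scale_right_diff_distrib)

lemma sw2_in_subspace: "fun_vs.subspace R \<Longrightarrow> (\<And>a b. F a b \<in> R) \<Longrightarrow> sw2 H x F \<in> R"
  unfolding sw2_unfold by (intro fun_vs.subspace_sum fun_vs.subspace_scale)

context kitaev
begin

lemma counit_q: "(\<Sum>j\<in>UNIV. \<epsilon> (unit_vec j) * (pinv \<cdot> pinv) j) = 1"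
proof -
  have "\<epsilon> (pinv \<cdot> pinv) = 1" by (simp add: counit_mult counit_pinv)
  then show ?thesis using lin_form_expand[OF counit_linear, of "pinv \<cdot> pinv"] by (simp add: mult.commute)
qed

lemma comult_counit: "(\<Sum>j\<in>UNIV. \<epsilon> (unit_vec j) * comult H (unit_vec m) (l, j)) = (if m = l then 1 else 0)"
  using comult_counit_coord(2)[of m l] by (simp add: mult.commute)

lemma corep_B_counit: "c \<in> C \<Longrightarrow> (\<Sum>j\<in>UNIV. \<epsilon> (unit_vec j) *\<^sub>o B c j) = 1"
  and corep_B_mult: "c \<in> C \<Longrightarrow> B c i * B c l = (\<Sum>m\<in>UNIV. comult H (unit_vec m) (l, i) *\<^sub>o B c m)"
  using corep_B by (simp_all add: corep_def)

text \<open>Pairing with the counit at all other sites isolates the condition at one site.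
  Conversely, the conditions at the single sites are multiplied up along the list of sites.\<close>

lemma cotensor_iff:
  "t \<in> prot_cotensor \<zeta> \<longleftrightarrow> t \<in> big \<and>
    (\<forall>k l i. \<forall>d\<in>C - {c0}. app (B d i) (slice k l t) = (pinv \<cdot> pinv) i *\<^sub>v slice k l t) \<and>
    (\<forall>k l i. app (B c0 i) (slice k l t) = (\<Sum>l'\<in>UNIV. comult H (unit_vec l') (l, i) *\<^sub>v slice k l' t))"
    (is "_ \<longleftrightarrow> _ \<and> ?P \<and> ?Q")
proof (intro iffI conjI)
  assume t: "t \<in> prot_cotensor \<zeta>"
  then show "t \<in> big" by (simp add: cotensor_prod_iff)
  \<comment> \<open>The coefficient coaction at each site: the comultiplication of l at
    \<open>c0\<close>, the group-like element p^-2 elsewhere.\<close>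
  define g where "g l l' c = (if c = c0 then (\<lambda>i. comult H (unit_vec l') (l, i)) else pinv \<cdot> pinv)" for l l' c
  have gen: "app (prod_list (map (\<lambda>c. \<Sum>i\<in>UNIV. f c i *\<^sub>o B c i) sites)) (slice k l t)
    = (\<Sum>l'\<in>UNIV. (\<Prod>c\<in>C. \<Sum>i\<in>UNIV. f c i * g l l' c i) *\<^sub>v slice k l' t)" for f k l
  proof -
    have "app (prod_list (map (\<lambda>c. \<Sum>i\<in>UNIV. f c i *\<^sub>o B c i) sites)) (slice k l t)
      = (\<Sum>b\<in>PiE C (\<lambda>_. UNIV). (\<Prod>c\<in>C. f c (b c)) *\<^sub>v app (prod_list (map (\<lambda>c. B c (b c)) sites)) (slice k l t))"
      unfolding sum_PiE_prod_list[OF sites(2), unfolded sites(1), symmetric] by (simp add: app_lsum app_lscale)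
    also have "\<dots> = (\<Sum>b\<in>PiE C (\<lambda>_. UNIV). (\<Prod>c\<in>C. f c (b c)) *\<^sub>v (\<Sum>l'\<in>UNIV. (\<Prod>c\<in>C. g l l' c (b c)) *\<^sub>v slice k l' t))"
      using t unfolding prod_split g_def by (intro sum.cong refl) (simp add: cotensor_prod_iff)
    also have "\<dots> = (\<Sum>l'\<in>UNIV. (\<Sum>b\<in>PiE C (\<lambda>_. UNIV). \<Prod>c\<in>C. f c (b c) * g l l' c (b c)) *\<^sub>v slice k l' t)"
      unfolding fun_vs.scale_sum_right fun_vs.scale_sum_left prod.distrib by (subst sum.swap) simp
    also have "\<dots> = (\<Sum>l'\<in>UNIV. (\<Prod>c\<in>C. \<Sum>i\<in>UNIV. f c i * g l l' c i) *\<^sub>v slice k l' t)"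
      using finite_C by (subst prod_sum_PiE) auto
    finally show ?thesis .
  qed
  have single: "app (B d i) (slice k l t)
    = (\<Sum>l'\<in>UNIV. (\<Prod>c\<in>C. if c = d then g l l' d i else \<Sum>j\<in>UNIV. \<epsilon> (unit_vec j) * g l l' c j) *\<^sub>v slice k l' t)"
    if d: "d \<in> C" for d i k l
  proof -
    \<comment> \<open>The i-th dual basis vector at \<open>d\<close> and the counit at all other
      sites, where the face words then sum to 1.\<close>
    let ?f = "\<lambda>c. if c = d then unit_vec i else (\<lambda>j. \<epsilon> (unit_vec j))"
    have "prod_list (map (\<lambda>c. \<Sum>j\<in>UNIV. ?f c j *\<^sub>o B c j) sites) = B d i"
      by (subst prod_list_single[where d = d]) (use d corep_B_counit in \<open>auto simp: unit_vec_lscale_sum\<close>)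
    moreover have "(\<Sum>j\<in>UNIV. ?f c j * g l l' c j) = (if c = d then g l l' d i else \<Sum>j\<in>UNIV. \<epsilon> (unit_vec j) * g l l' c j)" for c l'
      by (simp add: unit_vec_sum)
    ultimately show ?thesis using gen[of ?f k l] by simp
  qed
  show ?P
  proof (intro allI ballI)
    fix k l i d assume d: "d \<in> C - {c0}"
    have "(\<Prod>c\<in>C. if c = d then g l l' d i else \<Sum>j\<in>UNIV. \<epsilon> (unit_vec j) * g l l' c j) = (if l' = l then (pinv \<cdot> pinv) i else 0)" for l'
    proof -
      have "(\<Prod>c\<in>C - {c0}. if c = d then g l l' d i else \<Sum>j\<in>UNIV. \<epsilon> (unit_vec j) * g l l' c j) = (\<Prod>c\<in>C - {c0}. if c = d then (pinv \<cdot> pinv) i else 1)"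
        by (rule prod.cong) (use d counit_q in \<open>auto simp: g_def\<close>)
      then show ?thesis unfolding prod_split using d finite_C by (auto simp: g_def comult_counit)
    qed
    then show "app (B d i) (slice k l t) = (pinv \<cdot> pinv) i *\<^sub>v slice k l t"
      using single[of d i k l] d by (simp add: if_distrib[of "\<lambda>c. c *\<^sub>v _"] cong: if_cong)
  qed
  show ?Q
  proof (intro allI)
    fix k l i
    have "(\<Prod>c\<in>C. if c = c0 then g l l' c0 i else \<Sum>j\<in>UNIV. \<epsilon> (unit_vec j) * g l l' c j) = comult H (unit_vec l') (l, i)" for l'
    proof -
      have "(\<Prod>c\<in>C - {c0}. if c = c0 then g l l' c0 i else \<Sum>j\<in>UNIV. \<epsilon> (unit_vec j) * g l l' c j) = 1"
        by (rule prod.neutral) (use counit_q in \<open>auto simp: g_def\<close>)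
      then show ?thesis unfolding prod_split by (simp add: g_def)
    qed
    then show "app (B c0 i) (slice k l t) = (\<Sum>l'\<in>UNIV. comult H (unit_vec l') (l, i) *\<^sub>v slice k l' t)"
      using single[OF pt, of i k l] by simp
  qed
next
  assume a: "t \<in> big \<and> ?P \<and> ?Q"
  have P: "app (B d i) (slice k l t) = (pinv \<cdot> pinv) i *\<^sub>v slice k l t" if "d \<in> C - {c0}" for k l i d using a that by blast
  have Q: "app (B c0 i) (slice k l t) = (\<Sum>l'\<in>UNIV. comult H (unit_vec l') (l, i) *\<^sub>v slice k l' t)" for k l i using a by blast
  have "app (prod_list (map (\<lambda>c. B c (b c)) cs)) (slice k l t)
    = (\<Prod>c\<in>set cs - {c0}. (pinv \<cdot> pinv) (b c)) *\<^sub>v (if c0 \<in> set cs then \<Sum>l'\<in>UNIV. comult H (unit_vec l') (l, b c0) *\<^sub>v slice k l' t else slice k l t)"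
    if "distinct cs" "set cs \<subseteq> C" for cs k l b
    using that
  proof (induction cs)
    case (Cons d cs)
    note ls = lin_map_sum[OF lin_map_app[of "B d (b d)"]] lin_map_scale[OF lin_map_app[of "B d (b d)"]]
    let ?s = "if c0 \<in> set cs then \<Sum>l'\<in>UNIV. comult H (unit_vec l') (l, b c0) *\<^sub>v slice k l' t else slice k l t"
    have IH: "app (prod_list (map (\<lambda>c. B c (b c)) (d # cs))) (slice k l t) = (\<Prod>c\<in>set cs - {c0}. (pinv \<cdot> pinv) (b c)) *\<^sub>v app (B d (b d)) ?s"
    proof -
      have "app (prod_list (map (\<lambda>c. B c (b c)) cs)) (slice k l t) = (\<Prod>c\<in>set cs - {c0}. (pinv \<cdot> pinv) (b c)) *\<^sub>v ?s"
        by (rule Cons.IH) (use Cons.prems in auto)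
      then show ?thesis unfolding list.map prod_list.Cons app_times ls(2)[symmetric] by (rule arg_cong)
    qed
    show ?case
    proof (cases "d = c0")
      case True
      then show ?thesis unfolding IH using Cons.prems Q by simp
    next
      case False
      then have d: "d \<in> C - {c0}" using Cons.prems by simp
      have "set (d # cs) - {c0} = insert d (set cs - {c0})" "d \<notin> set cs - {c0}" using False Cons.prems by auto
      then have "(\<Prod>c\<in>set (d # cs) - {c0}. (pinv \<cdot> pinv) (b c)) = (pinv \<cdot> pinv) (b d) * (\<Prod>c\<in>set cs - {c0}. (pinv \<cdot> pinv) (b c))" by simp
      moreover have "app (B d (b d)) ?s = (pinv \<cdot> pinv) (b d) *\<^sub>v ?s"
        using P[OF d] by (simp add: ls fun_vs.scale_sum_right mult.commute)
      ultimately show ?thesis unfolding IH using False by (simp add: mult.commute)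
    qed
  qed (simp add: app_one)
  from this[OF sites(2)] have "app (prod_list (map (\<lambda>c. B c (b c)) sites)) (slice k l t)
    = (\<Prod>c\<in>C - {c0}. (pinv \<cdot> pinv) (b c)) *\<^sub>v (\<Sum>l'\<in>UNIV. comult H (unit_vec l') (l, b c0) *\<^sub>v slice k l' t)" for b k l
    using pt finite_C by simp
  then show "t \<in> prot_cotensor \<zeta>"
    using a unfolding cotensor_prod_iff by (simp add: fun_vs.scale_sum_right mult.commute)
qed

lemma subspace_big: "fun_vs.subspace big"
  by (auto simp: fun_vs.subspace_def coord_space_def fscale_apply)

lemma subspace_cotensor: "fun_vs.subspace (prot_cotensor \<zeta>)"
proof -
  have s: "lin_map (slice k l)" for k l by (rule slice_lin[OF lin_map_ident])
  note s = lin_map_add[OF s] lin_map_scale[OF s] lin_map_0[OF s] lin_map_add[OF lin_map_app] lin_map_scale[OF lin_map_app] lin_map_0[OF lin_map_app]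
  show ?thesis
  proof (rule fun_vs.subspaceI)
    show "0 \<in> prot_cotensor \<zeta>"
      unfolding cotensor_iff using fun_vs.subspace_0[OF subspace_big] by (simp add: s)
    fix t u assume t: "t \<in> prot_cotensor \<zeta>"
    show "c *\<^sub>v t \<in> prot_cotensor \<zeta>" for c
      using t fun_vs.subspace_scale[OF subspace_big] unfolding cotensor_iff by (simp add: s fun_vs.scale_sum_right mult.commute)
    assume u: "u \<in> prot_cotensor \<zeta>"
    show "t + u \<in> prot_cotensor \<zeta>"
      using t u fun_vs.subspace_add[OF subspace_big] unfolding cotensor_iff by (simp add: s fun_vs.scale_right_distrib sum.distrib)
  qed
qed

end

context kitaev
begin

abbreviation "inv_space \<equiv> Inv X C c0 (face_list \<Gamma>)"
abbreviation "rel_space \<equiv> Rel X C c0 (vertex_list \<Gamma>)"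
abbreviation "prot_relations \<zeta> \<equiv> tensor_relations (PiE C (\<lambda>_. UNIV)) (coefficient_mc H p \<chi> \<Gamma> (U_mc H))
  (hilbert_space H (induced_bimodule H p \<chi> \<zeta>) \<Gamma>)"

lemma stable_X: "stable V X"
  using stable_coord_space unfolding edges_def .

lemma A_X: "c \<in> C \<Longrightarrow> n \<in> X \<Longrightarrow> app (A c i) n \<in> X" and B_X: "c \<in> C \<Longrightarrow> n \<in> X \<Longrightarrow> app (B c i) n \<in> X"
  using stable_wordL[OF stable_X lists(1)] stable_wordT[OF stable_X lists(2)] by (simp_all add: pres_app)

lemma subspace_X: "fun_vs.subspace X"
  by (rule stable_subspace[OF stable_X])

lemma subspace_relations: "fun_vs.subspace (prot_relations \<zeta>)"
  unfolding tensor_relations_def by (rule fun_vs.subspace_span)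

text \<open>The relation for a pure tensor of algebra elements, one for each site. Taking all but
  one of them to be 1 gives the relations at single sites.\<close>

lemma relation_family:
  assumes n: "n \<in> X"
  shows "(\<Prod>c\<in>C - {c0}. \<phi> (a c)) *\<^sub>v (embed (uact x (a c0)) \<otimes>\<^sub>v n)
    - embed x \<otimes>\<^sub>v app (prod_list (map (\<lambda>c. \<Sum>i\<in>UNIV. a c i *\<^sub>o A c i) sites)) n \<in> prot_relations \<zeta>"
proof -
  let ?M = "induced_bimodule H p \<chi> \<zeta>" and ?P = "PiE C (\<lambda>_. UNIV :: 'b set)" and ?\<Phi> = "\<Prod>c\<in>C - {c0}. \<phi> (a c)"
  \<comment> \<open>Coordinates of the pure tensor of the elements \<open>a c\<close>, cut off
    outside the basis.\<close>
  define a' where "a' b = (if b \<in> ?P then \<Prod>c\<in>C. a c (b c) else 0)" for b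
  have le: "lin_map embed" by (rule embed_lin[OF lin_map_ident])
  have 1: "(\<Sum>b\<in>?P. (a' b * (\<Prod>c\<in>C - {c0}. \<phi> (unit_vec (b c)))) *\<^sub>v uact u (unit_vec (b c0))) = ?\<Phi> *\<^sub>v uact u (a c0)" for u
  proof
    fix r
    let ?g = "\<lambda>c i. if c = c0 then uact u (unit_vec i) r else \<phi> (unit_vec i)"
    have g: "(\<Prod>c\<in>C. ?g c (b c)) = uact u (unit_vec (b c0)) r * (\<Prod>c\<in>C - {c0}. \<phi> (unit_vec (b c)))" for b
      unfolding prod_split by simp
    have lu: "lin_form (\<lambda>h. uact u h r)" by (rule lin_form_coord[OF uact_lin_right[OF lin_map_ident]])
    have "(\<Sum>b\<in>?P. (a' b * (\<Prod>c\<in>C - {c0}. \<phi> (unit_vec (b c)))) *\<^sub>v uact u (unit_vec (b c0))) r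
      = (\<Sum>b\<in>?P. \<Prod>c\<in>C. a c (b c) * ?g c (b c))"
      unfolding sum_fun_apply prod.distrib g by (rule sum.cong) (simp_all add: a'_def)
    also have "\<dots> = (\<Prod>c\<in>C. \<Sum>i\<in>UNIV. a c i * ?g c i)"
      using finite_C by (subst prod_sum_PiE) auto
    also have "\<dots> = (\<Sum>i\<in>UNIV. a c0 i * uact u (unit_vec i) r) * (\<Prod>c\<in>C - {c0}. \<Sum>i\<in>UNIV. a c i * \<phi> (unit_vec i))"
      unfolding prod_split by simp
    also have "\<dots> = (?\<Phi> *\<^sub>v uact u (a c0)) r"
      unfolding lin_form_expand[OF lu, symmetric] lin_form_expand[OF phi_linear, symmetric] by (simp add: fscale_apply)
    finally show "(\<Sum>b\<in>?P. (a' b * (\<Prod>c\<in>C - {c0}. \<phi> (unit_vec (b c)))) *\<^sub>v uact u (unit_vec (b c0))) r = (?\<Phi> *\<^sub>v uact u (a c0)) r" .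
  qed
  have "(\<Sum>kl\<in>UNIV. \<Sum>b\<in>?P. (embed x (node kl) * a' b * (\<Prod>c\<in>C - {c0}. \<phi> (unit_vec (b c)))) *\<^sub>v uact (unit_vec kl) (unit_vec (b c0)))
    = (\<Sum>kl\<in>UNIV. x kl *\<^sub>v (\<Sum>b\<in>?P. (a' b * (\<Prod>c\<in>C - {c0}. \<phi> (unit_vec (b c)))) *\<^sub>v uact (unit_vec kl) (unit_vec (b c0))))"
    by (simp add: embed_node fun_vs.scale_sum_right mult.assoc)
  also have "\<dots> = ?\<Phi> *\<^sub>v (\<Sum>kl\<in>UNIV. x kl *\<^sub>v uact (unit_vec kl) (a c0))"
    unfolding 1 by (simp add: fun_vs.scale_sum_right mult.commute)
  also have "\<dots> = ?\<Phi> *\<^sub>v uact x (a c0)"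
    by (subst lin_map_expand[OF uact_lin_left[OF lin_map_ident], of x, symmetric]) (rule refl)
  finally have r: "r_act (tensor_mc C site_mc) (embed x) a' = ?\<Phi> *\<^sub>v embed (uact x (a c0))"
    unfolding r_act_tensor by (simp add: lin_map_scale[OF le])
  have l: "l_act (hilbert_space H ?M \<Gamma>) a' n = app (prod_list (map (\<lambda>c. \<Sum>i\<in>UNIV. a c i *\<^sub>o A c i) sites)) n"
    unfolding l_act_hilbert_space sum_PiE_prod_list[OF sites(2), unfolded sites(1), symmetric] app_lsum app_lscale
    by (rule sum.cong) (simp_all add: a'_def)
  have "r_act (tensor_mc C site_mc) (embed x) a' \<otimes>\<^sub>v n - embed x \<otimes>\<^sub>v l_act (hilbert_space H ?M \<Gamma>) a' n \<in> prot_relations \<zeta>"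
    unfolding tensor_relations_def coefficient_mc_site_mc
  proof (rule fun_vs.span_base, intro CollectI exI conjI)
    show "embed x \<in> coord_space (r_basis (tensor_mc C site_mc))" using embed_coord_space by (simp add: tensor_mc_def basis)
    show "n \<in> coord_space (l_basis (hilbert_space H ?M \<Gamma>))" using n by (simp add: hilbert_space_def)
    show "a' \<in> coord_space ?P" by (simp add: coord_space_def a'_def)
  qed (rule refl)
  then show ?thesis
    unfolding r l by (simp add: lin_map_scale[OF lin_map_tensor_left[OF lin_map_ident]])
qed

lemma act_lop: "app (\<Sum>i\<in>UNIV. a i *\<^sub>o A c i) n = act c a n"
  by (simp add: act_def app_lsum app_lscale)

lemma act_lop_one: "c \<in> C \<Longrightarrow> (\<Sum>i\<in>UNIV. \<one> i *\<^sub>o A c i) = 1"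
  using rep_A by (simp add: rep_def)

lemma relation_pt:
  assumes "n \<in> X"
  shows "embed (uact x h) \<otimes>\<^sub>v n - embed x \<otimes>\<^sub>v act c0 h n \<in> prot_relations \<zeta>"
proof -
  have "prod_list (map (\<lambda>c. \<Sum>i\<in>UNIV. (if c = c0 then h else \<one>) i *\<^sub>o A c i) sites) = (\<Sum>i\<in>UNIV. h i *\<^sub>o A c0 i)"
    by (subst prod_list_single[where d = c0]) (use pt in \<open>auto simp: act_lop_one\<close>)
  then show ?thesis
    using relation_family[OF assms, of "\<lambda>c. if c = c0 then h else \<one>" x] by (simp add: phi_unit act_lop)
qed

lemma relation_other:
  assumes "n \<in> X" and d: "d \<in> C - {c0}"
  shows "embed x \<otimes>\<^sub>v app (A d i) n - \<phi> (unit_vec i) *\<^sub>v (embed x \<otimes>\<^sub>v n) \<in> prot_relations \<zeta>"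
proof -
  have "prod_list (map (\<lambda>c. \<Sum>j\<in>UNIV. (if c = d then unit_vec i else \<one>) j *\<^sub>o A c j) sites) = A d i"
    by (subst prod_list_single[where d = d]) (use d in \<open>auto simp: act_lop_one unit_vec_lscale_sum\<close>)
  moreover have "(\<Prod>c\<in>C - {c0}. \<phi> (if c = d then unit_vec i else \<one>)) = (\<Prod>c\<in>C - {c0}. if c = d then \<phi> (unit_vec i) else 1)"
    by (rule prod.cong) (auto simp: phi_unit)
  moreover have "\<dots> = \<phi> (unit_vec i)" using d finite_C by simp
  ultimately have "\<phi> (unit_vec i) *\<^sub>v (embed x \<otimes>\<^sub>v n) - embed x \<otimes>\<^sub>v app (A d i) n \<in> prot_relations \<zeta>"
    using relation_family[OF assms(1), of "\<lambda>c. if c = d then unit_vec i else \<one>" x] d by (auto simp: uact_one)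
  from fun_vs.subspace_neg[OF subspace_relations this] show ?thesis by simp
qed

definition collapse :: "((nat \<Rightarrow> ('b \<times> 'b) option) \<times> (nat set \<Rightarrow> 'b) \<Rightarrow> 'k) \<Rightarrow> (nat set \<Rightarrow> 'b) \<Rightarrow> 'k"
  where "collapse t = (\<Sum>k\<in>UNIV. \<Sum>l\<in>UNIV. \<epsilon> (unit_vec l) *\<^sub>v app (A c0 k) (slice k l t))"

text \<open>The map n to 1 \<otimes> n_[-1] \<otimes> n_[0] for the coaction at \<open>pt\<close>, a
  section of \<open>collapse\<close> on the invariants.\<close>

definition spread :: "((nat set \<Rightarrow> 'b) \<Rightarrow> 'k) \<Rightarrow> (nat \<Rightarrow> ('b \<times> 'b) option) \<times> (nat set \<Rightarrow> 'b) \<Rightarrow> 'k"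
  where "spread n = (\<Sum>m\<in>UNIV. embed (\<one> \<otimes>\<^sub>v unit_vec m) \<otimes>\<^sub>v app (B c0 m) n)"

lemma collapse_linear: "lin_map collapse"
  unfolding collapse_def by (intro lin lin_map_comp[OF lin_map_app])

lemma spread_linear: "lin_map spread"
  unfolding spread_def by (intro lin lin_map_comp[OF lin_map_app])

lemma collapse_embed: "collapse (embed x \<otimes>\<^sub>v n) = lift2 (\<lambda>u v. \<epsilon> v *\<^sub>v act c0 u n) x"
  unfolding collapse_def slice_embed lift2_sum
  by (simp add: lin_map_scale[OF lin_map_app] act_unit_vec mult.commute)

lemma rel_A_pt: "w \<in> rel_space \<Longrightarrow> app (A c0 i) w \<in> rel_space"
  unfolding Rel_def
proof (erule span_image_subset[OF lin_map_app, rotated])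
  fix x assume "x \<in> {app (A c i) n - \<phi> (unit_vec i) *\<^sub>v n |c i n. c \<in> C - {c0} \<and> n \<in> X}"
  then obtain c j n where x: "x = app (A c j) n - \<phi> (unit_vec j) *\<^sub>v n" "c \<in> C - {c0}" "n \<in> X" by blast
  have "app (A c0 i) x = app (A c j) (app (A c0 i) n) - \<phi> (unit_vec j) *\<^sub>v app (A c0 i) n"
    using A_commute[OF pt, of c i j] x(2) by (simp add: x(1) lin_map_diff[OF lin_map_app] lin_map_scale[OF lin_map_app] app_times[symmetric])
  then show "app (A c0 i) x \<in> fun_vs.span {app (A c i) n - \<phi> (unit_vec i) *\<^sub>v n |c i n. c \<in> C - {c0} \<and> n \<in> X}"
    using x(2) A_X[OF pt x(3)] by (intro fun_vs.span_base) blast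
qed

lemma subspace_rel: "fun_vs.subspace rel_space"
  unfolding Rel_def by (rule fun_vs.subspace_span)

lemma rel_base: "c \<in> C - {c0} \<Longrightarrow> n \<in> X \<Longrightarrow> app (A c i) n - \<phi> (unit_vec i) *\<^sub>v n \<in> rel_space"
  unfolding Rel_def by (rule fun_vs.span_base) blast

text \<open>Modulo relations, a letter at a site other than \<open>c0\<close> is a scalar given by
  \<phi>. The letter at \<open>c0\<close> does no harm, because the action at \<open>c0\<close>
  preserves the relations.\<close>

lemma prod_A_rel:
  assumes n: "n \<in> X"
  shows "distinct cs \<Longrightarrow> set cs \<subseteq> C \<Longrightarrow> app (prod_list (map (\<lambda>c. A c (b c)) cs)) n \<in> X \<and>
    app (prod_list (map (\<lambda>c. A c (b c)) cs)) n - (\<Prod>c\<in>set cs - {c0}. \<phi> (unit_vec (b c))) *\<^sub>v (if c0 \<in> set cs then app (A c0 (b c0)) n else n) \<in> rel_space"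
proof (induction cs)
  case Nil
  then show ?case using n fun_vs.subspace_0[OF subspace_rel] by (simp add: app_one zero_fun_def)
next
  case (Cons d cs)
  let ?m = "app (prod_list (map (\<lambda>c. A c (b c)) cs)) n" and ?\<Phi> = "\<Prod>c\<in>set cs - {c0}. \<phi> (unit_vec (b c))"
  let ?s = "if c0 \<in> set cs then app (A c0 (b c0)) n else n"
  have IH: "?m \<in> X" "?m - ?\<Phi> *\<^sub>v ?s \<in> rel_space"
    using Cons.IH Cons.prems unfolding distinct.simps list.set by blast+
  have e: "app (prod_list (map (\<lambda>c. A c (b c)) (d # cs))) n = app (A d (b d)) ?m" by (simp add: app_times)
  have main: "app (A d (b d)) ?m - (\<Prod>c\<in>set (d # cs) - {c0}. \<phi> (unit_vec (b c))) *\<^sub>v (if c0 \<in> set (d # cs) then app (A c0 (b c0)) n else n) \<in> rel_space"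
  proof (cases "d = c0")
    case True
    then have "c0 \<notin> set cs" using Cons.prems by simp
    then show ?thesis
      using True rel_A_pt[OF IH(2), of "b c0"] by (simp add: lin_map_diff[OF lin_map_app] lin_map_scale[OF lin_map_app])
  next
    case False
    then have d: "d \<in> C - {c0}" using Cons.prems by simp
    have "set (d # cs) - {c0} = insert d (set cs - {c0})" "d \<notin> set cs - {c0}" using False Cons.prems by auto
    then have "(\<Prod>c\<in>set (d # cs) - {c0}. \<phi> (unit_vec (b c))) = \<phi> (unit_vec (b d)) * ?\<Phi>" by simp
    moreover have "app (A d (b d)) ?m - \<phi> (unit_vec (b d)) *\<^sub>v ?m + \<phi> (unit_vec (b d)) *\<^sub>v (?m - ?\<Phi> *\<^sub>v ?s) \<in> rel_space"
      by (rule fun_vs.subspace_add[OF subspace_rel rel_base[OF d IH(1)] fun_vs.subspace_scale[OF subspace_rel IH(2)]])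
    ultimately show ?thesis using False by (simp only: fun_vs.scale_right_diff_distrib fun_vs.scale_scale) simp
  qed
  have "d \<in> C" using Cons.prems by simp
  show ?case unfolding e by (rule conjI[OF A_X[OF \<open>d \<in> C\<close> IH(1)] main])
qed

text \<open>\<open>collapse\<close> carries the right action on \<open>U\<close> at
  \<open>pt\<close> to the action on n, so that only the part of a relation that belongs to the
  other sites survives.\<close>

lemma collapse_relations:
  assumes "t \<in> prot_relations \<zeta>"
  shows "collapse t \<in> rel_space"
proof -
  let ?N = "hilbert_space H (induced_bimodule H p \<chi> \<zeta>) \<Gamma>" and ?P = "PiE C (\<lambda>_. UNIV :: 'b set)"
  have s: "fun_vs.span rel_space = rel_space" by (rule fun_vs.span_eq_iff[THEN iffD2, OF subspace_rel])
  have "collapse t \<in> fun_vs.span rel_space"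
  proof (rule span_image_subset[OF collapse_linear _ assms[unfolded tensor_relations_def]])
    fix g assume "g \<in> {r_act (coefficient_mc H p \<chi> \<Gamma> (U_mc H)) x a \<otimes>\<^sub>v n - x \<otimes>\<^sub>v l_act ?N a n |x a n.
      x \<in> coord_space (r_basis (coefficient_mc H p \<chi> \<Gamma> (U_mc H))) \<and> a \<in> coord_space ?P \<and> n \<in> coord_space (l_basis ?N)}"
    then obtain v a n where g: "g = r_act (tensor_mc C site_mc) v a \<otimes>\<^sub>v n - v \<otimes>\<^sub>v l_act ?N a n"
      and v: "v \<in> coord_space (range node)" and n: "n \<in> X"
      unfolding coefficient_mc_site_mc by (auto simp: tensor_mc_def basis hilbert_space_def)
    let ?\<Phi> = "\<lambda>b. \<Prod>c\<in>C - {c0}. \<phi> (unit_vec (b c))" and ?A = "\<lambda>b. app (prod_list (map (\<lambda>c. A c (b c)) sites)) n"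
    let ?K = "lift2 (\<lambda>u v. \<epsilon> v *\<^sub>v act c0 u n)"
    have lK: "lin_map ?K" by (rule lift2_linear[OF lin_map_ident])
    have K: "?K (uact (unit_vec kl) h) = \<epsilon> (unit_vec (snd kl)) *\<^sub>v act c0 (unit_vec (fst kl)) (act c0 h n)" for kl h
      using lift2_uact[of "\<lambda>u. act c0 u n" "unit_vec (fst kl)" "unit_vec (snd kl)" h]
      by (simp add: tensor_unit_vec act_mult[OF pt] act_lin_left[OF lin_map_ident])
    have 1: "collapse (r_act (tensor_mc C site_mc) v a \<otimes>\<^sub>v n) = (\<Sum>kl\<in>UNIV. \<Sum>b\<in>?P.
      (v (node kl) * a b * \<epsilon> (unit_vec (snd kl))) *\<^sub>v app (A c0 (fst kl)) (?\<Phi> b *\<^sub>v app (A c0 (b c0)) n))"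
      unfolding r_act_tensor collapse_embed
      by (simp add: lin_map_sum[OF lK] lin_map_scale[OF lK] K act_unit_vec lin_map_scale[OF lin_map_app] mult_ac)
    have "collapse (v \<otimes>\<^sub>v l_act ?N a n) = collapse (embed (\<lambda>kl. v (node kl)) \<otimes>\<^sub>v l_act ?N a n)"
      unfolding embed_restrict[OF v] ..
    also have "\<dots> = (\<Sum>kl\<in>UNIV. (v (node kl) * \<epsilon> (unit_vec (snd kl))) *\<^sub>v app (A c0 (fst kl)) (l_act ?N a n))"
      unfolding collapse_embed lift2_def by (simp add: act_unit_vec case_prod_beta')
    also have "\<dots> = (\<Sum>kl\<in>UNIV. \<Sum>b\<in>?P. (v (node kl) * a b * \<epsilon> (unit_vec (snd kl))) *\<^sub>v app (A c0 (fst kl)) (?A b))"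
      unfolding l_act_hilbert_space
      by (simp add: lin_map_sum[OF lin_map_app] lin_map_scale[OF lin_map_app] fun_vs.scale_sum_right mult_ac)
    finally have 2: "collapse (v \<otimes>\<^sub>v l_act ?N a n) = \<dots>" .
    have "collapse g = (\<Sum>kl\<in>UNIV. \<Sum>b\<in>?P. (v (node kl) * a b * \<epsilon> (unit_vec (snd kl))) *\<^sub>v
        app (A c0 (fst kl)) (?\<Phi> b *\<^sub>v app (A c0 (b c0)) n - ?A b))"
      unfolding g lin_map_diff[OF collapse_linear] 1 2
      by (simp add: sum_subtractf[symmetric] fun_vs.scale_right_diff_distrib lin_map_diff[OF lin_map_app])
    also have "\<dots> \<in> rel_space"
    proof (intro fun_vs.subspace_sum[OF subspace_rel] fun_vs.subspace_scale[OF subspace_rel] rel_A_pt)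
      fix b
      have "?A b - ?\<Phi> b *\<^sub>v app (A c0 (b c0)) n \<in> rel_space"
        using prod_A_rel[OF n sites(2)] pt by simp
      from fun_vs.subspace_neg[OF subspace_rel this] show "?\<Phi> b *\<^sub>v app (A c0 (b c0)) n - ?A b \<in> rel_space" by simp
    qed
    finally show "collapse g \<in> fun_vs.span rel_space" unfolding s .
  qed
  then show ?thesis unfolding s .
qed

text \<open>The action at \<open>pt\<close>, through which \<open>collapse\<close> multiplies,
  commutes with the coactions at the other sites.\<close>

lemma collapse_cotensor:
  assumes t: "t \<in> prot_cotensor \<zeta>"
  shows "collapse t \<in> inv_space"
proof -
  have t': "t \<in> big" "d \<in> C - {c0} \<Longrightarrow> app (B d i) (slice k l t) = (pinv \<cdot> pinv) i *\<^sub>v slice k l t" for d i k l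
    using t by (simp_all add: cotensor_iff)
  have "collapse t \<in> X"
    unfolding collapse_def
    by (intro fun_vs.subspace_sum[OF subspace_X] fun_vs.subspace_scale[OF subspace_X] A_X[OF pt] slice_X t')
  moreover have "app (B d i) (collapse t) = (pinv \<cdot> pinv) i *\<^sub>v collapse t" if d: "d \<in> C - {c0}" for d i
  proof -
    have "app (B d i) (app (A c0 k) n) = app (A c0 k) (app (B d i) n)" for k n
      using A_B_commute[of d c0 k i] d pt by (simp add: app_times[symmetric])
    then show ?thesis
      using t'(2)[OF d] unfolding collapse_def
      by (simp add: lin_map_sum[OF lin_map_app] lin_map_scale[OF lin_map_app] fun_vs.scale_sum_right mult.commute)
  qed
  ultimately show ?thesis by (simp add: Inv_def)
qed

lemma slice_spread: "slice k l (spread n) = \<one> k *\<^sub>v app (B c0 l) n"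
proof -
  have "slice k l (spread n) = (\<Sum>m\<in>UNIV. if m = l then \<one> k *\<^sub>v app (B c0 m) n else 0)"
    unfolding spread_def lin_map_sum[OF slice_lin[OF lin_map_ident]] slice_embed
    by (rule sum.cong) (auto simp: tensor_def unit_vec_def)
  then show ?thesis by simp
qed

lemma spread_cotensor:
  assumes n: "n \<in> inv_space"
  shows "spread n \<in> prot_cotensor \<zeta>" "collapse (spread n) = n"
proof -
  have n': "n \<in> X" "d \<in> C - {c0} \<Longrightarrow> app (B d i) n = (pinv \<cdot> pinv) i *\<^sub>v n" for d i using n by (simp_all add: Inv_def)
  have big: "spread n \<in> big"
    unfolding spread_def by (intro fun_vs.subspace_sum[OF subspace_big] embed_tensor_big B_X pt n')
  have "app (B d i) (app (B c0 l) n) = (pinv \<cdot> pinv) i *\<^sub>v app (B c0 l) n" if d: "d \<in> C - {c0}" for d i l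
  proof -
    have "app (B d i) (app (B c0 l) n) = app (B c0 l) (app (B d i) n)"
      using B_commute[of d c0 i l] d pt by (simp add: app_times[symmetric])
    then show ?thesis using n'(2)[OF d] by (simp add: lin_map_scale[OF lin_map_app])
  qed
  moreover have "app (B c0 i) (app (B c0 l) n) = (\<Sum>m\<in>UNIV. comult H (unit_vec m) (l, i) *\<^sub>v app (B c0 m) n)" for i l
    using arg_cong[OF corep_B_mult[OF pt, of i l], of "\<lambda>Y. app Y n"] by (simp add: app_times app_lsum app_lscale)
  ultimately show "spread n \<in> prot_cotensor \<zeta>"
    unfolding cotensor_iff slice_spread using big
    by (simp add: lin_map_scale[OF lin_map_app] fun_vs.scale_sum_right mult.commute)
  have "collapse (spread n) = (\<Sum>k\<in>UNIV. \<one> k *\<^sub>v app (A c0 k) (\<Sum>l\<in>UNIV. \<epsilon> (unit_vec l) *\<^sub>v app (B c0 l) n))"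
    unfolding collapse_def slice_spread
    by (simp add: lin_map_sum[OF lin_map_app] lin_map_scale[OF lin_map_app] fun_vs.scale_sum_right mult.commute)
  also have "(\<Sum>l\<in>UNIV. \<epsilon> (unit_vec l) *\<^sub>v app (B c0 l) n) = n"
    using arg_cong[OF corep_B_counit[OF pt], of "\<lambda>Y. app Y n"] by (simp add: app_lsum app_lscale app_one)
  also have "(\<Sum>k\<in>UNIV. \<one> k *\<^sub>v app (A c0 k) n) = n"
    using act_one[OF pt, of n] unfolding act_def .
  finally show "collapse (spread n) = n" .
qed

lemma spread_rel:
  assumes "w \<in> rel_space"
  shows "spread w \<in> prot_relations \<zeta>"
proof -
  have s: "fun_vs.span (prot_relations \<zeta>) = prot_relations \<zeta>"
    by (rule fun_vs.span_eq_iff[THEN iffD2, OF subspace_relations])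
  have "spread w \<in> fun_vs.span (prot_relations \<zeta>)"
  proof (rule span_image_subset[OF spread_linear _ assms[unfolded Rel_def]])
    fix x assume "x \<in> {app (A c i) n - \<phi> (unit_vec i) *\<^sub>v n |c i n. c \<in> C - {c0} \<and> n \<in> X}"
    then obtain d i n where x: "x = app (A d i) n - \<phi> (unit_vec i) *\<^sub>v n" and d: "d \<in> C - {c0}" and n: "n \<in> X" by blast
    have "app (B c0 m) (app (A d i) n) = app (A d i) (app (B c0 m) n)" for m
      using A_B_commute[of c0 d i m] d pt by (auto simp: app_times[symmetric])
    then have "spread x = (\<Sum>m\<in>UNIV. embed (\<one> \<otimes>\<^sub>v unit_vec m) \<otimes>\<^sub>v app (A d i) (app (B c0 m) n)
        - \<phi> (unit_vec i) *\<^sub>v (embed (\<one> \<otimes>\<^sub>v unit_vec m) \<otimes>\<^sub>v app (B c0 m) n))"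
      unfolding x lin_map_diff[OF spread_linear] lin_map_scale[OF spread_linear]
      by (simp add: spread_def sum_subtractf fun_vs.scale_sum_right)
    also have "\<dots> \<in> prot_relations \<zeta>"
      by (intro fun_vs.subspace_sum[OF subspace_relations] relation_other B_X pt n d)
    finally show "spread x \<in> fun_vs.span (prot_relations \<zeta>)" unfolding s .
  qed
  then show ?thesis unfolding s .
qed

text \<open>
  Modulo the relations, $k \otimes l \otimes n = (1 \otimes k_{(1)} l S(k_{(3)})) \triangleleft k_{(2)} \otimes n
  \equiv 1 \otimes k_{(1)} l S(k_{(3)}) \otimes k_{(2)} n$; by the Yetter--Drinfeld condition the right-hand side is
  $1 \otimes \delta(k n_{[0]})$ if $l \otimes n$ is replaced by $n_{[-1]} \otimes n_{[0]}$.
\<close>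

lemma spread_collapse:
  assumes t: "t \<in> prot_cotensor \<zeta>"
  shows "t - spread (collapse t) \<in> prot_relations \<zeta>"
proof -
  have big: "t \<in> big" using t by (simp add: cotensor_iff)
  \<comment> \<open>The counit applied to the second tensor factor. By the condition at
    \<open>pt\<close>, each \<open>slice k l t\<close> is a component of the coaction on
    \<open>n k\<close>, so that t is the sum of the e_k \<otimes> \<delta>(n_k).\<close>
  define n where "n k = (\<Sum>l\<in>UNIV. \<epsilon> (unit_vec l) *\<^sub>v slice k l t)" for k
  have nX: "n k \<in> X" for k
    unfolding n_def by (intro fun_vs.subspace_sum[OF subspace_X] fun_vs.subspace_scale[OF subspace_X] slice_X big)
  have B_n: "app (B c0 i) (n k) = slice k i t" for k i
  proof -
    have "app (B c0 i) (n k) = (\<Sum>l\<in>UNIV. \<epsilon> (unit_vec l) *\<^sub>v (\<Sum>l'\<in>UNIV. comult H (unit_vec l') (l, i) *\<^sub>v slice k l' t))"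
      using t by (simp add: n_def cotensor_iff lin_map_sum[OF lin_map_app] lin_map_scale[OF lin_map_app])
    also have "\<dots> = (\<Sum>l'\<in>UNIV. (\<Sum>l\<in>UNIV. comult H (unit_vec l') (l, i) * \<epsilon> (unit_vec l)) *\<^sub>v slice k l' t)"
      unfolding fun_vs.scale_sum_right fun_vs.scale_sum_left by (subst sum.swap) (simp add: mult.commute)
    also have "\<dots> = (\<Sum>l'\<in>UNIV. if l' = i then slice k l' t else 0)"
      unfolding comult_counit_coord by (rule sum.cong) auto
    finally show ?thesis by simp
  qed
  let ?\<Psi> = "\<lambda>y n. embed (\<one> \<otimes>\<^sub>v y) \<otimes>\<^sub>v n"
  have \<Psi>: "bilin ?\<Psi>" by (intro conjI allI lin)
  let ?g = "\<lambda>k l. sw2 H (unit_vec k) (\<lambda>x w. sw2 H w (\<lambda>y z. ?\<Psi> (x \<cdot> unit_vec l \<cdot> S z) (act c0 y (app (B c0 l) (n k)))))"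
  have lt: "lin_map (\<lambda>x. embed x \<otimes>\<^sub>v m)" for m by (intro lin)
  have "spread (collapse t) = (\<Sum>k\<in>UNIV. spread (act c0 (unit_vec k) (n k)))"
    unfolding collapse_def n_def act_unit_vec
    by (simp add: lin_map_sum[OF spread_linear] lin_map_sum[OF lin_map_app] lin_map_scale[OF lin_map_app])
  also have "\<dots> = (\<Sum>k\<in>UNIV. \<Sum>l\<in>UNIV. ?g k l)"
    unfolding spread_def yetter_drinfeld_conjugate[OF pt \<Psi>, symmetric] sw2_sum ..
  finally have 1: "spread (collapse t) = (\<Sum>k\<in>UNIV. \<Sum>l\<in>UNIV. ?g k l)" .
  \<comment> \<open>After each e_k \<otimes> e_l has been rewritten by
    \<open>uact_conjugate\<close>, t and \<open>spread (collapse t)\<close> differ term by term by a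
    relation at \<open>pt\<close>.\<close>
  have 2: "t = (\<Sum>k\<in>UNIV. \<Sum>l\<in>UNIV. sw2 H (unit_vec k) (\<lambda>x w. sw2 H w (\<lambda>y z. embed (uact (\<one> \<otimes>\<^sub>v (x \<cdot> unit_vec l \<cdot> S z)) y) \<otimes>\<^sub>v app (B c0 l) (n k))))"
    unfolding sw2_lin[OF lt, symmetric] uact_conjugate tensor_unit_vec B_n by (rule expand_big[OF big])
  have "t - spread (collapse t) = (\<Sum>k\<in>UNIV. \<Sum>l\<in>UNIV. sw2 H (unit_vec k) (\<lambda>x w. sw2 H w (\<lambda>y z.
    embed (uact (\<one> \<otimes>\<^sub>v (x \<cdot> unit_vec l \<cdot> S z)) y) \<otimes>\<^sub>v app (B c0 l) (n k) - ?\<Psi> (x \<cdot> unit_vec l \<cdot> S z) (act c0 y (app (B c0 l) (n k))))))"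
    unfolding 1 by (subst (1) 2) (simp only: sum_subtractf[symmetric] sw2_diff)
  also have "\<dots> \<in> prot_relations \<zeta>"
    by (intro fun_vs.subspace_sum[OF subspace_relations] sw2_in_subspace[OF subspace_relations] relation_pt B_X pt nX)
  finally show ?thesis .
qed

lemma subquot_iso_prot: "subquot_iso (prot_cotensor \<zeta>) (prot_relations \<zeta>) inv_space rel_space"
  unfolding subquot_iso_def
proof (intro exI[of _ collapse] conjI ballI collapse_linear)
  show "collapse ` prot_cotensor \<zeta> = inv_space"
    using collapse_cotensor spread_cotensor by (force simp: image_iff)
  fix t assume t: "t \<in> prot_cotensor \<zeta>"
  show "collapse t \<in> rel_space \<longleftrightarrow> t \<in> prot_relations \<zeta>"
  proof
    assume "collapse t \<in> rel_space"
    from fun_vs.subspace_add[OF subspace_relations spread_collapse[OF t] spread_rel[OF this]]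
    show "t \<in> prot_relations \<zeta>" by simp
  qed (rule collapse_relations)
qed

end

section \<open>From subquotients to spaces of cosets\<close>

text \<open>The map G vanishes on an element of \<open>V\<close> exactly if it lies in
  \<open>R\<close>; hence it descends to an injective map on the cosets of elements of
  \<open>V\<close>.\<close>

lemma subquot_iso_image_in_quotient:
  assumes "subquot_iso V R (coord_space B) {0}" and V: "fun_vs.subspace V" and R: "fun_vs.subspace R"
  shows "image_in_quotient V R \<cong>\<^sub>v coord_vspace B"
proof -
  obtain G where G: "lin_map G" "G ` V = coord_space B" "\<And>v. v \<in> V \<Longrightarrow> G v = 0 \<longleftrightarrow> v \<in> R"
    using assms(1) unfolding subquot_iso_def by auto
  define coset where "coset v = {v + r | r. r \<in> R}" for v
  have coset_mem: "u \<in> coset v \<longleftrightarrow> u - v \<in> R" for u v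
    unfolding coset_def by (auto intro: exI[of _ "u - v"])
  have coset_eq: "coset u = coset v \<longleftrightarrow> u - v \<in> R" for u v
  proof
    assume "coset u = coset v"
    then show "u - v \<in> R" using coset_mem[of u u] fun_vs.subspace_0[OF R] coset_mem[of u v] by simp
  next
    assume r: "u - v \<in> R"
    have "x - u \<in> R \<longleftrightarrow> x - v \<in> R" for x
      using fun_vs.subspace_add[OF R r, of "x - u"] fun_vs.subspace_diff[OF R _ r, of "x - v"] by auto
    then show "coset u = coset v" by (auto simp: coset_mem)
  qed
  have G_eq: "G u = G v \<longleftrightarrow> u - v \<in> R" if "u \<in> V" "v \<in> V" for u v
    using G(3)[OF fun_vs.subspace_diff[OF V that]] by (simp add: lin_map_diff[OF G(1)])
  \<comment> \<open>Representatives are chosen inside \<open>V\<close>; G takes the same value on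
    all of them.\<close>
  define f where "f P = G (SOME v. v \<in> V \<and> P = coset v)" for P
  have f: "f (coset v) = G v" if "v \<in> V" for v
  proof -
    have "(SOME u. u \<in> V \<and> coset v = coset u) \<in> V \<and> coset v = coset (SOME u. u \<in> V \<and> coset v = coset u)"
      by (rule someI[of _ v]) (use that in auto)
    then show ?thesis unfolding f_def using G_eq coset_eq that by metis
  qed
  have plus: "{x + y | x y. x \<in> coset u \<and> y \<in> coset v} = coset (u + v)" for u v
  proof (intro equalityI subsetI)
    fix x assume "x \<in> {x + y | x y. x \<in> coset u \<and> y \<in> coset v}"
    then obtain a b where x: "x = a + b" "a - u \<in> R" "b - v \<in> R" by (auto simp: coset_mem)
    have e: "x - (u + v) = (a - u) + (b - v)" by (simp add: x(1))
    show "x \<in> coset (u + v)" unfolding coset_mem e by (rule fun_vs.subspace_add[OF R x(2,3)])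
  next
    fix x assume x: "x \<in> coset (u + v)"
    have "x - v \<in> coset u" "v \<in> coset v" using x fun_vs.subspace_0[OF R] by (auto simp: coset_mem algebra_simps)
    moreover have "x = (x - v) + v" by simp
    ultimately show "x \<in> {x + y | x y. x \<in> coset u \<and> y \<in> coset v}" by blast
  qed
  have scale: "{c *\<^sub>v x + r | x r. x \<in> coset u \<and> r \<in> R} = coset (c *\<^sub>v u)" for c u
  proof (intro equalityI subsetI)
    fix x assume "x \<in> {c *\<^sub>v x + r | x r. x \<in> coset u \<and> r \<in> R}"
    then obtain a r where x: "x = c *\<^sub>v a + r" "a - u \<in> R" "r \<in> R" by (auto simp: coset_mem)
    have "x - c *\<^sub>v u = c *\<^sub>v (a - u) + r" by (simp add: x(1) fun_vs.scale_right_diff_distrib)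
    then show "x \<in> coset (c *\<^sub>v u)" unfolding coset_mem using fun_vs.subspace_add[OF R fun_vs.subspace_scale[OF R x(2)] x(3)] by simp
  next
    fix x assume x: "x \<in> coset (c *\<^sub>v u)"
    then have "x = c *\<^sub>v u + (x - c *\<^sub>v u)" "x - c *\<^sub>v u \<in> R" "u \<in> coset u"
      using fun_vs.subspace_0[OF R] by (auto simp: coset_mem)
    then show "x \<in> {c *\<^sub>v x + r | x r. x \<in> coset u \<and> r \<in> R}" by blast
  qed
  have I: "image_in_quotient V R = \<lparr>vcarrier = coset ` V, vplus = (\<lambda>P Q. {u + v | u v. u \<in> P \<and> v \<in> Q}),
     vscale = (\<lambda>c P. {c *\<^sub>v u + r | u r. u \<in> P \<and> r \<in> R})\<rparr>"
    by (simp add: image_in_quotient_def coset_def[abs_def])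
  have "bij_betw f (coset ` V) (coord_space B)"
    unfolding bij_betw_def
  proof
    show "inj_on f (coset ` V)" by (rule inj_onI) ((erule imageE)+, simp add: f G_eq coset_eq)
    show "f ` coset ` V = coord_space B" unfolding image_image using G(2) f by (simp cong: image_cong)
  qed
  moreover have "f {x + y | x y. x \<in> coset u \<and> y \<in> coset v} = f (coset u) + f (coset v)" if "u \<in> V" "v \<in> V" for u v
    unfolding plus using that by (simp add: f fun_vs.subspace_add[OF V] lin_map_add[OF G(1)])
  moreover have "f {c *\<^sub>v x + r | x r. x \<in> coset u \<and> r \<in> R} = c *\<^sub>v f (coset u)" if "u \<in> V" for c u
    unfolding scale using that by (simp add: f fun_vs.subspace_scale[OF V] lin_map_scale[OF G(1)])
  ultimately show ?thesis
    unfolding vspace_iso_def I coord_vspace_def by (intro exI[of _ f]) auto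
qed

theorem corollary7p26:
  fixes H :: "('b::finite, 'k::field) hopf"
    and p :: "'b \<Rightarrow> 'k"
    and \<chi> :: "('b \<Rightarrow> 'k) \<Rightarrow> 'k"
    and \<zeta> :: 'k
    and M :: "('b, 'b, 'k) inv_bimodule"
    and \<Gamma> :: "nat kitaev_graph"
  assumes "hopf_algebra H"
    and "pair_in_involution H p \<chi>"
    and "\<zeta>\<^sup>2 = \<chi> p"
    and "M = induced_bimodule H p \<chi> \<zeta>"
    and "\<Gamma> \<in> RK"
  shows "Prot H p \<chi> M \<Gamma> (U_mc H) \<cong>\<^sub>v tensor_power M (2 * genus \<Gamma>)"
proof -
  interpret hopf_algebra H by (rule assms(1))
  interpret kitaev H p \<chi> \<Gamma> by unfold_locales (fact assms(2,5))+
  show ?thesis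
    unfolding Prot_def Bit_def tensor_power_def assms(4)
    by (rule subquot_iso_image_in_quotient[OF subquot_iso_trans[OF subquot_iso_prot subquot_iso_coord] subspace_cotensor subspace_relations])
qed

end
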